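(* Let $d\ge 1$ be an integer, let $\alpha\in(1-1/d,1)$ and set $\beta = 1+d\alpha-d\in(0,1)$. Let $\nu$ be a nonzero finite positive Borel measure on $\mathbb{R}^d$ with compact support which is absolutely continuous with respect to the Lebesgue measure $\mathcal{L}^d$, and denote its density also by $\nu$. Set $M_{\alpha,d}(\nu) := \int_{\mathbb{R}^d}\nu(x)^{\frac{\alpha}{\alpha+\frac1d}}\,dx$. (i) If $(\mu_N)_{N\ge 1}$ is a sequence such that each $\mu_N$ is an optimal $N$-point quantizer of $\nu$, then $$\mu_N^\diamond := \frac1N\sum_{\{x\,:\,\mu_N(\{x\})>0\}}\delta_x \;\longrightarrow\; M_{\alpha,d}(\nu)^{-1}\,\nu^{\frac{\alpha}{\alpha+\frac1d}}\,\mathcal{L}^d\qquad (N\to+\infty)$$ narrowly (i.e. in duality with bounded continuous functions). (ii) The leading-order asymptotics of the optimal quantization error is $$\lim_{N\to\infty} N^{\beta/d}\,\mathcal{E}^\alpha(\nu,N) = c_{\alpha,d}\,M_{\alpha,d}(\nu)^{\alpha+\frac1d},$$ where $c_{\alpha,d} := \lim_{N\to\infty}N^{\beta/d}\,\mathcal{E}^\alpha(\mathcal{L}^d|_{[0,1]^d},N)$, a limit which exists and belongs to $(0,+\infty)$.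
   Context: Traffic plans. $\Gamma^d$ is the set of $1$-Lipschitz curves $\gamma:[0,\infty)\to\mathbb{R}^d$ with the topology of uniform convergence on compact sets. For $\gamma\in\Gamma^d$, $T(\gamma)=\inf\{\tau\ge0:\gamma\text{ is constant on }[\tau,+\infty)\}\in[0,+\infty]$. A traffic plan is a finite positive Borel measure $\mathbf{P}$ on $\Gamma^d$ with $\mathbf{P}(\{T=+\infty\})=0$. Put $e_0(\gamma)=\gamma(0)$ and $e_\infty(\gamma)=\gamma(\infty):=\gamma(T(\gamma))$. For finite positive measures $\mu^\pm$ on $\mathbb{R}^d$ of equal total mass, $\mathbf{TP}(\mu^-,\mu^+)$ is the set of traffic plans with $(e_0)_\sharp\mathbf{P}=\mu^-$ and $(e_\infty)_\sharp\mathbf{P}=\mu^+$. Multiplicity: $\Theta_{\mathbf{P}}(x)=\int_{\Gamma^d}\#\gamma^{-1}(\{x\})\,d\mathbf{P}(\gamma)$; network: $\Sigma_{\mathbf{P}}=\{x:\Theta_{\mathbf{P}}(x)>0\}$. $\mathbf{P}$ is rectifiable if there is a countably $1$-rectifiable set $\Sigma$ (contained, up to an $\mathcal{H}^1$-null set, in a countable union of Lipschitz curves) such that $\mathcal{H}^1(\gamma([0,\infty))\setminus\Sigma)=0$ for $\mathbf{P}$-a.e. $\gamma$. The $\alpha$-mass is $\mathbb{M}^\alpha(\mathbf{P})=\int_{\Sigma_{\mathbf{P}}}\Theta_{\mathbf{P}}(x)^\alpha\,d\mathcal{H}^1(x)$ if $\mathbf{P}$ is rectifiable and $+\infty$ otherwise.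 The branched transport distance is $\mathbf{d}^\alpha(\mu^-,\mu^+)=\inf\{\mathbb{M}^\alpha(\mathbf{P}):\mathbf{P}\in\mathbf{TP}(\mu^-,\mu^+)\}$. Quantization. $\mathcal{E}^\alpha(\nu,N)=\inf\{\mathbf{d}^\alpha(\mu,\nu):\mu\text{ positive measure on }\mathbb{R}^d,\ \|\mu\|=\|\nu\|,\ \#\operatorname{spt}\mu\le N\}$, where $\|\cdot\|$ is total mass. When this is finite, a minimizer is called an ($N$-point) optimal quantizer of $\nu$. *)

theory Defs
  imports "HOL-Analysis.Analysis"
begin

section \<open>Powers of extended nonnegative reals\<close>

text \<open>Only used with exponents \<open>p > 0\<close>, so that \<open>0\<close> and \<open>\<infinity>\<close> are mapped to themselves.\<close>

definition ennpow :: "ennreal \<Rightarrow> real \<Rightarrow> ennreal" where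
  "ennpow x p = (if x = \<infinity> then \<infinity> else ennreal (enn2real x powr p))"

section \<open>One-dimensional Hausdorff measure\<close>

text \<open>Boundedness of the covering sets is required explicitly because the library
  sets the diameter of an unbounded set to \<open>0\<close>.\<close>

definition hausdorff1_pre :: "real \<Rightarrow> 'a::metric_space set \<Rightarrow> ennreal" where
  "hausdorff1_pre \<delta> A =
     (INF C \<in> {C :: nat \<Rightarrow> 'a set.
                 A \<subseteq> (\<Union>i. C i) \<and> (\<forall>i. bounded (C i) \<and> diameter (C i) \<le> \<delta>)}.
        \<Sum>i. ennreal (diameter (C i)))"

definition hausdorff1_outer :: "'a::metric_space set \<Rightarrow> ennreal" where
  "hausdorff1_outer A = (SUP \<delta>\<in>{0<..}. hausdorff1_pre \<delta> A)"

text \<open>The restriction of the metric outer measure above to the Borel sets.\<close>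

definition hausdorff1 :: "'a::metric_space measure" where
  "hausdorff1 = measure_of UNIV (sets borel) hausdorff1_outer"

definition countably_1_rectifiable :: "'a::metric_space set \<Rightarrow> bool" where
  "countably_1_rectifiable S \<longleftrightarrow>
     (\<exists>\<phi> :: nat \<Rightarrow> real \<Rightarrow> 'a. (\<forall>i. \<exists>L. L-lipschitz_on {0..} (\<phi> i)) \<and>
        hausdorff1_outer (S - (\<Union>i. \<phi> i ` {0..})) = 0)"

section \<open>The space of 1-Lipschitz curves\<close>

text \<open>A curve on \<open>[0,\<infinity>)\<close> is represented by a function on \<open>\<real>\<close> that takes the fixed value
  \<^term>\<open>undefined\<close> outside \<open>[0,\<infinity>)\<close>, so that equality of functions is equality of curves.\<close>

definition curves :: "(real \<Rightarrow> 'a::metric_space) set" where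
  "curves = {\<gamma> \<in> extensional {0..}. 1-lipschitz_on {0..} \<gamma>}"

definition curve_nbhd :: "(real \<Rightarrow> 'a::metric_space) \<Rightarrow> real set \<Rightarrow> real \<Rightarrow> (real \<Rightarrow> 'a) set" where
  "curve_nbhd \<gamma> K \<epsilon> = {\<eta> \<in> curves. \<forall>t\<in>K. dist (\<eta> t) (\<gamma> t) < \<epsilon>}"

definition curve_open :: "(real \<Rightarrow> 'a::metric_space) set \<Rightarrow> bool" where
  "curve_open U \<longleftrightarrow> U \<subseteq> curves \<and>
     (\<forall>\<gamma>\<in>U. \<exists>K \<epsilon>. compact K \<and> K \<subseteq> {0..} \<and> 0 < \<epsilon> \<and> curve_nbhd \<gamma> K \<epsilon> \<subseteq> U)"

text \<open>The topology of uniform convergence on compact sets.\<close>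

definition curve_topology :: "(real \<Rightarrow> 'a::metric_space) topology" where
  "curve_topology = topology curve_open"

lemma istopology_curve_open: "istopology (curve_open :: (real \<Rightarrow> 'a::metric_space) set \<Rightarrow> bool)"
  unfolding istopology_def
proof (intro conjI allI impI)
  fix S T :: "(real \<Rightarrow> 'a) set"
  assume S: "curve_open S" and T: "curve_open T"
  show "curve_open (S \<inter> T)"
    unfolding curve_open_def
  proof (intro conjI ballI)
    show "S \<inter> T \<subseteq> curves" using S by (auto simp: curve_open_def)
    fix \<gamma> assume "\<gamma> \<in> S \<inter> T"
    then obtain K \<epsilon> K' \<epsilon>' where
      K: "compact K" "K \<subseteq> {0..}" "0 < \<epsilon>" "curve_nbhd \<gamma> K \<epsilon> \<subseteq> S" and
      K': "compact K'" "K' \<subseteq> {0..}" "0 < \<epsilon>'" "curve_nbhd \<gamma> K' \<epsilon>' \<subseteq> T"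
      using S T unfolding curve_open_def by (meson IntD1 IntD2)
    have "curve_nbhd \<gamma> (K \<union> K') (min \<epsilon> \<epsilon>') \<subseteq> curve_nbhd \<gamma> K \<epsilon> \<inter> curve_nbhd \<gamma> K' \<epsilon>'"
      by (auto simp: curve_nbhd_def)
    with K K' show "\<exists>K \<epsilon>. compact K \<and> K \<subseteq> {0..} \<and> 0 < \<epsilon> \<and> curve_nbhd \<gamma> K \<epsilon> \<subseteq> S \<inter> T"
      by (intro exI[of _ "K \<union> K'"] exI[of _ "min \<epsilon> \<epsilon>'"]) (auto simp: compact_Un)
  qed
next
  fix \<K> :: "(real \<Rightarrow> 'a) set set"
  assume "\<forall>U\<in>\<K>. curve_open U"
  then show "curve_open (\<Union>\<K>)"
    unfolding curve_open_def by (meson Sup_le_iff Sup_upper UnionE subset_trans)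
qed

lemma openin_curve_topology: "openin curve_topology U \<longleftrightarrow> curve_open U"
  by (simp add: curve_topology_def topology_inverse' istopology_curve_open)

definition curve_borel :: "(real \<Rightarrow> 'a::metric_space) measure" where
  "curve_borel = sigma curves {U. openin curve_topology U}"

definition stop_time :: "(real \<Rightarrow> 'a::metric_space) \<Rightarrow> ennreal" where
  "stop_time \<gamma> = Inf {ennreal \<tau> | \<tau>. 0 \<le> \<tau> \<and> \<gamma> constant_on {\<tau>..}}"

text \<open>When \<open>stop_time \<gamma> = \<infinity>\<close> the value of \<open>curve_end \<gamma>\<close> is the irrelevant \<open>\<gamma> 0\<close>;
  traffic plans give no mass to such curves.\<close>

definition curve_end :: "(real \<Rightarrow> 'a::metric_space) \<Rightarrow> 'a" where
  "curve_end \<gamma> = \<gamma> (enn2real (stop_time \<gamma>))"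

section \<open>Traffic plans and branched transport\<close>

definition traffic_plan :: "(real \<Rightarrow> 'a::metric_space) measure \<Rightarrow> bool" where
  "traffic_plan P \<longleftrightarrow> finite_measure P \<and> sets P = sets curve_borel \<and>
     emeasure P {\<gamma> \<in> curves. stop_time \<gamma> = \<infinity>} = 0"

definition TP :: "'a::metric_space measure \<Rightarrow> 'a measure \<Rightarrow> (real \<Rightarrow> 'a) measure set" where
  "TP \<mu> \<nu> = {P. traffic_plan P \<and> distr P borel (\<lambda>\<gamma>. \<gamma> 0) = \<mu> \<and> distr P borel curve_end = \<nu>}"

definition multiplicity :: "(real \<Rightarrow> 'a::metric_space) measure \<Rightarrow> 'a \<Rightarrow> ennreal" where
  "multiplicity P x = (\<integral>\<^sup>+\<gamma>. emeasure (count_space UNIV) {t \<in> {0..}. \<gamma> t = x} \<partial>P)"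

definition network :: "(real \<Rightarrow> 'a::metric_space) measure \<Rightarrow> 'a set" where
  "network P = {x. multiplicity P x > 0}"

definition rectifiable_plan :: "(real \<Rightarrow> 'a::metric_space) measure \<Rightarrow> bool" where
  "rectifiable_plan P \<longleftrightarrow>
     (\<exists>S. countably_1_rectifiable S \<and> (AE \<gamma> in P. hausdorff1_outer (\<gamma> ` {0..} - S) = 0))"

definition alpha_mass :: "real \<Rightarrow> (real \<Rightarrow> 'a::metric_space) measure \<Rightarrow> ennreal" where
  "alpha_mass \<alpha> P =
     (if rectifiable_plan P
      then \<integral>\<^sup>+x\<in>network P. ennpow (multiplicity P x) \<alpha> \<partial>hausdorff1
      else \<infinity>)"

definition branched_dist :: "real \<Rightarrow> 'a::metric_space measure \<Rightarrow> 'a measure \<Rightarrow> ennreal" where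
  "branched_dist \<alpha> \<mu> \<nu> = (INF P \<in> TP \<mu> \<nu>. alpha_mass \<alpha> P)"

section \<open>Optimal quantization\<close>

definition spt :: "'a::topological_space measure \<Rightarrow> 'a set" where
  "spt \<mu> = {x. \<forall>U. open U \<and> x \<in> U \<longrightarrow> emeasure \<mu> U > 0}"

definition quantizers :: "'a::metric_space measure \<Rightarrow> nat \<Rightarrow> 'a measure set" where
  "quantizers \<nu> N = {\<mu>. sets \<mu> = sets borel \<and> emeasure \<mu> UNIV = emeasure \<nu> UNIV \<and>
     finite (spt \<mu>) \<and> card (spt \<mu>) \<le> N}"

definition quant_error :: "real \<Rightarrow> 'a::metric_space measure \<Rightarrow> nat \<Rightarrow> ennreal" where
  "quant_error \<alpha> \<nu> N = (INF \<mu> \<in> quantizers \<nu> N. branched_dist \<alpha> \<mu> \<nu>)"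

definition optimal_quantizer ::
    "real \<Rightarrow> 'a::metric_space measure \<Rightarrow> nat \<Rightarrow> 'a measure \<Rightarrow> bool" where
  "optimal_quantizer \<alpha> \<nu> N \<mu> \<longleftrightarrow>
     quant_error \<alpha> \<nu> N < \<infinity> \<and> \<mu> \<in> quantizers \<nu> N \<and>
     branched_dist \<alpha> \<mu> \<nu> = quant_error \<alpha> \<nu> N"

text \<open>The counting measure on the atoms of \<open>\<mu>\<close>, i.e. a sum of unit Dirac masses, divided by \<open>N\<close>.\<close>

definition atom_distribution :: "nat \<Rightarrow> 'a::topological_space measure \<Rightarrow> 'a measure" where
  "atom_distribution N \<mu> = scale_measure (ennreal (1 / real N))
     (distr (count_space {x. emeasure \<mu> {x} > 0}) borel (\<lambda>x. x))"

definition narrow_conv :: "(nat \<Rightarrow> 'a::topological_space measure) \<Rightarrow> 'a measure \<Rightarrow> bool" where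
  "narrow_conv M L \<longleftrightarrow>
     (\<forall>g :: 'a \<Rightarrow> real. continuous_on UNIV g \<and> bounded (range g) \<longrightarrow>
        (\<lambda>N. integral\<^sup>L (M N) g) \<longlonglongrightarrow> integral\<^sup>L L g)"

section \<open>The constants of the asymptotics\<close>

text \<open>For finite absolutely continuous \<open>\<nu>\<close>, \<open>RN_deriv lborel \<nu>\<close> is a version of its density,
  so this is that density raised to the power \<open>\<alpha> / (\<alpha> + 1/d)\<close>.\<close>

definition density_pow :: "real \<Rightarrow> (real^'n) measure \<Rightarrow> real^'n \<Rightarrow> ennreal" where
  "density_pow \<alpha> \<nu> x = ennpow (RN_deriv lborel \<nu> x) (\<alpha> / (\<alpha> + 1 / real CARD('n)))"

definition M_const :: "real \<Rightarrow> (real^'n) measure \<Rightarrow> ennreal" where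
  "M_const \<alpha> \<nu> = (\<integral>\<^sup>+x. density_pow \<alpha> \<nu> x \<partial>lborel)"

definition beta_exp :: "real \<Rightarrow> 'n::finite itself \<Rightarrow> real" where
  "beta_exp \<alpha> _ = 1 + real CARD('n) * \<alpha> - real CARD('n)"

definition scaled_quant_error :: "real \<Rightarrow> (real^'n) measure \<Rightarrow> nat \<Rightarrow> ennreal" where
  "scaled_quant_error \<alpha> \<nu> N =
     ennreal (real N powr (beta_exp \<alpha> TYPE('n) / real CARD('n))) * quant_error \<alpha> \<nu> N"

text \<open>Lebesgue measure restricted to the unit cube, as a Borel measure on the whole space.\<close>

definition cube_measure :: "(real^'n) measure" where
  "cube_measure = density lborel (indicator (cbox 0 1))"

definition c_const :: "real \<Rightarrow> 'n::finite itself \<Rightarrow> ennreal" where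
  "c_const \<alpha> _ = lim (scaled_quant_error \<alpha> (cube_measure :: (real^'n) measure))"

end

(* By subadditivity and scaling, N^(beta/d) E(L|cube, N) converges to its infimum over N; a direct
   estimate of the flow of curves through small cubes shows that this infimum c is positive, and
   irrigation along dyadic trees shows that it is finite. A density is approximated in L^1 by a step
   function on a grid of cubes; the difference costs little, again by dyadic irrigation. For a step
   function the upper bound distributes the N points over the cells. For the lower bound, a plan with N
   sources is cut along the boundaries of slightly shrunk cells: about N^(1-1/d) additional sources, one
   per cell of a grid of mesh N^(-1/d) meeting the boundaries, absorb the flow that crosses them, and
   their cost is negligible. In both bounds the cells compete through the convex function
   m^(alpha+1/d) n^(-beta/d) of mass powers m and cardinalities n, whose minimum is attained for
   n proportional to m. The near-equality case of this convexity inequality, applied to a box and to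
   the complement of a larger one, gives a lower bound on the fraction of the atoms of an optimal
   quantizer in each box; since the fractions sum to at most 1, narrow convergence follows. *)

theory Submission
  imports Defs
begin

text \<open>The condition \<alpha> > 1 - 1/d is used in the form
  \<open>real CARD('n) * (1 - al) < 1\<close>. Generation k of a dyadic tree has about 2^(dk) edges
  of length about 2^(-k), so Jensen bounds its cost by 2^(k(d(1-al)-1)), and exactly under this
  condition the series converges. The same count shows why cuts are cheap: about N^(1-1/d) boundary
  sources with trees of size N^(-1/d) cost N^(-1/d) times N^((1-1/d)(1-al)), which is smaller than
  N^(-beta/d) by the factor N^(-(1-al)/d). The obstacle to cutting is that a curve may cross a
  region many times. Only curves ending in the region are kept, each reduced to the part after its
  last time outside. It then stays in the region and starts at an old source or on the boundary, so
  costs over disjoint closed regions add up. Since plans are measures on curves, every operation on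
  curves (prefixing a branch, passing to a tail) has to be a Borel map, and multiplicities and
  coverings have to be measurable; this accounts for the long measure-theoretic beginning.\<close>

abbreviation H1 :: "'a::metric_space set => ennreal" where
  "H1 \<equiv> hausdorff1_outer"

abbreviation density_error :: "real => ('a::euclidean_space => ennreal) => nat => ennreal" where
  "density_error al f \<equiv> quant_error al (density lborel f)"

abbreviation cube_error :: "real => 'n::finite itself => nat => ennreal" where
  "cube_error al t \<equiv> quant_error al (cube_measure :: (real^'n) measure)"

abbreviation scaled_cube :: "real => 'n::finite itself => nat => ennreal" where
  "scaled_cube al t \<equiv> scaled_quant_error al (cube_measure :: (real^'n) measure)"

section \<open>Powers of extended nonnegative reals\<close>

lemma ennpow_0 [simp]: "ennpow 0 p = 0" by (simp add: ennpow_def)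

lemma ennpow_top [simp]: "ennpow top p = top" by (simp add: ennpow_def)

lemma ennpow_ennreal: "0 <= a ==> ennpow (ennreal a) p = ennreal (a powr p)" by (simp add: ennpow_def)

lemma ennpow_mono: "x <= y ==> 0 <= p ==> ennpow x p <= ennpow y p" by (cases x; cases y) (auto simp: ennpow_ennreal top_unique intro!: ennreal_leI powr_mono2)

lemma ennpow_mult: "ennpow (x * y) p = ennpow x p * ennpow y p"
proof (cases x; cases y)
  fix a b assume "0 <= a" "x = ennreal a" "0 <= b" "y = ennreal b"
  then show ?thesis by (simp add: ennpow_ennreal powr_mult flip: ennreal_mult)
next
  fix a assume "0 <= a" "x = ennreal a" "y = top"
  then show ?thesis by (cases "a = 0") (auto simp: ennpow_ennreal ennreal_mult_top)
next
  fix a assume "x = top" "0 <= a" "y = ennreal a"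
  then show ?thesis by (cases "a = 0") (auto simp: ennpow_ennreal ennreal_top_mult)
qed (simp add: ennpow_ennreal)

lemma ennpow_ennpow: "ennpow (ennpow x p) q = ennpow x (p * q)" by (cases x) (auto simp: ennpow_ennreal powr_powr)

lemma ennpow_one [simp]: "ennpow x 1 = x" by (cases x) (auto simp: ennpow_ennreal)

lemma borel_measurable_ennpow [measurable]:
  assumes [measurable]: "f \<in> borel_measurable M"
  shows "(\<lambda>x. ennpow (f x) p) \<in> borel_measurable M" unfolding ennpow_def by measurable

text \<open>The shares \<open>a / S\<close> and \<open>b / S\<close> of the sum lie in [0,1], where
  x is at most \<open>x powr p\<close>, and they add up to 1.\<close>

lemma powr_add_le:
  fixes a b p :: real
  assumes "0 <= a" "0 <= b" "0 < p" "p <= 1"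
  shows "(a + b) powr p <= a powr p + b powr p"
proof (cases "a + b = 0")
  case False
  define S where "S = a + b"
  have S: "S > 0" using False assms by (auto simp: S_def)
  have le: "S powr p * (c / S) <= c powr p" if "0 <= c" "c <= S" for c
  proof -
    have "c / S <= (c / S) powr p" using powr_mono'[of p 1 "c / S"] that S assms by simp
    then have "S powr p * (c / S) <= S powr p * (c / S) powr p" by (intro mult_left_mono) auto
    also have "... = c powr p" using S that by (simp add: powr_divide)
    finally show ?thesis .
  qed
  have "S powr p = S powr p * (a / S) + S powr p * (b / S)" using S by (simp add: S_def flip: distrib_left add_divide_distrib)
  also have "... <= a powr p + b powr p" using assms by (intro add_mono le) (auto simp: S_def)
  finally show ?thesis by (simp add: S_def)
qed (use assms in auto)

lemma ennpow_add_le: "0 < p ==> p <= 1 ==> ennpow (x + y) p <= ennpow x p + ennpow y p" by (cases x; cases y)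
     (auto simp: ennpow_ennreal ennreal_plus[symmetric] simp del: ennreal_plus
       intro!: ennreal_leI powr_add_le)

lemma ennpow_sum_le:
  assumes "0 < p" "p <= 1"
  shows "ennpow (sum f I) p <= (\<Sum>i\<in>I. ennpow (f i) p)"
proof (induction I rule: infinite_finite_induct)
  case (insert x F)
  then show ?case using ennpow_add_le[OF assms, of "f x" "sum f F"] by (auto intro: order.trans add_left_mono)
qed auto

text \<open>Applying the inverse power \<open>1 / p\<close> to the partial sums turns the claim into
  a constant bound for a series, which avoids a passage to the limit under
  \<open>ennpow\<close>.\<close>

lemma ennpow_suminf_le:
  assumes p: "0 < p" "p <= 1"
  shows "ennpow (\<Sum>i. f i) p <= (\<Sum>i. ennpow (f i) p)"
proof (cases "\<Sum>i. ennpow (f i) p")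
  case (real r)
  have "(\<Sum>i. f i) <= ennreal (r powr (1 / p))"
  proof (rule suminf_le_const)
    fix n
    have "ennpow (\<Sum>i<n. f i) p <= ennreal r" unfolding real(2)[symmetric] using ennpow_sum_le[OF p] sum_le_suminf[of "\<lambda>i. ennpow (f i) p" "{..<n}"]
      by (auto intro: order.trans)
    then have "ennpow (ennpow (\<Sum>i<n. f i) p) (1/p) <= ennpow (ennreal r) (1/p)" using p by (intro ennpow_mono) auto
    then show "(\<Sum>i<n. f i) <= ennreal (r powr (1 / p))" using p real by (simp add: ennpow_ennpow ennpow_ennreal)
  qed simp
  then have "ennpow (\<Sum>i. f i) p <= ennpow (ennreal (r powr (1 / p))) p" using p by (intro ennpow_mono) auto
  with real p show ?thesis by (simp add: ennpow_ennreal powr_powr)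
qed simp

section \<open>Concavity of powers: the tangent at 1 and Jensen's inequality\<close>

lemma powr_tangent_le:
  fixes t :: real
  assumes "0 <= t" "0 < a" "a <= 1"
  shows "t powr a <= 1 + a * (t - 1)"
proof (cases "t = 0")
  case False
  then have t: "t > 0" using assms by simp
  have "a * ln t + (1 - a) * ln 1 <= ln (a * t + (1 - a) * 1)" using ln_concave[unfolded concave_on_iff, THEN conjunct2, rule_format, of t 1 a "1 - a"] t assms by simp
  moreover have "a * t + (1 - a) * 1 > 0" using t assms by (intro add_pos_nonneg) auto
  ultimately have "exp (a * ln t) <= a * t + (1 - a) * 1" by (metis exp_le_cancel_iff exp_ln add.right_neutral ln_one mult_zero_right)
  then show ?thesis using t by (simp add: powr_def algebra_simps)
qed (use assms in auto)

lemma sum_powr_le: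
  fixes m :: "'a => real"
  assumes "0 < a" "a <= 1" "finite I" "\<And>i. i \<in> I ==> 0 <= m i"
  shows "(\<Sum>i\<in>I. m i powr a) <= real (card I) powr (1 - a) * (sum m I) powr a"
proof (cases "sum m I = 0")
  case True
  then have "\<And>i. i \<in> I ==> m i = 0" using assms by (simp add: sum_nonneg_eq_0_iff)
  then show ?thesis by simp
next
  case False
  define n where "n = real (card I)"
  have S: "sum m I > 0" using False assms by (metis sum_nonneg order_le_less)
  have n: "n > 0" using False assms by (cases "I = {}") (auto simp: n_def card_gt_0_iff)
  define c where "c = sum m I / n"
  have c: "c > 0" using S n by (simp add: c_def)
  have "(\<Sum>i\<in>I. m i powr a) = c powr a * (\<Sum>i\<in>I. (m i / c) powr a)" using c assms by (simp add: sum_distrib_left powr_divide)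
  also have "... <= c powr a * (\<Sum>i\<in>I. 1 + a * (m i / c - 1))" using assms c by (intro mult_left_mono sum_mono powr_tangent_le) auto
  also have "(\<Sum>i\<in>I. 1 + a * (m i / c - 1)) = n + a * (sum m I / c - n)" by (simp add: sum.distrib n_def sum_subtractf flip: sum_distrib_left sum_divide_distrib)
  also have "... = n" using S n by (simp add: c_def)
  also have "c powr a * n = n powr (1 - a) * (sum m I) powr a" using n S by (simp add: c_def powr_divide powr_diff field_simps)
  finally show ?thesis by (simp add: n_def)
qed

lemma sum_ennpow_le:
  assumes "0 < a" "a <= 1" "finite I"
  shows "(\<Sum>i\<in>I. ennpow (m i) a) <= ennreal (real (card I) powr (1 - a)) * ennpow (sum m I) a"
proof (cases "\<exists>i\<in>I. m i = top")
  case True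
  then have "sum m I = top" "card I > 0" using assms by (auto simp: card_gt_0_iff)
  then show ?thesis by (simp add: ennreal_mult_top)
next
  case False
  then have *: "m i = ennreal (enn2real (m i))" if "i \<in> I" for i using that by (simp add: top.not_eq_extremum)
  have "sum m I = ennreal (\<Sum>i\<in>I. enn2real (m i))" by (subst sum_ennreal[symmetric]) (use * in \<open>auto intro!: sum.cong\<close>)
  moreover have "(\<Sum>i\<in>I. ennpow (m i) a) = ennreal (\<Sum>i\<in>I. enn2real (m i) powr a)" by (subst sum_ennreal[symmetric]) (use False in \<open>auto intro!: sum.cong simp: ennpow_def\<close>)
  ultimately show ?thesis using assms sum_powr_le[of a I "\<lambda>i. enn2real (m i)"] by (simp add: ennpow_ennreal sum_nonneg flip: ennreal_mult)
qed

section \<open>One-dimensional Hausdorff measure\<close>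

lemma hausdorff1_pre_mono: "A \<subseteq> B ==> hausdorff1_pre dl A <= hausdorff1_pre dl B" unfolding hausdorff1_pre_def by (intro INF_superset_mono) auto

lemma hausdorff1_pre_antimono: "dl <= dl' ==> hausdorff1_pre dl' A <= hausdorff1_pre dl A"
  unfolding hausdorff1_pre_def by (intro INF_superset_mono) (auto intro: order.trans)

lemma hausdorff1_pre_le:
  assumes "A \<subseteq> (\<Union>i. C i)" "\<And>i. bounded (C i)" "\<And>i. diameter (C i) <= dl"
  shows "hausdorff1_pre dl A <= (\<Sum>i. ennreal (diameter (C i)))" unfolding hausdorff1_pre_def by (rule INF_lower) (use assms in auto)

lemma hausdorff1_pre_close:
  assumes "hausdorff1_pre dl A < e"
  obtains C where "A \<subseteq> (\<Union>i::nat. C i)" "\<And>i. bounded (C i)" "\<And>i. diameter (C i) <= dl"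
    "(\<Sum>i. ennreal (diameter (C i))) < e" using assms unfolding hausdorff1_pre_def INF_less_iff by auto

lemma hausdorff1_pre_subadd:
  fixes A :: "nat => 'a::metric_space set"
  shows "hausdorff1_pre dl (\<Union>i. A i) <= (\<Sum>i. hausdorff1_pre dl (A i))"
proof (rule ennreal_le_epsilon)
  let ?O = "hausdorff1_pre dl :: 'a set => ennreal"
  fix e :: real assume "0 < e" "(\<Sum>n. ?O (A n)) < top"
  then have *: "\<And>n. ?O (A n) < ?O (A n) + e * (1/2)^Suc n" by (auto simp add: less_top dest!: ennreal_suminf_lessD)
  have "\<exists>C. A n \<subseteq> (\<Union>i::nat. C i) \<and> (\<forall>i. bounded (C i) \<and> diameter (C i) <= dl) \<and>
     (\<Sum>i. ennreal (diameter (C i))) <= ?O (A n) + e * (1/2)^(Suc n)" for n using hausdorff1_pre_close[OF *[of n]] by (metis less_imp_le)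
  then obtain B :: "nat => nat => 'a set" where
      B: "\<And>n. A n \<subseteq> (\<Union>i. B n i)" "\<And>n i. bounded (B n i)" "\<And>n i. diameter (B n i) <= dl"
      "\<And>n. (\<Sum>i. ennreal (diameter (B n i))) <= ?O (A n) + e * (1/2)^(Suc n)" by metis
  define C where "C = case_prod B o prod_decode"
  have "(\<Union>i. A i) \<subseteq> (\<Union>i. C i)" using B(1) by (auto simp add: C_def subset_eq) (metis prod.case prod_encode_inverse)
  then have "?O (\<Union>i. A i) <= (\<Sum>i. ennreal (diameter (C i)))" using B(2,3) by (intro hausdorff1_pre_le) (auto simp: C_def split: prod.split)
  also have "... = (\<Sum>n. \<Sum>i. ennreal (diameter (B n i)))" using suminf_ennreal_2dimen[where f="\<lambda>(m, n). ennreal (diameter (B m n))"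
        and g="\<lambda>n. \<Sum>i. ennreal (diameter (B n i))"] by (simp add: C_def comp_def case_prod_beta)
  also have "... <= (\<Sum>n. ?O (A n) + e * (1/2) ^ Suc n)" by (intro suminf_le B) auto
  also have "... = (\<Sum>n. ?O (A n)) + (\<Sum>n. ennreal e * ennreal ((1/2) ^ Suc n))" using \<open>0 < e\<close> by (subst suminf_add[symmetric])
       (auto simp del: ennreal_suminf_cmult simp add: ennreal_mult[symmetric])
  also have "... = (\<Sum>n. ?O (A n)) + e" unfolding ennreal_suminf_cmult by (subst suminf_ennreal_eq[OF zero_le_power power_half_series]) auto
  finally show "?O (\<Union>i. A i) <= (\<Sum>n. ?O (A n)) + e" .
qed

lemma hausdorff1_pre_le_outer: "0 < dl ==> hausdorff1_pre dl A <= H1 A" unfolding hausdorff1_outer_def by (rule SUP_upper) simp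

lemma hausdorff1_outer_mono: "A \<subseteq> B ==> H1 A <= H1 B" unfolding hausdorff1_outer_def by (intro SUP_mono') (auto intro: hausdorff1_pre_mono)

lemma hausdorff1_outer_empty [simp]: "H1 {} = 0"
proof -
  have "hausdorff1_pre dl ({}::'a set) <= 0" if "0 < dl" for dl using hausdorff1_pre_le[of "{}" "\<lambda>_. {}" dl] that by simp
  then show ?thesis by (auto simp: hausdorff1_outer_def)
qed

lemma hausdorff1_outer_subadd: "H1 (\<Union>i::nat. A i) <= (\<Sum>i. H1 (A i))" unfolding hausdorff1_outer_def[of "\<Union>i. A i"]
proof (rule SUP_least)
  fix dl :: real assume "dl \<in> {0<..}"
  then show "hausdorff1_pre dl (\<Union>i. A i) <= (\<Sum>i. H1 (A i))" by (intro order.trans[OF hausdorff1_pre_subadd] suminf_le hausdorff1_pre_le_outer) auto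
qed

lemma hausdorff1_outer_Un: "H1 (A \<union> B) <= H1 A + H1 B"
proof -
  have "H1 (A \<union> B) <= H1 (\<Union>i. (\<lambda>n. if n = 0 then A else if n = 1 then B else {}) (i::nat))" by (intro hausdorff1_outer_mono) (auto split: if_splits)
  also have "... <= (\<Sum>i. H1 ((\<lambda>n. if n = 0 then A else if n = 1 then B else {}) (i::nat)))" by (rule hausdorff1_outer_subadd)
  also have "... = (\<Sum>i<2. H1 ((\<lambda>n. if n = 0 then A else if n = 1 then B else {}) (i::nat)))" by (intro suminf_finite) auto
  also have "... = H1 A + H1 B" by (simp add: eval_nat_numeral)
  finally show ?thesis .
qed

text \<open>A covering set of diameter below \<open>e\<close> cannot meet both \<open>A\<close> and
  \<open>B\<close>, so a fine cover of the union splits into a cover of each part. Coarser meshes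
  are harmless because the premeasure grows as the mesh shrinks.\<close>

lemma hausdorff1_outer_metric_add:
  assumes "0 < e" and sep: "\<And>x y. x \<in> A ==> y \<in> B ==> e <= dist x y"
  shows "H1 A + H1 B <= H1 (A \<union> B)"
proof -
  have *: "hausdorff1_pre dl A + hausdorff1_pre dl B <= H1 (A \<union> B)" if d: "0 < dl" "dl < e" for dl
  proof -
    have "hausdorff1_pre dl A + hausdorff1_pre dl B <= hausdorff1_pre dl (A \<union> B)"
    proof (rule dense_ge)
      fix z assume "hausdorff1_pre dl (A \<union> B) < z"
      then obtain C where C: "A \<union> B \<subseteq> (\<Union>i::nat. C i)" "\<And>i. bounded (C i)" "\<And>i. diameter (C i) <= dl"
         "(\<Sum>i. ennreal (diameter (C i))) < z" by (rule hausdorff1_pre_close) blast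
      define D where "D X i = (if C i \<inter> X = {} then {} else C i)" for X i
      have D: "hausdorff1_pre dl X <= (\<Sum>i. ennreal (diameter (D X i)))" if "X \<subseteq> A \<union> B" for X using C that d by (intro hausdorff1_pre_le) (fastforce simp: D_def)+
      have disj: "C i \<inter> A = {} \<or> C i \<inter> B = {}" for i
      proof (rule ccontr)
        assume "\<not> ?thesis"
        then obtain x y where "x \<in> C i" "x \<in> A" "y \<in> C i" "y \<in> B" by auto
        then show False using sep[of x y] diameter_bounded_bound[OF C(2), of x i y] C(3)[of i] d by simp
      qed
      have "hausdorff1_pre dl A + hausdorff1_pre dl B \<le>
         (\<Sum>i. ennreal (diameter (D A i))) + (\<Sum>i. ennreal (diameter (D B i)))" by (intro add_mono D) auto
      also have "... = (\<Sum>i. ennreal (diameter (D A i)) + ennreal (diameter (D B i)))" by (rule suminf_add) auto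
      also have "... <= (\<Sum>i. ennreal (diameter (C i)))" using disj by (intro suminf_le) (auto simp: D_def)
      finally show "hausdorff1_pre dl A + hausdorff1_pre dl B <= z" using C(4) by simp
    qed
    then show ?thesis using hausdorff1_pre_le_outer[OF d(1), of "A \<union> B"] by (rule order.trans)
  qed
  have "H1 A + H1 B = (SUP dl\<in>{0<..}. hausdorff1_pre dl A + hausdorff1_pre dl B)" unfolding hausdorff1_outer_def
  proof (rule SUP_add_directed_ennreal[symmetric])
    fix i j :: real assume "i \<in> {0<..}" "j \<in> {0<..}"
    then show "\<exists>k\<in>{0<..}. hausdorff1_pre i A + hausdorff1_pre j B <= hausdorff1_pre k A + hausdorff1_pre k B"
      by (intro bexI[of _ "min i j"] add_mono hausdorff1_pre_antimono) auto
  qed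
  also have "... <= H1 (A \<union> B)"
  proof (rule SUP_least)
    fix dl :: real assume "dl \<in> {0<..}"
    then have "hausdorff1_pre dl A + hausdorff1_pre dl B \<le>
       hausdorff1_pre (min dl (e/2)) A + hausdorff1_pre (min dl (e/2)) B" by (intro add_mono hausdorff1_pre_antimono) auto
    also have "... <= H1 (A \<union> B)" using \<open>dl \<in> {0<..}\<close> assms(1) by (intro *) auto
    finally show "hausdorff1_pre dl A + hausdorff1_pre dl B <= H1 (A \<union> B)" .
  qed
  finally show ?thesis .
qed

text \<open>Caratheodory's criterion for metric outer measures: the part of \<open>A\<close> off the closed set \<open>F\<close>
  is exhausted by the sets at distance at least \<open>1/(k+1)\<close> from \<open>F\<close>; the shells of even (odd) index are
  mutually separated, so the masses of the shells are summable and the exhaustion is lossless.\<close>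

lemma hausdorff1_outer_closed_split:
  assumes F: "closed F" "F \<noteq> {}"
  shows "H1 (A \<inter> F) + H1 (A - F) <= H1 A"
proof (cases "H1 A = top")
  case fin: False
  let ?H = H1
  define G where "G k = {x \<in> A. 1 / real (Suc k) <= infdist x F}" for k
  define R where "R k = {x \<in> A. 1 / real (Suc (Suc k)) <= infdist x F \<and> infdist x F < 1 / real (Suc k)}" for k
  \<comment> \<open>Between two shells of equal parity a whole shell is missing; the gap in distance
    to \<open>F\<close> is the width 1/m - 1/(m+1) of the shell skipped just before shell m.\<close>
  have sepR: "\<exists>e>0. \<forall>x\<in>R (2 * n + b). \<forall>y\<in>(\<Union>k<n. R (2 * k + b)). e <= dist x y" for n b
  proof -
    let ?m = "2 * n + b"
    let ?e = "1 / real ?m - 1 / real (Suc ?m)"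
    show ?thesis
    proof (cases "n = 0")
      case False
      have "?e > 0" using False by (simp add: divide_strict_left_mono)
      moreover have "?e <= dist x y" if "x \<in> R ?m" "k < n" "y \<in> R (2 * k + b)" for x y k
      proof -
        have "infdist x F < 1 / real (Suc ?m)" using that by (simp add: R_def)
        moreover have "1 / real ?m <= 1 / real (Suc (Suc (2 * k + b)))" using that by (intro divide_left_mono) auto
        then have "1 / real ?m <= infdist y F" using that(3) by (simp add: R_def)
        moreover have "infdist y F <= infdist x F + dist y x" by (rule infdist_triangle)
        ultimately show ?thesis by (simp add: dist_commute)
      qed
      ultimately show ?thesis by blast
    qed (auto intro: exI[of _ 1])
  qed
  have par: "(\<Sum>k<n. ?H (R (2 * k + b))) <= ?H (\<Union>k<n. R (2 * k + b))" for n b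
  proof (induction n)
    case (Suc n)
    obtain e where e: "e > 0" "\<And>x y. x \<in> R (2 * n + b) ==> y \<in> (\<Union>k<n. R (2 * k + b)) ==> e <= dist x y" using sepR[of n b] by blast
    have "(\<Sum>k<Suc n. ?H (R (2 * k + b))) <= ?H (R (2 * n + b)) + ?H (\<Union>k<n. R (2 * k + b))" using Suc by (simp add: add.commute add_mono)
    also have "... <= ?H (R (2 * n + b) \<union> (\<Union>k<n. R (2 * k + b)))" by (rule hausdorff1_outer_metric_add[OF e])
    also have "R (2 * n + b) \<union> (\<Union>k<n. R (2 * k + b)) = (\<Union>k<Suc n. R (2 * k + b))" by (auto simp: less_Suc_eq)
    finally show ?case .
  qed simp
  have "(\<Sum>k. ?H (R (2 * k + b))) <= ?H A" for b by (intro suminf_le_const order.trans[OF par] hausdorff1_outer_mono) (auto simp: R_def)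
  then have fin2: "(\<Sum>k. ?H (R (2 * k + b))) < top" for b using fin by (metis le_less_trans less_top)
  have sumR: "(\<Sum>k. ?H (R k)) < top"
  proof -
    have "(\<Sum>k. ?H (R k)) <= (\<Sum>k. ?H (R (2 * k + 0))) + (\<Sum>k. ?H (R (2 * k + 1)))"
    proof (rule suminf_le_const)
      fix n
      have "(\<Sum>k<n. ?H (R k)) <= (\<Sum>k<2*n. ?H (R k))" by (intro sum_mono2) auto
      also have "... = (\<Sum>k<n. ?H (R (2 * k + 0))) + (\<Sum>k<n. ?H (R (2 * k + 1)))" by (induction n) (auto simp: algebra_simps)
      also have "... <= (\<Sum>k. ?H (R (2 * k + 0))) + (\<Sum>k. ?H (R (2 * k + 1)))" by (intro add_mono sum_le_suminf) auto
      finally show "(\<Sum>k<n. ?H (R k)) <= (\<Sum>k. ?H (R (2 * k + 0))) + (\<Sum>k. ?H (R (2 * k + 1)))" .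
    qed simp
    also have "... < top" using fin2[of 0] fin2[of 1] by (simp add: less_top[symmetric])
    finally show ?thesis .
  qed
  have pos: "0 < infdist x F" if "x \<notin> F" for x using F that in_closed_iff_infdist_zero[of F x] infdist_nonneg[of x F] by fastforce
  have tail: "A - F \<subseteq> G n \<union> (\<Union>k. R (k + n))" for n
  proof
    fix x assume x: "x \<in> A - F"
    then have p: "0 < infdist x F" using pos by auto
    show "x \<in> G n \<union> (\<Union>k. R (k + n))"
    proof (cases "1 / real (Suc n) <= infdist x F")
      case False
      define k where "k = (LEAST k. 1 / real (Suc k) <= infdist x F)"
      obtain m where "1 / real (Suc m) < infdist x F" using reals_Archimedean[OF p] by (auto simp: inverse_eq_divide)
      then have k1: "1 / real (Suc k) <= infdist x F" unfolding k_def by (metis (mono_tags, lifting) LeastI less_imp_le)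
      have kn: "n < k"
      proof (rule ccontr)
        assume "\<not> n < k"
        then have "1 / real (Suc n) <= 1 / real (Suc k)" by (intro divide_left_mono) auto
        with k1 False show False by simp
      qed
      then obtain j where j: "k = Suc j" using gr0_implies_Suc by (metis gr_implies_not0 not0_implies_Suc)
      have "\<not> 1 / real (Suc j) <= infdist x F" using not_less_Least[of j "\<lambda>k. 1 / real (Suc k) <= infdist x F"] j by (simp add: k_def)
      then have "x \<in> R j" using x k1 j by (simp add: R_def)
      moreover have "j = (j - n) + n" using kn j by simp
      ultimately show ?thesis by (metis UN_I UNIV_I UnI2)
    qed (use x in \<open>simp add: G_def\<close>)
  qed
  \<comment> \<open>\<open>G n\<close> keeps distance 1/(n+1) from \<open>F\<close>, so metric
    additivity applies to it; what it misses of \<open>A - F\<close> lies in the shells from n on, a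
    tail of a convergent series.\<close>
  have bd: "?H (A \<inter> F) + ?H (A - F) <= ?H A + (\<Sum>k. ?H (R (k + n)))" for n
  proof -
    have "?H (A \<inter> F) + ?H (A - F) <= ?H (A \<inter> F) + (?H (G n) + (\<Sum>k. ?H (R (k + n))))" by (intro add_left_mono order.trans[OF hausdorff1_outer_mono[OF tail[of n]]]
          order.trans[OF hausdorff1_outer_Un] hausdorff1_outer_subadd)
    also have "?H (A \<inter> F) + ?H (G n) <= ?H (A \<inter> F \<union> G n)"
    proof (rule hausdorff1_outer_metric_add[of "1 / real (Suc n)"])
      fix x y assume "x \<in> A \<inter> F" "y \<in> G n"
      then show "1 / real (Suc n) <= dist x y" using infdist_le[of x F y] by (auto simp: G_def dist_commute)
    qed simp
    then have "?H (A \<inter> F) + (?H (G n) + (\<Sum>k. ?H (R (k + n)))) <= ?H (A \<inter> F \<union> G n) + (\<Sum>k. ?H (R (k + n)))" by (simp add: add.assoc[symmetric] add_right_mono)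
    also have "?H (A \<inter> F \<union> G n) <= ?H A" by (intro hausdorff1_outer_mono) (auto simp: G_def)
    finally show ?thesis by (simp add: add_right_mono)
  qed
  show ?thesis
  proof (rule ennreal_le_epsilon)
    fix e :: real assume e: "0 < e"
    define r where "r k = enn2real (?H (R k))" for k
    have rH: "?H (R k) = ennreal (r k)" for k using ennreal_suminf_lessD[OF sumR, of k] by (simp add: r_def)
    have "summable r" using sumR unfolding rH by (intro summable_suminf_not_top) (auto simp: r_def)
    then obtain N where N: "norm (\<Sum>i. r (i + N)) < e" using suminf_exist_split[OF e] by blast
    have "(\<Sum>k. ?H (R (k + N))) = ennreal (\<Sum>i. r (i + N))" unfolding rH using summable_ignore_initial_segment[OF \<open>summable r\<close>, of N]
      by (intro suminf_ennreal2) (auto simp: r_def)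
    also have "... <= ennreal e" using N by (intro ennreal_leI) auto
    finally show "?H (A \<inter> F) + ?H (A - F) <= ?H A + ennreal e" using bd[of N] by (meson add_left_mono order.trans)
  qed
qed simp

text \<open>Closed sets belong to Caratheodory's sigma-algebra, hence so do all Borel sets.
  \<open>measure_of\<close> yields the zero measure when its set function is not a measure, so this
  is the fact that gives \<open>hausdorff1\<close> its meaning.\<close>

lemma measure_space_hausdorff1:
  "measure_space UNIV (sets (borel :: 'a::metric_space measure)) H1"
proof -
  let ?H = "H1 :: 'a set => ennreal"
  interpret sigma_algebra UNIV "UNIV :: 'a set set" using sigma_algebra_Pow[of "UNIV :: 'a set"] by simp
  have oms: "outer_measure_space UNIV ?H" unfolding outer_measure_space_def positive_def increasing_def countably_subadditive_def
    using hausdorff1_outer_mono hausdorff1_outer_subadd by auto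
  have ms: "measure_space UNIV (lambda_system UNIV UNIV ?H) ?H" using oms by (rule caratheodory_lemma)
  have "F \<in> lambda_system UNIV UNIV ?H" if F: "closed F" for F
  proof -
    have "?H (F \<inter> x) + ?H ((UNIV - F) \<inter> x) = ?H x" for x
    proof (cases "F = {}")
      case False
      have "?H (F \<inter> x) + ?H ((UNIV - F) \<inter> x) = ?H (x \<inter> F) + ?H (x - F)" by (auto intro!: arg_cong2[where f="(+)"] arg_cong[where f="?H"])
      moreover have "?H x <= ?H (x \<inter> F) + ?H (x - F)" using hausdorff1_outer_Un[of "x \<inter> F" "x - F"] by (simp add: Int_Diff_Un)
      ultimately show ?thesis using hausdorff1_outer_closed_split[OF F False, of x] by simp
    qed simp
    then show ?thesis by (simp add: lambda_system_def)
  qed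
  then have "sigma_sets UNIV (Collect closed) \<subseteq> lambda_system UNIV UNIV ?H" using ms by (intro sigma_algebra.sigma_sets_subset) (auto simp: measure_space_def)
  then have "sets (borel :: 'a measure) \<subseteq> lambda_system UNIV UNIV ?H" by (simp add: borel_eq_closed)
  then show ?thesis using sets.sigma_algebra_axioms[of "borel :: 'a measure"] by (intro measure_down[OF ms]) simp_all
qed

section \<open>The measure \<open>hausdorff1\<close> and its behaviour under Lipschitz maps and
  similarities\<close>

lemma space_hausdorff1 [simp]: "space hausdorff1 = UNIV" by (simp add: hausdorff1_def space_measure_of_conv)

lemma sets_hausdorff1 [simp, measurable_cong]: "sets hausdorff1 = sets borel" using sets.sigma_sets_eq[of "borel :: 'a measure"] by (simp add: hausdorff1_def)

lemma emeasure_hausdorff1: "A \<in> sets borel ==> emeasure hausdorff1 A = H1 A" using measure_space_hausdorff1 sets.sigma_sets_eq[of "borel :: 'a measure"]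
  unfolding hausdorff1_def by (subst emeasure_measure_of_sigma) (auto simp: measure_space_def)

lemma hausdorff1_outer_lipschitz_interval:
  fixes f :: "real => 'a::metric_space"
  assumes f: "L-lipschitz_on {a..b} f" and ab: "a <= b"
  shows "H1 (f ` {a..b}) <= ennreal (L * (b - a))" unfolding hausdorff1_outer_def
proof (rule SUP_least)
  fix dl :: real assume "dl \<in> {0<..}"
  then have dl: "0 < dl" by simp
  have L: "0 <= L" using f by (rule lipschitz_on_nonneg)
  obtain n :: nat where n: "L * (b - a) / dl < real n" using reals_Archimedean2 by blast
  have n0: "n > 0" using n L ab dl by (metis divide_nonneg_pos diff_ge_0_iff_ge gr0I mult_nonneg_nonneg not_less of_nat_0)
  define h where "h = (b - a) / n"
  have h: "0 <= h" "real n * h = b - a" using ab n0 by (auto simp: h_def)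
  define C where "C i = (if i < n then f ` ({a + i * h .. a + Suc i * h} \<inter> {a..b}) else {})" for i
  have Cd: "dist x y <= L * h" if "x \<in> C i" "y \<in> C i" for x y i
  proof -
    from that obtain s t where st: "s \<in> {a..b}" "t \<in> {a..b}" "x = f s" "y = f t"
      "s \<in> {a + i * h .. a + Suc i * h}" "t \<in> {a + i * h .. a + Suc i * h}" by (auto simp: C_def split: if_splits)
    have "dist x y <= L * dist s t" using st lipschitz_onD[OF f] by auto
    also have "dist s t <= h" using st(5,6) by (auto simp: dist_real_def algebra_simps)
    finally show ?thesis using L by (simp add: mult_left_mono)
  qed
  have bd: "bounded (C i)" for i using Cd[of _ i] by (cases "C i = {}") (auto simp: bounded_def, metis)
  have di: "diameter (C i) <= L * h" for i using Cd[of _ i] L h(1) by (cases "C i = {}") (auto simp: diameter_def intro!: cSUP_least)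
  have "f ` {a..b} \<subseteq> (\<Union>i. C i)"
  proof
    fix y assume "y \<in> f ` {a..b}"
    then obtain t where t: "t \<in> {a..b}" "y = f t" by auto
    show "y \<in> (\<Union>i. C i)"
    proof (cases "h = 0")
      case True
      then have "b = a" using h by simp
      then have "y \<in> C 0" using t n0 by (auto simp: C_def True)
      then show ?thesis by blast
    next
      case False
      then have hp: "h > 0" using h by simp
      \<comment> \<open>The minimum with \<open>n - 1\<close> puts the right end point
        \<open>b\<close> into the last piece.\<close>
      define i where "i = min (n - 1) (nat \<lfloor>(t - a) / h\<rfloor>)"
      have tn: "(t - a) / h <= real n" using t h hp by (simp add: field_simps)
      have i1: "real i <= (t - a) / h"
      proof -
        have "real i <= real (nat \<lfloor>(t - a) / h\<rfloor>)" by (simp add: i_def)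
        also have "... <= (t - a) / h" using t hp by simp
        finally show ?thesis .
      qed
      have i2: "(t - a) / h <= real (Suc i)"
      proof (cases "nat \<lfloor>(t - a) / h\<rfloor> <= n - 1")
        case True
        then have "i = nat \<lfloor>(t - a) / h\<rfloor>" by (simp add: i_def)
        then show ?thesis using t hp by (simp) linarith
      next
        case False
        then have "Suc i = n" using n0 by (simp add: i_def)
        then show ?thesis using tn by simp
      qed
      have "t \<in> {a + i * h .. a + Suc i * h}" using i1 i2 hp by (auto simp: field_simps)
      moreover have "i < n" using n0 by (simp add: i_def min_less_iff_disj)
      ultimately have "y \<in> C i" using t by (auto simp: C_def)
      then show ?thesis by blast
    qed
  qed
  moreover have "L * h <= dl" using n n0 dl by (simp add: h_def field_simps)
  ultimately have "hausdorff1_pre dl (f ` {a..b}) <= (\<Sum>i. ennreal (diameter (C i)))" using bd order.trans[OF di] by (intro hausdorff1_pre_le) auto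
  also have "... = (\<Sum>i<n. ennreal (diameter (C i)))" by (rule suminf_finite) (auto simp: C_def)
  also have "... <= (\<Sum>i<n. ennreal (L * h))" by (intro sum_mono ennreal_leI di)
  also have "... = ennreal (L * (b - a))" using h L by (simp add: ennreal_of_nat_eq_real_of_nat mult.left_commute flip: ennreal_mult)
  finally show "hausdorff1_pre dl (f ` {a..b}) <= ennreal (L * (b - a))" .
qed

text \<open>Each covering set contributes the interval around the image of one of its points whose
  radius is its diameter. Such an interval has length twice the diameter, whence the factor
  1/2.\<close>

lemma hausdorff1_outer_ge:
  fixes f :: "'a::metric_space => real"
  assumes f: "1-lipschitz_on A f" and r: "{0<..<r} \<subseteq> f ` A"
  shows "ennreal (r / 2) <= H1 A"
proof -
  have "ennreal (r / 2) <= hausdorff1_pre 1 A" unfolding hausdorff1_pre_def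
  proof (rule INF_greatest)
    fix C assume "C \<in> {C :: nat => 'a set. A \<subseteq> (\<Union>i. C i) \<and> (\<forall>i. bounded (C i) \<and> diameter (C i) <= 1)}"
    then have C: "A \<subseteq> (\<Union>i. C i)" "\<And>i. bounded (C i)" by auto
    define p where "p i = (SOME x. x \<in> C i \<inter> A)" for i
    have p: "p i \<in> C i \<inter> A" if "C i \<inter> A \<noteq> {}" for i unfolding p_def using that by (metis ex_in_conv someI_ex)
    have "{0<..<r} \<subseteq> (\<Union>i. cball (f (p i)) (diameter (C i)))"
    proof
      fix s assume "s \<in> {0<..<r}"
      then obtain x where x: "x \<in> A" "s = f x" using r by auto
      then obtain i where i: "x \<in> C i" using C by auto
      have pi: "p i \<in> C i \<inter> A" using x i by (intro p) auto
      have "dist (f (p i)) (f x) <= 1 * dist (p i) x" using pi x by (intro lipschitz_onD[OF f]) auto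
      also have "... <= diameter (C i)" using diameter_bounded_bound[OF C(2)] pi i by simp
      finally show "s \<in> (\<Union>i. cball (f (p i)) (diameter (C i)))" using x by auto
    qed
    then have "emeasure lborel {0<..<r} <= emeasure lborel (\<Union>i. cball (f (p i)) (diameter (C i)))" by (intro emeasure_mono) auto
    also have "... <= (\<Sum>i. emeasure lborel (cball (f (p i)) (diameter (C i))))" by (intro emeasure_subadditive_countably) auto
    also have "... = (\<Sum>i. 2 * ennreal (diameter (C i)))" using diameter_ge_0[OF C(2)]
      by (intro suminf_cong) (simp add: cball_eq_atLeastAtMost ennreal_mult[symmetric] algebra_simps
           del: ennreal_numeral add: ennreal_numeral[symmetric])
    also have "... = 2 * (\<Sum>i. ennreal (diameter (C i)))" by simp
    finally have *: "ennreal r <= 2 * (\<Sum>i. ennreal (diameter (C i)))" by (cases "0 <= r") (auto simp: ennreal_neg)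
    show "ennreal (r / 2) <= (\<Sum>i. ennreal (diameter (C i)))"
    proof (cases "\<Sum>i. ennreal (diameter (C i))")
      case (real q)
      with * have "ennreal r <= ennreal (2 * q)" by (simp add: ennreal_mult)
      then show ?thesis using real by (auto simp: ennreal_le_iff intro!: ennreal_leI)
    qed simp
  qed
  also have "... <= H1 A" by (rule hausdorff1_pre_le_outer) simp
  finally show ?thesis .
qed

lemma ennreal_times_divide_cancel: "0 < c ==> ennreal c * (z / ennreal c) = z" by (simp add: ennreal_times_divide mult.commute[of _ z] ennreal_mult_divide_eq)

lemma hausdorff1_outer_similarity:
  fixes f :: "'a::metric_space => 'b::metric_space"
  assumes f: "\<And>x y. dist (f x) (f y) = L * dist x y" and L: "0 < L"
  shows "H1 (f ` A) <= ennreal L * H1 A" unfolding hausdorff1_outer_def[of "f ` A"]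
proof (rule SUP_least)
  fix dl :: real assume "dl \<in> {0<..}"
  then have d: "0 < dl / L" using L by simp
  show "hausdorff1_pre dl (f ` A) <= ennreal L * H1 A"
  proof (rule dense_ge)
    fix z assume z: "ennreal L * H1 A < z"
    have "H1 A < z / ennreal L" using z ennreal_times_divide_cancel[OF L, of z] by (metis leD leI mult_left_mono zero_le)
    then have "hausdorff1_pre (dl / L) A < z / ennreal L" using hausdorff1_pre_le_outer[OF d, of A] by (rule le_less_trans[rotated])
    then obtain C where C: "A \<subseteq> (\<Union>i::nat. C i)" "\<And>i. bounded (C i)" "\<And>i. diameter (C i) <= dl / L"
         "(\<Sum>i. ennreal (diameter (C i))) < z / ennreal L" by (rule hausdorff1_pre_close) blast
    have di: "diameter (f ` C i) <= L * diameter (C i)" for i using L diameter_bounded_bound[OF C(2), of _ i] diameter_ge_0[OF C(2)]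
      by (cases "C i = {}") (auto simp: diameter_def[of "f ` C i"] f intro!: cSUP_least)
    have "bounded (f ` C i)" for i
    proof -
      from C(2)[of i] obtain x e where "\<forall>y\<in>C i. dist x y <= e" unfolding bounded_def by blast
      then have "\<forall>y\<in>f ` C i. dist (f x) y <= L * e" using L by (auto simp: f)
      then show ?thesis unfolding bounded_def by blast
    qed
    moreover have "diameter (f ` C i) <= dl" for i
    proof -
      have "L * diameter (C i) <= dl" using C(3)[of i] L by (simp add: field_simps)
      then show ?thesis using di[of i] by simp
    qed
    moreover have "f ` A \<subseteq> (\<Union>i. f ` C i)" using C(1) by blast
    ultimately have "hausdorff1_pre dl (f ` A) <= (\<Sum>i. ennreal (diameter (f ` C i)))" by (intro hausdorff1_pre_le)
    also have "... <= (\<Sum>i. ennreal L * ennreal (diameter (C i)))"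
      using di L diameter_ge_0[OF C(2)] by (intro suminf_le) (auto simp: ennreal_mult[symmetric] intro!: ennreal_leI)
    also have "... = ennreal L * (\<Sum>i. ennreal (diameter (C i)))" by simp
    also have "... <= z" using C(4) ennreal_times_divide_cancel[OF L, of z] by (metis less_imp_le mult_left_mono zero_le)
    finally show "hausdorff1_pre dl (f ` A) <= z" .
  qed
qed

lemma hausdorff1_outer_singleton [simp]: "H1 {x} = 0" using hausdorff1_outer_lipschitz_interval[of 0 0 0 "\<lambda>_. x"] by (simp add: lipschitz_on_def)



section \<open>Measurability on the space of curves\<close>

lemma curve_dist_le: "cv \<in> curves ==> 0 <= s ==> 0 <= t ==> dist (cv s) (cv t) <= \<bar>s - t\<bar>"
  unfolding curves_def using lipschitz_onD[of 1 "{0..}" cv s t] by (simp add: dist_real_def)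

lemma curve_continuous_on: "cv \<in> curves ==> continuous_on {0..} cv" unfolding curves_def by (auto intro: lipschitz_on_continuous_on)

lemma curvesI:
  "(\<And>t. t < 0 ==> cv t = undefined) ==> (\<And>s t. 0 <= s ==> s <= t ==> dist (cv s) (cv t) <= t - s) ==> cv \<in> curves"
proof -
  assume *: "\<And>t. t < 0 ==> cv t = undefined" "\<And>s t. 0 <= s ==> s <= t ==> dist (cv s) (cv t) <= t - s"
  have "dist (cv s) (cv t) <= 1 * dist s t" if "0 <= s" "0 <= t" for s t using *(2)[of s t] *(2)[of t s] that dist_commute[of "cv s" "cv t"]
    by (cases "s <= t") (simp_all add: dist_real_def)
  then show ?thesis using *(1) by (auto simp: curves_def extensional_def lipschitz_on_def)
qed

lemma space_curve_borel [simp]: "space curve_borel = curves" unfolding curve_borel_def by (rule space_measure_of) (auto simp: openin_curve_topology curve_open_def)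

lemma sets_curve_borel: "sets curve_borel = sigma_sets curves {U. curve_open U}" unfolding curve_borel_def openin_curve_topology
  by (rule sets_measure_of) (auto simp: curve_open_def)

lemma curve_open_eval:
  assumes "open S" "0 <= t" shows "curve_open {cv \<in> curves. cv t \<in> S}" unfolding curve_open_def
proof (intro conjI ballI)
  fix cv assume "cv \<in> {cv \<in> curves. cv t \<in> S}"
  then obtain e where "e > 0" "ball (cv t) e \<subseteq> S" using assms(1) open_contains_ball by blast
  then show "\<exists>K \<epsilon>. compact K \<and> K \<subseteq> {0..} \<and> 0 < \<epsilon> \<and> curve_nbhd cv K \<epsilon> \<subseteq> {cv \<in> curves. cv t \<in> S}"
    using assms(2) by (intro exI[of _ "{t}"] exI[of _ e]) (auto simp: curve_nbhd_def dist_commute)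
qed auto

lemma measurable_curve_eval [measurable (raw)]:
  assumes "0 <= t" shows "(\<lambda>cv. cv t) \<in> borel_measurable curve_borel"
proof (rule borel_measurableI)
  fix S :: "'a set" assume "open S"
  then have "{cv \<in> curves. cv t \<in> S} \<in> sets curve_borel" using assms curve_open_eval unfolding sets_curve_borel by auto
  also have "{cv \<in> curves. cv t \<in> S} = (\<lambda>cv. cv t) -` S \<inter> space curve_borel" by auto
  finally show "(\<lambda>cv. cv t) -` S \<inter> space curve_borel \<in> sets curve_borel" .
qed

text \<open>The evaluations generate the Borel sets: by separability every open set of curves is a countable
  union of cylinders constraining the values at finitely many times.\<close>

lemma measurable_curve_borelI:
  fixes f :: "'b => real => 'a::{second_countable_topology, metric_space}"
  assumes f: "\<And>x. x \<in> space M ==> f x \<in> curves"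
    and [measurable]: "\<And>t. 0 <= t ==> (\<lambda>x. f x t) \<in> borel_measurable M"
  shows "f \<in> measurable M curve_borel"
proof -
  obtain D :: "'a set" where D: "countable D" "\<And>X. open X ==> X \<noteq> {} ==> \<exists>d\<in>D. d \<in> X" using countable_dense_exists by blast
  \<comment> \<open>A cylinder: the values at the times i/(m+1) are prescribed up to 1/(m+1) by the
    entries of a list. With entries from a countable dense set there are only countably many
    cylinders.\<close>
  define N :: "nat => 'a list => (real => 'a) set" where
    "N m ps = {cv \<in> curves. \<forall>i<length ps. dist (cv (i / Suc m)) (ps ! i) < 1 / Suc m}" for m ps
  have Nmeas: "f -` N m ps \<inter> space M \<in> sets M" for m ps
  proof -
    have "f -` N m ps \<inter> space M = {x \<in> space M. \<forall>i<length ps. dist (f x (i / Suc m)) (ps ! i) < 1 / Suc m}" using f by (auto simp: N_def)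
    also have "... \<in> sets M" by measurable
    finally show ?thesis .
  qed
  show ?thesis unfolding curve_borel_def openin_curve_topology
  proof (rule measurable_measure_of)
    fix U :: "(real => 'a) set" assume "U \<in> {U. curve_open U}"
    then have U: "curve_open U" by simp
    have "U \<subseteq> (\<Union>(m, ps) \<in> {(m, ps). ps \<in> lists D \<and> N m ps \<subseteq> U}. N m ps)"
    proof
      fix cv assume cv: "cv \<in> U"
      then have cvc: "cv \<in> curves" using U by (auto simp: curve_open_def)
      obtain K \<epsilon> where K: "compact K" "K \<subseteq> {0..}" "0 < \<epsilon>" "curve_nbhd cv K \<epsilon> \<subseteq> U" using U cv unfolding curve_open_def by meson
      obtain R where R: "\<And>t. t \<in> K ==> norm t <= R" using compact_imp_bounded[OF K(1)] by (auto simp: bounded_iff)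
      \<comment> \<open>Four errors of size at most 1/(m+1) have to fit below \<epsilon>: the
        displacement of each of the two curves to the nearest earlier grid time, and the distance of
        each curve there to the chosen point of \<open>D\<close>.\<close>
      obtain m where m: "inverse (Suc m) < \<epsilon> / 4" using reals_Archimedean[of "\<epsilon> / 4"] K(3) by auto
      define dl where "dl = 1 / real (Suc m)"
      have dl: "0 < dl" "4 * dl < \<epsilon>" using m by (auto simp: dl_def inverse_eq_divide)
      define L where "L = Suc (nat \<lfloor>R * Suc m\<rfloor>)"
      have "\<exists>p\<in>D. dist (cv (i / Suc m)) p < dl" for i :: nat using D(2)[of "ball (cv (i / Suc m)) dl"] dl by auto
      then obtain p where p: "\<And>i::nat. p i \<in> D" "\<And>i::nat. dist (cv (i / Suc m)) (p i) < dl" by metis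
      let ?ps = "map p [0..<L]"
      have "cv \<in> N m ?ps" using p cvc by (auto simp: N_def dl_def)
      moreover have "N m ?ps \<subseteq> U"
      proof -
        have "eta \<in> curve_nbhd cv K \<epsilon>" if eta: "eta \<in> N m ?ps" for eta unfolding curve_nbhd_def
        proof (intro CollectI conjI ballI)
          show etac: "eta \<in> curves" using eta by (auto simp: N_def)
          fix t assume t: "t \<in> K"
          then have t0: "0 <= t" "t <= R" using K R[OF t] by auto
          define i where "i = nat \<lfloor>t * Suc m\<rfloor>"
          have i: "real i <= t * Suc m" "t * Suc m < real i + 1" using t0 by (auto simp: i_def)
          have "\<lfloor>t * Suc m\<rfloor> <= \<lfloor>R * Suc m\<rfloor>" using t0 by (intro floor_mono mult_right_mono) auto
          then have iL: "i < L" by (auto simp: i_def L_def less_Suc_eq_le intro!: nat_mono)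
          have ti: "\<bar>t - i / Suc m\<bar> <= dl" 
          proof -
            have "t * Suc m * dl = t" by (simp add: dl_def)
            moreover have "real i * dl <= t * Suc m * dl" "t * Suc m * dl <= (real i + 1) * dl" using i dl by (intro mult_right_mono; simp)+
            ultimately show ?thesis by (simp add: dl_def abs_le_iff add_divide_distrib)
          qed
          have "dist (eta (i / Suc m)) (p i) < dl" using eta iL by (auto simp: N_def dl_def)
          moreover have "dist (eta t) (eta (i / Suc m)) <= dl" using curve_dist_le[OF etac, of t "i / Suc m"] ti t0 by auto
          moreover have "dist (cv t) (cv (i / Suc m)) <= dl" using curve_dist_le[OF cvc, of t "i / Suc m"] ti t0 by auto
          moreover have "dist (eta t) (cv t) <= dist (eta t) (eta (i / Suc m)) + dist (eta (i / Suc m)) (p i)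
             + dist (cv (i / Suc m)) (p i) + dist (cv t) (cv (i / Suc m))" by metric
          ultimately show "dist (eta t) (cv t) < \<epsilon>" using p(2)[of i] dl by linarith
        qed
        then show ?thesis using K(4) by blast
      qed
      moreover have "?ps \<in> lists D" using p by auto
      ultimately show "cv \<in> (\<Union>(m, ps) \<in> {(m, ps). ps \<in> lists D \<and> N m ps \<subseteq> U}. N m ps)" by blast
    qed
    then have U_eq: "U = (\<Union>(m, ps) \<in> {(m, ps). ps \<in> lists D \<and> N m ps \<subseteq> U}. N m ps)" by (intro equalityI) auto
    have "f -` U \<inter> space M = (\<Union>(m, ps) \<in> {(m, ps). ps \<in> lists D \<and> N m ps \<subseteq> U}. f -` N m ps \<inter> space M)" by (subst U_eq) (auto simp: vimage_UN)
    also have "... \<in> sets M"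
    proof (rule sets.countable_UN'')
      have "countable ((UNIV :: nat set) \<times> lists D)" using D(1) by (intro countable_SIGMA countable_lists) auto
      then show "countable {(m :: nat, ps). ps \<in> lists D \<and> N m ps \<subseteq> U}" by (rule countable_subset[rotated]) auto
    qed (use Nmeas in auto)
    finally show "f -` U \<inter> space M \<in> sets M" .
  qed (use f in \<open>auto simp: curve_open_def\<close>)
qed

section \<open>Stopping and end points of curves\<close>

definition const_from :: "nat => (real => 'a) => bool" where
  "const_from n cv \<longleftrightarrow> (\<forall>t\<ge>real n. cv t = cv (real n))"

text \<open>Integer stopping times suffice to decide whether a curve stops, and they make the event
  a countable union.\<close>

definition stops :: "(real => 'a) => bool" where
  "stops cv \<longleftrightarrow> (\<exists>n. const_from n cv)"

lemma stop_time_eq_top_iff: "stop_time cv = \<infinity> \<longleftrightarrow> \<not> stops cv"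
proof -
  have "stop_time cv < top \<longleftrightarrow> (\<exists>tau\<ge>0. cv constant_on {tau..})" unfolding stop_time_def Inf_less_iff by auto
  also have "... \<longleftrightarrow> stops cv"
  proof
    assume "\<exists>tau\<ge>0. cv constant_on {tau..}"
    then obtain tau c where "\<And>t. t \<ge> tau ==> cv t = c" by (auto simp: constant_on_def)
    moreover obtain n :: nat where n: "tau <= real n" using real_arch_simple by blast
    ultimately have "cv t = cv (real n)" if "real n <= t" for t using that by (metis order.trans)
    then show "stops cv" unfolding stops_def const_from_def by blast
  next
    assume "stops cv"
    then show "\<exists>tau\<ge>0. cv constant_on {tau..}" unfolding stops_def const_from_def constant_on_def by (metis atLeast_iff of_nat_0_le_iff)
  qed
  finally show ?thesis by (metis infinity_ennreal_def less_top)
qed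

text \<open>The infimum \<open>T\<close> of the stopping times is not known to be attained. The
  curve equals \<open>c\<close> at every time \<open>T + e\<close>, and the Lipschitz bound lets
  \<open>e\<close> tend to 0.\<close>

lemma curve_end_eq:
  assumes cv: "cv \<in> curves" and tau: "0 <= tau" "\<And>t. t \<ge> tau ==> cv t = c"
  shows "curve_end cv = c"
proof -
  have "stop_time cv <= ennreal tau" unfolding stop_time_def using tau by (intro Inf_lower) (auto simp: constant_on_def)
  then have "stop_time cv < top" using le_less_trans ennreal_less_top by blast
  then have fin: "stop_time cv = ennreal (enn2real (stop_time cv))" by simp
  define T where "T = enn2real (stop_time cv)"
  have T0: "0 <= T" by (simp add: T_def)
  have "dist (cv T) c <= e" if e: "0 < e" for e
  proof -
    have "stop_time cv < ennreal (T + e)" using e T0 by (subst fin) (auto simp: T_def[symmetric] ennreal_less_iff)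
    then obtain sig where sig: "0 <= sig" "cv constant_on {sig..}" "ennreal sig < ennreal (T + e)" unfolding stop_time_def Inf_less_iff by auto
    then obtain d where d: "\<And>t. t \<ge> sig ==> cv t = d" by (auto simp: constant_on_def)
    have "d = c" using d[of "max sig tau"] tau(2)[of "max sig tau"] by simp
    moreover have "sig < T + e" using sig by (simp add: ennreal_less_iff)
    ultimately have "cv (T + e) = c" using d by simp
    then show ?thesis using curve_dist_le[OF cv T0, of "T + e"] e T0 by simp
  qed
  then have "dist (cv T) c <= 0" by (rule field_le_epsilon[of _ 0, simplified])
  then show ?thesis by (simp add: curve_end_def T_def)
qed

lemma curve_end_eq_nat:
  assumes "cv \<in> curves" "const_from n cv" shows "curve_end cv = cv (real n)"
proof (rule curve_end_eq[OF assms(1)])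
  show "0 <= real n" by simp
  show "cv t = cv (real n)" if "real n <= t" for t using assms(2) that unfolding const_from_def by blast
qed

lemma curve_end_not_stops: "\<not> stops cv ==> curve_end cv = cv 0" using stop_time_eq_top_iff[of cv] by (simp add: curve_end_def)

lemma curve_const_from_iff:
  assumes "cv \<in> curves"
  shows "const_from n cv \<longleftrightarrow> (\<forall>q\<in>{q\<in>\<rat>. q \<ge> real n}. dist (cv q) (cv (real n)) = 0)" unfolding const_from_def
proof (intro iffI allI impI)
  fix t assume *: "\<forall>q\<in>{q\<in>\<rat>. q \<ge> real n}. dist (cv q) (cv (real n)) = 0" and t: "real n <= t"
  have "dist (cv t) (cv (real n)) <= e" if e: "0 < e" for e
  proof -
    have "t < t + e" using e by simp
    then obtain q where q: "q \<in> \<rat>" "t < q" "q < t + e" using Rats_dense_in_real by blast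
    then have "cv q = cv (real n)" using bspec[OF *, of q] t by simp
    moreover have "0 <= t" using t of_nat_0_le_iff[of n, where ?'a=real] by linarith
    ultimately show ?thesis using curve_dist_le[OF assms, of t q] q by auto
  qed
  then have "dist (cv t) (cv (real n)) <= 0" by (rule field_le_epsilon[of _ 0, simplified])
  then show "cv t = cv (real n)" by simp
next
  assume *: "\<forall>t\<ge>real n. cv t = cv (real n)"
  show "\<forall>q\<in>{q\<in>\<rat>. q \<ge> real n}. dist (cv q) (cv (real n)) = 0" using spec[OF *] by (metis (mono_tags, lifting) dist_self mem_Collect_eq)
qed

context
  fixes dummy :: "'a::{second_countable_topology, metric_space}"
begin

lemma pred_const_from [measurable]:
  "Measurable.pred curve_borel (const_from n :: (real => 'a) => bool)"
proof -
  have c: "countable {q\<in>\<rat>. q \<ge> real n}" by (rule countable_subset[OF _ countable_rat]) auto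
  have "{cv \<in> space curve_borel. \<forall>q\<in>{q\<in>\<rat>. q \<ge> real n}. dist (cv q) (cv (real n) :: 'a) = 0} \<in> sets curve_borel"
  proof (rule sets.sets_Collect_countable_All'[OF _ c])
    fix q assume "q \<in> {q\<in>\<rat>. q \<ge> real n}"
    then have [simp]: "0 <= q" by (auto intro: order.trans[OF of_nat_0_le_iff])
    show "{cv \<in> space curve_borel. dist (cv q) (cv (real n) :: 'a) = 0} \<in> sets curve_borel" by measurable
  qed
  also have "{cv \<in> space curve_borel. \<forall>q\<in>{q\<in>\<rat>. q \<ge> real n}. dist (cv q) (cv (real n) :: 'a) = 0} =
     {cv \<in> space curve_borel. const_from n cv}" by (intro Collect_cong conj_cong refl) (simp only: space_curve_borel curve_const_from_iff)
  finally show ?thesis by (simp add: pred_def)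
qed

lemma pred_stops [measurable]: "Measurable.pred curve_borel (stops :: (real => 'a) => bool)"
  unfolding stops_def[abs_def] by (rule pred_intros_countable(2)) (rule pred_const_from)

text \<open>If the curve is constant from time n on, its end is the evaluation at n; if it never
  stops, \<open>curve_end\<close> takes its default value \<open>cv 0\<close>. This splits the
  preimage into countably many measurable events.\<close>

lemma measurable_curve_end [measurable]:
  "(curve_end :: (real => 'a) => 'a) \<in> borel_measurable curve_borel"
proof (rule measurableI)
  fix A :: "'a set" assume [measurable]: "A \<in> sets borel"
  have "curve_end -` A \<inter> space curve_borel =
     {cv \<in> space curve_borel. (\<exists>n. const_from n cv \<and> cv (real n) \<in> A) \<or> (\<not> stops cv \<and> cv 0 \<in> A)}"
    (is "?L = ?R")
  proof (intro equalityI subsetI)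
    fix cv :: "real => 'a" assume "cv \<in> ?L"
    then have cv: "cv \<in> curves" "curve_end cv \<in> A" by auto
    show "cv \<in> ?R"
    proof (cases "stops cv")
      case True
      then obtain n where n: "const_from n cv" unfolding stops_def by blast
      then have "cv (real n) \<in> A" using curve_end_eq_nat[OF cv(1) n] cv(2) by simp
      then show ?thesis unfolding mem_Collect_eq space_curve_borel using n cv(1) by blast
    next
      case False
      then have "cv 0 \<in> A" using curve_end_not_stops[OF False] cv(2) by simp
      then show ?thesis unfolding mem_Collect_eq space_curve_borel using False cv(1) by blast
    qed
  next
    fix cv :: "real => 'a" assume cv: "cv \<in> ?R"
    then have c: "cv \<in> curves" by simp
    from cv consider n where "const_from n cv" "cv (real n) \<in> A" | "\<not> stops cv" "cv 0 \<in> A" unfolding mem_Collect_eq by blast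
    then have "curve_end cv \<in> A"
    proof cases
      case 1 then show ?thesis using curve_end_eq_nat[OF c 1(1)] by simp
    next
      case 2 then show ?thesis using curve_end_not_stops[OF 2(1)] by simp
    qed
    then show "cv \<in> ?L" using c by simp
  qed
  also have "... \<in> sets curve_borel" by measurable
  finally show "curve_end -` A \<inter> space curve_borel \<in> sets curve_borel" .
qed simp

end



subsection \<open>Counting the visits of a point\<close>

definition visits :: "(real => 'a) => 'a => ennreal" where
  "visits cv x = emeasure (count_space UNIV) {t \<in> {0..}. cv t = x}"

text \<open>Finitely many distinct times eventually lie in distinct dyadic intervals, so the number
  of occupied intervals of length 2^(-n) tends to the number of times. This expresses the count of
  visits by countably many hitting events, jointly in point and curve.\<close>

lemma emeasure_count_space_eq_SUP_dyadic:
  fixes T :: "real set"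
  assumes T: "T \<subseteq> {0..}"
  shows "emeasure (count_space UNIV) T =
    (SUP n. emeasure (count_space UNIV) ((\<lambda>t. nat \<lfloor>t * 2 ^ n\<rfloor>) ` T))"
proof (rule antisym)
  let ?c = "emeasure (count_space UNIV) T"
  let ?d = "\<lambda>n S. emeasure (count_space UNIV) ((\<lambda>t::real. nat \<lfloor>t * 2 ^ n\<rfloor>) ` S)"
  have sub: "of_nat (card F) <= (SUP n. ?d n T)" if F: "finite F" "F \<subseteq> T" for F
  proof -
    have "eventually (\<lambda>n. nat \<lfloor>s * 2 ^ n\<rfloor> \<noteq> nat \<lfloor>t * 2 ^ n\<rfloor>) sequentially" if st: "s \<in> T" "s < t" "t \<in> T" for s t
    proof -
      obtain N where N: "1 / (t - s) < 2 ^ N" using real_arch_pow[of 2 "1 / (t - s)"] by auto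
      show ?thesis
      proof (rule eventually_sequentiallyI[of N])
        fix n assume "N <= n"
        then have "(2::real) ^ N <= 2 ^ n" by simp
        then have "1 / (t - s) < 2 ^ n" using N by linarith
        then have "1 < t * 2 ^ n - s * 2 ^ n" using st by (simp add: field_simps)
        then have "\<lfloor>s * 2 ^ n\<rfloor> < \<lfloor>t * 2 ^ n\<rfloor>" by linarith
        moreover have "0 <= s" using st T by auto
        then have "0 <= \<lfloor>s * 2 ^ n\<rfloor>" by simp
        ultimately show "nat \<lfloor>s * 2 ^ n\<rfloor> \<noteq> nat \<lfloor>t * 2 ^ n\<rfloor>" by linarith
      qed
    qed
    note * = this
    have "\<forall>s\<in>F. \<forall>t\<in>F. s \<noteq> t \<longrightarrow> eventually (\<lambda>n. nat \<lfloor>s * 2 ^ n\<rfloor> \<noteq> nat \<lfloor>t * 2 ^ n\<rfloor>) sequentially"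
    proof (intro ballI impI)
      fix s t assume "s \<in> F" "t \<in> F" "s \<noteq> t"
      then have "s \<in> T" "t \<in> T" "s < t \<or> t < s" using F by auto
      then show "eventually (\<lambda>n. nat \<lfloor>s * 2 ^ n\<rfloor> \<noteq> nat \<lfloor>t * 2 ^ n\<rfloor>) sequentially"
        using *[of s t] eventually_mono[OF *[of t s], of "\<lambda>n. nat \<lfloor>s * 2 ^ n\<rfloor> \<noteq> nat \<lfloor>t * 2 ^ n\<rfloor>"] by fastforce
    qed
    note ** = this
    have "eventually (\<lambda>n. \<forall>s\<in>F. \<forall>t\<in>F. s \<noteq> t \<longrightarrow> nat \<lfloor>s * 2 ^ n\<rfloor> \<noteq> nat \<lfloor>t * 2 ^ n\<rfloor>) sequentially"
    proof (intro eventually_ball_finite[OF F(1)] ballI)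
      fix s t assume "s \<in> F" "t \<in> F"
      then show "eventually (\<lambda>n. s \<noteq> t \<longrightarrow> nat \<lfloor>s * 2 ^ n\<rfloor> \<noteq> nat \<lfloor>t * 2 ^ n\<rfloor>) sequentially" using ** by (cases "s = t") auto
    qed
    then obtain n where "\<forall>s\<in>F. \<forall>t\<in>F. s \<noteq> t \<longrightarrow> nat \<lfloor>s * 2 ^ n\<rfloor> \<noteq> nat \<lfloor>t * 2 ^ n\<rfloor>" using eventually_happens'[OF sequentially_bot] by blast
    then have "inj_on (\<lambda>t. nat \<lfloor>t * 2 ^ n\<rfloor>) F" by (auto simp: inj_on_def)
    then have "of_nat (card F) = ?d n F" using F by (simp add: card_image)
    also have "... <= ?d n T" using F by (intro emeasure_mono) auto
    also have "... <= (SUP n. ?d n T)" by (rule SUP_upper) simp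
    finally show ?thesis .
  qed
  show "?c <= (SUP n. ?d n T)"
  proof (cases "finite T")
    case True then show ?thesis using sub[of T] by simp
  next
    case False
    have "(SUP n. ?d n T) = top"
    proof (rule ccontr)
      assume "(SUP n. ?d n T) \<noteq> top"
      then obtain r where r: "0 <= r" "(SUP n. ?d n T) = ennreal r" by (cases "SUP n. ?d n T") auto
      obtain k :: nat where k: "r < real k" using reals_Archimedean2 by blast
      obtain F where "finite F" "card F = k" "F \<subseteq> T" using infinite_arbitrarily_large[OF False] by blast
      then have "ennreal (real k) <= ennreal r" using sub[of F] r by (simp add: ennreal_of_nat_eq_real_of_nat)
      then show False using k r by (simp add: ennreal_le_iff2)
    qed
    then show ?thesis by (simp only: top_greatest)
  qed
  show "(SUP n. ?d n T) <= ?c"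
  proof (rule SUP_least)
    fix n
    show "?d n T <= ?c" by (cases "finite T") (auto intro!: card_image_le)
  qed
qed

text \<open>A compact piece of curve contains every point that it approaches, and approach can be
  tested at rational times.\<close>

lemma hit_iff:
  assumes cv: "cv \<in> curves" and ab: "0 <= a" "a < b"
  shows "(\<exists>t\<in>{a..b}. cv t = x) \<longleftrightarrow> (\<forall>k::nat. \<exists>q\<in>{q\<in>\<rat>. a <= q \<and> q <= b}. dist (cv q) x < 1 / Suc k)"
proof
  assume "\<exists>t\<in>{a..b}. cv t = x"
  then obtain t where t: "t \<in> {a..b}" "cv t = x" by auto
  show "\<forall>k::nat. \<exists>q\<in>{q\<in>\<rat>. a <= q \<and> q <= b}. dist (cv q) x < 1 / Suc k"
  proof
    fix k :: nat
    have "max a (t - 1 / Suc k) < min b (t + 1 / Suc k)" using t ab by (cases "t = b") (auto simp: max_def min_def)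
    then obtain q where q: "q \<in> \<rat>" "max a (t - 1 / Suc k) < q" "q < min b (t + 1 / Suc k)" using Rats_dense_in_real by blast
    moreover have "dist (cv q) (cv t) <= \<bar>q - t\<bar>" using q t ab by (intro curve_dist_le[OF cv]) auto
    ultimately show "\<exists>q\<in>{q\<in>\<rat>. a <= q \<and> q <= b}. dist (cv q) x < 1 / Suc k" using t by (intro bexI[of _ q]) auto
  qed
next
  assume *: "\<forall>k::nat. \<exists>q\<in>{q\<in>\<rat>. a <= q \<and> q <= b}. dist (cv q) x < 1 / Suc k"
  have "closed (cv ` {a..b})" using ab by (intro compact_imp_closed compact_continuous_image continuous_on_subset[OF curve_continuous_on[OF cv]]) auto
  moreover have "x \<in> closure (cv ` {a..b})" unfolding closure_approachable
  proof (intro allI impI)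
    fix e :: real assume "0 < e"
    then obtain k where "1 / real (Suc k) < e" using reals_Archimedean by (auto simp: inverse_eq_divide)
    then show "\<exists>y\<in>cv ` {a..b}. dist y x < e" using *[rule_format, of k] by force
  qed
  ultimately show "\<exists>t\<in>{a..b}. cv t = x" by (auto simp: closure_closed)
qed

context
  fixes dummy :: "'a::{second_countable_topology, metric_space}"
begin

lemma pred_hit:
  assumes ab: "0 <= a" "a < b"
  shows "Measurable.pred (borel \<Otimes>\<^sub>M curve_borel) (\<lambda>(x :: 'a, cv). \<exists>t\<in>{a..b}. cv t = x)"
proof -
  have c: "countable {q\<in>\<rat>. a <= q \<and> q <= b}" by (rule countable_subset[OF _ countable_rat]) auto
  let ?S = "borel \<Otimes>\<^sub>M curve_borel :: ('a \<times> (real => 'a)) measure"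
  have "{p \<in> space ?S. \<forall>k::nat. \<exists>q\<in>{q\<in>\<rat>. a <= q \<and> q <= b}. dist (snd p q) (fst p) < 1 / Suc k} \<in> sets ?S"
  proof (intro sets.sets_Collect_countable_All sets.sets_Collect_countable_Ex'[OF _ c])
    fix k :: nat and q assume "q \<in> {q\<in>\<rat>. a <= q \<and> q <= b}"
    then have [simp]: "0 <= q" using ab by auto
    have [measurable]: "(\<lambda>p. snd p q) \<in> borel_measurable ?S" by (rule measurable_compose[OF measurable_snd measurable_curve_eval]) simp
    show "{p \<in> space ?S. dist (snd p q) (fst p) < 1 / Suc k} \<in> sets ?S" by measurable
  qed
  also have "{p \<in> space ?S. \<forall>k::nat. \<exists>q\<in>{q\<in>\<rat>. a <= q \<and> q <= b}. dist (snd p q) (fst p) < 1 / Suc k} =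
     {p \<in> space ?S. case p of (x, cv) => \<exists>t\<in>{a..b}. cv t = x}"
  proof (intro Collect_cong conj_cong refl)
    fix p assume "p \<in> space ?S"
    then have "snd p \<in> curves" by (simp add: space_pair_measure mem_Times_iff)
    from hit_iff[OF this ab, of "fst p"]
    show "(\<forall>k::nat. \<exists>q\<in>{q\<in>\<rat>. a <= q \<and> q <= b}. dist (snd p q) (fst p) < 1 / Suc k) \<longleftrightarrow>
      (case p of (x, cv) => \<exists>t\<in>{a..b}. cv t = x)" by (simp add: case_prod_beta)
  qed
  finally show ?thesis by (simp add: pred_def)
qed

text \<open>The dyadic count needs intervals that partition time, whereas the hitting criterion
  needs compact ones; a half-open interval is exhausted by the closed intervals ending at
  \<open>c k\<close>.\<close>

lemma pred_hit_halfopen [measurable]: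
  assumes ab: "0 <= a" "a < b"
  shows "Measurable.pred (borel \<Otimes>\<^sub>M curve_borel) (\<lambda>(x :: 'a, cv). \<exists>t\<in>{a..<b}. cv t = x)"
proof -
  define c where "c k = b - (b - a) / real (k + 2)" for k :: nat
  have c: "a < c k" "c k < b" for k
  proof -
    have "(b - a) / real (k + 2) < (b - a) / 1" using ab by (intro divide_strict_left_mono) auto
    moreover have "0 < (b - a) / real (k + 2)" using ab by simp
    ultimately show "a < c k" "c k < b" by (auto simp: c_def)
  qed
  have eq: "{a..<b} = (\<Union>k. {a..c k})"
  proof (intro equalityI subsetI)
    fix t assume t: "t \<in> {a..<b}"
    obtain k where k: "(b - a) / (b - t) < real k" using reals_Archimedean2 by blast
    then have "(b - a) < real k * (b - t)" using t by (simp add: field_simps)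
    also have "... <= real (k + 2) * (b - t)" using t by (intro mult_right_mono) auto
    finally have "t <= c k" by (simp add: c_def field_simps)
    then show "t \<in> (\<Union>k. {a..c k})" using t by auto
  next
    fix t assume "t \<in> (\<Union>k. {a..c k})"
    then show "t \<in> {a..<b}" using c(2) by (auto intro: le_less_trans)
  qed
  have "(\<lambda>(x :: 'a, cv). \<exists>t\<in>{a..<b}. cv t = x) = (\<lambda>p. \<exists>k. case p of (x, cv) => \<exists>t\<in>{a..c k}. cv t = x)" unfolding eq by (auto simp: fun_eq_iff)
  then show ?thesis using pred_hit[OF ab(1) c(1)] by (simp del: split_paired_Ex)
qed

lemma measurable_visits_pair [measurable]:
  "(\<lambda>(x :: 'a, cv). visits cv x) \<in> borel_measurable (borel \<Otimes>\<^sub>M curve_borel)"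
proof -
  define h where "h n j = (\<lambda>(x :: 'a, cv). \<exists>t\<in>{real j / 2 ^ n ..< real (Suc j) / 2 ^ n}. cv t = x)" for n j :: nat
  have [measurable]: "Measurable.pred (borel \<Otimes>\<^sub>M curve_borel) (h n j)" for n j unfolding h_def by (rule pred_hit_halfopen) (auto simp: divide_strict_right_mono)
  have "visits cv x = (SUP n. \<Sum>j. if h n j (x, cv) then 1 else 0)" for cv x
  proof -
    have cell: "nat \<lfloor>t * 2 ^ n\<rfloor> = j \<longleftrightarrow> t \<in> {real j / 2 ^ n ..< real (Suc j) / 2 ^ n}" if "0 <= t" for t :: real and n j
    proof -
      have "nat \<lfloor>t * 2 ^ n\<rfloor> = j \<longleftrightarrow> \<lfloor>t * 2 ^ n\<rfloor> = int j" using that by (auto simp: nat_eq_iff)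
      also have "... \<longleftrightarrow> real j <= t * 2 ^ n \<and> t * 2 ^ n < real j + 1" by (simp add: floor_eq_iff)
      finally show ?thesis by (auto simp: field_simps)
    qed
    have "emeasure (count_space UNIV) ((\<lambda>t. nat \<lfloor>t * 2 ^ n\<rfloor>) ` {t \<in> {0..}. cv t = x})
       = (\<Sum>j. if h n j (x, cv) then 1 else 0)" for n
    proof -
      have "j \<in> (\<lambda>t. nat \<lfloor>t * 2 ^ n\<rfloor>) ` {t \<in> {0..}. cv t = x} \<longleftrightarrow> h n j (x, cv)" for j
      proof
        assume "h n j (x, cv)"
        then obtain t where t: "t \<in> {real j / 2 ^ n ..< real (Suc j) / 2 ^ n}" "cv t = x" by (auto simp: h_def)
        then have "0 <= t" by (auto intro: order.trans[rotated])
        then show "j \<in> (\<lambda>t. nat \<lfloor>t * 2 ^ n\<rfloor>) ` {t \<in> {0..}. cv t = x}" using t cell[of t n j] by (intro image_eqI[of _ _ t]) auto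
      next
        assume "j \<in> (\<lambda>t. nat \<lfloor>t * 2 ^ n\<rfloor>) ` {t \<in> {0..}. cv t = x}"
        then obtain t where t: "0 <= t" "cv t = x" "nat \<lfloor>t * 2 ^ n\<rfloor> = j" by auto
        then show "h n j (x, cv)" unfolding h_def using cell[OF t(1), of n j] by blast
      qed
      then have "(\<Sum>j. if h n j (x, cv) then 1 else 0) =
         (\<Sum>j. indicator ((\<lambda>t. nat \<lfloor>t * 2 ^ n\<rfloor>) ` {t \<in> {0..}. cv t = x}) j :: ennreal)" by (intro suminf_cong) (auto simp: indicator_def)
      also have "... = \<integral>\<^sup>+j. indicator ((\<lambda>t. nat \<lfloor>t * 2 ^ n\<rfloor>) ` {t \<in> {0..}. cv t = x}) j \<partial>count_space UNIV" by (rule nn_integral_count_space_nat[symmetric])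
      finally show ?thesis by simp
    qed
    then show ?thesis unfolding visits_def by (subst emeasure_count_space_eq_SUP_dyadic) auto
  qed
  then have "(\<lambda>(x :: 'a, cv). visits cv x) = (\<lambda>p. SUP n. \<Sum>j. if h n j p then 1 else 0)" by (auto simp: fun_eq_iff)
  then show ?thesis by simp
qed

lemma pred_range [measurable]:
  "Measurable.pred (borel \<Otimes>\<^sub>M curve_borel) (\<lambda>(x :: 'a, cv). x \<in> cv ` {0..})"
proof -
  have "x \<in> cv ` {0..} \<longleftrightarrow> (\<exists>n. \<exists>t\<in>{0..<real (Suc n)}. cv t = x)" for x :: 'a and cv
  proof
    assume "x \<in> cv ` {0..}"
    then obtain t where t: "0 <= t" "x = cv t" by auto
    obtain n where "t < real n" using reals_Archimedean2 by blast
    then show "\<exists>n. \<exists>t\<in>{0..<real (Suc n)}. cv t = x" using t by (intro exI[of _ n] bexI[of _ t]) auto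
  qed auto
  then have "(\<lambda>(x :: 'a, cv). x \<in> cv ` {0..}) = (\<lambda>p. \<exists>n. case p of (x, cv) => \<exists>t\<in>{0..<real (Suc n)}. cv t = x)" by (auto simp: fun_eq_iff)
  then show ?thesis using pred_hit_halfopen[of 0] by (simp del: split_paired_Ex of_nat_Suc)
qed

end



section \<open>Rectifiable plans\<close>

lemma curve_image_compact: "cv \<in> curves ==> compact (cv ` {0..real n})" by (intro compact_continuous_image continuous_on_subset[OF curve_continuous_on]) auto

lemma hausdorff1_outer_curve_le:
  assumes "cv \<in> curves" shows "H1 (cv ` {0..real n}) <= ennreal (real n)"
proof -
  have "1-lipschitz_on {0..real n} cv" using assms unfolding curves_def by (auto intro: lipschitz_on_subset)
  from hausdorff1_outer_lipschitz_interval[OF this] show ?thesis by simp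
qed

lemma diameter_leI:
  assumes "S \<noteq> {}" "\<And>x y. x \<in> S ==> y \<in> S ==> dist x y <= d"
  shows "diameter S <= d" unfolding diameter_def using assms by (auto intro!: cSUP_least)

lemma diameter_fattening:
  assumes C: "bounded C" and e: "0 < e"
  shows "bounded (\<Union>z\<in>C. ball z e)" "diameter (\<Union>z\<in>C. ball z e) <= diameter C + 2 * e"
proof -
  have d: "dist x y <= diameter C + 2 * e" if xy: "x \<in> (\<Union>z\<in>C. ball z e)" "y \<in> (\<Union>z\<in>C. ball z e)" for x y
  proof -
    from xy obtain z w where zw: "z \<in> C" "w \<in> C" "dist z x < e" "dist w y < e" by auto
    have "dist z w <= diameter C" using zw by (intro diameter_bounded_bound C)
    moreover have "dist x y <= dist z x + dist z w + dist w y" by metric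
    ultimately show ?thesis using zw by linarith
  qed
  show "bounded (\<Union>z\<in>C. ball z e)"
  proof (cases "(\<Union>z\<in>C. ball z e) = {}")
    case False
    then obtain x where "x \<in> (\<Union>z\<in>C. ball z e)" by blast
    then show ?thesis using d[of x] unfolding bounded_def by blast
  next
    case True
    then show ?thesis by (simp only: bounded_empty)
  qed
  show "diameter (\<Union>z\<in>C. ball z e) <= diameter C + 2 * e"
  proof (cases "(\<Union>z\<in>C. ball z e) = {}")
    case True
    then show ?thesis using e diameter_ge_0[OF C] by simp
  next
    case False
    then show ?thesis using d by (rule diameter_leI)
  qed
qed

text \<open>Upper semicontinuity of the premeasures along uniformly convergent curves: an open cover of
  a compact piece of a curve also covers the corresponding pieces of all nearby curves.\<close>

lemma measurable_hausdorff1_curve_closed: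
  fixes C :: "'a::euclidean_space set"
  assumes C: "closed C"
  shows "(\<lambda>cv. H1 (cv ` {0..real n} \<inter> C)) \<in> borel_measurable curve_borel"
proof (rule borel_measurableI_le)
  fix y :: ennreal
  show "{cv \<in> space curve_borel. H1 (cv ` {0..real n} \<inter> C) <= y} \<in> sets curve_borel"
  proof (cases "y = top")
    case True
    then have "{cv \<in> space curve_borel. H1 (cv ` {0..real n} \<inter> C) <= y} = space (curve_borel :: (real => 'a) measure)" by auto
    then show ?thesis by (metis sets.top)
  next
    case y: False
    \<comment> \<open>Mesh and sum are both granted the slack 1/(k+1). This slack makes the
      condition open in the curve, and the intersection over k removes it again.\<close>
    define good where "good k cv O' \<longleftrightarrow> (\<forall>i::nat. open (O' i) \<and> bounded (O' i) \<and> diameter (O' i) <= 1 / real (Suc k)) \<and>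
        cv ` {0..real n} \<inter> C \<subseteq> (\<Union>i. O' i) \<and> (\<Sum>i. ennreal (diameter (O' i))) <= y + ennreal (1 / real (Suc k))"
      for k cv and O' :: "nat => 'a set"
    define U where "U k = {cv \<in> curves. \<exists>O'. good k cv O'}" for k
    have "curve_open (U k)" for k unfolding curve_open_def
    proof (intro conjI ballI)
      fix cv assume "cv \<in> U k"
      then obtain O' where cv: "cv \<in> curves" and O': "good k cv O'" by (auto simp: U_def)
      let ?V = "\<Union>i. O' i"
      have "closed (C - ?V)" using C O' by (auto simp: good_def intro!: closed_Diff)
      moreover have "cv ` {0..real n} \<inter> (C - ?V) = {}" using O' by (auto simp: good_def)
      \<comment> \<open>The compact piece of curve avoids the closed part of \<open>C\<close> left
        uncovered, hence stays at a positive distance from it; curves within that distance are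
        covered by the same open sets.\<close>
      ultimately obtain d where d: "0 < d" "\<And>x y. x \<in> cv ` {0..real n} ==> y \<in> C - ?V ==> d <= dist x y"
        using separate_compact_closed[OF curve_image_compact[OF cv, of n]] by metis
      have "good k eta O'" if eta: "eta \<in> curve_nbhd cv {0..real n} d" for eta
      proof -
        have "eta t \<in> ?V" if t: "t \<in> {0..real n}" "eta t \<in> C" for t
        proof (rule ccontr)
          assume "eta t \<notin> ?V"
          then have "d <= dist (cv t) (eta t)" using t by (intro d(2)) auto
          then show False using eta t by (auto simp: curve_nbhd_def dist_commute not_less[symmetric])
        qed
        then show ?thesis using O' unfolding good_def by blast
      qed
      then have "curve_nbhd cv {0..real n} d \<subseteq> U k" unfolding U_def curve_nbhd_def by blast
      then show "\<exists>K \<epsilon>. compact K \<and> K \<subseteq> {0..} \<and> 0 < \<epsilon> \<and> curve_nbhd cv K \<epsilon> \<subseteq> U k" using d(1) by (intro exI[of _ "{0..real n}"] exI[of _ d]) auto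
    qed (auto simp: U_def)
    then have "U k \<in> sets curve_borel" for k unfolding sets_curve_borel by auto
    then have "(\<Inter>k. U k) \<in> sets curve_borel" by auto
    also have "(\<Inter>k. U k) = {cv \<in> space curve_borel. H1 (cv ` {0..real n} \<inter> C) <= y}"
    proof (intro equalityI subsetI)
      fix cv assume cv: "cv \<in> (\<Inter>k. U k)"
      have le: "hausdorff1_pre (1 / real (Suc k)) (cv ` {0..real n} \<inter> C) <= y + ennreal (1 / real (Suc k))" for k
      proof -
        obtain O' where "good k cv O'" using cv by (auto simp: U_def)
        then show ?thesis using hausdorff1_pre_le[of "cv ` {0..real n} \<inter> C" O' "1 / real (Suc k)"] unfolding good_def by (meson order.trans)
      qed
      have "H1 (cv ` {0..real n} \<inter> C) <= y" unfolding hausdorff1_outer_def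
      proof (rule SUP_least, rule ennreal_le_epsilon)
        fix dl e :: real assume d: "dl \<in> {0<..}" and e: "0 < e"
        then obtain k where k: "inverse (real (Suc k)) < min dl e" using reals_Archimedean[of "min dl e"] by auto
        have "hausdorff1_pre dl (cv ` {0..real n} \<inter> C) <= hausdorff1_pre (1 / real (Suc k)) (cv ` {0..real n} \<inter> C)"
          using k by (intro hausdorff1_pre_antimono) (auto simp: inverse_eq_divide)
        also have "... <= y + ennreal (1 / real (Suc k))" by (rule le)
        also have "... <= y + ennreal e" using k by (intro add_left_mono ennreal_leI) (auto simp: inverse_eq_divide)
        finally show "hausdorff1_pre dl (cv ` {0..real n} \<inter> C) <= y + ennreal e" .
      qed
      then show "cv \<in> {cv \<in> space curve_borel. H1 (cv ` {0..real n} \<inter> C) <= y}" using cv by (auto simp: U_def)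
    next
      fix cv assume "cv \<in> {cv \<in> space curve_borel. H1 (cv ` {0..real n} \<inter> C) <= y}"
      then have cv: "cv \<in> curves" "H1 (cv ` {0..real n} \<inter> C) <= y" by auto
      have "\<exists>O'. good k cv O'" for k
      proof -
        \<comment> \<open>Half of the slack 1/(k+1) is spent on choosing a cover, the other half on
          widening its sets to open ones: the increments \<open>2 * e i\<close> of the diameters sum
          to \<open>dl\<close>.\<close>
        define dl where "dl = 1 / (2 * real (Suc k))"
        have dl: "dl > 0" by (simp add: dl_def)
        have "hausdorff1_pre dl (cv ` {0..real n} \<inter> C) <= y" using hausdorff1_pre_le_outer[OF dl] cv(2) by (rule order.trans)
        also have "y < y + ennreal dl" using y dl ennreal_add_left_cancel_less[of y 0 "ennreal dl"] by simp
        finally obtain B where B: "cv ` {0..real n} \<inter> C \<subseteq> (\<Union>i::nat. B i)" "\<And>i. bounded (B i)" "\<And>i. diameter (B i) <= dl"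
           "(\<Sum>i. ennreal (diameter (B i))) < y + ennreal dl" by (rule hausdorff1_pre_close) blast
        define e where "e i = dl * (1/2) ^ (i + 2)" for i :: nat
        have e: "e i > 0" "2 * e i <= dl" for i using dl power_le_one[of "1/2::real" "i+1"] by (auto simp: e_def)
        define O' where "O' i = (\<Union>z\<in>B i. ball z (e i))" for i
        have O': "bounded (O' i)" "diameter (O' i) <= diameter (B i) + 2 * e i" for i unfolding O'_def using diameter_fattening[OF B(2) e(1)] by auto
        have "(\<Sum>i. ennreal (diameter (O' i))) <= (\<Sum>i. ennreal (diameter (B i)) + ennreal (2 * e i))" using O' e diameter_ge_0[OF B(2)]
          by (intro suminf_le) (auto simp: ennreal_plus[symmetric] less_imp_le simp del: ennreal_plus intro!: ennreal_leI)
        also have "... = (\<Sum>i. ennreal (diameter (B i))) + (\<Sum>i. ennreal (2 * e i))" by (rule suminf_add[symmetric]) auto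
        also have "(\<Sum>i. ennreal (2 * e i)) = ennreal dl"
        proof (rule suminf_ennreal_eq)
          have "(\<lambda>i. dl * (1/2) ^ Suc i) sums (dl * 1)" by (intro sums_mult power_half_series)
          then show "(\<lambda>i. 2 * e i) sums dl" by (simp add: e_def)
        qed (use e in \<open>auto intro: less_imp_le\<close>)
        also have "(\<Sum>i. ennreal (diameter (B i))) + ennreal dl <= y + ennreal dl + ennreal dl" using B(4) by (intro add_right_mono) auto
        also have "... = y + ennreal (1 / real (Suc k))" using dl by (simp add: add.assoc ennreal_plus[symmetric] dl_def field_simps del: ennreal_plus)
        finally have 1: "(\<Sum>i. ennreal (diameter (O' i))) <= y + ennreal (1 / real (Suc k))" .
        have "diameter (O' i) <= 1 / real (Suc k)" for i
        proof -
          have "diameter (O' i) <= dl + dl" using O'(2)[of i] B(3)[of i] e(2)[of i] by linarith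
          also have "... = 1 / real (Suc k)" by (simp add: dl_def field_simps)
          finally show ?thesis .
        qed
        moreover have "B i \<subseteq> O' i" for i unfolding O'_def using e(1) by auto
        then have "(\<Union>i. B i) \<subseteq> (\<Union>i. O' i)" by (intro UN_mono) auto
        then have "cv ` {0..real n} \<inter> C \<subseteq> (\<Union>i. O' i)" using B(1) by (rule order.trans[rotated])
        moreover have "open (O' i)" for i unfolding O'_def by auto
        ultimately have "good k cv O'" using 1 O'(1) by (simp add: good_def)
        then show ?thesis by blast
      qed
      then show "cv \<in> (\<Inter>k. U k)" using cv by (simp add: U_def)
    qed
    finally show ?thesis .
  qed
qed

section \<open>Rectifiability expressed through countable families of Lipschitz curves\<close>

definition lip_family :: "(nat => real => 'a::metric_space) => bool" where
  "lip_family phi \<longleftrightarrow> (\<forall>i. \<exists>L. L-lipschitz_on {0..} (phi i))"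

definition lip_trace :: "(nat => real => 'a) => 'a set" where
  "lip_trace phi = (\<Union>i. phi i ` {0..})"

text \<open>The arbitrary rectifiable set in the definition of a rectifiable plan is replaced by the
  trace of a Lipschitz family, which differs from it by a null set where it matters. Being
  sigma-compact, the trace makes the condition measurable in the curve.\<close>

definition covered :: "(nat => real => 'a::metric_space) => (real => 'a) => bool" where
  "covered phi cv \<longleftrightarrow> H1 (cv ` {0..} - lip_trace phi) = 0"

definition lip_join :: "(nat => real => 'a) => (nat => real => 'a) => nat => real => 'a" where
  "lip_join phi psi i = (if even i then phi (i div 2) else psi (i div 2))"

lemma lip_family_join: "lip_family phi ==> lip_family psi ==> lip_family (lip_join phi psi)" by (simp add: lip_family_def lip_join_def)

lemma trace_join: "lip_trace (lip_join phi psi) = lip_trace phi \<union> lip_trace psi"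
proof -
  have "phi i = lip_join phi psi (2 * i)" "psi i = lip_join phi psi (2 * i + 1)" for i by (simp_all add: lip_join_def)
  then have "lip_trace phi \<union> lip_trace psi \<subseteq> lip_trace (lip_join phi psi)" unfolding lip_trace_def by (metis (no_types, lifting) UN_least UN_upper UNIV_I Un_least)
  moreover have "lip_join phi psi i ` {0..} \<subseteq> lip_trace phi \<union> lip_trace psi" for i
    unfolding lip_trace_def lip_join_def by (cases "even i") (simp_all only: if_True if_False, blast+)
  then have "lip_trace (lip_join phi psi) \<subseteq> lip_trace phi \<union> lip_trace psi" unfolding lip_trace_def[of "lip_join phi psi"] by (rule UN_least)
  ultimately show ?thesis by blast
qed

lemma covered_mono: "covered phi cv ==> lip_trace phi \<subseteq> lip_trace psi ==> eta ` {0..} \<subseteq> cv ` {0..} \<union> lip_trace psi ==> covered psi eta" unfolding covered_def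
  using hausdorff1_outer_mono[of "eta ` {0..} - lip_trace psi" "cv ` {0..} - lip_trace phi"] by fastforce

lemma rectifiable_plan_iff:
  "rectifiable_plan P \<longleftrightarrow> (\<exists>phi. lip_family phi \<and> (AE cv in P. covered phi cv))"
proof
  assume "rectifiable_plan P"
  then obtain S phi where S: "AE cv in P. H1 (cv ` {0..} - S) = 0"
    and phi: "lip_family phi" "H1 (S - lip_trace phi) = 0" unfolding rectifiable_plan_def countably_1_rectifiable_def lip_family_def lip_trace_def by blast
  have "covered phi cv" if "H1 (cv ` {0..} - S) = 0" for cv
  proof -
    have "H1 (cv ` {0..} - lip_trace phi) <= H1 ((cv ` {0..} - S) \<union> (S - lip_trace phi))" by (intro hausdorff1_outer_mono) auto
    also have "... <= H1 (cv ` {0..} - S) + H1 (S - lip_trace phi)" by (rule hausdorff1_outer_Un)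
    finally show ?thesis using that phi by (simp add: covered_def)
  qed
  with S have "AE cv in P. covered phi cv" by auto
  with phi show "\<exists>phi. lip_family phi \<and> (AE cv in P. covered phi cv)" by blast
next
  assume "\<exists>phi. lip_family phi \<and> (AE cv in P. covered phi cv)"
  then obtain phi where phi: "lip_family phi" "AE cv in P. covered phi cv" by blast
  have "countably_1_rectifiable (lip_trace phi)" unfolding countably_1_rectifiable_def using phi(1) by (intro exI[of _ phi]) (simp add: lip_family_def lip_trace_def)
  then show "rectifiable_plan P" unfolding rectifiable_plan_def using phi(2) unfolding covered_def by blast
qed

text \<open>The trace is the increasing union of the compact sets \<open>S m\<close>, and the
  complement of \<open>S m\<close> is the increasing union of the closed sets \<open>D m k\<close>.
  A piece of curve of bounded duration has finite length, so continuity from above applies and the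
  uncovered length becomes an infimum of suprema of measurable functions.\<close>

lemma pred_covered [measurable]:
  fixes phi :: "nat => real => 'a::euclidean_space"
  assumes phi: "lip_family phi"
  shows "Measurable.pred curve_borel (covered phi)"
proof -
  define S where "S m = (\<Union>i\<in>{..m}. phi i ` {0..real m})" for m :: nat
  have cont: "continuous_on {0..} (phi i)" for i using phi unfolding lip_family_def by (metis lipschitz_on_continuous_on)
  have Sc: "compact (S m)" for m unfolding S_def by (intro compact_UN compact_continuous_image continuous_on_subset[OF cont]) auto
  then have Scl: "closed (S m)" for m by (rule compact_imp_closed)
  have Sne: "S m \<noteq> {}" for m by (auto simp: S_def)
  have Sinc: "S m \<subseteq> S m'" if "m <= m'" for m m' unfolding S_def using that by (fastforce intro!: UN_mono)
  have ST: "(\<Union>m. S m) = lip_trace phi"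
  proof (intro equalityI subsetI)
    fix x assume "x \<in> lip_trace phi"
    then obtain i t where it: "0 <= t" "x = phi i t" by (auto simp: lip_trace_def)
    obtain m where "max t (real i) <= real m" using real_arch_simple by blast
    then show "x \<in> (\<Union>m. S m)" using it by (auto simp: S_def intro!: exI[of _ m] bexI[of _ i])
  next
    fix x assume "x \<in> (\<Union>m. S m)"
    then show "x \<in> lip_trace phi" unfolding S_def lip_trace_def by (blast intro: atLeast_iff[THEN iffD2] dest: atLeastAtMost_iff[THEN iffD1])
  qed
  define D where "D m k = {x. 1 / real (Suc k) <= infdist x (S m)}" for m k
  have Dcl: "closed (D m k)" for m k unfolding D_def by (intro closed_Collect_le continuous_intros)
  define f where "f n m k cv = H1 (cv ` {0..real n} \<inter> D m k)" for n m k and cv :: "real => 'a"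
  have fm[measurable]: "f n m k \<in> borel_measurable curve_borel" for n m k unfolding f_def by (rule measurable_hausdorff1_curve_closed[OF Dcl])
  have eq: "H1 (cv ` {0..real n} - lip_trace phi) = (INF m. SUP k. f n m k cv)"
    if cv: "cv \<in> curves" for cv n
  proof -
    let ?K = "cv ` {0..real n}"
    have K[measurable]: "?K \<in> sets borel" by (intro borel_compact curve_image_compact cv)
    have [measurable]: "S m \<in> sets borel" "D m k \<in> sets borel" for m k using Scl Dcl by auto
    have "H1 (?K - S m) = (SUP k. f n m k cv)" for m
    proof -
      have "(SUP k. emeasure hausdorff1 (?K \<inter> D m k)) = emeasure hausdorff1 (\<Union>k. ?K \<inter> D m k)"
      proof (rule SUP_emeasure_incseq)
        show "incseq (\<lambda>k. ?K \<inter> D m k)"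
        proof (rule incseq_SucI)
          fix k
          have "1 / real (Suc (Suc k)) <= 1 / real (Suc k)" by (intro divide_left_mono) auto
          then show "?K \<inter> D m k \<subseteq> ?K \<inter> D m (Suc k)" by (auto simp: D_def)
        qed
      qed auto
      also have "(\<Union>k. ?K \<inter> D m k) = ?K - S m"
      proof -
        have "x \<notin> S m \<longleftrightarrow> (\<exists>k. x \<in> D m k)" for x
        proof
          assume "x \<notin> S m"
          then have "0 < infdist x (S m)" using in_closed_iff_infdist_zero[OF Scl Sne, of x m] infdist_nonneg[of x "S m"] by fastforce
          then show "\<exists>k. x \<in> D m k" using reals_Archimedean[of "infdist x (S m)"] by (auto simp: D_def inverse_eq_divide intro: less_imp_le)
        next
          assume "\<exists>k. x \<in> D m k"
          then obtain k where "1 / real (Suc k) <= infdist x (S m)" by (auto simp: D_def)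
          moreover have "0 < 1 / real (Suc k)" by simp
          ultimately have "infdist x (S m) \<noteq> 0" by linarith
          then show "x \<notin> S m" by auto
        qed
        then show ?thesis by blast
      qed
      finally show ?thesis by (simp add: f_def emeasure_hausdorff1)
    qed
    moreover have "(INF m. emeasure hausdorff1 (?K - S m)) = emeasure hausdorff1 (\<Inter>m. ?K - S m)"
    proof (rule INF_emeasure_decseq)
      show "decseq (\<lambda>m. ?K - S m)" using Sinc by (auto simp: decseq_def)
      show "emeasure hausdorff1 (?K - S m) \<noteq> \<infinity>" for m
      proof -
        have "emeasure hausdorff1 (?K - S m) <= H1 ?K" by (simp add: emeasure_hausdorff1 hausdorff1_outer_mono)
        also have "... <= ennreal (real n)" by (rule hausdorff1_outer_curve_le[OF cv])
        finally show ?thesis by (auto simp: top_unique)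
      qed
    qed auto
    moreover have "(\<Inter>m. ?K - S m) = ?K - lip_trace phi" unfolding ST[symmetric] by auto
    moreover have "lip_trace phi \<in> sets borel" unfolding ST[symmetric] by auto
    ultimately show ?thesis by (simp add: emeasure_hausdorff1)
  qed
  have "covered phi cv \<longleftrightarrow> (\<forall>n::nat. H1 (cv ` {0..real n} - lip_trace phi) = 0)" for cv
  proof
    assume *: "\<forall>n::nat. H1 (cv ` {0..real n} - lip_trace phi) = 0"
    have "cv ` {0..} - lip_trace phi \<subseteq> (\<Union>n. cv ` {0..real n} - lip_trace phi)"
    proof
      fix x assume "x \<in> cv ` {0..} - lip_trace phi"
      then obtain t where t: "0 <= t" "x = cv t" "x \<notin> lip_trace phi" by blast
      obtain n where "t <= real n" using real_arch_simple by blast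
      then have "x \<in> cv ` {0..real n} - lip_trace phi" using t by simp
      then show "x \<in> (\<Union>n. cv ` {0..real n} - lip_trace phi)" by blast
    qed
    then have "H1 (cv ` {0..} - lip_trace phi) <= (\<Sum>n. H1 (cv ` {0..real n} - lip_trace phi))" by (intro order.trans[OF hausdorff1_outer_mono hausdorff1_outer_subadd])
    then show "covered phi cv" using * by (simp add: covered_def)
  next
    assume c: "covered phi cv"
    have "H1 (cv ` {0..real n} - lip_trace phi) <= H1 (cv ` {0..} - lip_trace phi)" for n by (intro hausdorff1_outer_mono) auto
    then show "\<forall>n::nat. H1 (cv ` {0..real n} - lip_trace phi) = 0" using c by (simp add: covered_def)
  qed
  then have "{cv \<in> space curve_borel. covered phi cv} =
     {cv \<in> space curve_borel. \<forall>n. (INF m. SUP k. f n m k cv) = 0}" using eq by auto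
  also have "... \<in> sets curve_borel" by measurable
  finally show ?thesis by (simp add: pred_def)
qed



section \<open>Images and weighted restrictions of traffic plans\<close>

lemma rectifiable_planE:
  assumes "rectifiable_plan P"
  obtains phi where "lip_family phi" "AE cv in P. covered phi cv" using assms unfolding rectifiable_plan_iff by blast

lemma traffic_plan_iff:
  fixes P :: "(real => 'a::euclidean_space) measure"
  shows "traffic_plan P \<longleftrightarrow> finite_measure P \<and> sets P = sets curve_borel \<and> (AE cv in P. stops cv)"
proof (cases "sets P = sets curve_borel")
  case True
  then have sp: "space P = curves" using sets_eq_imp_space_eq[OF True] by simp
  have "{cv \<in> space curve_borel. \<not> stops cv} \<in> sets (curve_borel :: (real => 'a) measure)" by measurable
  then have "{cv \<in> curves. stop_time cv = \<infinity>} \<in> sets P" using True by (simp only: stop_time_eq_top_iff space_curve_borel)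
  then have "(AE cv in P. stop_time cv \<noteq> \<infinity>) \<longleftrightarrow> emeasure P {cv \<in> curves. stop_time cv = \<infinity>} = 0" by (intro AE_iff_measurable) (auto simp: sp)
  then show ?thesis using True unfolding stop_time_eq_top_iff traffic_plan_def by simp
qed (auto simp: traffic_plan_def)

lemma traffic_planD:
  fixes P :: "(real => 'a::euclidean_space) measure"
  assumes "traffic_plan P"
  shows "finite_measure P" "sets P = sets curve_borel" "space P = curves" "AE cv in P. stops cv"
  using assms sets_eq_imp_space_eq[of P curve_borel] unfolding traffic_plan_iff by auto

lemma multiplicity_eq: "multiplicity P x = (\<integral>\<^sup>+cv. visits cv x \<partial>P)" by (simp add: multiplicity_def visits_def)

lemma measurable_multiplicity:
  fixes P :: "(real => 'a::euclidean_space) measure"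
  assumes "traffic_plan P"
  shows "multiplicity P \<in> borel_measurable borel"
proof -
  note P = traffic_planD[OF assms]
  interpret finite_measure P by (rule P)
  have "(\<lambda>(x :: 'a, cv). visits cv x) \<in> borel_measurable (borel \<Otimes>\<^sub>M P)"
    using measurable_visits_pair P(2) by (simp cong: measurable_cong_sets add: measurable_cong_sets[OF sets_pair_measure_cong[OF refl P(2)] refl])
  then have "(\<lambda>x. \<integral>\<^sup>+cv. visits cv x \<partial>P) \<in> borel_measurable borel" by (rule borel_measurable_nn_integral)
  then show ?thesis by (simp add: multiplicity_eq[abs_def])
qed

lemma alpha_mass_eq:
  "rectifiable_plan P ==> alpha_mass al P = (\<integral>\<^sup>+x. ennpow (multiplicity P x) al \<partial>hausdorff1)" unfolding alpha_mass_def network_def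
  by (auto intro!: nn_integral_cong simp: indicator_def zero_less_iff_neq_zero)

lemma alpha_mass_less_top: "alpha_mass al P < top ==> rectifiable_plan P" by (auto simp: alpha_mass_def split: if_splits)

lemma traffic_plan_distr:
  fixes P :: "(real => 'a::euclidean_space) measure" and F :: "(real => 'a) => real => 'b::euclidean_space"
  assumes P: "traffic_plan P" and F: "F \<in> measurable curve_borel curve_borel"
    and st: "\<And>cv. cv \<in> curves ==> stops cv ==> stops (F cv)"
  shows "traffic_plan (distr P curve_borel F)"
proof -
  note P = traffic_planD[OF P]
  have F': "F \<in> measurable P curve_borel" using F P(2) by (simp cong: measurable_cong_sets)
  have "AE cv in P. stops (F cv)" using P(4) AE_space by eventually_elim (use P(3) st in auto)
  then have "AE cv in distr P curve_borel F. stops cv" using F' pred_stops[unfolded pred_def] by (subst AE_distr_iff) auto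
  then show ?thesis unfolding traffic_plan_iff using finite_measure.finite_measure_distr[OF P(1) F'] by simp
qed

lemma AE_covered_distr:
  fixes P :: "(real => 'a::euclidean_space) measure" and F :: "(real => 'a) => real => 'b::euclidean_space"
  assumes P: "traffic_plan P" and F: "F \<in> measurable curve_borel curve_borel"
    and phi: "AE cv in P. covered phi cv" and psi: "lip_family psi"
    and st: "\<And>cv. cv \<in> curves ==> covered phi cv ==> covered psi (F cv)"
  shows "AE cv in distr P curve_borel F. covered psi cv"
proof -
  note P = traffic_planD[OF P]
  have F': "F \<in> measurable P curve_borel" using F P(2) by (simp cong: measurable_cong_sets)
  have "AE cv in P. covered psi (F cv)" using phi AE_space by eventually_elim (use P(3) st in auto)
  then show ?thesis using F' pred_covered[OF psi, unfolded pred_def] by (subst AE_distr_iff) auto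
qed

lemma multiplicity_distr:
  fixes P :: "(real => 'a::euclidean_space) measure" and F :: "(real => 'a) => real => 'b::euclidean_space"
  assumes P: "traffic_plan P" and F: "F \<in> measurable curve_borel curve_borel"
  shows "multiplicity (distr P curve_borel F) x = (\<integral>\<^sup>+cv. visits (F cv) x \<partial>P)"
proof -
  note P = traffic_planD[OF P]
  have F': "F \<in> measurable P curve_borel" using F P(2) by (simp cong: measurable_cong_sets)
  show ?thesis unfolding multiplicity_eq by (rule nn_integral_distr[OF F']) simp
qed

lemma traffic_plan_density:
  fixes P :: "(real => 'a::euclidean_space) measure"
  assumes P: "traffic_plan P" and g: "g \<in> borel_measurable curve_borel" "\<And>cv. g cv <= ennreal c"
  shows "traffic_plan (density P g)"
proof -
  note P = traffic_planD[OF P]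
  have g': "g \<in> borel_measurable P" using g P(2) by (simp cong: measurable_cong_sets)
  have "emeasure (density P g) (space P) = (\<integral>\<^sup>+cv. g cv * indicator (space P) cv \<partial>P)" using g' by (rule emeasure_density) simp
  also have "... <= (\<integral>\<^sup>+cv. ennreal c \<partial>P)" using g(2) by (intro nn_integral_mono) (auto simp: indicator_def)
  also have "... < top" using finite_measure.emeasure_finite[OF P(1), of "space P"] by (simp add: ennreal_mult_less_top less_top)
  finally have "finite_measure (density P g)" by (intro finite_measureI) auto
  then show ?thesis unfolding traffic_plan_iff using P g' by (auto simp: AE_density)
qed

lemma multiplicity_density:
  fixes P :: "(real => 'a::euclidean_space) measure"
  assumes P: "traffic_plan P" and g: "g \<in> borel_measurable curve_borel"
  shows "multiplicity (density P g) x = (\<integral>\<^sup>+cv. g cv * visits cv x \<partial>P)"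
proof -
  have cs: "measurable P borel = measurable curve_borel (borel :: ennreal measure)" by (rule measurable_cong_sets[OF traffic_planD(2)[OF P] refl])
  show ?thesis unfolding multiplicity_eq by (rule nn_integral_density) (use g in \<open>simp_all add: cs\<close>)
qed

lemma AE_density_of:
  fixes P :: "(real => 'a::euclidean_space) measure"
  assumes P: "traffic_plan P" and g: "g \<in> borel_measurable curve_borel" and Q: "AE cv in P. Q cv"
  shows "AE cv in density P g. Q cv"
proof -
  have cs: "measurable P borel = measurable curve_borel (borel :: ennreal measure)" by (rule measurable_cong_sets[OF traffic_planD(2)[OF P] refl])
  show ?thesis using Q g by (subst AE_density) (auto simp: cs)
qed

lemma alpha_mass_density_le:
  fixes P :: "(real => 'a::euclidean_space) measure"
  assumes P: "traffic_plan P" and g: "g \<in> borel_measurable curve_borel" "\<And>cv. g cv <= 1" and al: "0 <= al"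
  shows "alpha_mass al (density P g) <= alpha_mass al P"
proof (cases "rectifiable_plan P")
  case True
  then obtain phi where "lip_family phi" "AE cv in P. covered phi cv" by (rule rectifiable_planE)
  then have rect: "rectifiable_plan (density P g)" unfolding rectifiable_plan_iff using AE_density_of[OF P g(1)] by blast
  have "multiplicity (density P g) x <= multiplicity P x" for x unfolding multiplicity_density[OF P g(1)] unfolding multiplicity_eq
    using mult_right_mono[OF g(2)] by (intro nn_integral_mono) simp
  then show ?thesis unfolding alpha_mass_eq[OF True] alpha_mass_eq[OF rect] using al by (intro nn_integral_mono ennpow_mono)
qed (simp add: alpha_mass_def)

subsection \<open>Quantization error in terms of plans\<close>

text \<open>With its converse \<open>quant_error_less\<close>, this replaces quantizers by plans
  almost all of whose curves start in a set of at most \<open>N\<close> points; from here on mainly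
  plans are manipulated.\<close>

lemma quant_error_le:
  fixes P :: "(real => 'a::euclidean_space) measure"
  assumes P: "traffic_plan P" and tgt: "distr P borel curve_end = \<nu>"
    and F: "finite F" "card F <= N" and start: "AE cv in P. cv 0 \<in> F"
  shows "quant_error al \<nu> N <= alpha_mass al P"
proof -
  note P' = traffic_planD[OF P]
  have cs: "measurable P borel = measurable curve_borel (borel :: 'a measure)" by (rule measurable_cong_sets[OF P'(2) refl])
  define \<mu> where "\<mu> = distr P borel (\<lambda>cv. cv 0)"
  have m0: "(\<lambda>cv. cv 0) \<in> measurable P (borel :: 'a measure)" unfolding cs by simp
  have m1: "curve_end \<in> measurable P (borel :: 'a measure)" unfolding cs by simp
  have "emeasure \<mu> UNIV = emeasure \<nu> UNIV" unfolding \<mu>_def tgt[symmetric] using m0 m1 by (simp add: emeasure_distr)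
  moreover have "spt \<mu> \<subseteq> F"
  proof
    fix x assume x: "x \<in> spt \<mu>"
    show "x \<in> F"
    proof (rule ccontr)
      assume "x \<notin> F"
      then have "emeasure \<mu> (- F) > 0" using x F(1) by (auto simp: spt_def finite_imp_closed open_Compl)
      moreover have "emeasure \<mu> (- F) = emeasure P ((\<lambda>cv. cv 0) -` (- F) \<inter> space P)"
        unfolding \<mu>_def using m0 F(1) by (intro emeasure_distr) (auto simp: finite_imp_closed borel_closed)
      moreover have "... = 0"
      proof (rule AE_iff_measurable[THEN iffD1, OF _ _ start])
        show "(\<lambda>cv. cv 0) -` (- F) \<inter> space P \<in> sets P" using F(1) by (intro measurable_sets[OF m0]) (auto simp: finite_imp_closed borel_closed)
      qed auto
      ultimately show False by simp
    qed
  qed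
  ultimately have "\<mu> \<in> quantizers \<nu> N" using F finite_subset[of "spt \<mu>" F] card_mono[of F "spt \<mu>"] by (auto simp: quantizers_def \<mu>_def)
  moreover have "P \<in> TP \<mu> \<nu>" using P tgt by (simp add: TP_def \<mu>_def)
  ultimately show ?thesis unfolding quant_error_def branched_dist_def by (meson INF_lower order.trans)
qed

text \<open>Every point off the support has a null neighbourhood from a countable basis, and
  countably many null sets form a null set.\<close>

lemma emeasure_Compl_spt:
  fixes \<mu> :: "'a::euclidean_space measure"
  assumes "sets \<mu> = sets borel"
  shows "emeasure \<mu> (- spt \<mu>) = 0"
proof -
  obtain B :: "'a set set" where B: "countable B" "topological_basis B" using ex_countable_basis by blast
  let ?N = "{b \<in> B. emeasure \<mu> b = 0}"
  have "- spt \<mu> \<subseteq> \<Union> ?N"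
  proof
    fix x assume "x \<in> - spt \<mu>"
    then obtain U where U: "open U" "x \<in> U" "emeasure \<mu> U = 0" by (auto simp: spt_def)
    obtain b where b: "b \<in> B" "x \<in> b" "b \<subseteq> U" using topological_basisE[OF B(2) U(1,2)] by blast
    have "emeasure \<mu> b <= emeasure \<mu> U" using U assms b by (intro emeasure_mono) auto
    then show "x \<in> \<Union> ?N" using b U by auto
  qed
  moreover have "\<Union> ?N \<in> null_sets \<mu>"
  proof (rule null_sets_UN'[where N="\<lambda>b. b", simplified])
    show "countable ?N" using B(1) by auto
    show "b \<in> null_sets \<mu>" if "b \<in> ?N" for b using that assms topological_basis_open[OF B(2), of b] by (auto simp: null_sets_def)
  qed
  ultimately have "emeasure \<mu> (- spt \<mu>) <= 0" using emeasure_mono[of "- spt \<mu>" "\<Union> ?N" \<mu>] by (auto simp: null_sets_def)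
  then show ?thesis by simp
qed

lemma quant_error_less:
  fixes \<nu> :: "'a::euclidean_space measure"
  assumes "quant_error al \<nu> N < e"
  obtains P F where "traffic_plan P" "distr P borel curve_end = \<nu>" "finite F" "card F <= N"
    "AE cv in P. cv 0 \<in> F" "alpha_mass al P < e"
proof -
  from assms obtain \<mu> P where \<mu>: "\<mu> \<in> quantizers \<nu> N" and P: "P \<in> TP \<mu> \<nu>" "alpha_mass al P < e" unfolding quant_error_def branched_dist_def INF_less_iff by blast
  have tp: "traffic_plan P" using P by (simp add: TP_def)
  have cs: "measurable P borel = measurable curve_borel (borel :: 'a measure)" by (rule measurable_cong_sets[OF traffic_planD(2)[OF tp] refl])
  have m0: "(\<lambda>cv. cv 0) \<in> measurable P (borel :: 'a measure)" unfolding cs by simp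
  have s: "sets \<mu> = sets borel" "finite (spt \<mu>)" "card (spt \<mu>) <= N" using \<mu> by (auto simp: quantizers_def)
  have "distr P borel (\<lambda>cv. cv 0) = \<mu>" using P by (simp add: TP_def)
  moreover have "AE x in \<mu>. x \<in> spt \<mu>"
  proof (rule AE_I[where N="- spt \<mu>"])
    show "emeasure \<mu> (- spt \<mu>) = 0" by (rule emeasure_Compl_spt[OF s(1)])
    show "- spt \<mu> \<in> sets \<mu>" using s by (simp add: finite_imp_closed borel_closed borel_comp)
  qed auto
  ultimately have "AE x in distr P borel (\<lambda>cv. cv 0). x \<in> spt \<mu>" by (simp only:)
  then have "AE cv in P. cv 0 \<in> spt \<mu>" by (rule AE_distrD[OF m0])
  then show ?thesis using that[OF tp _ s(2,3) _ P(2)] P by (simp add: TP_def)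
qed

lemma quant_error_antimono: "N <= N' ==> quant_error al \<nu> N' <= quant_error al \<nu> N" unfolding quant_error_def by (intro INF_superset_mono) (auto simp: quantizers_def)

text \<open>An optimal plan is thinned: each curve is kept with the weight of \<open>g\<close> at
  its end point, which can only lower multiplicities and creates no new source.\<close>

lemma quant_error_density_le:
  fixes \<nu> :: "'a::euclidean_space measure"
  assumes g: "g \<in> borel_measurable borel" "\<And>x. g x <= 1" and al: "0 <= al"
  shows "quant_error al (density \<nu> g) N <= quant_error al \<nu> N"
proof (rule dense_ge)
  fix e assume "quant_error al \<nu> N < e"
  then obtain P F where P: "traffic_plan P" "distr P borel curve_end = \<nu>" "finite F" "card F <= N"
    "AE cv in P. cv 0 \<in> F" "alpha_mass al P < e" by (rule quant_error_less)
  have cs: "measurable P borel = measurable curve_borel (borel :: 'a measure)" by (rule measurable_cong_sets[OF traffic_planD(2)[OF P(1)] refl])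
  let ?g = "\<lambda>cv. g (curve_end cv)"
  have gm: "?g \<in> borel_measurable curve_borel" using g by measurable
  have "distr (density P ?g) borel curve_end = density \<nu> g" unfolding P(2)[symmetric] using g by (intro density_distr[symmetric]) (auto simp: cs)
  moreover have "traffic_plan (density P ?g)" using gm g(2) by (intro traffic_plan_density[OF P(1), where c=1]) auto
  ultimately have "quant_error al (density \<nu> g) N <= alpha_mass al (density P ?g)" using AE_density_of[OF P(1) gm P(5)] P(3,4) by (intro quant_error_le) auto
  also have "... <= alpha_mass al P" using gm g(2) by (intro alpha_mass_density_le P(1) al) auto
  finally show "quant_error al (density \<nu> g) N <= e" using P(6) by simp
qed



subsection \<open>Subadditivity\<close>

definition add_measure :: "'a measure => 'a measure => 'a measure" where
  "add_measure M N = measure_of (space M) (sets M) (\<lambda>A. emeasure M A + emeasure N A)"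

lemma space_add_measure [simp]: "space (add_measure M N) = space M" by (simp add: add_measure_def sets.space_closed space_measure_of_conv)

lemma sets_add_measure [simp, measurable_cong]: "sets (add_measure M N) = sets M" by (simp add: add_measure_def)

lemma emeasure_add_measure:
  assumes "sets N = sets M" "A \<in> sets M"
  shows "emeasure (add_measure M N) A = emeasure M A + emeasure N A" unfolding add_measure_def
proof (rule emeasure_measure_of_sigma)
  show "countably_additive (sets M) (\<lambda>A. emeasure M A + emeasure N A)" unfolding countably_additive_def
  proof (intro allI impI)
    fix B :: "nat => 'a set" assume B: "range B \<subseteq> sets M" "disjoint_family B" "\<Union> (range B) \<in> sets M"
    have "(\<Sum>i. emeasure M (B i) + emeasure N (B i)) = (\<Sum>i. emeasure M (B i)) + (\<Sum>i. emeasure N (B i))" by (rule suminf_add[symmetric]) auto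
    also have "... = emeasure M (\<Union> (range B)) + emeasure N (\<Union> (range B))" using B assms(1) by (simp add: suminf_emeasure)
    finally show "(\<Sum>i. emeasure M (B i) + emeasure N (B i)) = emeasure M (\<Union> (range B)) + emeasure N (\<Union> (range B))" .
  qed
qed (use assms sets.sigma_algebra_axioms in \<open>auto simp: positive_def\<close>)

lemma nn_integral_add_measure:
  assumes NM: "sets N = sets M" and f: "f \<in> borel_measurable M"
  shows "(\<integral>\<^sup>+x. f x \<partial>add_measure M N) = (\<integral>\<^sup>+x. f x \<partial>M) + (\<integral>\<^sup>+x. f x \<partial>N)"
proof -
  note [measurable_cong] = NM
  have sp: "space N = space M" by (rule sets_eq_imp_space_eq[OF NM])
  show ?thesis using f
  proof (induction f rule: borel_measurable_induct)
    case (cong f g)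
    have "(\<integral>\<^sup>+x. f x \<partial>K) = (\<integral>\<^sup>+x. g x \<partial>K)" if "space K = space M" for K using cong(3) that by (intro nn_integral_cong) simp
    then show ?case using cong(4) by (simp add: sp)
  next
    case (set A)
    then show ?case using NM by (simp add: emeasure_add_measure)
  next
    case (mult u c)
    have "u \<in> borel_measurable N" "u \<in> borel_measurable (add_measure M N)" using mult by measurable
    then show ?case using mult by (simp add: nn_integral_cmult distrib_left)
  next
    case (add u v)
    have "u \<in> borel_measurable N" "u \<in> borel_measurable (add_measure M N)"
      "v \<in> borel_measurable N" "v \<in> borel_measurable (add_measure M N)" using add by measurable
    then show ?case using add by (simp add: nn_integral_add ac_simps)
  next
    case (seq U)
    have m: "U i \<in> borel_measurable N" "U i \<in> borel_measurable (add_measure M N)" for i using seq(1)[of i] by measurable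
    have inc: "incseq (\<lambda>i. \<integral>\<^sup>+x. U i x \<partial>K)" for K using seq(3) by (auto simp: incseq_def le_fun_def intro!: nn_integral_mono)
    have mc: "(\<integral>\<^sup>+x. Sup (range U) x \<partial>K) = (SUP i. \<integral>\<^sup>+x. U i x \<partial>K)" if "\<And>i. U i \<in> borel_measurable K" for K
      using nn_integral_monotone_convergence_SUP[OF seq(3) that] by (simp add: image_comp)
    show ?case unfolding mc[OF m(2)] mc[OF seq(1)] mc[OF m(1)] by (simp add: seq ennreal_SUP_add[OF inc inc])
  qed
qed

lemma AE_add_measure:
  assumes NM: "sets N = sets M" and "AE x in M. Q x" "AE x in N. Q x"
  shows "AE x in add_measure M N. Q x"
proof -
  obtain A where A: "{x \<in> space M. \<not> Q x} \<subseteq> A" "emeasure M A = 0" "A \<in> sets M" using assms(2) by (rule AE_E)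
  obtain B where B: "{x \<in> space N. \<not> Q x} \<subseteq> B" "emeasure N B = 0" "B \<in> sets N" using assms(3) by (rule AE_E)
  have sp: "space N = space M" by (rule sets_eq_imp_space_eq[OF NM])
  have AB: "A \<inter> B \<in> sets M" using A B NM by auto
  have "emeasure M (A \<inter> B) <= emeasure M A" "emeasure N (A \<inter> B) <= emeasure N B" using A(3) B(3) by (auto intro!: emeasure_mono)
  then have "emeasure M (A \<inter> B) = 0" "emeasure N (A \<inter> B) = 0" unfolding A(2) B(2) by simp_all
  then show ?thesis using A B AB NM sp by (intro AE_I[of _ _ "A \<inter> B"]) (auto simp: emeasure_add_measure)
qed

lemma distr_add_measure:
  assumes NM: "sets N = sets M" and f: "f \<in> measurable M K"
  shows "distr (add_measure M N) K f = add_measure (distr M K f) (distr N K f)"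
proof (rule measure_eqI)
  have f': "f \<in> measurable N K" "f \<in> measurable (add_measure M N) K" using f by (simp_all add: measurable_cong_sets[OF NM refl] cong: measurable_cong_sets)
  have sp: "space N = space M" by (rule sets_eq_imp_space_eq[OF NM])
  fix A assume "A \<in> sets (distr (add_measure M N) K f)"
  then have A: "A \<in> sets K" by simp
  then have "f -` A \<inter> space M \<in> sets M" using f by (rule measurable_sets[rotated])
  then show "emeasure (distr (add_measure M N) K f) A = emeasure (add_measure (distr M K f) (distr N K f)) A"
    using A f f' NM by (simp add: emeasure_distr emeasure_add_measure sp)
qed simp

text \<open>Near-optimal plans are superposed: their sources are united and their multiplicities
  add, where the power \<open>al\<close> is subadditive.\<close>

lemma quant_error_add_le:
  fixes \<nu>1 \<nu>2 :: "'a::euclidean_space measure"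
  assumes al: "0 < al" "al <= 1"
  shows "quant_error al (add_measure \<nu>1 \<nu>2) (N1 + N2) <= quant_error al \<nu>1 N1 + quant_error al \<nu>2 N2"
proof (rule ennreal_le_epsilon)
  fix e :: real
  assume e: "0 < e" and fin: "quant_error al \<nu>1 N1 + quant_error al \<nu>2 N2 < top"
  have lt: "x < x + ennreal (e / 2)" if "x < top" for x using that e ennreal_add_left_cancel_less[of x 0 "ennreal (e/2)"] by simp
  from fin have fin1: "quant_error al \<nu>1 N1 < top" and fin2: "quant_error al \<nu>2 N2 < top" by auto
  obtain P1 F1 where P1: "traffic_plan P1" "distr P1 borel curve_end = \<nu>1" "finite F1" "card F1 <= N1"
    "AE cv in P1. cv 0 \<in> F1" "alpha_mass al P1 < quant_error al \<nu>1 N1 + ennreal (e / 2)" using lt[OF fin1] by (rule quant_error_less)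
  obtain P2 F2 where P2: "traffic_plan P2" "distr P2 borel curve_end = \<nu>2" "finite F2" "card F2 <= N2"
    "AE cv in P2. cv 0 \<in> F2" "alpha_mass al P2 < quant_error al \<nu>2 N2 + ennreal (e / 2)" using lt[OF fin2] by (rule quant_error_less)
  note T1 = traffic_planD[OF P1(1)] and T2 = traffic_planD[OF P2(1)]
  have ss: "sets P2 = sets P1" using T1 T2 by simp
  define P where "P = add_measure P1 P2"
  have tp: "traffic_plan P" unfolding traffic_plan_iff P_def
  proof (intro conjI)
    show "finite_measure (add_measure P1 P2)" using finite_measure.emeasure_finite[OF T1(1)] finite_measure.emeasure_finite[OF T2(1)]
        emeasure_add_measure[OF ss sets.top] by (intro finite_measureI) (simp only: space_add_measure infinity_ennreal_def ennreal_add_eq_top, blast)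
    show "AE cv in add_measure P1 P2. stops cv" using T1 T2 by (intro AE_add_measure ss)
  qed (use T1 in simp)
  have m1: "curve_end \<in> measurable P1 (borel :: 'a measure)" using T1(2) by (simp cong: measurable_cong_sets)
  have tgt: "distr P borel curve_end = add_measure \<nu>1 \<nu>2" unfolding P_def distr_add_measure[OF ss m1] P1(2) P2(2) ..
  have "AE cv in P. cv 0 \<in> F1 \<union> F2" unfolding P_def using P1(5) P2(5) by (intro AE_add_measure ss) auto
  moreover have "card (F1 \<union> F2) <= N1 + N2" using card_Un_le[of F1 F2] P1(4) P2(4) by linarith
  ultimately have "quant_error al (add_measure \<nu>1 \<nu>2) (N1 + N2) <= alpha_mass al P" using P1(3) P2(3) by (intro quant_error_le[OF tp tgt]) auto
  also have "... <= alpha_mass al P1 + alpha_mass al P2"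
  proof -
    have r1: "rectifiable_plan P1" using P1(6) by (intro alpha_mass_less_top[of al]) (auto intro: less_le_trans)
    have r2: "rectifiable_plan P2" using P2(6) by (intro alpha_mass_less_top[of al]) (auto intro: less_le_trans)
    obtain phi1 where phi1: "lip_family phi1" "AE cv in P1. covered phi1 cv" using r1 by (rule rectifiable_planE)
    obtain phi2 where phi2: "lip_family phi2" "AE cv in P2. covered phi2 cv" using r2 by (rule rectifiable_planE)
    have c: "covered phi1 cv ==> covered (lip_join phi1 phi2) cv" "covered phi2 cv ==> covered (lip_join phi1 phi2) cv" for cv
      by (auto elim!: covered_mono simp: trace_join)
    have "AE cv in P. covered (lip_join phi1 phi2) cv" unfolding P_def using phi1(2) phi2(2) c by (intro AE_add_measure ss) auto
    then have r: "rectifiable_plan P" unfolding rectifiable_plan_iff using lip_family_join[OF phi1(1) phi2(1)] by blast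
    have mult: "multiplicity P x = multiplicity P1 x + multiplicity P2 x" for x unfolding multiplicity_eq P_def
      using T1(2) by (intro nn_integral_add_measure[OF ss]) (simp cong: measurable_cong_sets)
    have [measurable]: "multiplicity P1 \<in> borel_measurable hausdorff1" "multiplicity P2 \<in> borel_measurable hausdorff1"
      using measurable_multiplicity[OF P1(1)] measurable_multiplicity[OF P2(1)] by (simp_all cong: measurable_cong_sets)
    have "alpha_mass al P <= (\<integral>\<^sup>+x. ennpow (multiplicity P1 x) al + ennpow (multiplicity P2 x) al \<partial>hausdorff1)"
      unfolding alpha_mass_eq[OF r] mult using al by (intro nn_integral_mono ennpow_add_le)
    also have "... = alpha_mass al P1 + alpha_mass al P2" unfolding alpha_mass_eq[OF r1] alpha_mass_eq[OF r2] by (rule nn_integral_add) measurable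
    finally show ?thesis .
  qed
  also have "... <= (quant_error al \<nu>1 N1 + ennreal (e / 2)) + (quant_error al \<nu>2 N2 + ennreal (e / 2))" using P1(6) P2(6) by (intro add_mono) auto
  also have "... = quant_error al \<nu>1 N1 + quant_error al \<nu>2 N2 + (ennreal (e / 2) + ennreal (e / 2))" by (simp add: ac_simps)
  also have "ennreal (e / 2) + ennreal (e / 2) = ennreal e" using e by (simp add: ennreal_plus[symmetric] del: ennreal_plus)
  finally show "quant_error al (add_measure \<nu>1 \<nu>2) (N1 + N2) <= quant_error al \<nu>1 N1 + quant_error al \<nu>2 N2 + ennreal e" .
qed

subsection \<open>Scaling\<close>

text \<open>Time is stretched by the same factor as space, which keeps the curve
  1-Lipschitz.\<close>

definition affine_curve :: "'a::real_normed_vector => real => (real => 'a) => real => 'a" where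
  "affine_curve v l cv = (\<lambda>t. if t < 0 then undefined else v + l *\<^sub>R cv (t / l))"

lemma affine_curve_in_curves:
  assumes "cv \<in> curves" "0 < l" shows "affine_curve v l cv \<in> curves"
proof (rule curvesI)
  fix s t :: real assume st: "0 <= s" "s <= t"
  have "dist (affine_curve v l cv s) (affine_curve v l cv t) = l * dist (cv (s / l)) (cv (t / l))"
    using st assms(2) by (simp add: affine_curve_def dist_norm norm_minus_commute flip: scaleR_diff_right)
  also have "... <= l * \<bar>s / l - t / l\<bar>" using assms st by (intro mult_left_mono curve_dist_le) auto
  also have "... = t - s" using assms(2) st by (simp add: diff_divide_distrib[symmetric] abs_if divide_less_0_iff)
  finally show "dist (affine_curve v l cv s) (affine_curve v l cv t) <= t - s" .
qed (simp add: affine_curve_def)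

lemma measurable_affine_curve:
  fixes v :: "'a::euclidean_space"
  assumes "0 < l" shows "affine_curve v l \<in> measurable curve_borel curve_borel"
proof (rule measurable_curve_borelI)
  fix t :: real assume t: "0 <= t"
  have [measurable]: "(\<lambda>cv :: real => 'a. cv (t / l)) \<in> borel_measurable curve_borel" using t assms by (intro measurable_curve_eval) simp
  have "(\<lambda>cv :: real => 'a. v + l *\<^sub>R cv (t / l)) \<in> borel_measurable curve_borel" by measurable
  then show "(\<lambda>cv. affine_curve v l cv t) \<in> borel_measurable curve_borel" using t by (simp add: affine_curve_def)
qed (use assms affine_curve_in_curves in auto)

lemma visits_affine_curve:
  assumes l: "0 < l"
  shows "visits (affine_curve v l cv) x = visits cv ((x - v) /\<^sub>R l)"
proof -
  let ?S = "{t \<in> {0..}. cv t = (x - v) /\<^sub>R l}"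
  have "{t \<in> {0..}. affine_curve v l cv t = x} = (\<lambda>t. l * t) ` ?S"
  proof (intro equalityI subsetI)
    fix t assume t: "t \<in> {t \<in> {0..}. affine_curve v l cv t = x}"
    then have "cv (t / l) = (x - v) /\<^sub>R l" using l by (auto simp: affine_curve_def)
    then show "t \<in> (\<lambda>t. l * t) ` ?S" using t l by (intro image_eqI[of _ _ "t / l"]) auto
  next
    fix t assume "t \<in> (\<lambda>t. l * t) ` ?S"
    then show "t \<in> {t \<in> {0..}. affine_curve v l cv t = x}" using l by (auto simp: affine_curve_def mult_less_0_iff)
  qed
  moreover have inj: "inj_on (\<lambda>t. l * t) ?S" using l by (auto simp: inj_on_def)
  ultimately show ?thesis unfolding visits_def by (cases "finite ?S") (simp_all add: card_image finite_image_iff)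
qed

lemma affine_curve_end:
  assumes "cv \<in> curves" "stops cv" and l: "0 < l"
  shows "curve_end (affine_curve v l cv) = v + l *\<^sub>R curve_end cv" "stops (affine_curve v l cv)"
proof -
  obtain n where n: "const_from n cv" using assms(2) by (auto simp: stops_def)
  have c: "affine_curve v l cv t = v + l *\<^sub>R curve_end cv" if "l * real n <= t" for t
  proof -
    have "real n <= t / l" using that l by (simp add: field_simps)
    then have "cv (t / l) = cv (real n)" using n unfolding const_from_def by blast
    moreover have "0 <= l * real n" using l by simp
    then have "0 <= t" using that by linarith
    ultimately show ?thesis using curve_end_eq_nat[OF assms(1) n] by (simp add: affine_curve_def)
  qed
  show "curve_end (affine_curve v l cv) = v + l *\<^sub>R curve_end cv" by (rule curve_end_eq[OF affine_curve_in_curves[OF assms(1) l], of "l * real n"]) (use l c in auto)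
  obtain m :: nat where m: "l * real n <= real m" using real_arch_simple by blast
  have "const_from m (affine_curve v l cv)" unfolding const_from_def using c[of "real m"] c m by (metis order.trans)
  then show "stops (affine_curve v l cv)" by (auto simp: stops_def)
qed

lemma affine_curve_image: "0 < l ==> affine_curve v l cv ` {0..} = (\<lambda>x. v + l *\<^sub>R x) ` cv ` {0..}"
proof (intro equalityI subsetI)
  fix x assume l: "0 < l" and "x \<in> (\<lambda>x. v + l *\<^sub>R x) ` cv ` {0..}"
  then obtain t where "0 <= t" "x = v + l *\<^sub>R cv t" by auto
  then show "x \<in> affine_curve v l cv ` {0..}" using l by (intro image_eqI[of _ _ "l * t"]) (auto simp: affine_curve_def mult_less_0_iff)
qed (auto simp: affine_curve_def)

lemma hausdorff1_affine:
  fixes v :: "'a::euclidean_space"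
  assumes l: "0 < l"
  shows "H1 ((\<lambda>x. v + l *\<^sub>R x) ` A) = ennreal l * H1 A"
proof (rule antisym)
  show "H1 ((\<lambda>x. v + l *\<^sub>R x) ` A) <= ennreal l * H1 A" using l by (intro hausdorff1_outer_similarity) (simp_all add: dist_norm flip: scaleR_diff_right)
  have "A = (\<lambda>x. (x - v) /\<^sub>R l) ` (\<lambda>x. v + l *\<^sub>R x) ` A" using l by (auto simp: image_comp o_def)
  also have "H1 ... <= ennreal (1 / l) * H1 ((\<lambda>x. v + l *\<^sub>R x) ` A)"
    using l by (intro hausdorff1_outer_similarity) (simp_all add: dist_norm inverse_eq_divide flip: scaleR_diff_right)
  finally have "ennreal l * H1 A <= ennreal l * (ennreal (1 / l) * H1 ((\<lambda>x. v + l *\<^sub>R x) ` A))" by (rule mult_left_mono) simp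
  also have "... = H1 ((\<lambda>x. v + l *\<^sub>R x) ` A)" using l by (simp add: mult.assoc[symmetric] ennreal_mult[symmetric])
  finally show "ennreal l * H1 A <= H1 ((\<lambda>x. v + l *\<^sub>R x) ` A)" .
qed

lemma nn_integral_hausdorff1_affine:
  fixes f :: "'a::euclidean_space => ennreal"
  assumes l: "0 < l" and f: "f \<in> borel_measurable borel"
  shows "(\<integral>\<^sup>+x. f ((x - v) /\<^sub>R l) \<partial>hausdorff1) = ennreal l * (\<integral>\<^sup>+x. f x \<partial>hausdorff1)"
proof -
  have m: "(\<lambda>x. (x - v) /\<^sub>R l) \<in> measurable hausdorff1 (borel :: 'a measure)" by measurable
  have "distr hausdorff1 borel (\<lambda>x. (x - v) /\<^sub>R l) = density hausdorff1 (\<lambda>_::'a. ennreal l)"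
  proof (rule measure_eqI)
    fix A :: "'a set" assume "A \<in> sets (distr hausdorff1 borel (\<lambda>x. (x - v) /\<^sub>R l))"
    then have A[measurable]: "A \<in> sets borel" by simp
    have "(\<lambda>x. (x - v) /\<^sub>R l) -` A = (\<lambda>x. v + l *\<^sub>R x) ` A"
    proof (intro equalityI subsetI)
      fix x assume "x \<in> (\<lambda>x. (x - v) /\<^sub>R l) -` A"
      then show "x \<in> (\<lambda>x. v + l *\<^sub>R x) ` A" using l by (intro image_eqI[of _ _ "(x - v) /\<^sub>R l"]) auto
    qed (use l in auto)
    moreover have "(\<lambda>x. (x - v) /\<^sub>R l) -` A \<in> sets borel" using measurable_sets[OF m, of A] A by simp
    ultimately show "emeasure (distr hausdorff1 borel (\<lambda>x. (x - v) /\<^sub>R l)) A = emeasure (density hausdorff1 (\<lambda>_. ennreal l)) A"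
      using m by (simp add: emeasure_distr emeasure_hausdorff1 hausdorff1_affine[OF l] emeasure_density nn_integral_cmult)
  qed simp
  then have "(\<integral>\<^sup>+x. f x \<partial>distr hausdorff1 borel (\<lambda>x. (x - v) /\<^sub>R l)) = (\<integral>\<^sup>+x. ennreal l * f x \<partial>hausdorff1)"
    using f by (simp add: nn_integral_density cong: measurable_cong_sets)
  then show ?thesis using f m by (simp add: nn_integral_distr nn_integral_cmult cong: measurable_cong_sets)
qed

text \<open>Multiplying mass by \<open>c\<close> multiplies the integrand of the
  \<open>al\<close>-mass by \<open>c powr al\<close>; the similarity multiplies one-dimensional
  measure by \<open>l\<close>.\<close>

lemma quant_error_affine_le:
  fixes \<nu> :: "'a::euclidean_space measure"
  assumes l: "0 < l" and c: "0 < c" and al: "0 < al" "al <= 1"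
  shows "quant_error al (density (distr \<nu> borel (\<lambda>x. v + l *\<^sub>R x)) (\<lambda>_. ennreal c)) N
    <= ennreal (c powr al * l) * quant_error al \<nu> N"
proof -
  define C where "C = ennreal (c powr al * l)"
  have C: "C \<noteq> 0" "C \<noteq> top" using c l by (auto simp: C_def)
  have "quant_error al (density (distr \<nu> borel (\<lambda>x. v + l *\<^sub>R x)) (\<lambda>_. ennreal c)) N / C <= quant_error al \<nu> N"
  proof (rule dense_ge)
    fix e assume "quant_error al \<nu> N < e"
    then obtain P F where P: "traffic_plan P" "distr P borel curve_end = \<nu>" "finite F" "card F <= N"
      "AE cv in P. cv 0 \<in> F" "alpha_mass al P < e" by (rule quant_error_less)
    note T = traffic_planD[OF P(1)]
    have cs: "measurable P K = measurable curve_borel K" for K :: "'k measure" by (rule measurable_cong_sets[OF T(2) refl])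
    note am = measurable_affine_curve[OF l, of v]
    define P0 where "P0 = distr P curve_borel (affine_curve v l)"
    define P' where "P' = density P0 (\<lambda>_. ennreal c)"
    have tp0: "traffic_plan P0" unfolding P0_def using affine_curve_end(2)[OF _ _ l] by (intro traffic_plan_distr P(1) am)
    have tp: "traffic_plan P'" unfolding P'_def by (rule traffic_plan_density[OF tp0, of _ c]) auto
    have cs0: "measurable P0 K = measurable curve_borel K" for K :: "'k measure" by (rule measurable_cong_sets[OF traffic_planD(2)[OF tp0] refl])
    have AEs: "AE cv in P. cv \<in> curves \<and> stops cv" using T(3,4) AE_space[of P] by auto
    have "distr P0 borel curve_end = distr P borel (curve_end \<circ> affine_curve v l)" unfolding P0_def by (rule distr_distr) (use am in \<open>simp_all add: cs\<close>)
    also have "... = distr P borel ((\<lambda>x. v + l *\<^sub>R x) \<circ> curve_end)" using AEs am by (intro distr_cong_AE refl)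
        (auto simp: cs affine_curve_end(1)[OF _ _ l] intro!: measurable_comp)
    also have "... = distr \<nu> borel (\<lambda>x. v + l *\<^sub>R x)" unfolding P(2)[symmetric] by (rule distr_distr[symmetric]) (simp_all add: cs)
    finally have d0: "distr P0 borel curve_end = distr \<nu> borel (\<lambda>x. v + l *\<^sub>R x)" .
    have tgt: "distr P' borel curve_end = density (distr \<nu> borel (\<lambda>x. v + l *\<^sub>R x)) (\<lambda>_. ennreal c)"
      unfolding P'_def d0[symmetric] by (rule density_distr[symmetric]) (simp_all add: cs0)
    have "AE cv in P0. cv 0 \<in> (\<lambda>x. v + l *\<^sub>R x) ` F" unfolding P0_def
    proof (subst AE_distr_iff)
      have "AE cv in P. cv 0 \<in> F" by (rule P)
      then show "AE cv in P. affine_curve v l cv 0 \<in> (\<lambda>x. v + l *\<^sub>R x) ` F" by (auto simp: affine_curve_def)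
      have "(\<lambda>cv. cv 0) -` ((\<lambda>x. v + l *\<^sub>R x) ` F) \<inter> space curve_borel \<in> sets (curve_borel :: (real => 'a) measure)"
        using P(3) by (intro measurable_sets[OF measurable_curve_eval]) (auto simp: finite_imp_closed borel_closed)
      also have "(\<lambda>cv. cv 0) -` ((\<lambda>x. v + l *\<^sub>R x) ` F) \<inter> space curve_borel = {cv \<in> space curve_borel. cv 0 \<in> (\<lambda>x. v + l *\<^sub>R x) ` F}" by auto
      finally show "{cv \<in> space curve_borel. cv 0 \<in> (\<lambda>x. v + l *\<^sub>R x) ` F} \<in> sets curve_borel" .
    qed (use am in \<open>simp add: cs\<close>)
    then have st: "AE cv in P'. cv 0 \<in> (\<lambda>x. v + l *\<^sub>R x) ` F" unfolding P'_def by (intro AE_density_of[OF tp0]) auto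
    have "quant_error al (density (distr \<nu> borel (\<lambda>x. v + l *\<^sub>R x)) (\<lambda>_. ennreal c)) N <= alpha_mass al P'" using P(3,4) card_image_le[OF P(3), of "\<lambda>x. v + l *\<^sub>R x"]
      by (intro quant_error_le[OF tp tgt _ _ st]) auto
    also have "... <= C * alpha_mass al P"
    proof (cases "rectifiable_plan P")
      case True
      then obtain phi where phi: "lip_family phi" "AE cv in P. covered phi cv" by (rule rectifiable_planE)
      define psi where "psi i t = v + l *\<^sub>R phi i t" for i t
      have "lip_family psi" unfolding lip_family_def
      proof
        fix i
        obtain L where "L-lipschitz_on {0..} (phi i)" using phi(1) by (auto simp: lip_family_def)
        then have "(l * L)-lipschitz_on {0..} (psi i)" using l unfolding lipschitz_on_def psi_def
          by (auto simp: dist_norm mult.assoc mult_left_mono simp flip: scaleR_diff_right)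
        then show "\<exists>L. L-lipschitz_on {0..} (psi i)" ..
      qed
      have tr: "lip_trace psi = (\<lambda>x. v + l *\<^sub>R x) ` lip_trace phi" by (auto simp: lip_trace_def psi_def image_UN image_comp o_def)
      have "inj (\<lambda>x. v + l *\<^sub>R x)" using l by (auto simp: inj_on_def)
      then have cov: "covered psi (affine_curve v l cv)" if "covered phi cv" for cv using that unfolding covered_def tr affine_curve_image[OF l]
        by (simp add: hausdorff1_affine[OF l] flip: image_set_diff)
      have "AE cv in P0. covered psi cv" unfolding P0_def using cov by (intro AE_covered_distr[OF P(1) am phi(2) \<open>lip_family psi\<close>])
      then have "AE cv in P'. covered psi cv" unfolding P'_def by (intro AE_density_of[OF tp0]) auto
      then have r': "rectifiable_plan P'" using \<open>lip_family psi\<close> unfolding rectifiable_plan_iff by blast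
      have mult: "multiplicity P' x = ennreal c * multiplicity P ((x - v) /\<^sub>R l)" for x
      proof -
        have "multiplicity P' x = (\<integral>\<^sup>+cv. ennreal c * visits cv x \<partial>P0)" unfolding P'_def by (rule multiplicity_density[OF tp0]) simp
        also have "... = ennreal c * multiplicity P0 x" unfolding multiplicity_eq by (rule nn_integral_cmult) (simp add: cs0)
        also have "multiplicity P0 x = multiplicity P ((x - v) /\<^sub>R l)"
          by (simp add: P0_def multiplicity_distr[OF P(1) am] visits_affine_curve[OF l] multiplicity_eq[of P])
        finally show ?thesis .
      qed
      note mm[measurable] = measurable_multiplicity[OF P(1)]
      have [measurable]: "(\<lambda>x. multiplicity P ((x - v) /\<^sub>R l)) \<in> borel_measurable borel" by (rule measurable_compose[OF _ mm]) measurable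
      have "alpha_mass al P' = (\<integral>\<^sup>+x. ennpow (ennreal c) al * ennpow (multiplicity P ((x - v) /\<^sub>R l)) al \<partial>hausdorff1)" unfolding alpha_mass_eq[OF r'] mult ennpow_mult ..
      also have "... = ennpow (ennreal c) al * (\<integral>\<^sup>+x. ennpow (multiplicity P ((x - v) /\<^sub>R l)) al \<partial>hausdorff1)" by (intro nn_integral_cmult) measurable
      also have "(\<integral>\<^sup>+x. ennpow (multiplicity P ((x - v) /\<^sub>R l)) al \<partial>hausdorff1) = ennreal l * alpha_mass al P"
        unfolding alpha_mass_eq[OF True] by (intro nn_integral_hausdorff1_affine[OF l]) measurable
      also have "ennpow (ennreal c) al * (ennreal l * alpha_mass al P) = C * alpha_mass al P" using c l by (simp add: C_def ennpow_ennreal ennreal_mult mult.assoc)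
      finally show ?thesis by simp
    next
      case False
      then show ?thesis using C by (simp add: alpha_mass_def ennreal_mult_top)
    qed
    also have "... <= C * e" using P(6) by (intro mult_left_mono) auto
    finally have "quant_error al (density (distr \<nu> borel (\<lambda>x. v + l *\<^sub>R x)) (\<lambda>_. ennreal c)) N / C <= C * e / C" by (rule divide_right_mono_ennreal)
    then show "quant_error al (density (distr \<nu> borel (\<lambda>x. v + l *\<^sub>R x)) (\<lambda>_. ennreal c)) N / C <= e" using C by (simp add: mult.commute[of C] ennreal_mult_divide_eq)
  qed
  then have "C * (quant_error al (density (distr \<nu> borel (\<lambda>x. v + l *\<^sub>R x)) (\<lambda>_. ennreal c)) N / C) <= C * quant_error al \<nu> N" by (rule mult_left_mono) simp
  then show ?thesis using ennreal_times_divide_cancel[of "c powr al * l"] c l by (simp add: C_def)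
qed



section \<open>Dyadic irrigation trees\<close>

subsection \<open>The branches\<close>

text \<open>The branch towards \<open>y\<close> joins the centres of the dyadic cells containing \<open>y\<close>. The step from
  generation \<open>k\<close> to \<open>k + 1\<close> is given the time \<open>T / 2^(k+1)\<close>, so every branch takes the same total time \<open>T\<close>
  and prefixing a branch to a curve is a time shift independent of the curve.\<close>

definition ctr :: "real => nat => real^'n => real^'n" where
  "ctr h k y = (\<chi> i. h / 2 ^ k * (of_int \<lfloor>y $ i * 2 ^ k / h\<rfloor> + 1 / 2))"

definition node_time :: "real => nat => real" where
  "node_time T k = T * (1 - 1 / 2 ^ k)"

text \<open>The fraction of the edge from generation k to k + 1 that has been traversed at time
  t.\<close>

definition ramp :: "real => nat => real => real" where
  "ramp T k t = max 0 (min 1 ((t - node_time T k) / (T / 2 ^ Suc k)))"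

text \<open>Edge k moves every coordinate by h / 2^(k+2), so its length is at most the number of
  coordinates times this, which is exactly the time \<open>dur / 2 ^ Suc k\<close> allotted to it.
  Hence branches have speed at most 1.\<close>

definition dur :: "real => 'n::finite itself => real" where
  "dur h _ = real CARD('n) * h / 2"

definition branch :: "real => nat => real^'n => real => real^'n" where
  "branch h n y t = ctr h 0 y +
     (\<Sum>k<n. ramp (dur h TYPE('n)) k t *\<^sub>R (ctr h (Suc k) y - ctr h k y))"

section \<open>Timing and geometry of the branches\<close>

lemma node_time_0 [simp]: "node_time T 0 = 0" by (simp add: node_time_def)

lemma node_time_Suc: "node_time T (Suc k) = node_time T k + T / 2 ^ Suc k" by (simp add: node_time_def field_simps)

lemma node_time_mono: "0 <= T ==> j <= k ==> node_time T j <= node_time T k" unfolding node_time_def by (intro mult_left_mono diff_left_mono divide_left_mono) auto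

lemma node_time_less: "0 < T ==> node_time T k < T" by (simp add: node_time_def algebra_simps)

lemma node_time_nonneg: "0 <= T ==> 0 <= node_time T k" using node_time_mono[of T 0 k] by simp

lemma node_time_tendsto: "(\<lambda>k. node_time T k) \<longlonglongrightarrow> T"
proof -
  have "(\<lambda>k. T * (1 - (1/2) ^ k)) \<longlonglongrightarrow> T * (1 - 0)" by (intro tendsto_intros LIMSEQ_power_zero) auto
  then show ?thesis by (simp add: node_time_def power_one_over)
qed

lemma node_time_ex: "0 < T ==> t < T ==> \<exists>n. t <= node_time T n" using order_tendstoD(1)[OF node_time_tendsto, of t T] eventually_happens'[OF sequentially_bot]
  by (metis (no_types, lifting) less_imp_le)

text \<open>In this form the increments telescope over the generations, and the Lipschitz constant
  of a branch comes out as 1 independently of its depth.\<close>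

lemma ramp_mult: "0 < T ==> ramp T k t * (T / 2 ^ Suc k) = min t (node_time T (Suc k)) - min t (node_time T k)"
proof -
  assume T: "0 < T"
  define w where "w = T / 2 ^ Suc k"
  have w: "0 < w" using T by (simp add: w_def)
  have "max 0 (min 1 ((t - node_time T k) / w)) * w = min t (node_time T k + w) - min t (node_time T k)" using w by (auto simp: max_def min_def field_simps)
  then show ?thesis unfolding ramp_def node_time_Suc w_def .
qed

lemma ramp_mono: "0 < T ==> s <= t ==> ramp T k s <= ramp T k t" unfolding ramp_def by (intro max.mono min.mono divide_right_mono) auto

lemma ramp_eq_0: "0 < T ==> t <= node_time T k ==> ramp T k t = 0" using divide_nonpos_pos[of "t - node_time T k" "T / 2 ^ Suc k"] by (simp add: ramp_def del: power_Suc)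

lemma ramp_eq_1: "0 < T ==> node_time T (Suc k) <= t ==> ramp T k t = 1" by (simp add: ramp_def node_time_Suc field_simps)

text \<open>In each coordinate the child cell is the lower or the upper half of its parent,
  according to whether the floor of 2u is even or odd.\<close>

lemma abs_ctr_diff:
  assumes "0 < h"
  shows "\<bar>ctr h (Suc k) y $ i - ctr h k y $ i\<bar> = h / 2 ^ (k + 2)"
proof -
  let ?u = "y $ i * 2 ^ k / h"
  have dbl: "\<lfloor>2 * u\<rfloor> = 2 * \<lfloor>u\<rfloor> \<or> \<lfloor>2 * u\<rfloor> = 2 * \<lfloor>u\<rfloor> + 1" for u :: real by linarith
  have "\<lfloor>y $ i * 2 ^ Suc k / h\<rfloor> = 2 * \<lfloor>?u\<rfloor> \<or> \<lfloor>y $ i * 2 ^ Suc k / h\<rfloor> = 2 * \<lfloor>?u\<rfloor> + 1" using dbl[of ?u] by (simp add: mult.left_commute)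
  then show ?thesis
  proof
    assume a: "\<lfloor>y $ i * 2 ^ Suc k / h\<rfloor> = 2 * \<lfloor>?u\<rfloor>"
    have "ctr h (Suc k) y $ i - ctr h k y $ i = - (h / 2 ^ (k + 2))" unfolding ctr_def vec_lambda_beta a by (simp add: field_simps)
    then show ?thesis using assms by simp
  next
    assume a: "\<lfloor>y $ i * 2 ^ Suc k / h\<rfloor> = 2 * \<lfloor>?u\<rfloor> + 1"
    have "ctr h (Suc k) y $ i - ctr h k y $ i = h / 2 ^ (k + 2)" unfolding ctr_def vec_lambda_beta a by (simp add: field_simps)
    then show ?thesis using assms by simp
  qed
qed

lemma abs_ctr_diff_point:
  assumes "0 < h"
  shows "\<bar>ctr h k y $ i - y $ i\<bar> <= h / 2 ^ Suc k"
proof -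
  let ?u = "y $ i * 2 ^ k / h"
  have "y $ i = h / 2 ^ k * ?u" using assms by simp
  then have "ctr h k y $ i - y $ i = h / 2 ^ k * (of_int \<lfloor>?u\<rfloor> + 1 / 2 - ?u)" unfolding ctr_def vec_lambda_beta by (metis right_diff_distrib)
  also have "\<bar>...\<bar> = h / 2 ^ k * \<bar>of_int \<lfloor>?u\<rfloor> + 1 / 2 - ?u\<bar>" using assms by (simp add: abs_mult)
  also have "... <= h / 2 ^ k * (1 / 2)" using assms by (intro mult_left_mono) (linarith, simp)
  finally show ?thesis by (simp add: field_simps)
qed

lemma norm_le_card_mult:
  fixes x :: "real^'n" assumes "\<And>i. \<bar>x $ i\<bar> <= b" shows "norm x <= real CARD('n) * b"
proof -
  have "norm x <= (\<Sum>i\<in>UNIV. \<bar>x $ i\<bar>)" by (rule norm_le_l1_cart)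
  also have "... <= (\<Sum>i\<in>(UNIV :: 'n set). b)" by (intro sum_mono assms)
  finally show ?thesis by simp
qed

lemma norm_ctr_diff:
  fixes y :: "real^'n" assumes "0 < h"
  shows "norm (ctr h (Suc k) y - ctr h k y) <= dur h TYPE('n) / 2 ^ Suc k"
proof -
  have "norm (ctr h (Suc k) y - ctr h k y) <= real CARD('n) * (h / 2 ^ (k + 2))"
    by (rule norm_le_card_mult) (simp only: vector_minus_component abs_ctr_diff[OF assms] order_refl)
  then show ?thesis by (simp add: dur_def)
qed

lemma dist_ctr_point:
  fixes y :: "real^'n" assumes "0 < h"
  shows "dist (ctr h k y) y <= dur h TYPE('n) / 2 ^ k"
proof -
  have "norm (ctr h k y - y) <= real CARD('n) * (h / 2 ^ Suc k)" by (rule norm_le_card_mult) (simp only: vector_minus_component abs_ctr_diff_point[OF assms])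
  then show ?thesis by (simp add: dur_def dist_norm)
qed

text \<open>No edge degenerates to a point, so a branch visits a point of an edge only once while
  traversing that edge.\<close>

lemma ctr_Suc_neq: "0 < h ==> ctr h (Suc k) y \<noteq> ctr h k y"
proof
  assume h: "0 < h" and "ctr h (Suc k) y = ctr h k y"
  then have "h / 2 ^ (k + 2) = 0" using abs_ctr_diff[OF h, of k y undefined] by simp
  then show False using h by simp
qed

lemma dur_pos: "0 < h ==> 0 < dur h TYPE('n::finite)" by (simp add: dur_def)

lemma measurable_ctr [measurable]: "ctr h k \<in> borel_measurable borel"
proof -
  have "(\<lambda>y. ctr h k y \<bullet> b) \<in> borel_measurable borel" if "b \<in> Basis" for b :: "real^'n"
  proof -
    obtain i where b: "b = axis i 1" using \<open>b \<in> Basis\<close> by (auto simp: Basis_vec_def)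
    have "(\<lambda>y :: real^'n. h / 2 ^ k * (of_int \<lfloor>y $ i * 2 ^ k / h\<rfloor> + 1 / 2)) \<in> borel_measurable borel" by measurable
    then show ?thesis by (simp add: b inner_axis ctr_def)
  qed
  then show ?thesis by (subst borel_measurable_euclidean_space) blast
qed

lemma measurable_branch [measurable]: "(\<lambda>y. branch h n y t) \<in> borel_measurable borel" unfolding branch_def by measurable

subsection \<open>Prefixing a branch to a curve\<close>

definition stage :: "real => real => nat" where
  "stage T t = (LEAST n. t <= node_time T n)"

text \<open>Before time \<open>dur\<close> only finitely many generations have begun, and
  \<open>stage\<close> picks enough of them. At time \<open>dur\<close> the branch has converged to
  \<open>cv 0\<close>, where the old curve takes over.\<close>

definition graft :: "real => (real => real^'n) => real => real^'n" where
  "graft h cv t = (if t < 0 then undefined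
     else if t < dur h TYPE('n) then branch h (stage (dur h TYPE('n)) t) (cv 0) t
     else cv (t - dur h TYPE('n)))"

context
  fixes h :: real and dummy :: "'n::finite"
  assumes h: "0 < h"
begin

lemma tt_pos: "0 < dur h TYPE('n)" using h by (rule dur_pos)

lemma branch_lipschitz:
  fixes y :: "real^'n"
  assumes st: "0 <= s" "s <= t"
  shows "dist (branch h n y s) (branch h n y t) <= t - s"
proof -
  have "branch h n y t - branch h n y s = (\<Sum>k<n. (ramp (dur h TYPE('n)) k t - ramp (dur h TYPE('n)) k s) *\<^sub>R (ctr h (Suc k) y - ctr h k y))"
    by (simp add: branch_def scaleR_diff_left sum_subtractf)
  then have "dist (branch h n y s) (branch h n y t) <= (\<Sum>k<n. norm ((ramp (dur h TYPE('n)) k t - ramp (dur h TYPE('n)) k s) *\<^sub>R (ctr h (Suc k) y - ctr h k y)))"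
    by (simp only: dist_norm norm_minus_commute[of "branch h n y s"] norm_sum)
  also have "... <= (\<Sum>k<n. (ramp (dur h TYPE('n)) k t - ramp (dur h TYPE('n)) k s) * (dur h TYPE('n) / 2 ^ Suc k))"
  proof (rule sum_mono)
    fix k
    show "norm ((ramp (dur h TYPE('n)) k t - ramp (dur h TYPE('n)) k s) *\<^sub>R (ctr h (Suc k) y - ctr h k y)) <= (ramp (dur h TYPE('n)) k t - ramp (dur h TYPE('n)) k s) * (dur h TYPE('n) / 2 ^ Suc k)"
      using ramp_mono[OF tt_pos st(2), of k] norm_ctr_diff[OF h, of k y]
      mult_left_mono[OF norm_ctr_diff[OF h, of k y], of "ramp (dur h TYPE('n)) k t - ramp (dur h TYPE('n)) k s"] by (simp del: power_Suc)
  qed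
  also have "... = (\<Sum>k<n. (min t (node_time (dur h TYPE('n)) (Suc k)) - min t (node_time (dur h TYPE('n)) k)) - (min s (node_time (dur h TYPE('n)) (Suc k)) - min s (node_time (dur h TYPE('n)) k)))"
    by (simp only: left_diff_distrib ramp_mult[OF tt_pos])
  also have "... = (min t (node_time (dur h TYPE('n)) n) - min t 0) - (min s (node_time (dur h TYPE('n)) n) - min s 0)"
    using sum_lessThan_telescope[of "\<lambda>k. min s (node_time (dur h TYPE('n)) k)" n]
      sum_lessThan_telescope[of "\<lambda>k. min t (node_time (dur h TYPE('n)) k)" n] by (subst sum_subtractf) (simp only: node_time_0)
  also have "... <= t - s" using st by (auto simp: min_def)
  finally show ?thesis .
qed

lemma branch_ge:
  fixes y :: "real^'n"
  assumes "node_time (dur h TYPE('n)) n <= t" shows "branch h n y t = ctr h n y"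
proof -
  have "ramp (dur h TYPE('n)) k t = 1" if "k < n" for k using that assms node_time_mono[of "dur h TYPE('n)" "Suc k" n] tt_pos by (intro ramp_eq_1) auto
  then have "branch h n y t = ctr h 0 y + (\<Sum>k<n. (ctr h (Suc k) y - ctr h k y))" by (simp add: branch_def)
  also have "... = ctr h n y" using sum_lessThan_telescope[of "\<lambda>k. ctr h k y" n] by simp
  finally show ?thesis .
qed

text \<open>Generations from n on have not begun by \<open>node_time n\<close>. The values at any
  two times can therefore be read off from one common truncation.\<close>

lemma branch_stable:
  fixes y :: "real^'n"
  assumes t: "t <= node_time (dur h TYPE('n)) n" and "n <= m" shows "branch h m y t = branch h n y t"
proof -
  have "ramp (dur h TYPE('n)) k t = 0" if "n <= k" for k using that t node_time_mono[of "dur h TYPE('n)" n k] tt_pos by (intro ramp_eq_0) auto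
  then have "(\<Sum>k<m. ramp (dur h TYPE('n)) k t *\<^sub>R (ctr h (Suc k) y - ctr h k y)) = (\<Sum>k<n. ramp (dur h TYPE('n)) k t *\<^sub>R (ctr h (Suc k) y - ctr h k y))"
    using assms(2) by (intro sum.mono_neutral_right) auto
  then show ?thesis by (simp add: branch_def)
qed

lemma branch_segment:
  fixes y :: "real^'n"
  assumes "node_time (dur h TYPE('n)) k <= t"
  shows "branch h (Suc k) y t = ctr h k y + ramp (dur h TYPE('n)) k t *\<^sub>R (ctr h (Suc k) y - ctr h k y)" using branch_ge[OF assms, of y] by (simp add: branch_def)

lemma branch_0:
  fixes y :: "real^'n" shows "branch h n y 0 = ctr h 0 y" using ramp_eq_0[OF tt_pos node_time_nonneg[OF less_imp_le[OF tt_pos]]] by (simp add: branch_def)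

lemma stage: "t < dur h TYPE('n) ==> t <= node_time (dur h TYPE('n)) (stage (dur h TYPE('n)) t)" unfolding stage_def using LeastI_ex[OF node_time_ex[OF tt_pos]] by blast

lemma graft_eq_branch: fixes cv :: "real => real^'n" shows "0 <= t ==> t < dur h TYPE('n) ==> stage (dur h TYPE('n)) t <= n ==> graft h cv t = branch h n (cv 0) t"
  using branch_stable[OF stage, of t n "cv 0"] by (simp add: graft_def)

lemma graft_0: fixes cv :: "real => real^'n" shows "graft h cv 0 = ctr h 0 (cv 0)" using tt_pos by (simp add: graft_def branch_0)

lemma graft_in_curves:
  fixes cv :: "real => real^'n"
  assumes cv: "cv \<in> curves" shows "graft h cv \<in> curves"
proof (rule curvesI)
  fix s t :: real assume st: "0 <= s" "s <= t"
  consider "t < dur h TYPE('n)" | "s < dur h TYPE('n)" "dur h TYPE('n) <= t" | "dur h TYPE('n) <= s" by linarith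
  then show "dist (graft h cv s) (graft h cv t) <= t - s"
  proof cases
    case 1
    let ?n = "max (stage (dur h TYPE('n)) s) (stage (dur h TYPE('n)) t)"
    have "graft h cv s = branch h ?n (cv 0) s" "graft h cv t = branch h ?n (cv 0) t" using 1 st by (auto intro!: graft_eq_branch)
    then show ?thesis using branch_lipschitz[OF st, of ?n "cv 0"] by simp
  next
    case 2
    \<comment> \<open>The route passes through the centre of generation n. The time
      \<open>dur / 2 ^ n\<close> missing from node n to the end of the branch pays exactly for the
      distance from that centre to \<open>cv 0\<close>, so the bound adds up to t - s.\<close>
    have bound: "dist (graft h cv s) (graft h cv t) <= (node_time (dur h TYPE('n)) n - s) + dur h TYPE('n) / 2 ^ n + (t - dur h TYPE('n))" if n: "stage (dur h TYPE('n)) s <= n" for n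
    proof -
      have s1: "graft h cv s = branch h n (cv 0) s" using 2 st n by (intro graft_eq_branch) auto
      have sn: "s <= node_time (dur h TYPE('n)) n" using stage[OF 2(1)] node_time_mono[of "dur h TYPE('n)" "stage (dur h TYPE('n)) s" n] n tt_pos by linarith
      have "dist (graft h cv s) (ctr h n (cv 0)) <= node_time (dur h TYPE('n)) n - s"
        using branch_lipschitz[OF st(1) sn, of n "cv 0"] branch_ge[of n "node_time (dur h TYPE('n)) n" "cv 0"] s1 by simp
      moreover have "dist (ctr h n (cv 0)) (cv 0) <= dur h TYPE('n) / 2 ^ n" by (rule dist_ctr_point[OF h])
      moreover have "dist (cv 0) (graft h cv t) <= t - dur h TYPE('n)" using curve_dist_le[OF cv, of 0 "t - dur h TYPE('n)"] 2 st by (simp add: graft_def)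
      moreover have "dist (graft h cv s) (graft h cv t) \<le>
          dist (graft h cv s) (ctr h n (cv 0)) + dist (ctr h n (cv 0)) (cv 0) + dist (cv 0) (graft h cv t)" by metric
      ultimately show ?thesis by linarith
    qed
    show ?thesis using bound[of "stage (dur h TYPE('n)) s"] by (simp add: node_time_def algebra_simps)
  next
    case 3
    then show ?thesis using curve_dist_le[OF cv, of "s - dur h TYPE('n)" "t - dur h TYPE('n)"] st tt_pos by (simp add: graft_def)
  qed
qed (simp add: graft_def)

lemma measurable_graft: "(graft h :: (real => real^'n) => _) \<in> measurable curve_borel curve_borel"
proof (rule measurable_curve_borelI)
  fix t :: real assume t: "0 <= t"
  show "(\<lambda>cv :: real => real^'n. graft h cv t) \<in> borel_measurable curve_borel"
  proof (cases "t < dur h TYPE('n)")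
    case True
    have "(\<lambda>cv :: real => real^'n. branch h (stage (dur h TYPE('n)) t) (cv 0) t) \<in> borel_measurable curve_borel"
      by (rule measurable_compose[OF measurable_curve_eval measurable_branch]) simp
    then show ?thesis using t True by (simp add: graft_def)
  next
    case False
    then have "(\<lambda>cv :: real => real^'n. cv (t - dur h TYPE('n))) \<in> borel_measurable curve_borel" by (intro measurable_curve_eval) simp
    then show ?thesis using t False by (simp add: graft_def)
  qed
qed (use graft_in_curves in auto)

lemma graft_end:
  fixes cv :: "real => real^'n"
  assumes cv: "cv \<in> curves" "stops cv"
  shows "curve_end (graft h cv) = curve_end cv" "stops (graft h cv)"
proof -
  obtain n where n: "const_from n cv" using cv by (auto simp: stops_def)
  have c: "graft h cv t = curve_end cv" if "dur h TYPE('n) + real n <= t" for t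
  proof -
    have "real n <= t - dur h TYPE('n)" using that by linarith
    then have "cv (t - dur h TYPE('n)) = cv (real n)" using n unfolding const_from_def by blast
    moreover have "dur h TYPE('n) <= t" "0 <= t" using that tt_pos by linarith+
    ultimately show ?thesis using curve_end_eq_nat[OF cv(1) n] by (simp add: graft_def)
  qed
  show "curve_end (graft h cv) = curve_end cv" by (rule curve_end_eq[OF graft_in_curves[OF cv(1)], of "dur h TYPE('n) + real n"]) (use c tt_pos in auto)
  obtain m :: nat where m: "dur h TYPE('n) + real n <= real m" using real_arch_simple by blast
  have "const_from m (graft h cv)" unfolding const_from_def using c[of "real m"] c m by (metis order.trans)
  then show "stops (graft h cv)" by (auto simp: stops_def)
qed

lemma graft_on_edge:
  fixes cv :: "real => real^'n"
  assumes k: "node_time (dur h TYPE('n)) k <= t" "t < node_time (dur h TYPE('n)) (Suc k)"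
  shows "graft h cv t = ctr h k (cv 0) + ((t - node_time (dur h TYPE('n)) k) / (dur h TYPE('n) / 2 ^ Suc k)) *\<^sub>R (ctr h (Suc k) (cv 0) - ctr h k (cv 0))"
    and "(t - node_time (dur h TYPE('n)) k) / (dur h TYPE('n) / 2 ^ Suc k) \<in> {0..1}"
proof -
  have t: "0 <= t" "t < dur h TYPE('n)" using k node_time_nonneg[of "dur h TYPE('n)" k] node_time_less[of "dur h TYPE('n)" "Suc k"] tt_pos by linarith+
  have r: "0 <= (t - node_time (dur h TYPE('n)) k) / (dur h TYPE('n) / 2 ^ Suc k)" "(t - node_time (dur h TYPE('n)) k) / (dur h TYPE('n) / 2 ^ Suc k) <= 1"
    using k divide_le_eq_1_pos[of "dur h TYPE('n) / 2 ^ Suc k" "t - node_time (dur h TYPE('n)) k"] tt_pos by (simp_all only: node_time_Suc) simp_all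
  then show "(t - node_time (dur h TYPE('n)) k) / (dur h TYPE('n) / 2 ^ Suc k) \<in> {0..1}" by simp
  have "stage (dur h TYPE('n)) t <= Suc k" unfolding stage_def using k by (intro Least_le) simp
  then have "graft h cv t = branch h (Suc k) (cv 0) t" using t by (intro graft_eq_branch)
  also have "... = ctr h k (cv 0) + ramp (dur h TYPE('n)) k t *\<^sub>R (ctr h (Suc k) (cv 0) - ctr h k (cv 0))" by (rule branch_segment[OF k(1)])
  also have "ramp (dur h TYPE('n)) k t = (t - node_time (dur h TYPE('n)) k) / (dur h TYPE('n) / 2 ^ Suc k)" unfolding ramp_def using r by (simp del: power_Suc)
  finally show "graft h cv t = ctr h k (cv 0) + ((t - node_time (dur h TYPE('n)) k) / (dur h TYPE('n) / 2 ^ Suc k)) *\<^sub>R (ctr h (Suc k) (cv 0) - ctr h k (cv 0))" .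
qed

lemma node_time_cover:
  assumes "0 <= t" "t < dur h TYPE('n)" obtains k where "node_time (dur h TYPE('n)) k <= t" "t < node_time (dur h TYPE('n)) (Suc k)"
proof -
  have ex: "\<exists>n. t < node_time (dur h TYPE('n)) n" using order_tendstoD(1)[OF node_time_tendsto assms(2)] eventually_happens'[OF sequentially_bot] by blast
  define m where "m = (LEAST n. t < node_time (dur h TYPE('n)) n)"
  have m: "t < node_time (dur h TYPE('n)) m" unfolding m_def using LeastI_ex[OF ex] .
  then have "m \<noteq> 0" using assms by (metis node_time_0 not_less)
  then obtain k where k: "m = Suc k" using not0_implies_Suc by blast
  have "\<not> t < node_time (dur h TYPE('n)) k" using not_less_Least[of k "\<lambda>n. t < node_time (dur h TYPE('n)) n"] k by (simp add: m_def)
  then show ?thesis using that[of k] m k by simp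
qed

lemma graft_on_segment:
  fixes cv :: "real => real^'n"
  assumes k: "node_time (dur h TYPE('n)) k <= t" "t < node_time (dur h TYPE('n)) (Suc k)"
  shows "graft h cv t \<in> closed_segment (ctr h k (cv 0)) (ctr h (Suc k) (cv 0))" unfolding in_segment
  using graft_on_edge(1)[OF k, of cv] graft_on_edge(2)[OF k] by (intro exI[of _ "(t - node_time (dur h TYPE('n)) k) / (dur h TYPE('n) / 2 ^ Suc k)"]) (simp add: algebra_simps del: power_Suc)

lemma graft_image:
  fixes cv :: "real => real^'n"
  shows "graft h cv ` {0..} \<subseteq> (\<Union>k. closed_segment (ctr h k (cv 0)) (ctr h (Suc k) (cv 0))) \<union> cv ` {0..}"
proof
  fix x assume "x \<in> graft h cv ` {0..}"
  then obtain t where t: "0 <= t" "x = graft h cv t" by auto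
  show "x \<in> (\<Union>k. closed_segment (ctr h k (cv 0)) (ctr h (Suc k) (cv 0))) \<union> cv ` {0..}"
  proof (cases "t < dur h TYPE('n)")
    case True
    then obtain k where "node_time (dur h TYPE('n)) k <= t" "t < node_time (dur h TYPE('n)) (Suc k)" using t node_time_cover by blast
    then show ?thesis using graft_on_segment t by blast
  qed (use t in \<open>auto simp: graft_def\<close>)
qed

text \<open>Time is divided into the half-open intervals between nodes and the time after
  \<open>dur\<close>. On each interval the motion is affine along a nondegenerate edge, so a point
  is visited at most once there.\<close>

lemma visits_graft_le:
  fixes cv :: "real => real^'n"
  shows "visits (graft h cv) x \<le>
    (\<Sum>k. indicator (closed_segment (ctr h k (cv 0)) (ctr h (Suc k) (cv 0))) x) + visits cv x"
proof -
  define A where "A k = {t. node_time (dur h TYPE('n)) k <= t \<and> t < node_time (dur h TYPE('n)) (Suc k) \<and> graft h cv t = x}" for k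
  define B where "B = {t. dur h TYPE('n) <= t \<and> cv (t - dur h TYPE('n)) = x}"
  have A: "emeasure (count_space UNIV) (A k) <= indicator (closed_segment (ctr h k (cv 0)) (ctr h (Suc k) (cv 0))) x" for k
  proof (cases "A k = {}")
    case False
    then obtain s where s: "s \<in> A k" by blast
    have "t = s" if "t \<in> A k" for t
    proof -
      let ?r = "\<lambda>t. (t - node_time (dur h TYPE('n)) k) / (dur h TYPE('n) / 2 ^ Suc k)"
      have "?r t *\<^sub>R (ctr h (Suc k) (cv 0) - ctr h k (cv 0)) = ?r s *\<^sub>R (ctr h (Suc k) (cv 0) - ctr h k (cv 0))"
        using that s graft_on_edge(1)[of k t cv] graft_on_edge(1)[of k s cv] by (simp add: A_def del: power_Suc)
      then have "?r t = ?r s" using ctr_Suc_neq[OF h, of k "cv 0"] by simp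
      then show ?thesis using tt_pos by simp
    qed
    then have "A k = {s}" using s by blast
    moreover have "x \<in> closed_segment (ctr h k (cv 0)) (ctr h (Suc k) (cv 0))" using s graft_on_segment[of k s cv] by (auto simp: A_def)
    ultimately show ?thesis by simp
  qed simp
  have B: "emeasure (count_space UNIV) B = visits cv x"
  proof -
    have "B = (\<lambda>t. t + dur h TYPE('n)) ` {t \<in> {0..}. cv t = x}"
    proof (intro equalityI subsetI)
      fix t assume "t \<in> B"
      then show "t \<in> (\<lambda>t. t + dur h TYPE('n)) ` {t \<in> {0..}. cv t = x}" by (intro image_eqI[of _ _ "t - dur h TYPE('n)"]) (auto simp: B_def)
    qed (auto simp: B_def)
    moreover have "inj_on (\<lambda>t. t + dur h TYPE('n)) {t \<in> {0..}. cv t = x}" by (auto simp: inj_on_def)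
    ultimately show ?thesis unfolding visits_def by (cases "finite {t \<in> {0..}. cv t = x}") (simp_all add: card_image finite_image_iff)
  qed
  have "{t \<in> {0..}. graft h cv t = x} \<subseteq> (\<Union>k. A k) \<union> B"
  proof
    fix t assume t: "t \<in> {t \<in> {0..}. graft h cv t = x}"
    show "t \<in> (\<Union>k. A k) \<union> B"
    proof (cases "t < dur h TYPE('n)")
      case True
      then obtain k where "node_time (dur h TYPE('n)) k <= t" "t < node_time (dur h TYPE('n)) (Suc k)" using t node_time_cover by auto
      then show ?thesis using t by (auto simp: A_def)
    qed (use t in \<open>auto simp: B_def graft_def\<close>)
  qed
  then have "visits (graft h cv) x <= emeasure (count_space UNIV) ((\<Union>k. A k) \<union> B)" unfolding visits_def by (intro emeasure_mono) auto
  also have "... <= emeasure (count_space UNIV) (\<Union>k. A k) + emeasure (count_space UNIV) B" by (rule emeasure_subadditive) auto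
  also have "emeasure (count_space UNIV) (\<Union>k. A k) <= (\<Sum>k. emeasure (count_space UNIV) (A k))" by (rule emeasure_subadditive_countably) auto
  also have "... <= (\<Sum>k. indicator (closed_segment (ctr h k (cv 0)) (ctr h (Suc k) (cv 0))) x)" by (intro suminf_le A) auto
  finally show ?thesis using B by (simp add: add_right_mono)
qed

end



subsection \<open>The cost of irrigating from finitely many centres\<close>

text \<open>The number q is the ratio of the cost bounds of consecutive generations: the count of
  edges contributes 2^(d(1-al)) and their length 1/2. The factor d/2 is \<open>dur h\<close> divided
  by \<open>h\<close>, and q/(1-q) sums the series from its first generation.\<close>

definition irr_const :: "real => 'n::finite itself => real" where
  "irr_const al _ = (let q = 2 powr (real CARD('n) * (1 - al) - 1) in real CARD('n) / 2 * (q / (1 - q)))"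

definition edge :: "real => nat => real^'n => (real^'n) \<times> (real^'n)" where
  "edge h k y = (ctr h k y, ctr h (Suc k) y)"

lemma ctr_Suc_eq:
  assumes "0 < h"
  shows "ctr h (Suc k) y = ctr h k y + (h / 2 ^ (k + 2)) *\<^sub>R (\<chi> i. if ctr h (Suc k) y $ i > ctr h k y $ i then 1 else - 1)"
proof -
  have "ctr h (Suc k) y $ i = ctr h k y $ i + h / 2 ^ (k + 2) * (if ctr h (Suc k) y $ i > ctr h k y $ i then 1 else - 1)" for i
    using abs_ctr_diff[OF assms, of k y i] by (auto simp: abs_if split: if_splits simp del: power_Suc)
  then show ?thesis by (simp add: vec_eq_iff)
qed

text \<open>An edge is determined by its initial centre and the set of coordinates that increase
  along it, which gives at most 2^d edges from every centre.\<close>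

lemma card_edge_image:
  fixes W :: "(real^'n) set"
  assumes h: "0 < h" and W: "finite (ctr h 0 ` W)"
  shows "finite (edge h k ` W) \<and> card (edge h k ` W) <= card (ctr h 0 ` W) * (2 ^ CARD('n)) ^ Suc k"
proof -
  define g where "g k = (\<lambda>(c :: real^'n, I :: 'n set). (c, c + (h / 2 ^ (k + 2)) *\<^sub>R (\<chi> i. if i \<in> I then 1 else - 1)))" for k :: nat
  have cardU: "card (UNIV :: 'n set set) = 2 ^ CARD('n)" using card_Pow[of "UNIV :: 'n set"] by simp
  have sub: "edge h k ` W \<subseteq> g k ` (ctr h k ` W \<times> UNIV)" for k
  proof
    fix e assume "e \<in> edge h k ` W"
    then obtain y where y: "y \<in> W" "e = edge h k y" by auto
    have "e = g k (ctr h k y, {i. ctr h (Suc k) y $ i > ctr h k y $ i})" unfolding y(2) edge_def g_def using ctr_Suc_eq[OF h, of k y] by simp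
    then show "e \<in> g k ` (ctr h k ` W \<times> UNIV)" using y by blast
  qed
  have step: "finite (edge h k ` W) \<and> card (edge h k ` W) <= card (ctr h k ` W) * 2 ^ CARD('n)"
    if fin: "finite (ctr h k ` W)" for k
  proof
    have fin': "finite (ctr h k ` W \<times> (UNIV :: 'n set set))" using fin by simp
    then show "finite (edge h k ` W)" using finite_subset[OF sub] by blast
    have "card (edge h k ` W) <= card (g k ` (ctr h k ` W \<times> UNIV))" using fin' sub by (intro card_mono) auto
    also have "... <= card (ctr h k ` W \<times> (UNIV :: 'n set set))" using fin' by (rule card_image_le)
    finally show "card (edge h k ` W) <= card (ctr h k ` W) * 2 ^ CARD('n)" by (simp add: card_cartesian_product cardU)
  qed
  have ctr_edge: "ctr h (Suc k) ` W = snd ` edge h k ` W" for k by (simp add: image_comp o_def edge_def)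
  have "finite (ctr h k ` W) \<and> card (ctr h k ` W) <= card (ctr h 0 ` W) * (2 ^ CARD('n)) ^ k" for k
  proof (induction k)
    case (Suc k)
    have "card (ctr h (Suc k) ` W) <= card (edge h k ` W)" unfolding ctr_edge using step[of k] Suc by (intro card_image_le) blast
    also have "... <= card (ctr h k ` W) * 2 ^ CARD('n)" using step[of k] Suc by blast
    also have "... <= card (ctr h 0 ` W) * (2 ^ CARD('n)) ^ k * 2 ^ CARD('n)" using Suc by simp
    finally have "card (ctr h (Suc k) ` W) <= card (ctr h 0 ` W) * (2 ^ CARD('n)) ^ Suc k" by (simp add: ac_simps)
    moreover have "finite (ctr h (Suc k) ` W)" unfolding ctr_edge using step[of k] Suc by blast
    ultimately show ?case by blast
  qed (use W in simp)
  note IH = this[of k]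
  have "card (edge h k ` W) <= card (ctr h k ` W) * 2 ^ CARD('n)" using step[of k] IH by blast
  also have "... <= card (ctr h 0 ` W) * (2 ^ CARD('n)) ^ k * 2 ^ CARD('n)" using IH by simp
  finally have "card (edge h k ` W) <= card (ctr h 0 ` W) * (2 ^ CARD('n)) ^ Suc k" by (simp add: ac_simps)
  then show ?thesis using step[of k] IH by blast
qed

lemma hausdorff1_outer_segment_le:
  fixes a b :: "'a::euclidean_space"
  shows "H1 (closed_segment a b) <= ennreal (dist a b)"
proof -
  have "(dist a b)-lipschitz_on {0..1} (\<lambda>u. a + u *\<^sub>R (b - a))" unfolding lipschitz_on_def
    by (auto simp: dist_norm norm_minus_commute mult.commute simp flip: scaleR_diff_left)
  moreover have "closed_segment a b = (\<lambda>u. a + u *\<^sub>R (b - a)) ` {0..1}" by (auto simp: closed_segment_def image_def algebra_simps)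
  ultimately show ?thesis using hausdorff1_outer_lipschitz_interval[of "dist a b" 0 1 "\<lambda>u. a + u *\<^sub>R (b - a)"] by simp
qed

lemma countable_segments_lip_family:
  fixes E :: "('a::euclidean_space \<times> 'a) set"
  assumes "countable E"
  obtains phi where "lip_family phi" "(\<Union>(a, b)\<in>E. closed_segment a b) \<subseteq> lip_trace phi"
proof (cases "E = {}")
  case True
  have "lip_family (\<lambda>i t. 0 :: 'a)" by (auto simp: lip_family_def lipschitz_on_def intro: exI[of _ 0])
  then show ?thesis using that True by blast
next
  case False
  define phi where "phi i t = (case from_nat_into E i of (a, b) => a + min t 1 *\<^sub>R (b - a))" for i and t :: real
  have "lip_family phi" unfolding lip_family_def
  proof
    fix i
    obtain a b where ab: "from_nat_into E i = (a, b)" by (cases "from_nat_into E i")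
    have "(dist a b)-lipschitz_on {0..} (phi i)" unfolding lipschitz_on_def
    proof (intro conjI ballI)
      fix s t :: real
      have "phi i s - phi i t = (min s 1 - min t 1) *\<^sub>R (b - a)" by (simp add: phi_def ab algebra_simps)
      then have "dist (phi i s) (phi i t) = \<bar>min s 1 - min t 1\<bar> * norm (b - a)" by (simp add: dist_norm)
      also have "... <= \<bar>s - t\<bar> * norm (b - a)" by (intro mult_right_mono) (auto simp: min_def)
      finally show "dist (phi i s) (phi i t) <= dist a b * dist s t" by (simp add: dist_norm norm_minus_commute mult.commute)
    qed simp
    then show "\<exists>L. L-lipschitz_on {0..} (phi i)" ..
  qed
  moreover have "(\<Union>(a, b)\<in>E. closed_segment a b) \<subseteq> lip_trace phi"
  proof
    fix x assume "x \<in> (\<Union>(a, b)\<in>E. closed_segment a b)"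
    then obtain a b u where ab: "(a, b) \<in> E" "0 <= u" "u <= 1" "x = (1 - u) *\<^sub>R a + u *\<^sub>R b" by (auto simp: closed_segment_def)
    obtain i where "from_nat_into E i = (a, b)" using from_nat_into_surj[OF assms ab(1)] by blast
    then have "x = phi i u" using ab by (simp add: phi_def algebra_simps min_def)
    then show "x \<in> lip_trace phi" using ab unfolding lip_trace_def by blast
  qed
  ultimately show ?thesis using that by blast
qed

text \<open>A geometric series: generation k has at most \<open>K\<close> times 2^(d(k+1)) edges, of
  length at most T/2^(k+1). The hypothesis on \<open>al\<close> says precisely that the ratio
  \<open>q\<close> is below 1.\<close>

lemma sums_tree_cost:
  fixes K T :: real
  assumes "0 <= K" "0 <= T" and s: "real d * (1 - al) < 1" and "al < 1"
  defines "q \<equiv> 2 powr (real d * (1 - al) - 1)"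
  shows "(\<lambda>k. (K * (2 ^ d) ^ Suc k) powr (1 - al) * (T / 2 ^ Suc k)) sums (K powr (1 - al) * T * (q / (1 - q)))"
proof -
  have q: "0 <= q" "q < 1" using s powr_less_mono[of "real d * (1 - al) - 1" 0 2] by (auto simp: q_def)
  have "(K * (2 ^ d) ^ Suc k) powr (1 - al) * (T / 2 ^ Suc k) = K powr (1 - al) * T * q * q ^ k" for k
  proof -
    have "((2::real) ^ d) ^ Suc k = 2 ^ (d * Suc k)" by (rule power_mult[symmetric])
    also have "... = 2 powr real (d * Suc k)" by (rule powr_realpow[symmetric]) simp
    finally have "((2::real) ^ d) ^ Suc k = 2 powr (real d * real (Suc k))" by (simp only: of_nat_mult)
    then have "(K * (2 ^ d) ^ Suc k) powr (1 - al) = K powr (1 - al) * 2 powr (real d * (1 - al) * real (Suc k))"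
      using assms(1) by (simp add: powr_mult powr_powr mult.commute mult.left_commute del: of_nat_Suc power_Suc)
    moreover have "T / 2 ^ Suc k = T * 2 powr (- real (Suc k))" by (simp add: powr_minus powr_realpow divide_inverse del: of_nat_Suc power_Suc)
    moreover have "2 powr (real d * (1 - al) * real (Suc k)) * 2 powr (- real (Suc k)) = q ^ Suc k"
    proof -
      have "2 powr (real d * (1 - al) * real (Suc k)) * 2 powr (- real (Suc k)) = 2 powr ((real d * (1 - al) - 1) * real (Suc k))"
        by (simp add: powr_add[symmetric] algebra_simps)
      also have "... = q powr real (Suc k)" by (simp only: q_def powr_powr)
      also have "... = q ^ Suc k" by (rule powr_realpow) (simp add: q_def)
      finally show ?thesis .
    qed
    ultimately show ?thesis by (simp add: mult_ac)
  qed
  moreover have "(\<lambda>k. K powr (1 - al) * T * q * q ^ k) sums (K powr (1 - al) * T * q * (1 / (1 - q)))" using q by (intro sums_mult geometric_sums) simp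
  ultimately show ?thesis by simp
qed

text \<open>Curves starting in \<open>W\<close> are prefixed with a branch, so the centres of the at
  most \<open>K\<close> cells meeting \<open>W\<close> replace the possibly infinitely many sources
  in \<open>W\<close>. The branches cost at most the tree series for the mass that starts in
  \<open>W\<close>.\<close>

lemma quant_error_graft_le:
  fixes P :: "(real => real^'n) measure"
  assumes P: "traffic_plan P" and h: "0 < h" and W[measurable]: "W \<in> sets borel"
    and K: "finite (ctr h 0 ` W)" "card (ctr h 0 ` W) <= K"
    and F: "finite F" "AE cv in P. cv 0 \<in> W \<or> cv 0 \<in> F"
    and al: "0 < al" "al < 1" "real CARD('n) * (1 - al) < 1"
  shows "quant_error al (distr P borel curve_end) (card F + K) \<le>
    alpha_mass al P + ennreal (irr_const al TYPE('n) * h * real K powr (1 - al)) * ennpow (emeasure P {cv \<in> space P. cv 0 \<in> W}) al"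
proof (cases "rectifiable_plan P")
  case False
  then show ?thesis by (simp add: alpha_mass_def)
next
  case True
  then obtain phi where phi: "lip_family phi" "AE cv in P. covered phi cv" by (rule rectifiable_planE)
  note T = traffic_planD[OF P]
  interpret finite_measure P by (rule T)
  have cs: "measurable P M = measurable curve_borel M" for M :: "'k measure" by (rule measurable_cong_sets[OF T(2) refl])
  let ?T = "dur h TYPE('n)"
  define E where "E k = edge h k ` W" for k
  have finE: "finite (E k)" and cardE: "card (E k) <= K * (2 ^ CARD('n)) ^ Suc k" for k
    using card_edge_image[OF h K(1), of k] K(2) order.trans mult_le_mono1 unfolding E_def by blast+
  define seg where "seg e = closed_segment (fst e) (snd e)" for e :: "(real^'n) \<times> (real^'n)"
  have seg_borel[measurable]: "seg e \<in> sets borel" for e unfolding seg_def by simp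
  have W0[measurable]: "Measurable.pred curve_borel (\<lambda>cv. cv 0 \<in> W)" by measurable
  define G where "G cv = (if cv 0 \<in> W then graft h cv else cv)" for cv :: "real => real^'n"
  have Gm: "G \<in> measurable curve_borel curve_borel" unfolding G_def using measurable_graft[OF h] W0[unfolded pred_def] by (intro measurable_If) auto
  define P' where "P' = distr P curve_borel G"
  have tp: "traffic_plan P'" unfolding P'_def using graft_end(2)[OF h] by (intro traffic_plan_distr P Gm) (auto simp: G_def)
  have AEs: "AE cv in P. cv \<in> curves \<and> stops cv" using T(3,4) AE_space[of P] by auto
  have "distr P' borel curve_end = distr P borel (curve_end \<circ> G)" unfolding P'_def by (rule distr_distr) (use Gm in \<open>simp_all add: cs\<close>)
  also have "... = distr P borel curve_end" using AEs Gm by (intro distr_cong_AE refl) (auto simp: cs graft_end(1)[OF h] G_def[abs_def] intro!: measurable_comp)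
  finally have tgt: "distr P' borel curve_end = distr P borel curve_end" .
  have st: "AE cv in P'. cv 0 \<in> ctr h 0 ` W \<union> F" unfolding P'_def
  proof (subst AE_distr_iff)
    show "AE cv in P. G cv 0 \<in> ctr h 0 ` W \<union> F" using F(2) by eventually_elim (auto simp: G_def graft_0[OF h])
    have "(\<lambda>cv. cv 0) -` (ctr h 0 ` W \<union> F) \<inter> space curve_borel \<in> sets (curve_borel :: (real => real^'n) measure)"
      using F(1) K(1) by (intro measurable_sets[OF measurable_curve_eval]) (auto simp: finite_imp_closed borel_closed)
    also have "(\<lambda>cv. cv 0) -` (ctr h 0 ` W \<union> F) \<inter> space curve_borel = {cv \<in> space curve_borel. cv 0 \<in> ctr h 0 ` W \<union> F}" by auto
    finally show "{cv \<in> space curve_borel. cv 0 \<in> ctr h 0 ` W \<union> F} \<in> sets curve_borel" .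
  qed (use Gm in \<open>simp add: cs\<close>)
  have "quant_error al (distr P borel curve_end) (card F + K) <= alpha_mass al P'"
    using K F(1) card_Un_le[of "ctr h 0 ` W" F] by (intro quant_error_le[OF tp tgt _ _ st]) auto
  also have "... <= alpha_mass al P + ennreal (irr_const al TYPE('n) * h * real K powr (1 - al)) * ennpow (emeasure P {cv \<in> space P. cv 0 \<in> W}) al"
  proof -
    \<comment> \<open>Rectifiability survives the grafting: all branches together run along
      countably many segments, and the rest of each new curve lies on the old one.\<close>
    have "countable (\<Union>k. E k)" using finE by (auto intro: countable_finite)
    then obtain psi where psi: "lip_family psi" "(\<Union>(a, b)\<in>(\<Union>k. E k). closed_segment a b) \<subseteq> lip_trace psi" by (rule countable_segments_lip_family)
    have j: "lip_family (lip_join phi psi)" by (rule lip_family_join[OF phi(1) psi(1)])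
    have "covered (lip_join phi psi) (G cv)" if "covered phi cv" for cv
    proof (rule covered_mono[OF that])
      show "G cv ` {0..} \<subseteq> cv ` {0..} \<union> lip_trace (lip_join phi psi)"
      proof (cases "cv 0 \<in> W")
        case True
        have "closed_segment (ctr h k (cv 0)) (ctr h (Suc k) (cv 0)) \<subseteq> lip_trace psi" for k
        proof -
          have "(ctr h k (cv 0), ctr h (Suc k) (cv 0)) \<in> (\<Union>k. E k)" using True by (auto simp: E_def edge_def)
          then show ?thesis using psi(2) by blast
        qed
        then have "(\<Union>k. closed_segment (ctr h k (cv 0)) (ctr h (Suc k) (cv 0))) \<subseteq> lip_trace psi" by (rule UN_least)
        moreover have "G cv = graft h cv" using True by (simp add: G_def)
        ultimately show ?thesis using graft_image[OF h, of cv] unfolding trace_join by (simp only:) blast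
      qed (auto simp: G_def)
    qed (simp add: trace_join)
    then have "AE cv in P'. covered (lip_join phi psi) cv" unfolding P'_def by (intro AE_covered_distr[OF P Gm phi(2) j])
    then have r': "rectifiable_plan P'" using j unfolding rectifiable_plan_iff by blast
    define B where "B k e = {cv \<in> space P. cv 0 \<in> W \<and> edge h k (cv 0) = e}" for k e
    have Bm[measurable]: "B k e \<in> sets P" for k e
    proof -
      have "{cv \<in> space (curve_borel :: (real => real^'n) measure). cv 0 \<in> W \<and> (ctr h k (cv 0) = fst e \<and> ctr h (Suc k) (cv 0) = snd e)} \<in> sets curve_borel" by measurable
      also have "{cv \<in> space (curve_borel :: (real => real^'n) measure). cv 0 \<in> W \<and> (ctr h k (cv 0) = fst e \<and> ctr h (Suc k) (cv 0) = snd e)} = B k e"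
        by (auto simp: B_def T(3) edge_def)
      finally show ?thesis using T(2) by simp
    qed
    define m where "m k e = emeasure P (B k e)" for k e
    define mW where "mW = emeasure P {cv \<in> space P. cv 0 \<in> W}"
    have pointwise: "visits (G cv) x <= (\<Sum>k. \<Sum>e\<in>E k. indicator (B k e) cv * indicator (seg e) x) + visits cv x"
      if cv: "cv \<in> space P" for cv x
    proof (cases "cv 0 \<in> W")
      case True
      have "indicator (closed_segment (ctr h k (cv 0)) (ctr h (Suc k) (cv 0))) x
         <= (\<Sum>e\<in>E k. indicator (B k e) cv * indicator (seg e) x :: ennreal)" for k
      proof -
        have "edge h k (cv 0) \<in> E k" using True by (simp add: E_def)
        then have "indicator (B k (edge h k (cv 0))) cv * indicator (seg (edge h k (cv 0))) x
           <= (\<Sum>e\<in>E k. indicator (B k e) cv * indicator (seg e) x :: ennreal)" using finE by (intro member_le_sum) auto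
        moreover have "cv \<in> B k (edge h k (cv 0))" using cv True by (simp add: B_def)
        ultimately show ?thesis by (simp add: seg_def edge_def)
      qed
      then have "(\<Sum>k. indicator (closed_segment (ctr h k (cv 0)) (ctr h (Suc k) (cv 0))) x)
         <= (\<Sum>k. \<Sum>e\<in>E k. indicator (B k e) cv * indicator (seg e) x :: ennreal)" by (intro suminf_le) auto
      then show ?thesis using visits_graft_le[OF h, of cv x] True by (simp add: G_def) (meson add_right_mono order.trans)
    qed (simp add: G_def)
    have mult: "multiplicity P' x <= (\<Sum>k. \<Sum>e\<in>E k. m k e * indicator (seg e) x) + multiplicity P x" for x
    proof -
      have "multiplicity P' x <= (\<integral>\<^sup>+cv. (\<Sum>k. \<Sum>e\<in>E k. indicator (B k e) cv * indicator (seg e) x) + visits cv x \<partial>P)"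
        unfolding P'_def multiplicity_distr[OF P Gm] by (intro nn_integral_mono pointwise)
      also have "... = (\<integral>\<^sup>+cv. (\<Sum>k. \<Sum>e\<in>E k. indicator (B k e) cv * indicator (seg e) x) \<partial>P) + multiplicity P x"
        unfolding multiplicity_eq by (rule nn_integral_add) (measurable, simp add: cs)
      also have "(\<integral>\<^sup>+cv. (\<Sum>k. \<Sum>e\<in>E k. indicator (B k e) cv * indicator (seg e) x) \<partial>P) =
         (\<Sum>k. \<Sum>e\<in>E k. m k e * indicator (seg e) x)" by (simp add: nn_integral_suminf nn_integral_sum nn_integral_multc m_def)
      finally show ?thesis .
    qed
    have ind: "ennpow (c * indicator S x) al = ennpow c al * indicator S x" for c :: ennreal and S and x :: "real^'n" by (auto simp: indicator_def)
    have [measurable]: "multiplicity P \<in> borel_measurable hausdorff1" using measurable_multiplicity[OF P] by (simp cong: measurable_cong_sets)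
    have segH: "emeasure hausdorff1 (seg e) <= ennreal (?T / 2 ^ Suc k)" if e: "e \<in> E k" for e k
    proof -
      obtain y where y: "e = edge h k y" using e by (auto simp: E_def)
      have "emeasure hausdorff1 (seg e) <= ennreal (dist (fst e) (snd e))" by (simp add: emeasure_hausdorff1 seg_def hausdorff1_outer_segment_le)
      also have "... <= ennreal (?T / 2 ^ Suc k)" using norm_ctr_diff[OF h, of k y] by (intro ennreal_leI) (simp add: y edge_def dist_norm norm_minus_commute)
      finally show ?thesis .
    qed
    \<comment> \<open>A curve starting in \<open>W\<close> uses exactly one edge of each generation,
      so the flows through the edges of one generation cannot exceed the mass starting in
      \<open>W\<close>.\<close>
    have massE: "(\<Sum>e\<in>E k. m k e) <= mW" for k
    proof -
      have "(\<Sum>e\<in>E k. m k e) = emeasure P (\<Union>e\<in>E k. B k e)" unfolding m_def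
      proof (rule sum_emeasure)
        show "B k ` E k \<subseteq> sets P" using Bm by blast
      qed (use finE in \<open>auto simp: disjoint_family_on_def B_def\<close>)
      also have "... <= mW" unfolding mW_def
      proof (rule emeasure_mono)
        show "{cv \<in> space P. cv 0 \<in> W} \<in> sets P" using W0 T(2,3) by (simp add: pred_def)
      qed (auto simp: B_def)
      finally show ?thesis .
    qed
    \<comment> \<open>Jensen over the edges of generation k: the worst case distributes the mass
      evenly among all of them.\<close>
    have level: "(\<Sum>e\<in>E k. ennpow (m k e) al * emeasure hausdorff1 (seg e))
        <= ennreal ((real K * (2 ^ CARD('n)) ^ Suc k) powr (1 - al) * (?T / 2 ^ Suc k)) * ennpow mW al" for k
    proof -
      have "(\<Sum>e\<in>E k. ennpow (m k e) al * emeasure hausdorff1 (seg e)) <= (\<Sum>e\<in>E k. ennpow (m k e) al * ennreal (?T / 2 ^ Suc k))"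
        by (intro sum_mono mult_left_mono segH) auto
      also have "... = (\<Sum>e\<in>E k. ennpow (m k e) al) * ennreal (?T / 2 ^ Suc k)" by (simp add: sum_distrib_right)
      also have "(\<Sum>e\<in>E k. ennpow (m k e) al) <= ennreal (real (card (E k)) powr (1 - al)) * ennpow (\<Sum>e\<in>E k. m k e) al" using al finE by (intro sum_ennpow_le) auto
      also have "... <= ennreal ((real K * (2 ^ CARD('n)) ^ Suc k) powr (1 - al)) * ennpow mW al"
      proof (intro mult_mono ennreal_leI powr_mono2 ennpow_mono massE)
        show "real (card (E k)) <= real K * (2 ^ CARD('n)) ^ Suc k" using of_nat_mono[OF cardE[of k], where 'a=real] by simp
      qed (use al in auto)
      finally have "(\<Sum>e\<in>E k. ennpow (m k e) al * emeasure hausdorff1 (seg e))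
         <= ennreal ((real K * (2 ^ CARD('n)) ^ Suc k) powr (1 - al)) * ennpow mW al * ennreal (?T / 2 ^ Suc k)" by (simp add: mult_right_mono)
      also have "... = ennreal ((real K * (2 ^ CARD('n)) ^ Suc k) powr (1 - al) * (?T / 2 ^ Suc k)) * ennpow mW al"
      proof -
        have "ennreal X * c * ennreal Y = ennreal (X * Y) * c" if "0 <= X" "0 <= Y" for X Y c using that by (simp add: ennreal_mult mult_ac)
        then show ?thesis using dur_pos[OF h, where 'n='n] by (simp del: power_Suc)
      qed
      finally show ?thesis .
    qed
    have "alpha_mass al P' <= (\<integral>\<^sup>+x. (\<Sum>k. \<Sum>e\<in>E k. ennpow (m k e) al * indicator (seg e) x) + ennpow (multiplicity P x) al \<partial>hausdorff1)" unfolding alpha_mass_eq[OF r']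
    proof (rule nn_integral_mono)
      fix x :: "real^'n"
      have "ennpow (multiplicity P' x) al <= ennpow ((\<Sum>k. \<Sum>e\<in>E k. m k e * indicator (seg e) x) + multiplicity P x) al" using al by (intro ennpow_mono mult) auto
      also have "... <= ennpow (\<Sum>k. \<Sum>e\<in>E k. m k e * indicator (seg e) x) al + ennpow (multiplicity P x) al" using al by (intro ennpow_add_le) auto
      also have "ennpow (\<Sum>k. \<Sum>e\<in>E k. m k e * indicator (seg e) x) al <= (\<Sum>k. ennpow (\<Sum>e\<in>E k. m k e * indicator (seg e) x) al)" using al by (intro ennpow_suminf_le) auto
      also have "... <= (\<Sum>k. \<Sum>e\<in>E k. ennpow (m k e) al * indicator (seg e) x)" unfolding ind[symmetric] using al by (intro suminf_le ennpow_sum_le) auto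
      finally show "ennpow (multiplicity P' x) al <= (\<Sum>k. \<Sum>e\<in>E k. ennpow (m k e) al * indicator (seg e) x) + ennpow (multiplicity P x) al" by (simp add: add_right_mono)
    qed
    also have "... = (\<integral>\<^sup>+x. (\<Sum>k. \<Sum>e\<in>E k. ennpow (m k e) al * indicator (seg e) x) \<partial>hausdorff1) + alpha_mass al P"
      unfolding alpha_mass_eq[OF True] by (rule nn_integral_add) measurable
    also have "(\<integral>\<^sup>+x. (\<Sum>k. \<Sum>e\<in>E k. ennpow (m k e) al * indicator (seg e) x) \<partial>hausdorff1)
       = (\<Sum>k. \<Sum>e\<in>E k. ennpow (m k e) al * emeasure hausdorff1 (seg e))" by (simp add: nn_integral_suminf nn_integral_sum nn_integral_cmult)
    also have "... <= (\<Sum>k. ennreal ((real K * (2 ^ CARD('n)) ^ Suc k) powr (1 - al) * (?T / 2 ^ Suc k)) * ennpow mW al)" by (intro suminf_le level) auto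
    also have "... = (\<Sum>k. ennreal ((real K * (2 ^ CARD('n)) ^ Suc k) powr (1 - al) * (?T / 2 ^ Suc k))) * ennpow mW al" by simp
    also have "(\<Sum>k. ennreal ((real K * (2 ^ CARD('n)) ^ Suc k) powr (1 - al) * (?T / 2 ^ Suc k)))
        = ennreal (irr_const al TYPE('n) * h * real K powr (1 - al))"
    proof (rule suminf_ennreal_eq)
      have "(\<lambda>k. (real K * (2 ^ CARD('n)) ^ Suc k) powr (1 - al) * (?T / 2 ^ Suc k)) sums
        (real K powr (1 - al) * ?T * (2 powr (real CARD('n) * (1 - al) - 1) / (1 - 2 powr (real CARD('n) * (1 - al) - 1))))"
        using al dur_pos[OF h, where 'n='n] by (intro sums_tree_cost) auto
      also have "real K powr (1 - al) * ?T * (2 powr (real CARD('n) * (1 - al) - 1) / (1 - 2 powr (real CARD('n) * (1 - al) - 1)))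
         = irr_const al TYPE('n) * h * real K powr (1 - al)" by (simp add: irr_const_def dur_def Let_def mult_ac)
      finally show "(\<lambda>k. (real K * (2 ^ CARD('n)) ^ Suc k) powr (1 - al) * (?T / 2 ^ Suc k)) sums
         (irr_const al TYPE('n) * h * real K powr (1 - al))" .
    qed (use dur_pos[OF h, where 'n='n] in \<open>simp add: less_imp_le\<close>)
    finally show ?thesis by (simp add: mW_def add.commute add_right_mono)
  qed
  finally show ?thesis .
qed

lemma irr_const_nonneg:
  assumes "real CARD('n::finite) * (1 - al) < 1" shows "0 <= irr_const al TYPE('n)"
proof -
  have "2 powr (real CARD('n) * (1 - al) - 1) < 1" using assms powr_less_mono[of "real CARD('n) * (1 - al) - 1" 0 2] by simp
  then show ?thesis by (simp add: irr_const_def Let_def)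
qed

text \<open>Constant curves form a plan from \<nu> to itself. Without atoms its multiplicity
  vanishes everywhere, so it costs nothing; grafting branches onto it leaves only the cost of the
  trees.\<close>

lemma quant_error_atomless_le:
  fixes \<nu> :: "(real^'n) measure"
  assumes \<nu>: "sets \<nu> = sets borel" "finite_measure \<nu>" "\<And>x. emeasure \<nu> {x} = 0"
    and h: "0 < h" and W: "W \<in> sets borel" "AE y in \<nu>. y \<in> W"
    and K: "finite (ctr h 0 ` W)" "card (ctr h 0 ` W) <= K"
    and al: "0 < al" "al < 1" "real CARD('n) * (1 - al) < 1"
  shows "quant_error al \<nu> K <= ennreal (irr_const al TYPE('n) * h * real K powr (1 - al)) * ennpow (emeasure \<nu> UNIV) al"
proof -
  define c where "c y t = (if t < 0 then undefined else y)" for y :: "real^'n" and t :: real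
  have cc: "c y \<in> curves" for y by (rule curvesI) (auto simp: c_def)
  have cn: "const_from 0 (c y)" for y unfolding const_from_def by (auto simp: c_def)
  then have cst: "stops (c y)" for y unfolding stops_def by blast
  have cend: "curve_end (c y) = y" for y using curve_end_eq_nat[OF cc cn] by (simp add: c_def)
  have cs\<nu>: "measurable \<nu> M = measurable borel M" for M :: "'k measure" by (rule measurable_cong_sets[OF \<nu>(1) refl])
  have cm: "c \<in> measurable \<nu> curve_borel" using cc by (intro measurable_curve_borelI) (auto simp: c_def cs\<nu>)
  define P where "P = distr \<nu> curve_borel c"
  have tp: "traffic_plan P" unfolding traffic_plan_iff P_def
  proof (intro conjI)
    show "AE cv in distr \<nu> curve_borel c. stops cv" using cst pred_stops[unfolded pred_def] by (subst AE_distr_iff[OF cm]) auto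
  qed (use finite_measure.finite_measure_distr[OF \<nu>(2) cm] in auto)
  have spP: "space P = curves" by (simp add: P_def)
  have "distr P borel curve_end = distr \<nu> borel (curve_end \<circ> c)" unfolding P_def by (rule distr_distr[OF _ cm]) simp
  also have "... = distr \<nu> \<nu> (\<lambda>x. x)" using \<nu>(1) cend by (intro distr_cong) auto
  finally have tgt: "distr P borel curve_end = \<nu>" by (simp add: distr_id2)
  have r: "rectifiable_plan P" unfolding rectifiable_plan_iff
  proof (intro exI conjI)
    show l: "lip_family (\<lambda>i t. 0 :: real^'n)" by (auto simp: lip_family_def lipschitz_on_def intro: exI[of _ 0])
    have "covered (\<lambda>i t. 0) (c y)" for y
    proof -
      have "c y ` {0..} - lip_trace (\<lambda>i t. 0) \<subseteq> {y}" by (auto simp: c_def)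
      from hausdorff1_outer_mono[OF this] show ?thesis by (simp add: covered_def)
    qed
    then show "AE cv in P. covered (\<lambda>i t. 0) cv" unfolding P_def using cm pred_covered[OF l, unfolded pred_def] by (auto simp: AE_distr_iff)
  qed
  have mult: "multiplicity P x = 0" for x
  proof -
    have "multiplicity P x = (\<integral>\<^sup>+y. visits (c y) x \<partial>\<nu>)" unfolding multiplicity_eq P_def by (rule nn_integral_distr[OF cm]) simp
    also have "... = (\<integral>\<^sup>+y. 0 \<partial>\<nu>)"
    proof (rule nn_integral_cong_AE)
      have "{x} \<in> null_sets \<nu>" using \<nu> by (simp add: null_sets_def)
      then have "AE y in \<nu>. y \<noteq> x" using AE_not_in by fastforce
      then show "AE y in \<nu>. visits (c y) x = 0"
      proof eventually_elim
        case (elim y)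
        then have "{t \<in> {0..}. c y t = x} = {}" by (auto simp: c_def)
        then show ?case by (simp only: visits_def emeasure_empty)
      qed
    qed
    finally show ?thesis by simp
  qed
  then have am: "alpha_mass al P = 0" unfolding alpha_mass_eq[OF r] by simp
  have "AE cv in P. cv 0 \<in> W \<or> cv 0 \<in> {}"
  proof -
    have [measurable]: "W \<in> sets borel" by (rule W)
    have "{cv \<in> space curve_borel. cv 0 \<in> W} \<in> sets (curve_borel :: (real => real^'n) measure)" by measurable
    then show ?thesis unfolding P_def using cm W(2) by (simp add: AE_distr_iff) (simp add: c_def)
  qed
  from quant_error_graft_le[OF tp h W(1) K _ this al]
  have "quant_error al \<nu> K <= ennreal (irr_const al TYPE('n) * h * real K powr (1 - al)) * ennpow (emeasure P {cv \<in> space P. cv 0 \<in> W}) al" by (simp add: tgt am)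
  also have "... <= ennreal (irr_const al TYPE('n) * h * real K powr (1 - al)) * ennpow (emeasure \<nu> UNIV) al"
  proof (intro mult_left_mono ennpow_mono)
    have "emeasure P {cv \<in> space P. cv 0 \<in> W} <= emeasure P (space P)" by (rule emeasure_space)
    also have "... = emeasure \<nu> (c -` space curve_borel \<inter> space \<nu>)" unfolding P_def using cm by (simp only: space_distr emeasure_distr sets.top)
    also have "... <= emeasure \<nu> UNIV" using \<nu>(1) by (intro emeasure_mono) auto
    finally show "emeasure P {cv \<in> space P. cv 0 \<in> W} <= emeasure \<nu> UNIV" .
  qed (use al in auto)
  finally show ?thesis .
qed



section \<open>Localization of plans to closed sets\<close>

text \<open>The last time spent outside \<open>A\<close>, and 0 if there is none. For closed
  \<open>A\<close> the times outside are relatively open, so rational times suffice, and a countable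
  supremum is measurable.\<close>

definition exit_time :: "'a set => (real => 'a) => ennreal" where
  "exit_time A cv = (SUP q\<in>{q\<in>\<rat>. 0 <= q}. ennreal q * indicator (- A) (cv q))"

definition tail :: "'a set => (real => 'a) => real => 'a" where
  "tail A cv t = (if t < 0 then undefined else cv (enn2real (exit_time A cv) + t))"

lemma measurable_exit_time [measurable]:
  fixes A :: "'a::euclidean_space set"
  assumes [measurable]: "A \<in> sets borel"
  shows "exit_time A \<in> borel_measurable curve_borel"
proof -
  have c: "countable {q\<in>\<rat>. 0 <= (q::real)}" by (rule countable_subset[OF _ countable_rat]) auto
  have "(\<lambda>cv. SUP q\<in>{q\<in>\<rat>. 0 <= q}. ennreal q * indicator (- A) (cv q)) \<in> borel_measurable curve_borel"
  proof (rule borel_measurable_SUP[OF c])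
    fix q :: real assume "q \<in> {q\<in>\<rat>. 0 <= q}"
    then have [measurable]: "(\<lambda>cv. cv q) \<in> borel_measurable (curve_borel :: (real => 'a) measure)" by (intro measurable_curve_eval) simp
    show "(\<lambda>cv :: real => 'a. ennreal q * indicator (- A) (cv q)) \<in> borel_measurable curve_borel" by measurable
  qed
  then show ?thesis by (simp add: exit_time_def[abs_def])
qed

lemma tail_in_curves: "cv \<in> curves ==> tail A cv \<in> curves"
proof (rule curvesI)
  fix s t :: real assume "cv \<in> curves" "0 <= s" "s <= t"
  then show "dist (tail A cv s) (tail A cv t) <= t - s" using curve_dist_le[of cv "enn2real (exit_time A cv) + s" "enn2real (exit_time A cv) + t"] by (simp add: tail_def)
qed (simp add: tail_def)

text \<open>The starting time of the tail depends on the curve. It is approximated from above by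
  dyadic times, which take countably many values and so reduce the claim to evaluations at fixed
  times; the Lipschitz bound gives convergence.\<close>

lemma measurable_tail:
  fixes A :: "'a::euclidean_space set"
  assumes [measurable]: "A \<in> sets borel"
  shows "tail A \<in> measurable curve_borel curve_borel"
proof (rule measurable_curve_borelI)
  fix t :: real assume t: "0 <= t"
  define j where "j n cv = nat \<lfloor>enn2real (exit_time A cv) * 2 ^ n\<rfloor>" for n and cv :: "real => 'a"
  define f where "f n cv = cv (real (Suc (j n cv)) / 2 ^ n + t)" for n and cv :: "real => 'a"
  have [measurable]: "j n \<in> measurable curve_borel (count_space UNIV)" for n unfolding j_def by measurable
  have fm: "f n \<in> borel_measurable curve_borel" for n unfolding f_def
  proof (rule measurable_compose_countable[where g="j n" and f="\<lambda>i cv. cv (real (Suc i) / 2 ^ n + t)"])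
    show "(\<lambda>cv. cv (real (Suc i) / 2 ^ n + t)) \<in> borel_measurable curve_borel" for i using t by (intro measurable_curve_eval) simp
  qed measurable
  show "(\<lambda>cv. tail A cv t) \<in> borel_measurable curve_borel"
  proof (rule borel_measurable_LIMSEQ_metric[OF fm])
    fix cv :: "real => 'a" assume "cv \<in> space curve_borel"
    then have cv: "cv \<in> curves" by simp
    define tau where "tau = enn2real (exit_time A cv)"
    have tau: "0 <= tau" by (simp add: tau_def)
    have "dist (f n cv) (tail A cv t) <= (1/2) ^ n" for n
    proof -
      have j: "real (j n cv) <= tau * 2 ^ n" "tau * 2 ^ n < real (j n cv) + 1" using tau by (auto simp: j_def tau_def[symmetric])
      have "dist (f n cv) (tail A cv t) <= \<bar>(real (Suc (j n cv)) / 2 ^ n + t) - (tau + t)\<bar>"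
      proof -
        have "tail A cv t = cv (tau + t)" using t by (simp add: tail_def tau_def)
        then show ?thesis using t tau unfolding f_def by (simp only:) (intro curve_dist_le[OF cv], auto)
      qed
      also have "... = \<bar>(real (j n cv) + 1 - tau * 2 ^ n) / 2 ^ n\<bar>" by (simp add: field_simps)
      also have "... = (real (j n cv) + 1 - tau * 2 ^ n) / 2 ^ n" using j by simp
      also have "... <= 1 / 2 ^ n" using j by (intro divide_right_mono) auto
      finally show ?thesis by (simp add: power_one_over)
    qed
    then show "(\<lambda>n. f n cv) \<longlonglongrightarrow> tail A cv t" by (intro metric_tendsto_imp_tendsto[OF LIMSEQ_power_zero[of "1/2::real"]]) (auto simp: power_one_over)
  qed
qed (use tail_in_curves in auto)

lemma tail_const_from: "const_from n cv ==> t \<ge> real n ==> tail A cv t = cv (real n)"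
proof -
  assume c: "const_from n cv" and t: "t \<ge> real n"
  have "real n <= enn2real (exit_time A cv) + t" using t enn2real_nonneg[of "exit_time A cv"] by linarith
  then have "cv (enn2real (exit_time A cv) + t) = cv (real n)" using c unfolding const_from_def by blast
  moreover have "\<not> t < 0" using t of_nat_0_le_iff[of n, where 'a=real] by linarith
  ultimately show ?thesis by (simp add: tail_def)
qed

lemma tail_end:
  assumes "cv \<in> curves" "stops cv"
  shows "curve_end (tail A cv) = curve_end cv" "stops (tail A cv)"
proof -
  obtain n where n: "const_from n cv" using assms by (auto simp: stops_def)
  have c: "tail A cv t = curve_end cv" if "real n <= t" for t using tail_const_from[OF n that] curve_end_eq_nat[OF assms(1) n] by simp
  show "curve_end (tail A cv) = curve_end cv" by (rule curve_end_eq[OF tail_in_curves[OF assms(1)], of "real n"]) (use c in auto)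
  have "const_from n (tail A cv)" unfolding const_from_def using c by simp
  then show "stops (tail A cv)" by (auto simp: stops_def)
qed

lemma tail_image: "tail A cv ` {0..} \<subseteq> cv ` {0..}" by (auto simp: tail_def intro!: imageI)

lemma visits_tail_le: "visits (tail A cv) x <= visits cv x"
proof -
  let ?tau = "enn2real (exit_time A cv)" and ?S = "{t \<in> {0..}. tail A cv t = x}"
  have "inj_on (\<lambda>t. ?tau + t) ?S" by (auto simp: inj_on_def)
  then have "visits (tail A cv) x = emeasure (count_space UNIV) ((\<lambda>t. ?tau + t) ` ?S)"
    unfolding visits_def by (cases "finite ?S") (simp_all add: card_image finite_image_iff)
  also have "... <= visits cv x" unfolding visits_def by (rule emeasure_mono) (auto simp: tail_def)
  finally show ?thesis .
qed

text \<open>The curve is in \<open>A\<close> after the exit time, and by closedness at the exit time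
  itself. If that time is positive, times outside \<open>A\<close> accumulate at it, so the curve is
  then on the frontier; otherwise the tail is the whole curve.\<close>

lemma
  fixes A :: "'a::euclidean_space set"
  assumes cv: "cv \<in> curves" "stops cv" "curve_end cv \<in> A" and A: "closed A"
  shows tail_subset: "tail A cv ` {0..} \<subseteq> A"
    and tail_start: "tail A cv 0 \<in> frontier A \<or> tail A cv 0 = cv 0"
proof -
  obtain n where n: "const_from n cv" using cv by (auto simp: stops_def)
  define tau where "tau = enn2real (exit_time A cv)"
  have "exit_time A cv <= ennreal (real n)" unfolding exit_time_def
  proof (rule SUP_least)
    fix q assume q: "q \<in> {q\<in>\<rat>. 0 <= (q::real)}"
    show "ennreal q * indicator (- A) (cv q) <= ennreal (real n)"
    proof (cases "q <= real n")
      case True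
      then show ?thesis using q by (auto simp: indicator_def intro!: ennreal_leI)
    next
      case False
      then have "cv q = cv (real n)" using n unfolding const_from_def by (meson linear)
      then have "cv q \<in> A" using curve_end_eq_nat[OF cv(1) n] cv(3) by simp
      then show ?thesis by simp
    qed
  qed
  then have fin: "exit_time A cv = ennreal tau" unfolding tau_def by (metis ennreal_enn2real_if ennreal_less_top le_less_trans less_top)
  have tau0: "0 <= tau" by (simp add: tau_def)
  have qle: "q <= tau" if "q \<in> \<rat>" "0 <= q" "cv q \<notin> A" for q
  proof -
    have "ennreal q * indicator (- A) (cv q) <= exit_time A cv" unfolding exit_time_def using that by (intro SUP_upper) auto
    then show ?thesis using that tau0 by (simp add: fin)
  qed
  have after: "cv t \<in> A" if t: "tau < t" for t
  proof (rule ccontr)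
    assume "cv t \<notin> A"
    then obtain e where e: "0 < e" "ball (cv t) e \<subseteq> - A" using A open_contains_ball[of "- A"] by (auto simp: open_Compl)
    have "max tau (t - e) < t" using t e by simp
    then obtain q where q: "q \<in> \<rat>" "max tau (t - e) < q" "q < t" using Rats_dense_in_real by blast
    have "dist (cv t) (cv q) <= \<bar>t - q\<bar>" using q tau0 by (intro curve_dist_le[OF cv(1)]) auto
    then have "cv q \<in> ball (cv t) e" using q e by auto
    then have "cv q \<notin> A" using e by blast
    then show False using qle[of q] q tau0 by simp
  qed
  have at: "cv tau \<in> A"
  proof -
    have "cv tau \<in> closure A" unfolding closure_approachable
    proof (intro allI impI)
      fix e :: real assume e: "0 < e"
      have "dist (cv (tau + e / 2)) (cv tau) <= \<bar>(tau + e / 2) - tau\<bar>" using e tau0 by (intro curve_dist_le[OF cv(1)]) auto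
      then show "\<exists>y\<in>A. dist y (cv tau) < e" using after[of "tau + e / 2"] e by (intro bexI[of _ "cv (tau + e / 2)"]) auto
    qed
    then show ?thesis using A by (simp add: closure_closed)
  qed
  show "tail A cv ` {0..} \<subseteq> A"
  proof
    fix x assume "x \<in> tail A cv ` {0..}"
    then obtain t where t: "0 <= t" "x = cv (tau + t)" by (auto simp: tail_def tau_def)
    then show "x \<in> A" using at after[of "tau + t"] by (cases "t = 0") auto
  qed
  have t0: "tail A cv 0 = cv tau" by (simp add: tail_def tau_def)
  show "tail A cv 0 \<in> frontier A \<or> tail A cv 0 = cv 0"
  proof (cases "tau = 0")
    case False
    then have taup: "0 < tau" using tau0 by simp
    have "cv tau \<in> closure (- A)" unfolding closure_approachable
    proof (intro allI impI)
      fix e :: real assume e: "0 < e"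
      have "ennreal (max 0 (tau - e)) < exit_time A cv" using e taup by (simp add: fin ennreal_less_iff)
      then obtain q where q: "q \<in> \<rat>" "0 <= q" "ennreal (max 0 (tau - e)) < ennreal q * indicator (- A) (cv q)" unfolding exit_time_def less_SUP_iff by auto
      then have qA: "cv q \<notin> A" by (auto simp: indicator_def split: if_splits)
      then have "tau - e < q" using q by (simp add: ennreal_less_iff)
      moreover have "q <= tau" using qle q qA by simp
      moreover have "dist (cv q) (cv tau) <= \<bar>q - tau\<bar>" using q tau0 by (intro curve_dist_le[OF cv(1)]) auto
      ultimately show "\<exists>y\<in>- A. dist y (cv tau) < e" using qA by (intro bexI[of _ "cv q"]) auto
    qed
    then have "cv tau \<in> frontier A" using at A by (simp add: frontier_closures closure_closed)
    then show ?thesis by (simp add: t0)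
  qed (simp add: t0)
qed

text \<open>Curves ending in \<open>A\<close> are kept and replaced by their tails, which live in
  \<open>A\<close> and cost at most what the plan spends there. The tails start in \<open>F\<close>
  or on the frontier, and grafting replaces the frontier by \<open>K\<close> centres.\<close>

lemma quant_error_localize:
  fixes P :: "(real => real^'n) measure"
  assumes P: "traffic_plan P" "distr P borel curve_end = \<nu>" and F: "finite F" "AE cv in P. cv 0 \<in> F"
    and A: "closed A" and h: "0 < h"
    and K: "finite (ctr h 0 ` frontier A)" "card (ctr h 0 ` frontier A) <= K"
    and al: "0 < al" "al < 1" "real CARD('n) * (1 - al) < 1" and r: "rectifiable_plan P"
  shows "quant_error al (density \<nu> (indicator A)) (card (F \<inter> A) + K) \<le>
    (\<integral>\<^sup>+x. ennpow (multiplicity P x) al * indicator A x \<partial>hausdorff1) +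
    ennreal (irr_const al TYPE('n) * h * real K powr (1 - al)) * ennpow (emeasure \<nu> UNIV) al"
proof -
  note T = traffic_planD[OF P(1)]
  have cs: "measurable P M = measurable curve_borel M" for M :: "'k measure" by (rule measurable_cong_sets[OF T(2) refl])
  have Ab[measurable]: "A \<in> sets borel" using A by (rule borel_closed)
  define g :: "(real => real^'n) => ennreal" where "g cv = indicator A (curve_end cv)" for cv
  have gm: "g \<in> borel_measurable curve_borel" unfolding g_def by measurable
  define P0 where "P0 = density P g"
  have tp0: "traffic_plan P0" unfolding P0_def by (rule traffic_plan_density[OF P(1) gm, of 1]) (simp add: g_def indicator_def)
  note T0 = traffic_planD[OF tp0]
  have cs0: "measurable P0 M = measurable curve_borel M" for M :: "'k measure" by (rule measurable_cong_sets[OF T0(2) refl])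
  have end0: "distr P0 borel curve_end = density \<nu> (indicator A)" unfolding P(2)[symmetric] P0_def g_def by (rule density_distr[symmetric]) (simp_all add: cs)
  have good: "AE cv in P0. cv \<in> curves \<and> stops cv \<and> curve_end cv \<in> A \<and> cv 0 \<in> F"
  proof -
    have "AE cv in P0. curve_end cv \<in> A" unfolding P0_def using gm by (subst AE_density) (auto simp: cs g_def indicator_def)
    moreover have "AE cv in P0. cv 0 \<in> F" unfolding P0_def by (rule AE_density_of[OF P(1) gm F(2)])
    ultimately show ?thesis using T0(4) AE_space[of P0] unfolding T0(3) by eventually_elim auto
  qed
  have tm: "tail A \<in> measurable curve_borel curve_borel" by (rule measurable_tail[OF Ab])
  define P' where "P' = distr P0 curve_borel (tail A)"
  have tp: "traffic_plan P'" unfolding P'_def using tail_end(2) by (intro traffic_plan_distr tp0 tm)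
  have "distr P' borel curve_end = distr P0 borel (curve_end \<circ> tail A)" unfolding P'_def by (rule distr_distr) (use tm in \<open>simp_all add: cs0\<close>)
  also have "... = distr P0 borel curve_end" using good tm by (intro distr_cong_AE refl) (auto simp: cs0 tail_end(1) intro!: measurable_comp)
  finally have tgt: "distr P' borel curve_end = density \<nu> (indicator A)" by (simp add: end0)
  have "AE cv in P'. cv 0 \<in> frontier A \<or> cv 0 \<in> F \<inter> A" unfolding P'_def
  proof (subst AE_distr_iff)
    show "AE cv in P0. tail A cv 0 \<in> frontier A \<or> tail A cv 0 \<in> F \<inter> A" using good
    proof eventually_elim
      case (elim cv)
      have "tail A cv 0 \<in> A" using tail_subset[of cv A] elim A by auto
      then show ?case using tail_start[of cv A] elim A by auto
    qed
    have [measurable]: "frontier A \<union> (F \<inter> A) \<in> sets borel" by (rule borel_closed[OF closed_Un[OF frontier_closed closed_Int[OF finite_imp_closed[OF F(1)] A]]])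
    have "{cv \<in> space curve_borel. cv 0 \<in> frontier A \<union> (F \<inter> A)} \<in> sets (curve_borel :: (real => real^'n) measure)" by measurable
    then show "{cv \<in> space curve_borel. cv 0 \<in> frontier A \<or> cv 0 \<in> F \<inter> A} \<in> sets (curve_borel :: (real => real^'n) measure)" by simp
  qed (use tm in \<open>simp add: cs0\<close>)
  from quant_error_graft_le[OF tp h borel_closed[OF frontier_closed] K _ this al]
  have "quant_error al (density \<nu> (indicator A)) (card (F \<inter> A) + K) <= alpha_mass al P' +
     ennreal (irr_const al TYPE('n) * h * real K powr (1 - al)) * ennpow (emeasure P' {cv \<in> space P'. cv 0 \<in> frontier A}) al" using F(1) by (simp add: tgt)
  also have "... <= (\<integral>\<^sup>+x. ennpow (multiplicity P x) al * indicator A x \<partial>hausdorff1) +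
     ennreal (irr_const al TYPE('n) * h * real K powr (1 - al)) * ennpow (emeasure \<nu> UNIV) al"
  proof (intro add_mono mult_left_mono ennpow_mono)
    obtain phi where phi: "lip_family phi" "AE cv in P. covered phi cv" using r by (rule rectifiable_planE)
    have c0: "AE cv in P0. covered phi cv" unfolding P0_def by (rule AE_density_of[OF P(1) gm phi(2)])
    have "AE cv in P'. covered phi cv" unfolding P'_def
    proof (rule AE_covered_distr[OF tp0 tm c0 phi(1)])
      fix cv assume "covered phi cv"
      then show "covered phi (tail A cv)" by (rule covered_mono) (use tail_image[of A cv] in auto)
    qed
    then have r': "rectifiable_plan P'" using phi(1) unfolding rectifiable_plan_iff by blast
    have "multiplicity P' x <= multiplicity P x * indicator A x" for x
    proof -
      have "multiplicity P' x = (\<integral>\<^sup>+cv. visits (tail A cv) x \<partial>P0)" unfolding P'_def by (rule multiplicity_distr[OF tp0 tm])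
      also have "... <= (\<integral>\<^sup>+cv. visits cv x * indicator A x \<partial>P0)"
      proof (rule nn_integral_mono_AE, use good in eventually_elim)
        case (elim cv)
        show ?case
        proof (cases "x \<in> A")
          case False
          then have e: "{t \<in> {0..}. tail A cv t = x} = {}" using tail_subset[of cv A] elim A by blast
          show ?thesis unfolding visits_def e by simp
        qed (use visits_tail_le[of A cv x] in simp)
      qed
      also have "... = multiplicity P0 x * indicator A x" unfolding multiplicity_eq by (rule nn_integral_multc) (simp add: cs0)
      also have "multiplicity P0 x <= multiplicity P x" unfolding P0_def multiplicity_density[OF P(1) gm] unfolding multiplicity_eq
        by (intro nn_integral_mono) (simp add: g_def indicator_def)
      finally show ?thesis by (simp add: mult_right_mono)
    qed
    then have "ennpow (multiplicity P' x) al <= ennpow (multiplicity P x * indicator A x) al" for x using al by (intro ennpow_mono) auto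
    moreover have "ennpow (multiplicity P x * indicator A x) al = ennpow (multiplicity P x) al * indicator A x" for x by (auto simp: indicator_def)
    ultimately show "alpha_mass al P' <= (\<integral>\<^sup>+x. ennpow (multiplicity P x) al * indicator A x \<partial>hausdorff1)"
      unfolding alpha_mass_eq[OF r'] by (intro nn_integral_mono) metis
    have "emeasure P' {cv \<in> space P'. cv 0 \<in> frontier A} <= emeasure P' (space P')" by (rule emeasure_space)
    also have "... = emeasure P' (curve_end -` UNIV \<inter> space P')" by simp
    also have "... = emeasure (distr P' borel curve_end) UNIV" using traffic_planD(2)[OF tp] by (intro emeasure_distr[symmetric]) (auto cong: measurable_cong_sets)
    also have "... <= emeasure \<nu> UNIV"
    proof -
      have s: "sets \<nu> = sets borel" unfolding P(2)[symmetric] by simp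
      have "emeasure (density \<nu> (indicator A)) UNIV = emeasure \<nu> (A \<inter> UNIV)" by (rule emeasure_restricted) (simp_all only: s Ab UNIV_I sets.top space_borel[symmetric])
      also have "... <= emeasure \<nu> UNIV" by (rule emeasure_mono) (simp_all add: s)
      finally show ?thesis unfolding tgt .
    qed
    finally show "emeasure P' {cv \<in> space P'. cv 0 \<in> frontier A} <= emeasure \<nu> UNIV" .
  qed (use al in auto)
  finally show ?thesis .
qed

text \<open>The local costs are integrals over disjoint sets, so their sum is at most the total
  cost; only the boundary trees are paid once per set.\<close>

lemma quant_error_superadditive:
  fixes P :: "(real => real^'n) measure" and A :: "'j => (real^'n) set"
  assumes P: "traffic_plan P" "distr P borel curve_end = \<nu>" and F: "finite F" "AE cv in P. cv 0 \<in> F"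
    and A: "\<And>j. j \<in> J ==> closed (A j)" and h: "0 < h" and J: "finite J" "disjoint_family_on A J"
    and K: "\<And>j. j \<in> J ==> finite (ctr h 0 ` frontier (A j)) \<and> card (ctr h 0 ` frontier (A j)) <= K"
    and al: "0 < al" "al < 1" "real CARD('n) * (1 - al) < 1"
  shows "(\<Sum>j\<in>J. quant_error al (density \<nu> (indicator (A j))) (card (F \<inter> A j) + K)) \<le>
    alpha_mass al P + ennreal (real (card J) * (irr_const al TYPE('n) * h * real K powr (1 - al))) * ennpow (emeasure \<nu> UNIV) al"
proof (cases "rectifiable_plan P")
  case r: True
  define C where "C = irr_const al TYPE('n) * h * real K powr (1 - al)"
  have C: "0 <= C" using irr_const_nonneg[OF al(3)] h by (simp add: C_def)
  have [measurable]: "multiplicity P \<in> borel_measurable hausdorff1" using measurable_multiplicity[OF P(1)] by (simp cong: measurable_cong_sets)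
  have Ab[measurable]: "A j \<in> sets borel" if "j \<in> J" for j using A[OF that] by (rule borel_closed)
  have "(\<Sum>j\<in>J. quant_error al (density \<nu> (indicator (A j))) (card (F \<inter> A j) + K)) \<le>
     (\<Sum>j\<in>J. (\<integral>\<^sup>+x. ennpow (multiplicity P x) al * indicator (A j) x \<partial>hausdorff1) + ennreal C * ennpow (emeasure \<nu> UNIV) al)"
    unfolding C_def using K by (intro sum_mono quant_error_localize[OF P F A h _ _ al r]) auto
  also have "... = (\<Sum>j\<in>J. \<integral>\<^sup>+x. ennpow (multiplicity P x) al * indicator (A j) x \<partial>hausdorff1) + of_nat (card J) * (ennreal C * ennpow (emeasure \<nu> UNIV) al)"
    by (simp add: sum.distrib)
  also have "of_nat (card J) * (ennreal C * ennpow (emeasure \<nu> UNIV) al) = ennreal (real (card J) * C) * ennpow (emeasure \<nu> UNIV) al"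
    using C by (simp add: ennreal_mult ennreal_of_nat_eq_real_of_nat mult.assoc)
  also have "(\<Sum>j\<in>J. \<integral>\<^sup>+x. ennpow (multiplicity P x) al * indicator (A j) x \<partial>hausdorff1) =
     (\<integral>\<^sup>+x. (\<Sum>j\<in>J. ennpow (multiplicity P x) al * indicator (A j) x) \<partial>hausdorff1)" by (rule nn_integral_sum[symmetric]) simp
  also have "... <= alpha_mass al P" unfolding alpha_mass_eq[OF r]
  proof (rule nn_integral_mono)
    fix x
    have "(\<Sum>j\<in>J. ennpow (multiplicity P x) al * indicator (A j) x) = ennpow (multiplicity P x) al * indicator (\<Union>j\<in>J. A j) x"
      using J by (simp add: indicator_UN_disjoint sum_distrib_left)
    also have "... <= ennpow (multiplicity P x) al" by (simp add: indicator_def)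
    finally show "(\<Sum>j\<in>J. ennpow (multiplicity P x) al * indicator (A j) x) <= ennpow (multiplicity P x) al" .
  qed
  finally show ?thesis by (simp add: C_def add_right_mono)
qed (simp add: alpha_mass_def)



section \<open>A lower bound for the quantization error of a cube\<close>

lemma sets_lip_trace:
  assumes "lip_family phi"
  shows "phi i ` {0..real n} \<in> sets borel" "lip_trace phi \<in> sets borel"
    "\<exists>L. H1 (phi i ` {0..real n}) <= ennreal L"
proof -
  have c: "continuous_on {0..} (phi i)" for i using assms unfolding lip_family_def by (metis lipschitz_on_continuous_on)
  have b: "phi i ` {0..real n} \<in> sets borel" for i n by (intro borel_compact compact_continuous_image continuous_on_subset[OF c]) auto
  show "phi i ` {0..real n} \<in> sets borel" by (rule b)
  have "lip_trace phi = (\<Union>i. \<Union>n. phi i ` {0..real n})"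
  proof (intro equalityI subsetI)
    fix x assume "x \<in> lip_trace phi"
    then obtain i t where it: "0 <= t" "x = phi i t" unfolding lip_trace_def by blast
    obtain n where "t <= real n" using real_arch_simple by blast
    then have "x \<in> phi i ` {0..real n}" using it by simp
    then show "x \<in> (\<Union>i. \<Union>n. phi i ` {0..real n})" by blast
  next
    fix x assume "x \<in> (\<Union>i. \<Union>n. phi i ` {0..real n})"
    then obtain i n t where "t \<in> {0..real n}" "x = phi i t" by blast
    then have "x \<in> phi i ` {0..}" by simp
    then show "x \<in> lip_trace phi" unfolding lip_trace_def by blast
  qed
  also have "... \<in> sets borel" using b by blast
  finally show "lip_trace phi \<in> sets borel" .
  obtain L where "L-lipschitz_on {0..} (phi i)" using assms by (auto simp: lip_family_def)
  then have "L-lipschitz_on {0..real n} (phi i)" by (rule lipschitz_on_subset) auto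
  from hausdorff1_outer_lipschitz_interval[OF this]
  show "\<exists>L. H1 (phi i ` {0..real n}) <= ennreal L" by auto
qed

text \<open>In dimension at least 2 the measure \<open>hausdorff1\<close> is not sigma-finite. Its
  restriction to a Lipschitz trace is, which permits Fubini's theorem.\<close>

lemma sigma_finite_hausdorff1_trace:
  fixes phi :: "nat => real => 'a::euclidean_space"
  assumes phi: "lip_family phi"
  shows "sigma_finite_measure (density hausdorff1 (indicator (lip_trace phi)))"
proof
  let ?M = "density hausdorff1 (indicator (lip_trace phi)) :: 'a measure"
  note S[measurable] = sets_lip_trace(2)[OF phi]
  let ?A = "insert (- lip_trace phi) (range (\<lambda>(i, n). phi i ` {0..real n}))"
  have em: "emeasure ?M B = emeasure hausdorff1 (lip_trace phi \<inter> B)" if "B \<in> sets borel" for B by (rule emeasure_restricted) (use that S in simp_all)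
  show "\<exists>A. countable A \<and> A \<subseteq> sets ?M \<and> \<Union> A = space ?M \<and> (\<forall>a\<in>A. emeasure ?M a \<noteq> \<infinity>)"
  proof (intro exI[of _ ?A] conjI ballI)
    show "countable ?A" by simp
    show "?A \<subseteq> sets ?M" using sets_lip_trace(1)[OF phi] S by auto
    show "\<Union> ?A = space ?M"
    proof -
      have "x \<in> \<Union> ?A" for x
      proof (cases "x \<in> lip_trace phi")
        case True
        then obtain i t where it: "0 <= t" "x = phi i t" unfolding lip_trace_def by blast
        obtain n where "t <= real n" using real_arch_simple by blast
        then have "x \<in> phi i ` {0..real n}" using it by simp
        then show ?thesis by blast
      qed blast
      then show ?thesis by auto
    qed
    fix a assume "a \<in> ?A"
    then consider "a = - lip_trace phi" | i n where "a = phi i ` {0..real n}" by auto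
    then show "emeasure ?M a \<noteq> \<infinity>"
    proof cases
      case 1
      then show ?thesis using S by (simp add: em borel_comp)
    next
      case 2
      obtain L where L: "H1 (phi i ` {0..real n}) <= ennreal L" using sets_lip_trace(3)[OF phi] by blast
      have "emeasure ?M a <= H1 (phi i ` {0..real n})" unfolding 2 using sets_lip_trace(1)[OF phi] S
        by (subst em) (auto simp: emeasure_hausdorff1 intro!: hausdorff1_outer_mono)
      also have "... < \<infinity>" using L by (rule le_less_trans) simp
      finally show ?thesis by simp
    qed
  qed
qed

text \<open>The distance to the end point is 1-Lipschitz and, by the intermediate value theorem,
  takes all values in (0,r) along the curve, at points that lie in \<open>A\<close>.\<close>

lemma hausdorff1_curve_near_end:
  fixes cv :: "real => 'a::euclidean_space"
  assumes cv: "cv \<in> curves" "stops cv" and start: "cv 0 \<notin> A" and r: "ball (curve_end cv) r \<subseteq> A"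
  shows "ennreal (r / 2) <= H1 (cv ` {0..} \<inter> A)"
proof (cases "0 < r")
  case True
  obtain n where n: "const_from n cv" using cv by (auto simp: stops_def)
  let ?y = "curve_end cv"
  have yn: "?y = cv (real n)" by (rule curve_end_eq_nat[OF cv(1) n])
  show ?thesis
  proof (rule hausdorff1_outer_ge[where f="dist ?y"])
    show "1-lipschitz_on (cv ` {0..} \<inter> A) (dist ?y)" unfolding lipschitz_on_def
      by (auto simp: dist_real_def abs_le_iff) (metis (no_types, opaque_lifting) dist_commute dist_triangle diff_le_eq add.commute)+
    show "{0<..<r} \<subseteq> dist ?y ` (cv ` {0..} \<inter> A)"
    proof
      fix s assume s: "s \<in> {0<..<r}"
      have "r <= dist ?y (cv 0)" using start r by (force simp: not_less[symmetric])
      moreover have "continuous_on {0..real n} (\<lambda>t. dist ?y (cv t))" by (intro continuous_intros continuous_on_subset[OF curve_continuous_on[OF cv(1)]]) auto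
      ultimately obtain t where t: "0 <= t" "t <= real n" "dist ?y (cv t) = s" using IVT2'[of "\<lambda>t. dist ?y (cv t)" "real n" s 0] s yn by auto
      then have "cv t \<in> A" using s r by auto
      then show "s \<in> dist ?y ` (cv ` {0..} \<inter> A)" using t by (intro image_eqI[of _ _ "cv t"]) auto
    qed
  qed
qed (simp add: ennreal_neg)

text \<open>The flow through \<open>A\<close> of the curves ending in \<open>A\<close> is at most the mass \<open>m\<close> of \<open>A\<close>, and concavity
  makes its \<open>al\<close>-mass at least \<open>m^(al-1)\<close> times the total length of these curves inside \<open>A\<close>.\<close>

lemma alpha_mass_localized_ge:
  fixes P :: "(real => 'a::euclidean_space) measure"
  assumes P: "traffic_plan P" "distr P borel curve_end = \<nu>" and rect: "rectifiable_plan P"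
    and A: "A \<in> sets borel" and start: "AE cv in P. cv 0 \<notin> A"
    and B: "B \<in> sets borel" "\<And>y. y \<in> B ==> ball y r \<subseteq> A" "B \<subseteq> A"
    and m: "emeasure \<nu> A = ennreal m" "0 < m" and al: "0 < al" "al <= 1"
  shows "ennreal (m powr (al - 1) * (r / 2)) * emeasure \<nu> B
    <= (\<integral>\<^sup>+x. ennpow (multiplicity P x) al * indicator A x \<partial>hausdorff1)"
proof -
  note T = traffic_planD[OF P(1)]
  interpret P: finite_measure P by (rule T)
  have cs: "measurable P M = measurable curve_borel M" for M :: "'k measure" by (rule measurable_cong_sets[OF T(2) refl])
  note [measurable] = A B(1)
  obtain phi where phi: "lip_family phi" "AE cv in P. covered phi cv" using rect by (rule rectifiable_planE)
  note S[measurable] = sets_lip_trace(2)[OF phi(1)]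
  \<comment> \<open>One-dimensional measure on a carrier of the plan: it is sigma-finite, and almost
    every curve keeps its full length on the carrier.\<close>
  define H :: "'a measure" where "H = density hausdorff1 (indicator (lip_trace phi))"
  interpret H: sigma_finite_measure H unfolding H_def by (rule sigma_finite_hausdorff1_trace[OF phi(1)])
  have sH[simp]: "sets H = sets borel" by (simp add: H_def)
  have csH: "measurable H M = measurable borel M" for M :: "'k measure" by (rule measurable_cong_sets[OF sH refl])
  interpret HP: pair_sigma_finite H P ..
  define f where "f x cv = (indicator A (curve_end cv) * indicator A x * (if x \<in> cv ` {0..} then 1 else 0) :: ennreal)" for x and cv :: "real => 'a"
  have "(\<lambda>p. f (fst p) (snd p)) \<in> borel_measurable (borel \<Otimes>\<^sub>M curve_borel)"
  proof -
    have [measurable]: "Measurable.pred (borel \<Otimes>\<^sub>M curve_borel) (\<lambda>p. fst p \<in> (snd p :: real => 'a) ` {0..})" using pred_range by (simp add: case_prod_beta')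
    show ?thesis unfolding f_def by measurable
  qed
  then have "(\<lambda>p. f (fst p) (snd p)) \<in> borel_measurable (H \<Otimes>\<^sub>M P)" by (simp only: measurable_cong_sets[OF sets_pair_measure_cong[OF sH T(2)] refl])
  then have fm: "(\<lambda>(x, cv). f x cv) \<in> borel_measurable (H \<Otimes>\<^sub>M P)" by (simp only: case_prod_beta')
  define tt where "tt x = (\<integral>\<^sup>+cv. f x cv \<partial>P)" for x
  have ttm: "tt \<in> borel_measurable H" unfolding tt_def by (rule P.borel_measurable_nn_integral[OF fm])
  have Pm: "emeasure P {cv \<in> space P. curve_end cv \<in> A} = ennreal m"
  proof -
    have "emeasure \<nu> A = emeasure P (curve_end -` A \<inter> space P)" unfolding P(2)[symmetric] by (rule emeasure_distr) (simp_all add: cs)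
    also have "curve_end -` A \<inter> space P = {cv \<in> space P. curve_end cv \<in> A}" by auto
    finally show ?thesis using m by simp
  qed
  have endm: "{cv \<in> space P. curve_end cv \<in> C} \<in> sets P" if [measurable]: "C \<in> sets borel" for C
  proof -
    have "{cv \<in> space curve_borel. curve_end cv \<in> C} \<in> sets (curve_borel :: (real => 'a) measure)" by measurable
    then show ?thesis using T by simp
  qed
  have ttle: "tt x <= ennreal m" for x
  proof -
    have "tt x <= (\<integral>\<^sup>+cv. indicator {cv \<in> space P. curve_end cv \<in> A} cv \<partial>P)" unfolding tt_def by (intro nn_integral_mono) (auto simp: f_def indicator_def)
    then show ?thesis using Pm endm[OF A] by simp
  qed
  have tt\<Theta>: "tt x <= multiplicity P x" for x unfolding tt_def multiplicity_eq
  proof (rule nn_integral_mono)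
    fix cv
    show "f x cv <= visits cv x"
    proof (cases "x \<in> cv ` {0..}")
      case True
      then obtain t where "t \<in> {t \<in> {0..}. cv t = x}" by auto
      then have "emeasure (count_space UNIV) {t} <= visits cv x" unfolding visits_def by (intro emeasure_mono) auto
      then have "1 <= visits cv x" by simp
      moreover have "f x cv <= 1" by (auto simp: f_def indicator_def)
      ultimately show ?thesis by (rule order.trans[rotated])
    qed (simp add: f_def)
  qed
  \<comment> \<open>As \<open>al - 1\<close> is not positive, q powr (al - 1) is at least m powr (al
    - 1) for a flow q not exceeding m.\<close>
  have conc: "ennreal (m powr (al - 1)) * tt x <= ennpow (multiplicity P x) al" for x
  proof -
    obtain q where q: "0 <= q" "tt x = ennreal q" "q <= m" using ttle[of x] m by (cases "tt x") (auto simp: top_unique)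
    have "m powr (al - 1) * q <= q powr al"
    proof (cases "q = 0")
      case False
      then have "m powr (al - 1) <= q powr (al - 1)" using q al by (intro powr_mono2') auto
      then have "m powr (al - 1) * q <= q powr (al - 1) * q" using q by (intro mult_right_mono) auto
      also have "... = q powr al" using False q by (simp add: powr_diff)
      finally show ?thesis .
    qed simp
    then have "ennreal (m powr (al - 1)) * tt x <= ennpow (tt x) al" using q by (simp add: ennpow_ennreal ennreal_mult[symmetric] ennreal_leI)
    also have "... <= ennpow (multiplicity P x) al" using al by (intro ennpow_mono tt\<Theta>) auto
    finally show ?thesis .
  qed
  \<comment> \<open>The length inside \<open>A\<close> of the curves ending in \<open>B\<close> is
    integrated over the curves; Fubini turns this into an integral of the flow \<open>tt\<close>
    over the points.\<close>
  have "ennreal (r / 2) * emeasure \<nu> B = (\<integral>\<^sup>+cv. ennreal (r / 2) * indicator {cv \<in> space P. curve_end cv \<in> B} cv \<partial>P)"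
  proof -
    have "emeasure \<nu> B = emeasure P (curve_end -` B \<inter> space P)" unfolding P(2)[symmetric] by (rule emeasure_distr) (simp_all add: cs)
    also have "curve_end -` B \<inter> space P = {cv \<in> space P. curve_end cv \<in> B}" by auto
    finally show ?thesis using endm[OF B(1)] by (simp add: nn_integral_cmult)
  qed
  also have "... <= (\<integral>\<^sup>+cv. (\<integral>\<^sup>+x. f x cv \<partial>H) \<partial>P)"
  proof (rule nn_integral_mono_AE)
    have "AE cv in P. cv \<in> curves" using AE_space[of P] T by simp
    then show "AE cv in P. ennreal (r / 2) * indicator {cv \<in> space P. curve_end cv \<in> B} cv <= (\<integral>\<^sup>+x. f x cv \<partial>H)" using T(4) phi(2) start
    proof eventually_elim
      case (elim cv)
      show ?case
      proof (cases "curve_end cv \<in> B")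
        case True
        let ?R = "cv ` {0..} \<inter> A"
        have Rb: "cv ` {0..} \<in> sets borel"
        proof -
          have "cv ` {0..} = (\<Union>n::nat. cv ` {0..real n})" by (intro equalityI subsetI) (use real_arch_simple in fastforce, auto)
          moreover have "cv ` {0..real n} \<in> sets borel" for n by (intro borel_compact curve_image_compact elim)
          ultimately show ?thesis by auto
        qed
        have "ennreal (r / 2) <= H1 ?R" using elim True B(2) by (intro hausdorff1_curve_near_end) auto
        also have "... <= H1 (lip_trace phi \<inter> ?R) + H1 (cv ` {0..} - lip_trace phi)" by (rule order.trans[OF hausdorff1_outer_mono hausdorff1_outer_Un]) auto
        also have "... = emeasure hausdorff1 (lip_trace phi \<inter> ?R)" using elim(3) Rb by (simp add: covered_def emeasure_hausdorff1)
        also have "... = emeasure H ?R" unfolding H_def using Rb by (intro emeasure_restricted[symmetric]) simp_all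
        also have "... = (\<integral>\<^sup>+x. f x cv \<partial>H)"
        proof -
          have "(\<integral>\<^sup>+x. f x cv \<partial>H) = (\<integral>\<^sup>+x. indicator ?R x \<partial>H)" using True B(3) by (intro nn_integral_cong) (auto simp: f_def indicator_def)
          then show ?thesis using Rb by simp
        qed
        finally show ?thesis using True by (simp add: indicator_def)
      qed simp
    qed
  qed
  also have "... = (\<integral>\<^sup>+x. tt x \<partial>H)" unfolding tt_def by (rule HP.Fubini'[OF fm])
  finally have "ennreal (m powr (al - 1)) * (ennreal (r / 2) * emeasure \<nu> B) <= ennreal (m powr (al - 1)) * (\<integral>\<^sup>+x. tt x \<partial>H)" by (rule mult_left_mono) simp
  also have "... = (\<integral>\<^sup>+x. ennreal (m powr (al - 1)) * tt x \<partial>H)" by (rule nn_integral_cmult[symmetric, OF ttm])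
  also have "... = (\<integral>\<^sup>+x. indicator (lip_trace phi) x * (ennreal (m powr (al - 1)) * tt x) \<partial>hausdorff1)"
    unfolding H_def using ttm by (intro nn_integral_density) (simp_all add: csH cong: measurable_cong_sets)
  also have "... <= (\<integral>\<^sup>+x. ennpow (multiplicity P x) al * indicator A x \<partial>hausdorff1)"
  proof (rule nn_integral_mono)
    fix x
    have "tt x = 0" if "x \<notin> A" using that by (simp add: tt_def f_def)
    then show "indicator (lip_trace phi) x * (ennreal (m powr (al - 1)) * tt x) <= ennpow (multiplicity P x) al * indicator A x"
      using conc[of x] by (auto simp: indicator_def)
  qed
  finally have *: "ennreal (m powr (al - 1)) * (ennreal (r / 2) * emeasure \<nu> B) <= (\<integral>\<^sup>+x. ennpow (multiplicity P x) al * indicator A x \<partial>hausdorff1)" .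
  show ?thesis
  proof (cases "0 <= r")
    case True
    then have "ennreal (m powr (al - 1) * (r / 2)) = ennreal (m powr (al - 1)) * ennreal (r / 2)" by (intro ennreal_mult) auto
    then show ?thesis using * by (simp only: mult.assoc)
  qed (simp add: ennreal_neg mult_nonneg_nonpos)
qed

text \<open>The cells are open, so that distinct ones are disjoint and a source occupies at most one
  of them.\<close>

definition subcube :: "nat => ('n::finite => nat) => (real^'n) set" where
  "subcube k g = box (\<chi> i. real (g i) / real k) (\<chi> i. real (Suc (g i)) / real k)"

definition multi_index :: "nat => ('n::finite => nat) set" where
  "multi_index k = PiE UNIV (\<lambda>_. {..<k})"

lemma finite_multi_index [simp]: "finite (multi_index k :: ('n::finite => nat) set)" by (simp add: multi_index_def finite_PiE)

lemma card_multi_index: "card (multi_index k :: ('n::finite => nat) set) = k ^ CARD('n)" by (simp add: multi_index_def card_PiE)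

lemma in_subcube: "x \<in> subcube k g \<longleftrightarrow> (\<forall>i. real (g i) / real k < x $ i \<and> x $ i < real (Suc (g i)) / real k)" by (simp add: subcube_def mem_box_cart)

lemma subcube_disjoint:
  assumes "0 < k" shows "disjoint_family_on (subcube k) (J :: ('n::finite => nat) set)" unfolding disjoint_family_on_def
proof (intro ballI impI)
  fix g g' :: "'n => nat" assume "g \<noteq> g'"
  then obtain i where i: "g i \<noteq> g' i" by auto
  show "subcube k g \<inter> subcube k g' = {}"
  proof (rule ccontr)
    assume "subcube k g \<inter> subcube k g' \<noteq> {}"
    then obtain x where x: "x \<in> subcube k g" "x \<in> subcube k g'" by auto
    have "real (g i) < x $ i * k" "x $ i * k < real (g i) + 1" "real (g' i) < x $ i * k" "x $ i * k < real (g' i) + 1"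
      using x assms unfolding in_subcube by (auto simp: field_simps dest!: spec[of _ i])
    then have "real (g i) < real (g' i) + 1" "real (g' i) < real (g i) + 1" by linarith+
    then show False using i by linarith
  qed
qed

lemma subcube_subset_cube:
  assumes "0 < k" "g \<in> multi_index k" shows "subcube k g \<subseteq> cbox 0 (1 :: real^'n)"
proof
  fix x :: "real^'n" assume x: "x \<in> subcube k g"
  show "x \<in> cbox 0 1" unfolding mem_box_cart
  proof
    fix i
    have "real (g i) / real k < x $ i" "x $ i < real (Suc (g i)) / real k" using x by (auto simp: in_subcube)
    moreover have "Suc (g i) <= k" using assms(2) by (auto simp: multi_index_def PiE_def Pi_def Suc_le_eq)
    then have "real (Suc (g i)) / real k <= 1" using assms(1) by (simp add: divide_le_eq_1 del: of_nat_Suc)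
    moreover have "0 <= real (g i) / real k" by simp
    ultimately show "(0 :: real^'n) $ i <= x $ i \<and> x $ i <= (1 :: real^'n) $ i" by (simp only: zero_index one_index) linarith
  qed
qed

lemma emeasure_cube_measure:
  assumes "A \<in> sets borel" "A \<subseteq> cbox 0 1"
  shows "emeasure cube_measure A = emeasure lborel A"
proof -
  have "emeasure cube_measure A = emeasure lborel (cbox 0 1 \<inter> A)" unfolding cube_measure_def by (rule emeasure_restricted) (use assms in auto)
  also have "cbox 0 1 \<inter> A = A" using assms by auto
  finally show ?thesis .
qed

text \<open>With at least 2N cells of side h = 1/k, half of them contain no source and are filled
  from outside. Curves ending in the concentric cube of side h/2 travel at least the distance h/4 in
  their cell, which by \<open>alpha_mass_localized_ge\<close> costs h^(d(al-1)) * h/8 * (h/2)^d per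
  cell.\<close>

lemma quant_error_cube_ge:
  assumes N: "1 <= N" and al: "0 < al" "al < 1" "real CARD('n::finite) * (1 - al) < 1"
  shows "ennreal (real N powr - (beta_exp al TYPE('n) / real CARD('n)) *
      (3 powr - beta_exp al TYPE('n) / 2 ^ (CARD('n) + 4)))
    <= cube_error al TYPE('n) N"
proof -
  let ?d = "CARD('n)"
  define \<beta> where "\<beta> = beta_exp al TYPE('n)"
  have \<beta>: "0 < \<beta>" "\<beta> = 1 + real ?d * al - real ?d" using al(3) by (auto simp: \<beta>_def beta_exp_def algebra_simps)
  \<comment> \<open>The least k with k^d at least 2N; rounding up keeps it below 3 N^(1/d), which is
    the origin of the base 3 in the bound.\<close>
  define k where "k = nat \<lceil>(2 * real N) powr (1 / real ?d)\<rceil>"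
  have d0: "0 < real ?d" by simp
  have N1: "1 <= real N powr (1 / real ?d)" using N by (intro ge_one_powr_ge_zero) auto
  have kr: "(2 * real N) powr (1 / real ?d) <= real k" "real k < (2 * real N) powr (1 / real ?d) + 1"
    unfolding k_def using powr_ge_zero[of "2 * real N" "1 / real ?d"] by linarith+
  have "1 <= (2 * real N) powr (1 / real ?d)" using N by (intro ge_one_powr_ge_zero) auto
  then have k0: "0 < k" using kr by (cases k) auto
  have kd: "2 * N <= k ^ ?d"
  proof -
    have "2 * real N = ((2 * real N) powr (1 / real ?d)) powr real ?d" using N by (simp add: powr_powr)
    also have "... <= real k powr real ?d" using kr by (intro powr_mono2) auto
    also have "... = real (k ^ ?d)" using k0 by (simp add: powr_realpow)
    finally show ?thesis by linarith
  qed
  have k3: "real k <= 3 * real N powr (1 / real ?d)"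
  proof -
    have "(2 * real N) powr (1 / real ?d) = 2 powr (1 / real ?d) * real N powr (1 / real ?d)" by (simp add: powr_mult)
    also have "2 powr (1 / real ?d) <= 2 powr 1" using d0 by (intro powr_mono) (auto simp: divide_le_eq_1)
    finally have "(2 * real N) powr (1 / real ?d) <= 2 * real N powr (1 / real ?d)" by (simp add: mult_right_mono)
    then show ?thesis using kr N1 by linarith
  qed
  define h where "h = 1 / real k"
  have h: "0 < h" using k0 by (simp add: h_def)
  have main: "ennreal (real k powr - \<beta> / 2 ^ (?d + 4)) <= cube_error al TYPE('n) N"
  proof (rule dense_ge)
    fix e assume "cube_error al TYPE('n) N < e"
    then obtain P F where P: "traffic_plan P" "distr P borel curve_end = (cube_measure :: (real^'n) measure)" "finite F" "card F <= N"
      "AE cv in P. cv 0 \<in> F" "alpha_mass al P < e" by (rule quant_error_less)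
    have r: "rectifiable_plan P" using P(6) by (intro alpha_mass_less_top[of al]) (auto intro: less_le_trans)
    define J where "J = {g \<in> multi_index k. subcube k g \<inter> F = {}}"
    have finJ: "finite J" by (simp add: J_def)
    have cardJ: "k ^ ?d <= 2 * card J"
    proof -
      \<comment> \<open>The cell containing a given source; it maps the sources onto the occupied
        cells, so at most \<open>N\<close> cells are occupied.\<close>
      define p where "p x = (SOME g. g \<in> multi_index k \<and> x \<in> subcube k g)" for x :: "real^'n"
      have "multi_index k - J \<subseteq> p ` F"
      proof
        fix g :: "'n => nat" assume g: "g \<in> multi_index k - J"
        then obtain x where x: "x \<in> subcube k g" "x \<in> F" by (auto simp: J_def)
        have "p x \<in> multi_index k \<and> x \<in> subcube k (p x)" unfolding p_def by (rule someI[of _ g]) (use g x in auto)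
        then have "p x = g" using subcube_disjoint[OF k0, of UNIV] x(1) unfolding disjoint_family_on_def by blast
        then show "g \<in> p ` F" using x by auto
      qed
      then have "card (multi_index k - J) <= card (p ` F)" using P(3) by (intro card_mono) auto
      also have "... <= N" using card_image_le[OF P(3), of p] P(4) by linarith
      finally have "card (multi_index k :: ('n => nat) set) - card J <= N" by (subst (asm) card_Diff_subset) (auto simp: J_def)
      then show ?thesis using kd by (simp add: card_multi_index)
    qed
    have [measurable]: "multiplicity P \<in> borel_measurable hausdorff1" using measurable_multiplicity[OF P(1)] by (simp cong: measurable_cong_sets)
    have [measurable]: "subcube k g \<in> sets borel" for g :: "'n => nat" by (simp add: subcube_def)
    have each: "ennreal ((h ^ ?d) powr (al - 1) * (h / 8) * (h / 2) ^ ?d)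
       <= (\<integral>\<^sup>+x. ennpow (multiplicity P x) al * indicator (subcube k g) x \<partial>hausdorff1)" if g: "g \<in> J" for g
    proof -
      have gm: "g \<in> multi_index k" "subcube k g \<inter> F = {}" using g by (auto simp: J_def)
      define B where "B = box (\<chi> i. (real (g i) + 1/4) * h) (\<chi> i. (real (g i) + 3/4) * h)"
      have BA: "ball y (h / 4) \<subseteq> subcube k g" if y: "y \<in> B" for y
      proof
        fix x assume x: "x \<in> ball y (h / 4)"
        show "x \<in> subcube k g" unfolding in_subcube
        proof
          fix i
          have "\<bar>(y - x) $ i\<bar> <= norm (y - x)" by (rule component_le_norm_cart)
          then have "\<bar>y $ i - x $ i\<bar> < h / 4" using x by (simp add: dist_norm)
          moreover define u where "u = real (g i) * h"
          have "(real (g i) + 1/4) * h < y $ i" "y $ i < (real (g i) + 3/4) * h" using y by (auto simp: B_def mem_box_cart)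
          then have "u + h / 4 < y $ i" "y $ i < u + 3 * h / 4" by (simp_all add: u_def algebra_simps)
          ultimately have "u < x $ i" "x $ i < u + h" by linarith+
          then have "real (g i) * h < x $ i" "x $ i < (real (g i) + 1) * h" by (simp_all add: u_def algebra_simps)
          then show "real (g i) / real k < x $ i \<and> x $ i < real (Suc (g i)) / real k" by (simp add: h_def algebra_simps add_divide_distrib)
        qed
      qed
      have BA': "B \<subseteq> subcube k g" using BA h by (meson centre_in_ball divide_pos_pos subsetD subsetI zero_less_numeral)
      have mA: "emeasure cube_measure (subcube k g) = ennreal (h ^ ?d)"
      proof -
        have "emeasure lborel (subcube k g) = ennreal (\<Prod>b\<in>Basis. ((\<chi> i. real (Suc (g i)) / real k) - (\<chi> i. real (g i) / real k)) \<bullet> b)" unfolding subcube_def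
          by (rule emeasure_lborel_box) (auto simp: Basis_vec_def inner_axis divide_right_mono)
        also have "(\<Prod>b\<in>(Basis :: (real^'n) set). ((\<chi> i. real (Suc (g i)) / real k) - (\<chi> i. real (g i) / real k)) \<bullet> b) = (\<Prod>b\<in>(Basis :: (real^'n) set). h)"
          by (intro prod.cong refl) (auto simp: Basis_vec_def inner_axis h_def simp flip: diff_divide_distrib)
        finally show ?thesis using emeasure_cube_measure[of "subcube k g"] subcube_subset_cube[OF k0 gm(1)] by simp
      qed
      have mB: "emeasure cube_measure B = ennreal ((h / 2) ^ ?d)"
      proof -
        have "emeasure lborel B = ennreal (\<Prod>b\<in>Basis. ((\<chi> i. (real (g i) + 3/4) * h) - (\<chi> i. (real (g i) + 1/4) * h)) \<bullet> b)" unfolding B_def using h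
          by (intro emeasure_lborel_box) (auto simp: Basis_vec_def inner_axis)
        also have "(\<Prod>b\<in>(Basis :: (real^'n) set). ((\<chi> i. (real (g i) + 3/4) * h) - (\<chi> i. (real (g i) + 1/4) * h)) \<bullet> b) = (\<Prod>b\<in>(Basis :: (real^'n) set). h / 2)"
          by (intro prod.cong refl) (auto simp: Basis_vec_def inner_axis algebra_simps)
        finally show ?thesis using emeasure_cube_measure[of B] subcube_subset_cube[OF k0 gm(1)] BA' by (simp add: B_def)
      qed
      have st: "AE cv in P. cv 0 \<notin> subcube k g" using P(5) by eventually_elim (use gm in auto)
      have "ennreal ((h ^ ?d) powr (al - 1) * (h / 4 / 2)) * emeasure cube_measure B
         <= (\<integral>\<^sup>+x. ennpow (multiplicity P x) al * indicator (subcube k g) x \<partial>hausdorff1)"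
        using h al by (intro alpha_mass_localized_ge[OF P(1,2) r _ st _ BA BA' mA]) (auto simp: B_def)
      then show ?thesis using h by (simp add: mB ennreal_mult[symmetric])
    qed
    have "ennreal (real k powr - \<beta> / 2 ^ (?d + 4)) <= of_nat (card J) * ennreal ((h ^ ?d) powr (al - 1) * (h / 8) * (h / 2) ^ ?d)"
    proof -
      \<comment> \<open>The k^d cells compensate the mass factor h^d, leaving the exponent d(al-1) +
        1 = \<beta> of h. The factors 1/2 for the empty cells, 1/8 and 2^(-d) make up
        2^(-(d+4)).\<close>
      have "real k powr - \<beta> = real k powr (real ?d) * ((h ^ ?d) powr (al - 1) * h * h ^ ?d)"
      proof -
        have hp: "h = real k powr (- 1)" using k0 by (simp add: h_def powr_minus inverse_eq_divide)
        have hd: "h ^ ?d = real k powr (- real ?d)" using k0 by (simp add: h_def powr_minus powr_realpow inverse_eq_divide power_one_over)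
        have "real k powr - \<beta> = real k powr (real ?d + (- real ?d * (al - 1) + (- 1) + - real ?d))" by (simp add: \<beta> algebra_simps)
        also have "... = real k powr (real ?d) * (real k powr (- real ?d * (al - 1)) * real k powr (- 1) * real k powr (- real ?d))" by (simp only: powr_add)
        also have "... = real k powr (real ?d) * ((h ^ ?d) powr (al - 1) * h * h ^ ?d)" by (simp only: hd powr_powr hp[symmetric])
        finally show ?thesis .
      qed
      then have "real k powr - \<beta> / 2 ^ (?d + 4) = real k ^ ?d / 2 * ((h ^ ?d) powr (al - 1) * (h / 8) * (h / 2) ^ ?d)"
        using k0 by (simp add: powr_realpow power_add power_divide)
      also have "... <= real (card J) * ((h ^ ?d) powr (al - 1) * (h / 8) * (h / 2) ^ ?d)"
      proof (rule mult_right_mono)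
        have "real (k ^ ?d) <= real (2 * card J)" using cardJ by (rule of_nat_mono)
        then show "real k ^ ?d / 2 <= real (card J)" by simp
      qed (use h in simp)
      finally show ?thesis using h by (simp add: ennreal_of_nat_eq_real_of_nat ennreal_mult[symmetric] ennreal_leI)
    qed
    also have "... = (\<Sum>g\<in>J. ennreal ((h ^ ?d) powr (al - 1) * (h / 8) * (h / 2) ^ ?d))" by simp
    also have "... <= (\<Sum>g\<in>J. \<integral>\<^sup>+x. ennpow (multiplicity P x) al * indicator (subcube k g) x \<partial>hausdorff1)" by (intro sum_mono each)
    also have "... = (\<integral>\<^sup>+x. (\<Sum>g\<in>J. ennpow (multiplicity P x) al * indicator (subcube k g) x) \<partial>hausdorff1)" by (rule nn_integral_sum[symmetric]) simp
    also have "... <= alpha_mass al P" unfolding alpha_mass_eq[OF r]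
    proof (rule nn_integral_mono)
      fix x
      have "(\<Sum>g\<in>J. ennpow (multiplicity P x) al * indicator (subcube k g) x) = ennpow (multiplicity P x) al * indicator (\<Union>g\<in>J. subcube k g) x"
        using finJ subcube_disjoint[OF k0, of J] by (simp add: indicator_UN_disjoint sum_distrib_left)
      also have "... <= ennpow (multiplicity P x) al" by (simp add: indicator_def)
      finally show "(\<Sum>g\<in>J. ennpow (multiplicity P x) al * indicator (subcube k g) x) <= ennpow (multiplicity P x) al" .
    qed
    finally show "ennreal (real k powr - \<beta> / 2 ^ (?d + 4)) <= e" using P(6) by simp
  qed
  have "real N powr - (\<beta> / real ?d) * (3 powr - \<beta> / 2 ^ (?d + 4)) = (3 * real N powr (1 / real ?d)) powr - \<beta> / 2 ^ (?d + 4)" by (simp add: powr_mult powr_powr mult_ac)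
  also have "... <= real k powr - \<beta> / 2 ^ (?d + 4)" using k3 k0 \<beta> by (intro divide_right_mono powr_mono2') auto
  finally show ?thesis using main unfolding \<beta>_def by (meson ennreal_leI order.trans)
qed



section \<open>The quantization error of absolutely continuous measures\<close>

text \<open>The smaller density is the larger one thinned by the weight \<open>f x / g x\<close>,
  which is at most 1; finiteness of \<open>g\<close> makes this quotient recover
  \<open>f\<close>.\<close>

lemma quant_error_mono:
  fixes f g :: "'a::euclidean_space => ennreal"
  assumes [measurable]: "f \<in> borel_measurable borel" "g \<in> borel_measurable borel"
    and le: "\<And>x. f x <= g x" "\<And>x. g x < top" and al: "0 <= al"
  shows "density_error al f N <= density_error al g N"
proof -
  have gf: "g x * (f x / g x) = f x" for x
  proof (cases "g x = 0")
    case True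
    then show ?thesis using le(1)[of x] by simp
  next
    case False
    then show ?thesis using le(2)[of x] by (simp add: ennreal_times_divide mult.commute[of "g x"] ennreal_mult_divide_eq)
  qed
  have le1: "f x / g x <= 1" for x
  proof (cases "g x = 0")
    case True
    then show ?thesis using le(1)[of x] by simp
  next
    case False
    have "f x / g x <= g x / g x" by (rule divide_right_mono_ennreal[OF le(1)])
    then show ?thesis using False le(2)[of x] by simp
  qed
  have "density lborel f = density (density lborel g) (\<lambda>x. f x / g x)" by (subst density_density_eq) (simp_all add: gf)
  then show ?thesis using quant_error_density_le[where \<nu>="density lborel g" and N=N, OF _ le1 al] by simp
qed

lemma density_add_measure:
  fixes f g :: "'a => ennreal"
  assumes [measurable]: "f \<in> borel_measurable M" "g \<in> borel_measurable M"
  shows "density M (\<lambda>x. f x + g x) = add_measure (density M f) (density M g)"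
proof (rule measure_eqI)
  fix A assume "A \<in> sets (density M (\<lambda>x. f x + g x))"
  then have [measurable]: "A \<in> sets M" by simp
  show "emeasure (density M (\<lambda>x. f x + g x)) A = emeasure (add_measure (density M f) (density M g)) A"
    by (simp add: emeasure_add_measure emeasure_density distrib_right nn_integral_add)
qed simp

lemma quant_error_plus_le:
  fixes f g :: "'a::euclidean_space => ennreal"
  assumes "f \<in> borel_measurable borel" "g \<in> borel_measurable borel" and al: "0 < al" "al <= 1"
  shows "density_error al (\<lambda>x. f x + g x) (N + M)
    <= density_error al f N + density_error al g M" using assms by (subst density_add_measure) (auto intro: quant_error_add_le)

lemma quant_error_sum_le:
  fixes f :: "'j => 'a::euclidean_space => ennreal"
  assumes "finite J" "J \<noteq> {}" and m: "\<And>j. j \<in> J ==> f j \<in> borel_measurable borel" and al: "0 < al" "al <= 1"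
  shows "density_error al (\<lambda>x. \<Sum>j\<in>J. f j x) (\<Sum>j\<in>J. N j)
    <= (\<Sum>j\<in>J. density_error al (f j) (N j))" using assms(1,2) m
proof (induction J rule: finite_ne_induct)
  case (insert j J)
  have "density_error al (\<lambda>x. f j x + (\<Sum>i\<in>J. f i x)) (N j + (\<Sum>i\<in>J. N i))
    <= density_error al (f j) (N j) + density_error al (\<lambda>x. \<Sum>i\<in>J. f i x) (\<Sum>i\<in>J. N i)" using insert by (intro quant_error_plus_le al borel_measurable_sum) auto
  also have "... <= density_error al (f j) (N j) + (\<Sum>i\<in>J. density_error al (f i) (N i))" using insert by (intro add_left_mono) auto
  finally show ?case using insert by simp
qed simp

subsection \<open>Cubes\<close>

definition cube :: "real^'n => real => (real^'n) set" where
  "cube v l = cbox v (v + l *\<^sub>R 1)"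

lemma in_cube: "x \<in> cube v l \<longleftrightarrow> (\<forall>i. v $ i <= x $ i \<and> x $ i <= v $ i + l)" by (simp add: cube_def mem_box_cart)

lemma sets_cube [measurable, simp]: "cube v l \<in> sets borel" by (simp add: cube_def)

lemma compact_cube: "compact (cube v l)" by (simp add: cube_def compact_cbox)

lemma emeasure_cube: "0 <= l ==> emeasure lborel (cube v l :: (real^'n) set) = ennreal (l ^ CARD('n))"
proof -
  assume "0 <= l"
  then have "emeasure lborel (cube v l) = ennreal (\<Prod>b\<in>Basis. (v + l *\<^sub>R 1 - v) \<bullet> b)"
    unfolding cube_def by (intro emeasure_lborel_cbox) (auto simp: Basis_vec_def inner_axis)
  also have "(\<Prod>b\<in>(Basis :: (real^'n) set). (v + l *\<^sub>R 1 - v) \<bullet> b) = (\<Prod>b\<in>(Basis :: (real^'n) set). l)" by (intro prod.cong refl) (auto simp: Basis_vec_def inner_axis)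
  finally show ?thesis by simp
qed

text \<open>A change of variables. Both densities and the cube are left free, so that the identity
  serves a similarity as well as its inverse.\<close>

lemma density_cube_affine:
  fixes w t :: "real^'n"
  assumes r: "0 < r" and b: "0 < b" and a: "0 <= a"
  shows "density lborel (\<lambda>x. ennreal a * indicator (cube (t + r *\<^sub>R w) (r * m)) x) =
    density (distr (density lborel (\<lambda>x. ennreal b * indicator (cube w m) x)) borel (\<lambda>x. t + r *\<^sub>R x))
      (\<lambda>_. ennreal (a * r ^ CARD('n) / b))"
proof (rule measure_eqI)
  fix A :: "(real^'n) set"
  assume "A \<in> sets (density lborel (\<lambda>x. ennreal a * indicator (cube (t + r *\<^sub>R w) (r * m)) x))"
  then have A[measurable]: "A \<in> sets borel" by simp
  have mem: "t + r *\<^sub>R x \<in> cube (t + r *\<^sub>R w) (r * m) \<longleftrightarrow> x \<in> cube w m" for x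
  proof -
    have "r * w $ i <= r * x $ i \<and> r * x $ i <= r * w $ i + r * m \<longleftrightarrow> w $ i <= x $ i \<and> x $ i <= w $ i + m" for i
      using r mult_le_cancel_left_pos[OF r, of "x $ i" "w $ i + m"] by (simp add: distrib_left)
    then show ?thesis by (simp add: in_cube)
  qed
  let ?F = "\<lambda>y. ennreal a * indicator (cube (t + r *\<^sub>R w) (r * m)) y * indicator A y"
  have "emeasure (density lborel (\<lambda>x. ennreal a * indicator (cube (t + r *\<^sub>R w) (r * m)) x)) A = (\<integral>\<^sup>+y. ?F y \<partial>lborel)" by (rule emeasure_density) auto
  also have "... = (\<integral>\<^sup>+y. ?F y \<partial>density (distr lborel borel (\<lambda>x. t + r *\<^sub>R x)) (\<lambda>_. ennreal (\<bar>r\<bar> ^ DIM(real^'n))))" using lborel_affine[of r t] r by simp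
  also have "... = (\<integral>\<^sup>+x. ennreal (r ^ CARD('n)) * ?F (t + r *\<^sub>R x) \<partial>lborel)" using r by (simp add: nn_integral_density nn_integral_distr)
  also have "... = (\<integral>\<^sup>+x. ennreal b * indicator (cube w m) x * (ennreal (a * r ^ CARD('n) / b) * indicator A (t + r *\<^sub>R x)) \<partial>lborel)"
  proof (rule nn_integral_cong)
    fix x
    have "ennreal (r ^ CARD('n)) * ennreal a = ennreal b * ennreal (a * r ^ CARD('n) / b)" using r a b by (simp add: ennreal_mult[symmetric] mult.commute)
    then show "ennreal (r ^ CARD('n)) * ?F (t + r *\<^sub>R x) = ennreal b * indicator (cube w m) x * (ennreal (a * r ^ CARD('n) / b) * indicator A (t + r *\<^sub>R x))"
      using mem[of x] by (auto simp: indicator_def)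
  qed
  also have "... = emeasure (density (distr (density lborel (\<lambda>x. ennreal b * indicator (cube w m) x)) borel (\<lambda>x. t + r *\<^sub>R x)) (\<lambda>_. ennreal (a * r ^ CARD('n) / b))) A"
    by (simp add: emeasure_density nn_integral_distr nn_integral_density)
  finally show "emeasure (density lborel (\<lambda>x. ennreal a * indicator (cube (t + r *\<^sub>R w) (r * m)) x)) A =
    emeasure (density (distr (density lborel (\<lambda>x. ennreal b * indicator (cube w m) x)) borel (\<lambda>x. t + r *\<^sub>R x)) (\<lambda>_. ennreal (a * r ^ CARD('n) / b))) A" .
qed simp

lemma cube_measure_eq: "(cube_measure :: (real^'n) measure) = density lborel (\<lambda>x. ennreal 1 * indicator (cube 0 1) x)" by (simp add: cube_measure_def cube_def)

text \<open>The scaling inequality is used for the similarity and for its inverse; the two factors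
  are reciprocal, so equality results.\<close>

lemma quant_error_cube:
  fixes v :: "real^'n"
  assumes a: "0 < a" and l: "0 < l" and al: "0 < al" "al <= 1"
  shows "density_error al (\<lambda>x. ennreal a * indicator (cube v l) x) N =
    ennreal (a powr al * l powr (real CARD('n) * al + 1)) * cube_error al TYPE('n) N"
proof (rule antisym)
  let ?c = "a * l ^ CARD('n)"
  have c: "0 < ?c" using a l by simp
  have ce: "?c powr al * l = a powr al * l powr (real CARD('n) * al + 1)" using a l by (simp add: powr_mult powr_add powr_powr flip: powr_realpow)
  have 1: "density lborel (\<lambda>x. ennreal a * indicator (cube v l) x) =
     density (distr cube_measure borel (\<lambda>x. v + l *\<^sub>R x)) (\<lambda>_. ennreal ?c)"
    using density_cube_affine[OF l zero_less_one less_imp_le[OF a], of v 0 1] unfolding cube_measure_eq by simp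
  show "density_error al (\<lambda>x. ennreal a * indicator (cube v l) x) N \<le>
    ennreal (a powr al * l powr (real CARD('n) * al + 1)) * cube_error al TYPE('n) N" unfolding 1 ce[symmetric] by (rule quant_error_affine_le[OF l c al])
  have l': "0 < 1 / l" using l by simp
  have 2: "(cube_measure :: (real^'n) measure) =
     density (distr (density lborel (\<lambda>x. ennreal a * indicator (cube v l) x)) borel (\<lambda>x. - (1 / l) *\<^sub>R v + (1 / l) *\<^sub>R x)) (\<lambda>_. ennreal (1 / ?c))"
    using density_cube_affine[OF l' a zero_le_one, of "- (1 / l) *\<^sub>R v" v l] l unfolding cube_measure_eq by (simp add: power_one_over mult.commute)
  have c': "0 < 1 / ?c" using c by simp
  have "cube_error al TYPE('n) N \<le>
     ennreal ((1 / ?c) powr al * (1 / l)) * density_error al (\<lambda>x. ennreal a * indicator (cube v l) x) N" by (subst 2) (rule quant_error_affine_le[OF l' c' al])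
  then have "ennreal (?c powr al * l) * cube_error al TYPE('n) N \<le>
     ennreal (?c powr al * l) * (ennreal ((1 / ?c) powr al * (1 / l)) * density_error al (\<lambda>x. ennreal a * indicator (cube v l) x) N)" by (rule mult_left_mono) simp
  also have "... = density_error al (\<lambda>x. ennreal a * indicator (cube v l) x) N"
  proof -
    have "?c powr al * l * ((1 / ?c) powr al * (1 / l)) = 1" using a c l by (simp add: powr_divide)
    then show ?thesis using c l by (simp add: mult.assoc[symmetric] ennreal_mult[symmetric])
  qed
  finally show "ennreal (a powr al * l powr (real CARD('n) * al + 1)) * cube_error al TYPE('n) N
     <= density_error al (\<lambda>x. ennreal a * indicator (cube v l) x) N" unfolding ce .
qed

subsection \<open>Counting grid cells\<close>

lemma card_ctr_box:
  fixes a b :: "real^'n"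
  assumes h: "0 < h" and S: "S \<subseteq> cbox a b"
  shows "finite (ctr h 0 ` S)" "card (ctr h 0 ` S) <= (\<Prod>i\<in>UNIV. nat \<lfloor>(b $ i - a $ i) / h\<rfloor> + 2)"
proof -
  let ?Z = "PiE UNIV (\<lambda>i. {\<lfloor>a $ i / h\<rfloor>..\<lfloor>b $ i / h\<rfloor>})"
  let ?g = "\<lambda>z :: 'n => int. \<chi> i. h * (of_int (z i) + 1 / 2)"
  have sub: "ctr h 0 ` S \<subseteq> ?g ` ?Z"
  proof
    fix c assume "c \<in> ctr h 0 ` S"
    then obtain x where x: "x \<in> S" "c = ctr h 0 x" by auto
    then have xb: "a $ i <= x $ i" "x $ i <= b $ i" for i using S by (auto simp: mem_box_cart)
    have "(\<lambda>i. \<lfloor>x $ i / h\<rfloor>) \<in> ?Z" using xb h by (auto intro!: floor_mono divide_right_mono)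
    then have "?g (\<lambda>i. \<lfloor>x $ i / h\<rfloor>) \<in> ?g ` ?Z" by (rule imageI)
    moreover have "c = ?g (\<lambda>i. \<lfloor>x $ i / h\<rfloor>)" by (simp add: x ctr_def)
    ultimately show "c \<in> ?g ` ?Z" by (simp only:)
  qed
  have fin: "finite ?Z" by (intro finite_PiE) auto
  then show "finite (ctr h 0 ` S)" using sub finite_surj by blast
  have "card (ctr h 0 ` S) <= card (?g ` ?Z)" using fin sub by (intro card_mono) auto
  also have "... <= card ?Z" by (rule card_image_le[OF fin])
  also have "... = (\<Prod>i\<in>UNIV. card {\<lfloor>a $ i / h\<rfloor>..\<lfloor>b $ i / h\<rfloor>})" by (rule card_PiE) simp
  also have "... <= (\<Prod>i\<in>UNIV. nat \<lfloor>(b $ i - a $ i) / h\<rfloor> + 2)"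
  proof (rule prod_mono, intro conjI)
    fix i
    \<comment> \<open>Rounding the two ends separately costs at most 1 and counting both end cells
      costs another 1, which explains the summand 2.\<close>
    have "\<lfloor>b $ i / h\<rfloor> <= \<lfloor>a $ i / h\<rfloor> + \<lfloor>(b $ i - a $ i) / h\<rfloor> + 1" by (simp add: diff_divide_distrib) linarith
    then have "\<lfloor>b $ i / h\<rfloor> - \<lfloor>a $ i / h\<rfloor> + 1 <= \<lfloor>(b $ i - a $ i) / h\<rfloor> + 2" by linarith
    then show "card {\<lfloor>a $ i / h\<rfloor>..\<lfloor>b $ i / h\<rfloor>} <= nat \<lfloor>(b $ i - a $ i) / h\<rfloor> + 2" by simp
  qed simp
  finally show "card (ctr h 0 ` S) <= (\<Prod>i\<in>UNIV. nat \<lfloor>(b $ i - a $ i) / h\<rfloor> + 2)" .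
qed

lemma finite_measure_density_bounded_support:
  fixes f :: "'a::euclidean_space => ennreal"
  assumes "f \<in> borel_measurable borel" "(\<integral>\<^sup>+x. f x \<partial>lborel) < top"
  shows "finite_measure (density lborel f)" using assms by (intro finite_measureI) (simp add: emeasure_density less_top)

lemma quant_error_le_mass:
  fixes f :: "real^'n => ennreal"
  assumes f[measurable]: "f \<in> borel_measurable borel" and fin: "(\<integral>\<^sup>+x. f x \<partial>lborel) < top"
    and supp: "\<And>x. x \<notin> cube v L ==> f x = 0" and L: "0 < L" and N: "3 ^ CARD('n) <= N"
    and al: "0 < al" "al < 1" "real CARD('n) * (1 - al) < 1"
  shows "density_error al f N \<le>
    ennreal (irr_const al TYPE('n) * 3 * L * real N powr - (beta_exp al TYPE('n) / real CARD('n))) * ennpow (\<integral>\<^sup>+x. f x \<partial>lborel) al"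
proof -
  let ?d = "CARD('n)"
  define n where "n = real N powr (1 / real ?d)"
  have N0: "0 < real N" using N by (meson less_le_trans of_nat_0_less_iff zero_less_numeral zero_less_power)
  have n: "3 <= n"
  proof -
    have "(3::real) = (3 powr real ?d) powr (1 / real ?d)" by (simp add: powr_powr)
    also have "... = (real (3 ^ ?d)) powr (1 / real ?d)" by (simp add: powr_realpow)
    also have "... <= n" unfolding n_def using N by (intro powr_mono2) (simp_all only: of_nat_le_iff, auto)
    finally show ?thesis .
  qed
  \<comment> \<open>A cube of side \<open>L\<close> meets at most (n/3 + 2)^d cells of this mesh,
    and n at least 3 makes this at most n^d = N. The product of \<open>h\<close> and N^(1-al) has
    exponent 1 - al - 1/d = -beta/d.\<close>
  define h where "h = 3 * L / n"
  have h: "0 < h" using L n by (simp add: h_def)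
  have card: "finite (ctr h 0 ` cube v L)" "card (ctr h 0 ` cube v L) <= N"
  proof -
    note c = card_ctr_box[OF h, of "cube v L" v "v + L *\<^sub>R 1"]
    show "finite (ctr h 0 ` cube v L)" using c(1) by (simp add: cube_def)
    have "card (ctr h 0 ` cube v L) <= (\<Prod>i\<in>(UNIV :: 'n set). nat \<lfloor>((v + L *\<^sub>R 1) $ i - v $ i) / h\<rfloor> + 2)" using c(2) by (simp add: cube_def)
    also have "... = (nat \<lfloor>L / h\<rfloor> + 2) ^ ?d" by simp
    finally have "real (card (ctr h 0 ` cube v L)) <= real (nat \<lfloor>L / h\<rfloor> + 2) ^ ?d" by (metis of_nat_le_iff of_nat_power)
    also have "... <= n ^ ?d"
    proof (rule power_mono)
      have "L / h = n / 3" using L n by (simp add: h_def)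
      moreover have "real (nat \<lfloor>L / h\<rfloor>) <= L / h" using L h by simp
      ultimately show "real (nat \<lfloor>L / h\<rfloor> + 2) <= n" using n by simp
    qed simp
    also have "... = real N" using N0 n by (simp add: n_def powr_powr flip: powr_realpow)
    finally show "card (ctr h 0 ` cube v L) <= N" by simp
  qed
  have fm: "finite_measure (density lborel f)" by (rule finite_measure_density_bounded_support[OF f fin])
  have at: "emeasure (density lborel f) {x} = 0" for x
  proof -
    have "{x} \<in> null_sets lborel" by (simp add: null_sets_def)
    then show ?thesis by (simp add: emeasure_density nn_integral_null_set)
  qed
  have ae: "AE y in density lborel f. y \<in> cube v L" using supp by (subst AE_density) (auto simp: zero_less_iff_neq_zero)
  have "density_error al f N <= ennreal (irr_const al TYPE('n) * h * real N powr (1 - al)) * ennpow (emeasure (density lborel f) UNIV) al"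
    by (rule quant_error_atomless_le[OF _ fm at h _ ae card al]) simp_all
  also have "emeasure (density lborel f) UNIV = (\<integral>\<^sup>+x. f x \<partial>lborel)" by (simp add: emeasure_density)
  also have "irr_const al TYPE('n) * h * real N powr (1 - al) = irr_const al TYPE('n) * 3 * L * real N powr - (beta_exp al TYPE('n) / real ?d)"
  proof -
    have "real N powr - (beta_exp al TYPE('n) / real ?d) = real N powr ((1 - al) - 1 / real ?d)"
      by (simp add: beta_exp_def add_divide_distrib diff_divide_distrib algebra_simps)
    also have "... = real N powr (1 - al) / n" by (simp add: powr_diff n_def)
    finally show ?thesis by (simp add: h_def mult_ac)
  qed
  finally show ?thesis .
qed

subsection \<open>The limit for the unit cube\<close>

text \<open>The cube is covered by k^d cells, each supplied by its own \<open>M\<close> sources;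
  overlaps of the closed cells only enlarge the density. All powers of k cancel, since beta + d - (d
  * al + 1) = 0.\<close>

lemma scaled_cube_multiple_le:
  assumes k: "0 < k" and M: "0 < M" and al: "0 < al" "al < 1"
  shows "scaled_cube al TYPE('n::finite) (k ^ CARD('n) * M) <= scaled_cube al TYPE('n) M"
proof -
  let ?d = "CARD('n)" and ?q = "cube_error al TYPE('n)"
  define s where "s = beta_exp al TYPE('n) / real ?d"
  define J where "J = (multi_index k :: ('n => nat) set)"
  define f where "f g x = ennreal 1 * indicator (cube (\<chi> i. real (g i) / real k) (1 / real k)) x" for g :: "'n => nat" and x :: "real^'n"
  have J: "finite J" "card J = k ^ ?d" by (simp_all add: J_def card_multi_index)
  then have Jne: "J \<noteq> {}" using k by auto
  have cover: "ennreal 1 * indicator (cube 0 1) x <= (\<Sum>g\<in>J. f g x)" for x :: "real^'n"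
  proof (cases "x \<in> cube 0 1")
    case True
    then have x: "0 <= x $ i" "x $ i <= 1" for i by (auto simp: in_cube)
    \<comment> \<open>The minimum with \<open>k - 1\<close> assigns the coordinate value 1 to the
      last cell.\<close>
    define g where "g i = min (k - 1) (nat \<lfloor>x $ i * k\<rfloor>)" for i
    have "g \<in> J" using k by (auto simp: J_def multi_index_def g_def min_less_iff_disj)
    moreover have "f g x = 1"
    proof -
      have "real (g i) <= x $ i * k \<and> x $ i * k <= real (g i) + 1" for i
      proof
        have "real (g i) <= real (nat \<lfloor>x $ i * k\<rfloor>)" by (simp add: g_def)
        also have "... <= x $ i * k" using x[of i] by simp
        finally show "real (g i) <= x $ i * k" .
        show "x $ i * k <= real (g i) + 1"
        proof (cases "nat \<lfloor>x $ i * k\<rfloor> <= k - 1")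
          case True
          then have "g i = nat \<lfloor>x $ i * k\<rfloor>" by (simp add: g_def)
          then show ?thesis using x[of i] by simp
        next
          case False
          then have "g i = k - 1" by (simp add: g_def)
          moreover have "x $ i * k <= 1 * real k" using x(2)[of i] by (intro mult_right_mono) auto
          ultimately show ?thesis using k by (simp add: of_nat_diff)
        qed
      qed
      then have "x \<in> cube (\<chi> i. real (g i) / real k) (1 / real k)" using k by (simp add: in_cube divide_le_eq le_divide_eq flip: add_divide_distrib)
      then show ?thesis by (simp add: f_def)
    qed
    moreover have "f g x <= (\<Sum>g\<in>J. f g x)" using \<open>g \<in> J\<close> J(1) by (intro member_le_sum) auto
    ultimately show ?thesis using True by simp
  qed simp
  have "?q (k ^ ?d * M) <= density_error al (\<lambda>x. \<Sum>g\<in>J. f g x) (k ^ ?d * M)" unfolding cube_measure_eq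
  proof (rule quant_error_mono[OF _ _ cover])
    show "(\<Sum>g\<in>J. f g x) < top" for x using J(1) by (auto simp: f_def split: split_indicator)
  qed (use al in \<open>auto simp: f_def[abs_def]\<close>)
  also have "k ^ ?d * M = (\<Sum>g\<in>J. M)" using J by simp
  also have "density_error al (\<lambda>x. \<Sum>g\<in>J. f g x) (\<Sum>g\<in>J. M) <= (\<Sum>g\<in>J. density_error al (f g) M)" using J Jne al by (intro quant_error_sum_le) (auto simp: f_def[abs_def])
  also have "... = (\<Sum>g\<in>J. ennreal ((1 / real k) powr (real ?d * al + 1)) * ?q M)"
    unfolding f_def[abs_def] using k al by (intro sum.cong refl) (subst quant_error_cube, simp_all)
  also have "... = ennreal (real (k ^ ?d)) * (ennreal ((1 / real k) powr (real ?d * al + 1)) * ?q M)" using J by (simp add: ennreal_of_nat_eq_real_of_nat)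
  finally have le: "?q (k ^ ?d * M) <= ennreal (real (k ^ ?d)) * (ennreal ((1 / real k) powr (real ?d * al + 1)) * ?q M)" using J by simp
  have "scaled_cube al TYPE('n) (k ^ ?d * M) \<le>
     ennreal (real (k ^ ?d * M) powr s) * (ennreal (real (k ^ ?d)) * (ennreal ((1 / real k) powr (real ?d * al + 1)) * ?q M))"
    unfolding scaled_quant_error_def s_def by (intro mult_left_mono le) simp
  also have "... = ennreal (real (k ^ ?d * M) powr s * real (k ^ ?d) * (1 / real k) powr (real ?d * al + 1)) * ?q M" by (simp add: ennreal_mult mult.assoc)
  also have "real (k ^ ?d * M) powr s * real (k ^ ?d) * (1 / real k) powr (real ?d * al + 1) = real M powr s"
  proof -
    have "real (k ^ ?d * M) powr s = real k powr (real ?d * s) * real M powr s" using k by (simp add: powr_mult powr_powr flip: powr_realpow)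
    moreover have "real (k ^ ?d) = real k powr real ?d" using k by (simp add: powr_realpow)
    moreover have "(1 / real k) powr (real ?d * al + 1) = real k powr - (real ?d * al + 1)" by (subst powr_minus_divide) (simp add: powr_divide)
    moreover have "real k powr (real ?d * s) * real k powr real ?d * real k powr - (real ?d * al + 1) = 1" using k by (simp add: powr_add[symmetric] s_def beta_exp_def)
    ultimately show ?thesis by (simp add: mult_ac)
  qed
  finally show ?thesis by (simp add: scaled_quant_error_def s_def)
qed

text \<open>A variant of Fekete's argument. Some \<open>M\<close> comes close to the infimum, the
  multiples k^d M are at least as good, and for N between two consecutive multiples monotonicity
  loses only the factor ((k+1)/k)^beta, which tends to 1.\<close>

lemma scaled_cube_tendsto:
  assumes al: "0 < al" "al < 1" "real CARD('n::finite) * (1 - al) < 1"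
  obtains c where "0 < c" "scaled_cube al TYPE('n) \<longlonglongrightarrow> ennreal c"
    "\<And>N. 1 <= N ==> ennreal c <= scaled_cube al TYPE('n) N"
proof -
  let ?d = "CARD('n)" and ?q = "cube_error al TYPE('n)"
  define s where "s = beta_exp al TYPE('n) / real ?d"
  have \<beta>: "0 < beta_exp al TYPE('n)" using al(3) by (auto simp: beta_exp_def algebra_simps)
  then have s: "0 < s" by (simp add: s_def)
  define F where "F = scaled_cube al TYPE('n)"
  have F: "F N = ennreal (real N powr s) * ?q N" for N by (simp add: F_def scaled_quant_error_def s_def)
  define C where "C = (INF N\<in>{1..}. F N)"
  define c0 where "c0 = 3 powr - beta_exp al TYPE('n) / 2 ^ (?d + 4)"
  have c0: "0 < c0" by (simp add: c0_def)
  have low: "ennreal c0 <= C" unfolding C_def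
  proof (rule INF_greatest)
    fix N :: nat assume "N \<in> {1..}"
    then have N: "1 <= N" by simp
    have "ennreal c0 = ennreal (real N powr s) * ennreal (real N powr - s * c0)"
    proof -
      have "real N powr s * (real N powr - s * c0) = c0" using N by (simp add: mult.assoc[symmetric] powr_add[symmetric])
      then show ?thesis using c0 by (simp add: ennreal_mult[symmetric])
    qed
    also have "... <= F N" unfolding F using quant_error_cube_ge[OF N al] by (intro mult_left_mono) (simp_all add: s_def c0_def)
    finally show "ennreal c0 <= F N" .
  qed
  have "F (3 ^ ?d) < top"
  proof -
    have "?q (3 ^ ?d) <= ennreal (irr_const al TYPE('n) * 3 * 1 * real (3 ^ ?d) powr - (beta_exp al TYPE('n) / real ?d)) *
        ennpow (\<integral>\<^sup>+x. ennreal 1 * indicator (cube (0 :: real^'n) 1) x \<partial>lborel) al" unfolding cube_measure_eq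
      by (rule quant_error_le_mass[of _ 0 1]) (use al emeasure_cube[of 1 "0 :: real^'n"] in auto)
    also have "... < top" using emeasure_cube[of 1 "0 :: real^'n"] ennpow_ennreal[of 1 al] by (simp add: ennreal_mult_less_top)
    finally show ?thesis unfolding F by (simp add: ennreal_mult_less_top)
  qed
  moreover have "C <= F (3 ^ ?d)" unfolding C_def by (rule INF_lower) simp
  ultimately have Ctop: "C < top" by simp
  then obtain c where c: "0 <= c" "C = ennreal c" by (cases C) auto
  have "0 < c" using low c0 c by (auto simp: ennreal_le_iff)
  moreover have ge: "C <= F N" if "1 <= N" for N unfolding C_def using that by (intro INF_lower) simp
  moreover have "F \<longlonglongrightarrow> C"
  proof (rule order_tendstoI)
    fix a assume "a < C"
    then show "\<forall>\<^sub>F N in sequentially. a < F N" using ge by (intro eventually_sequentiallyI[of 1]) (auto intro: less_le_trans)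
  next
    fix e assume "C < e"
    then obtain M where M: "1 <= M" "F M < e" unfolding C_def INF_less_iff by auto
    then have "F M < top" using less_le_trans top_greatest by blast
    then obtain r where r: "0 <= r" "F M = ennreal r" by (cases "F M") auto
    have lim: "(\<lambda>k. ennreal (((real k + 1) / real k) powr (real ?d * s) * r)) \<longlonglongrightarrow> ennreal (1 powr (real ?d * s) * r)"
    proof (intro tendsto_intros)
      have "(\<lambda>k. 1 + 1 / real k) \<longlonglongrightarrow> 1 + 0" by (intro tendsto_intros lim_1_over_n)
      moreover have "\<forall>\<^sub>F k in sequentially. 1 + 1 / real k = (real k + 1) / real k" using eventually_gt_at_top[of 0] by eventually_elim (simp add: field_simps)
      ultimately show "(\<lambda>k. (real k + 1) / real k) \<longlonglongrightarrow> 1" by (simp add: tendsto_cong)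
    qed auto
    have "\<forall>\<^sub>F k in sequentially. ennreal (((real k + 1) / real k) powr (real ?d * s) * r) < e" using order_tendstoD(2)[OF lim, of e] M r by simp
    then obtain k0 where k0: "\<And>k. k0 <= k ==> ennreal (((real k + 1) / real k) powr (real ?d * s) * r) < e" unfolding eventually_sequentially by blast
    define k1 where "k1 = max 1 k0"
    show "\<forall>\<^sub>F N in sequentially. F N < e"
    proof (rule eventually_sequentiallyI[of "k1 ^ ?d * M"])
      fix N assume N: "k1 ^ ?d * M <= N"
      have "N < (N + 1) ^ ?d * M"
      proof -
        have "N < (N + 1) ^ 1 * 1" by simp
        also have "... <= (N + 1) ^ ?d * M" using M by (intro mult_mono power_increasing) auto
        finally show ?thesis .
      qed
      then have ex: "\<exists>k. N < (k + 1) ^ ?d * M" by blast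
      define k where "k = (LEAST k. N < (k + 1) ^ ?d * M)"
      have k2: "N < (k + 1) ^ ?d * M" unfolding k_def using LeastI_ex[OF ex] .
      have kk1: "k1 <= k"
      proof (rule ccontr)
        assume "\<not> k1 <= k"
        then have "(k + 1) ^ ?d * M <= k1 ^ ?d * M" by (intro mult_right_mono power_mono) auto
        then show False using k2 N by linarith
      qed
      then have kp: "0 < k" "k0 <= k" by (auto simp: k1_def)
      have k3: "k ^ ?d * M <= N"
      proof -
        have "\<not> N < ((k - 1) + 1) ^ ?d * M" using not_less_Least[of "k - 1" "\<lambda>k. N < (k + 1) ^ ?d * M"] kp by (simp add: k_def)
        then show ?thesis using kp by simp
      qed
      have "F N <= ennreal (((real k + 1) / real k) powr (real ?d * s) * real (k ^ ?d * M) powr s) * ?q (k ^ ?d * M)" unfolding F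
      proof (intro mult_mono ennreal_leI quant_error_antimono k3)
        have "real N <= real ((k + 1) ^ ?d * M)" using k2 by (simp only: of_nat_le_iff less_imp_le)
        then have "real N powr s <= real ((k + 1) ^ ?d * M) powr s" using s by (intro powr_mono2) auto
        also have "... = ((real k + 1) / real k) powr (real ?d * s) * real (k ^ ?d * M) powr s"
        proof -
          have "real ((k + 1) ^ ?d * M) = ((real k + 1) / real k) ^ ?d * real (k ^ ?d * M)" using kp by (simp add: power_divide add.commute)
          moreover have "((real k + 1) / real k) ^ ?d = ((real k + 1) / real k) powr real ?d" using kp by (simp add: powr_realpow)
          ultimately show ?thesis by (simp only: powr_mult powr_powr)
        qed
        finally show "real N powr s <= ((real k + 1) / real k) powr (real ?d * s) * real (k ^ ?d * M) powr s" .
      qed auto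
      also have "... = ennreal (((real k + 1) / real k) powr (real ?d * s)) * F (k ^ ?d * M)" unfolding F by (simp add: ennreal_mult mult.assoc)
      also have "... <= ennreal (((real k + 1) / real k) powr (real ?d * s)) * F M"
        using scaled_cube_multiple_le[OF kp(1), of M al, where 'n='n] M al by (intro mult_left_mono) (auto simp: F_def)
      also have "... < e" using k0[OF kp(2)] r by (simp add: ennreal_mult)
      finally show "F N < e" .
    qed
  qed
  ultimately show thesis using that[of c] c by (simp add: F_def)
qed



section \<open>Approximation by step functions\<close>

text \<open>For a scaled indicator, regularity gives a closed set inside and an open set outside
  with a small difference, and Urysohn's function deviates from the indicator only between them.
  Sums and dominated limits are inherited.\<close>

lemma integrable_approx_continuous:
  fixes f :: "'a::euclidean_space => real"
  assumes "integrable lborel f" "0 < e"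
  shows "\<exists>g. continuous_on UNIV g \<and> (\<integral>\<^sup>+x. ennreal \<bar>f x - g x\<bar> \<partial>lborel) < ennreal e" using assms
proof (induction f arbitrary: e rule: integrable_induct)
  case (base A c)
  define e' where "e' = e / (2 * (\<bar>c\<bar> + 1))"
  have e': "0 < e'" using base by (simp add: e'_def)
  have Al: "A \<in> sets lebesgue" using base by auto
  obtain U where U: "open U" "A \<subseteq> U" "U - A \<in> lmeasurable" "emeasure lebesgue (U - A) < ennreal e'" using sets_lebesgue_outer_open[OF Al e'] by blast
  obtain K where K: "closed K" "K \<subseteq> A" "A - K \<in> lmeasurable" "emeasure lebesgue (A - K) < ennreal e'" using sets_lebesgue_inner_closed[OF Al e'] by blast
  have Ab: "A \<in> sets borel" "U \<in> sets borel" "K \<in> sets borel" using base U K by auto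
  obtain g :: "'a => real" where g: "continuous_on UNIV g" "\<And>x. g x \<in> closed_segment 0 1"
      "\<And>x. x \<in> - U ==> g x = 0" "\<And>x. x \<in> K ==> g x = 1" using Urysohn[of "- U" K 0 "1::real"] U K by (auto simp: closed_Compl)
  have g01: "0 <= g x" "g x <= 1" for x using g(2)[of x] by (auto simp: closed_segment_eq_real_ivl)
  have "\<bar>indicator A x *\<^sub>R c - c * g x\<bar> <= \<bar>c\<bar> * indicator (U - K) x" for x
  proof -
    have "\<bar>indicator A x *\<^sub>R c - c * g x\<bar> = \<bar>c\<bar> * \<bar>indicator A x - g x\<bar>" by (simp add: abs_mult[symmetric] right_diff_distrib mult.commute)
    also have "\<bar>indicator A x - g x\<bar> <= indicator (U - K) x" using g(3)[of x] g(4)[of x] g01[of x] U(2) K(2) by (auto simp: indicator_def)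
    finally show ?thesis by (simp add: mult_left_mono)
  qed
  then have b: "ennreal \<bar>indicator A x *\<^sub>R c - c * g x\<bar> <= ennreal (\<bar>c\<bar> * indicator (U - K) x)" for x by (rule ennreal_leI)
  have eq: "ennreal (\<bar>c\<bar> * indicator (U - K) x) = ennreal \<bar>c\<bar> * indicator (U - K) x" for x by (cases "x \<in> U - K") (simp_all add: indicator_def)
  have "(\<integral>\<^sup>+x. ennreal \<bar>indicator A x *\<^sub>R c - c * g x\<bar> \<partial>lborel) <= (\<integral>\<^sup>+x. ennreal \<bar>c\<bar> * indicator (U - K) x \<partial>lborel)"
    by (rule nn_integral_mono[OF order.trans[OF b eq_refl[OF eq]]])
  also have "... = ennreal \<bar>c\<bar> * emeasure lborel (U - K)" using Ab by (intro nn_integral_cmult_indicator) auto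
  also have "emeasure lborel (U - K) <= emeasure lborel (U - A) + emeasure lborel (A - K)"
  proof -
    have "emeasure lborel (U - K) <= emeasure lborel ((U - A) \<union> (A - K))" using Ab by (intro emeasure_mono) auto
    also have "... <= emeasure lborel (U - A) + emeasure lborel (A - K)" using Ab by (intro emeasure_subadditive) auto
    finally show ?thesis .
  qed
  also have "... <= ennreal e' + ennreal e'" using U(4) K(4) Ab by (intro add_mono) (auto simp: emeasure_completion less_imp_le)
  also have "ennreal \<bar>c\<bar> * (ennreal e' + ennreal e') = ennreal (\<bar>c\<bar> * (2 * e'))" using e' by (simp add: ennreal_mult[symmetric] flip: ennreal_plus)
  also have "... < ennreal e" using base(3) by (intro ennreal_lessI) (auto simp: e'_def divide_less_eq algebra_simps)
  finally show ?case using g(1) by (intro exI[of _ "\<lambda>x. c * g x"]) (auto simp: mult_left_mono intro!: continuous_intros)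
next
  case (add f1 f2)
  have e2: "0 < e / 2" using add by simp
  obtain g1 where g1: "continuous_on UNIV g1" "(\<integral>\<^sup>+x. ennreal \<bar>f1 x - g1 x\<bar> \<partial>lborel) < ennreal (e / 2)" using add(3)[OF e2] by blast
  obtain g2 where g2: "continuous_on UNIV g2" "(\<integral>\<^sup>+x. ennreal \<bar>f2 x - g2 x\<bar> \<partial>lborel) < ennreal (e / 2)" using add(4)[OF e2] by blast
  have [measurable]: "f1 \<in> borel_measurable borel" "f2 \<in> borel_measurable borel" "g1 \<in> borel_measurable borel" "g2 \<in> borel_measurable borel"
    using add(1,2) g1(1) g2(1) by (auto intro: borel_measurable_continuous_onI)
  have "(\<integral>\<^sup>+x. ennreal \<bar>(f1 x + f2 x) - (g1 x + g2 x)\<bar> \<partial>lborel) <= (\<integral>\<^sup>+x. ennreal \<bar>f1 x - g1 x\<bar> + ennreal \<bar>f2 x - g2 x\<bar> \<partial>lborel)"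
    by (intro nn_integral_mono) (auto simp: ennreal_plus[symmetric] simp del: ennreal_plus intro!: ennreal_leI)
  also have "... = (\<integral>\<^sup>+x. ennreal \<bar>f1 x - g1 x\<bar> \<partial>lborel) + (\<integral>\<^sup>+x. ennreal \<bar>f2 x - g2 x\<bar> \<partial>lborel)" by (rule nn_integral_add) auto
  also have "... < ennreal (e / 2) + ennreal (e / 2)" using g1(2) g2(2) by (rule add_strict_mono)
  also have "... = ennreal e" using e2 by (simp flip: ennreal_plus)
  finally show ?case using g1(1) g2(1) by (intro exI[of _ "\<lambda>x. g1 x + g2 x"]) (auto intro!: continuous_intros)
next
  case (lim f s)
  have e2: "0 < e / 2" using lim by simp
  have [measurable]: "f \<in> borel_measurable borel" "s i \<in> borel_measurable borel" for i using lim(1,4) by auto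
  have "(\<lambda>i. \<integral>\<^sup>+x. norm (f x - s i x) \<partial>lborel) \<longlonglongrightarrow> 0"
  proof (rule nn_integral_dominated_convergence_norm[where w="\<lambda>x. 2 * norm (f x)"])
    show "(\<integral>\<^sup>+x. ennreal (2 * norm (f x)) \<partial>lborel) < \<infinity>" using lim(4) by (simp add: integrable_iff_bounded ennreal_mult nn_integral_cmult ennreal_mult_less_top)
  qed (use lim(2,3) in \<open>auto\<close>)
  then have "\<forall>\<^sub>F i in sequentially. (\<integral>\<^sup>+x. norm (f x - s i x) \<partial>lborel) < ennreal (e / 2)" using e2 by (intro order_tendstoD) auto
  then obtain i where i: "(\<integral>\<^sup>+x. norm (f x - s i x) \<partial>lborel) < ennreal (e / 2)" using eventually_happens'[OF sequentially_bot] by blast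
  obtain g where g: "continuous_on UNIV g" "(\<integral>\<^sup>+x. ennreal \<bar>s i x - g x\<bar> \<partial>lborel) < ennreal (e / 2)" using lim(5)[OF e2] by blast
  have [measurable]: "g \<in> borel_measurable borel" using g(1) by (rule borel_measurable_continuous_onI)
  have "(\<integral>\<^sup>+x. ennreal \<bar>f x - g x\<bar> \<partial>lborel) <= (\<integral>\<^sup>+x. ennreal (norm (f x - s i x)) + ennreal \<bar>s i x - g x\<bar> \<partial>lborel)"
    by (intro nn_integral_mono) (auto simp: ennreal_plus[symmetric] simp del: ennreal_plus intro!: ennreal_leI)
  also have "... = (\<integral>\<^sup>+x. norm (f x - s i x) \<partial>lborel) + (\<integral>\<^sup>+x. ennreal \<bar>s i x - g x\<bar> \<partial>lborel)" by (rule nn_integral_add) auto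
  also have "... < ennreal (e / 2) + ennreal (e / 2)" using i g(2) by (rule add_strict_mono)
  also have "... = ennreal e" using e2 by (simp flip: ennreal_plus)
  finally show ?case using g(1) by blast
qed

section \<open>Grids of closed cubes and step functions\<close>

definition grid_cube :: "real^'n => real => nat => ('n => nat) => (real^'n) set" where
  "grid_cube v L k g = cube (\<chi> i. v $ i + L * real (g i) / real k) (L / real k)"

lemma in_grid_cube:
  "x \<in> grid_cube v L k g \<longleftrightarrow> (\<forall>i. v $ i + L * real (g i) / real k <= x $ i \<and> x $ i <= v $ i + L * real (Suc (g i)) / real k)"
  by (simp add: grid_cube_def in_cube algebra_simps add_divide_distrib)

lemma sets_grid_cube [measurable, simp]: "grid_cube v L k g \<in> sets borel" by (simp add: grid_cube_def)

lemma grid_cube_subset: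
  assumes "0 < k" "0 < L" "g \<in> multi_index k" shows "grid_cube v L k g \<subseteq> cube v L"
proof
  fix x assume x: "x \<in> grid_cube v L k g"
  show "x \<in> cube v L" unfolding in_cube
  proof
    fix i
    have "Suc (g i) <= k" using assms(3) by (auto simp: multi_index_def PiE_def Pi_def Suc_le_eq)
    then have "L * real (Suc (g i)) / real k <= L" using assms(1,2) by (simp add: divide_le_eq del: of_nat_Suc)
    moreover have "0 <= L * real (g i) / real k" using assms by simp
    moreover have "v $ i + L * real (g i) / real k <= x $ i" "x $ i <= v $ i + L * real (Suc (g i)) / real k" using x by (auto simp: in_grid_cube)
    ultimately show "v $ i <= x $ i \<and> x $ i <= v $ i + L" by linarith
  qed
qed

text \<open>Comparing volumes shows that almost every point lies in the interior of a cell of the grid.\<close>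

lemma AE_in_one_grid_cube:
  fixes v :: "real^'n"
  assumes k: "0 < k" and L: "0 < L"
  shows "AE x in lborel. x \<in> cube v L \<longrightarrow> (\<exists>g\<in>multi_index k. x \<in> grid_cube v L k g \<and> (\<forall>g'. x \<in> grid_cube v L k g' \<longrightarrow> g' = g))"
proof -
  let ?I = "multi_index k :: ('n => nat) set"
  let ?b = "\<lambda>g. box (\<chi> i. v $ i + L * real (g i) / real k) (\<chi> i. v $ i + L * real (Suc (g i)) / real k) :: (real^'n) set"
  have inb: "x \<in> ?b g \<longleftrightarrow> (\<forall>i. v $ i + L * real (g i) / real k < x $ i \<and> x $ i < v $ i + L * real (Suc (g i)) / real k)" for x g by (simp add: mem_box_cart)
  have bsub: "?b g \<subseteq> grid_cube v L k g" for g by (force simp: inb in_grid_cube less_imp_le simp del: of_nat_Suc)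
  have uniq: "g' = g" if x: "x \<in> ?b g" "x \<in> grid_cube v L k g'" for x g g'
  proof
    fix i
    have c: "L * real a / real k < L * real b / real k \<longleftrightarrow> a < b" for a b :: nat using k L by (simp add: divide_less_cancel)
    have "L * real (g i) / real k < L * real (Suc (g' i)) / real k" "L * real (g' i) / real k < L * real (Suc (g i)) / real k"
      using x unfolding inb in_grid_cube by (smt (verit))+
    then show "g' i = g i" unfolding c by simp
  qed
  have disj: "disjoint_family_on ?b ?I" unfolding disjoint_family_on_def using uniq bsub by (meson disjoint_iff subsetD)
  have vol: "emeasure lborel (?b g) = ennreal ((L / real k) ^ CARD('n))" for g
  proof -
    have "emeasure lborel (?b g) = ennreal (\<Prod>b\<in>Basis. ((\<chi> i. v $ i + L * real (Suc (g i)) / real k) - (\<chi> i. v $ i + L * real (g i) / real k)) \<bullet> b)"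
      using L by (intro emeasure_lborel_box) (auto simp: Basis_vec_def inner_axis divide_right_mono mult_left_mono)
    also have "(\<Prod>b\<in>(Basis :: (real^'n) set). ((\<chi> i. v $ i + L * real (Suc (g i)) / real k) - (\<chi> i. v $ i + L * real (g i) / real k)) \<bullet> b) = (\<Prod>b\<in>(Basis :: (real^'n) set). L / real k)"
      by (intro prod.cong refl) (auto simp: Basis_vec_def inner_axis algebra_simps add_divide_distrib)
    finally show ?thesis by simp
  qed
  have "emeasure lborel (\<Union>g\<in>?I. ?b g) = (\<Sum>g\<in>?I. emeasure lborel (?b g))" using disj by (intro sum_emeasure[symmetric]) auto
  also have "... = ennreal (real (k ^ CARD('n)) * (L / real k) ^ CARD('n))"
    unfolding vol using L by (simp add: card_multi_index ennreal_of_nat_eq_real_of_nat ennreal_mult)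
  also have "real (k ^ CARD('n)) * (L / real k) ^ CARD('n) = L ^ CARD('n)" using k by (simp add: power_divide)
  finally have full: "emeasure lborel (\<Union>g\<in>?I. ?b g) = emeasure lborel (cube v L)" using L by (simp add: emeasure_cube)
  have sub: "(\<Union>g\<in>?I. ?b g) \<subseteq> cube v L" using bsub grid_cube_subset[OF k L] by blast
  have "emeasure lborel (cube v L - (\<Union>g\<in>?I. ?b g)) = 0" using sub full emeasure_cube[of L v] L by (subst emeasure_Diff) auto
  moreover have "cube v L - (\<Union>g\<in>?I. ?b g) \<in> sets lborel" by auto
  ultimately have "AE x in lborel. x \<notin> cube v L - (\<Union>g\<in>?I. ?b g)" by (intro AE_not_in) (auto simp: null_sets_def)
  then show ?thesis
  proof eventually_elim
    case (elim x)
    show ?case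
    proof
      assume "x \<in> cube v L"
      then obtain g where "g \<in> ?I" "x \<in> ?b g" using elim by blast
      then show "\<exists>g\<in>?I. x \<in> grid_cube v L k g \<and> (\<forall>g'. x \<in> grid_cube v L k g' \<longrightarrow> g' = g)" using uniq bsub by blast
    qed
  qed
qed

definition step_fun :: "real^'n => real => nat => ('n => nat) set => (('n => nat) => real) => real^'n => ennreal" where
  "step_fun v L k J a x = (\<Sum>g\<in>J. ennreal (a g) * indicator (grid_cube v L k g) x)"

lemma measurable_step_fun [measurable]: "step_fun v L k J a \<in> borel_measurable borel" unfolding step_fun_def[abs_def] by measurable

lemma step_fun_less_top: "step_fun v L k J a x < top"
proof (cases "finite J")
  case True
  then show ?thesis unfolding step_fun_def by (auto simp: indicator_def)
qed (simp add: step_fun_def)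

text \<open>A continuous function close to \<open>f\<close> in L^1 is almost constant on fine cells.
  The two truncated \<open>ennreal\<close> differences are stated separately because
  \<open>f\<close> minus the step function enters the upper bound and the reverse difference the
  lower bound.\<close>

lemma step_approx:
  fixes f :: "real^'n => ennreal"
  assumes f[measurable]: "f \<in> borel_measurable borel" and fin: "\<And>x. f x < top" "(\<integral>\<^sup>+x. f x \<partial>lborel) < top"
    and supp: "\<And>x. x \<notin> cube v L ==> f x = 0" and L: "0 < L" and e: "0 < e"
  obtains k J a where "0 < k" "J \<subseteq> multi_index k" "\<And>g. g \<in> J ==> 0 < a g"
    "(\<integral>\<^sup>+x. (f x - step_fun v L k J a x) \<partial>lborel) < ennreal e"
    "(\<integral>\<^sup>+x. (step_fun v L k J a x - f x) \<partial>lborel) < ennreal e"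
proof -
  define fr where "fr x = enn2real (f x)" for x
  have fr: "f x = ennreal (fr x)" "0 <= fr x" for x using fin(1)[of x] by (simp_all add: fr_def)
  have [measurable]: "fr \<in> borel_measurable borel" unfolding fr_def by measurable
  have "integrable lborel fr" using fin(2) fr by (simp add: integrable_iff_bounded)
  then obtain h where h: "continuous_on UNIV h" "(\<integral>\<^sup>+x. ennreal \<bar>fr x - h x\<bar> \<partial>lborel) < ennreal (e / 2)" using integrable_approx_continuous[of fr "e / 2"] e by auto
  have [measurable]: "h \<in> borel_measurable borel" using h(1) by (rule borel_measurable_continuous_onI)
  \<comment> \<open>The oscillation on cells, integrated over the cube, may use e/2; the other half
    of \<open>e\<close> is the L^1 distance to the continuous function.\<close>
  define e1 where "e1 = e / (2 * (L ^ CARD('n) + 1))"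
  have e1: "0 < e1" "e1 * L ^ CARD('n) <= e / 2"
  proof -
    define w where "w = L ^ CARD('n)"
    have w: "0 < w" using L by (simp add: w_def)
    have "0 < e / (2 * (w + 1))" "e / (2 * (w + 1)) * w <= e / 2" using w e by (simp_all add: field_simps)
    then show "0 < e1" "e1 * L ^ CARD('n) <= e / 2" by (simp_all only: e1_def w_def)
  qed
  have "uniformly_continuous_on (cube v L) h" using compact_cube h(1) by (intro compact_uniformly_continuous continuous_on_subset[OF h(1)]) auto
  then obtain d where d: "0 < d" "\<And>x y. x \<in> cube v L ==> y \<in> cube v L ==> dist y x < d ==> dist (h y) (h x) < e1"
    unfolding uniformly_continuous_on_def using e1(1) by metis
  obtain k :: nat where k: "real CARD('n) * L / d < real k" using reals_Archimedean2 by blast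
  have "0 < real CARD('n) * L / d" using L d by simp
  then have k0: "0 < k" using k by (cases k) auto
  define c where "c g = (\<chi> i. v $ i + L * real (g i) / real k)" for g :: "'n => nat"
  \<comment> \<open>Truncation at 0 does not increase the distance to the nonnegative
    \<open>f\<close>. Cells of height 0 are then left out of \<open>J\<close>, because the scaling
    law for cubes requires positive heights.\<close>
  define a where "a g = max 0 (h (c g))" for g
  define J where "J = {g \<in> multi_index k. 0 < a g}"
  have cin: "c g \<in> grid_cube v L k g" for g using L k0 by (simp add: in_grid_cube c_def divide_right_mono mult_left_mono)
  have osc: "\<bar>h x - h (c g)\<bar> < e1" if g: "g \<in> multi_index k" "x \<in> grid_cube v L k g" for g x
  proof -
    have "norm (x - c g) <= real CARD('n) * (L / real k)"
    proof (rule norm_le_card_mult)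
      fix i
      have "v $ i + L * real (g i) / real k <= x $ i" "x $ i <= v $ i + L * real (g i) / real k + L / real k"
        using g(2) by (auto simp: in_grid_cube algebra_simps add_divide_distrib)
      then show "\<bar>(x - c g) $ i\<bar> <= L / real k" by (simp add: c_def)
    qed
    also have "... < d" using k k0 d by (simp add: field_simps)
    finally have "dist x (c g) < d" by (simp add: dist_norm)
    moreover have "x \<in> cube v L" "c g \<in> cube v L" using grid_cube_subset[OF k0 L g(1)] g(2) cin[of g] by blast+
    ultimately show ?thesis using d(2)[of "c g" x] by (simp add: dist_real_def)
  qed
  define phi where "phi = step_fun v L k J a"
  have [measurable]: "phi \<in> borel_measurable borel" unfolding phi_def by measurable
  have "AE x in lborel. f x - phi x <= ennreal \<bar>fr x - h x\<bar> + ennreal e1 * indicator (cube v L) x \<and>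
      phi x - f x <= ennreal \<bar>fr x - h x\<bar> + ennreal e1 * indicator (cube v L) x" using AE_in_one_grid_cube[OF k0 L, of v]
  proof eventually_elim
    case (elim x)
    show ?case
    proof (cases "x \<in> cube v L")
      case True
      then obtain g where g: "g \<in> multi_index k" "x \<in> grid_cube v L k g" "\<And>g'. x \<in> grid_cube v L k g' ==> g' = g" using elim by blast
      have "phi x = (\<Sum>g'\<in>J. if g' = g then ennreal (a g) else 0)" unfolding phi_def step_fun_def
      proof (rule sum.cong[OF refl])
        fix g'
        have "x \<notin> grid_cube v L k g'" if "g' \<noteq> g" using g(3)[of g'] that by blast
        then show "ennreal (a g') * indicator (grid_cube v L k g') x = (if g' = g then ennreal (a g) else 0)" using g(2) by (cases "g' = g") simp_all
      qed
      also have "... = ennreal (a g)" using g(1) by (auto simp: J_def a_def ennreal_neg)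
      finally have phix: "phi x = ennreal (a g)" .
      have "\<bar>fr x - a g\<bar> <= \<bar>fr x - h x\<bar> + e1" using osc[OF g(1,2)] fr(2)[of x] by (auto simp: a_def max_def)
      then have "ennreal (fr x - a g) <= ennreal (\<bar>fr x - h x\<bar> + e1)" "ennreal (a g - fr x) <= ennreal (\<bar>fr x - h x\<bar> + e1)" by (auto intro!: ennreal_leI)
      then show ?thesis using True e1 fr[of x] by (simp add: phix ennreal_minus a_def)
    next
      case False
      then have "phi x = 0" unfolding phi_def step_fun_def using grid_cube_subset[OF k0 L] by (intro sum.neutral) (auto simp: J_def indicator_def)
      then show ?thesis using supp[OF False] by simp
    qed
  qed
  then have ae: "AE x in lborel. f x - phi x <= ennreal \<bar>fr x - h x\<bar> + ennreal e1 * indicator (cube v L) x"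
    "AE x in lborel. phi x - f x <= ennreal \<bar>fr x - h x\<bar> + ennreal e1 * indicator (cube v L) x" by auto
  have "(\<integral>\<^sup>+x. ennreal \<bar>fr x - h x\<bar> + ennreal e1 * indicator (cube v L) x \<partial>lborel) =
     (\<integral>\<^sup>+x. ennreal \<bar>fr x - h x\<bar> \<partial>lborel) + ennreal e1 * emeasure lborel (cube v L)" by (subst nn_integral_add) (auto simp: nn_integral_cmult_indicator)
  also have "ennreal e1 * emeasure lborel (cube v L) = ennreal (e1 * L ^ CARD('n))" using L e1 by (simp add: emeasure_cube ennreal_mult)
  also have "(\<integral>\<^sup>+x. ennreal \<bar>fr x - h x\<bar> \<partial>lborel) + ennreal (e1 * L ^ CARD('n)) <= (\<integral>\<^sup>+x. ennreal \<bar>fr x - h x\<bar> \<partial>lborel) + ennreal (e / 2)"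
    using e1 by (intro add_left_mono ennreal_leI)
  also have "... = ennreal (e / 2) + (\<integral>\<^sup>+x. ennreal \<bar>fr x - h x\<bar> \<partial>lborel)" by (rule add.commute)
  also have "... < ennreal (e / 2) + ennreal (e / 2)" using h(2) by (simp add: ennreal_add_left_cancel_less)
  also have "... = ennreal e" using e by (simp flip: ennreal_plus)
  finally have bound: "(\<integral>\<^sup>+x. ennreal \<bar>fr x - h x\<bar> + ennreal e1 * indicator (cube v L) x \<partial>lborel) < ennreal e" .
  show thesis
  proof (rule that[of k J a])
    show "(\<integral>\<^sup>+x. (f x - step_fun v L k J a x) \<partial>lborel) < ennreal e" using nn_integral_mono_AE[OF ae(1)] bound unfolding phi_def by (rule le_less_trans)
    show "(\<integral>\<^sup>+x. (step_fun v L k J a x - f x) \<partial>lborel) < ennreal e" using nn_integral_mono_AE[OF ae(2)] bound unfolding phi_def by (rule le_less_trans)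
  qed (use k0 in \<open>auto simp: J_def\<close>)
qed



section \<open>Asymptotics for step functions\<close>

subsection \<open>Boundary cells\<close>

text \<open>An upper bound for the cells of mesh N^(-1/d) that meet the boundary of a box with sides
  at most \<open>L\<close>: d pairs of faces, a face meeting at most 2 (L N^(1/d) + 2)^(d-1) cells.
  It grows like N^(1-1/d).\<close>

definition frontier_cells :: "real => nat => 'n::finite itself => nat" where
  "frontier_cells L N _ = CARD('n) * (2 * (2 * (nat \<lfloor>L * real N powr (1 / real CARD('n))\<rfloor> + 2) ^ (CARD('n) - 1)))"

lemma card_ctr_face:
  fixes a b :: "real^'n"
  assumes h: "0 < h" and L: "\<And>j. b $ j - a $ j <= L"
  shows "finite (ctr h 0 ` {x \<in> cbox a b. x $ i = c})"
    "card (ctr h 0 ` {x \<in> cbox a b. x $ i = c}) <= 2 * (nat \<lfloor>L / h\<rfloor> + 2) ^ (CARD('n) - 1)"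
proof -
  let ?a = "\<chi> j. if j = i then c else a $ j" and ?b = "\<chi> j. if j = i then c else b $ j"
  have sub: "{x \<in> cbox a b. x $ i = c} \<subseteq> cbox ?a ?b" by (auto simp: mem_box_cart)
  note cc = card_ctr_box[OF h sub]
  show "finite (ctr h 0 ` {x \<in> cbox a b. x $ i = c})" by (rule cc(1))
  let ?f = "\<lambda>j. nat \<lfloor>(?b $ j - ?a $ j) / h\<rfloor> + 2"
  have "card (ctr h 0 ` {x \<in> cbox a b. x $ i = c}) <= (\<Prod>j\<in>UNIV. ?f j)" by (rule cc(2))
  also have "(\<Prod>j\<in>UNIV. ?f j) = ?f i * (\<Prod>j\<in>UNIV - {i}. ?f j)" by (rule prod.remove) auto
  \<comment> \<open>A face has extent 0 in direction i, but may lie on the border of two layers of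
    cells as far as the general count can tell.\<close>
  also have "?f i = 2" by simp
  also have "(\<Prod>j\<in>UNIV - {i}. ?f j) <= (\<Prod>j\<in>(UNIV :: 'n set) - {i}. nat \<lfloor>L / h\<rfloor> + 2)"
  proof (rule prod_mono, intro conjI)
    fix j assume "j \<in> UNIV - {i}"
    then have "\<lfloor>(?b $ j - ?a $ j) / h\<rfloor> <= \<lfloor>L / h\<rfloor>" using L[of j] h by (intro floor_mono divide_right_mono) auto
    then show "?f j <= nat \<lfloor>L / h\<rfloor> + 2" by (simp add: nat_mono)
  qed simp
  also have "... = (nat \<lfloor>L / h\<rfloor> + 2) ^ (CARD('n) - 1)" by (simp add: card_Diff_subset)
  finally show "card (ctr h 0 ` {x \<in> cbox a b. x $ i = c}) <= 2 * (nat \<lfloor>L / h\<rfloor> + 2) ^ (CARD('n) - 1)" by simp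
qed

lemma card_ctr_frontier:
  fixes a b :: "real^'n"
  assumes S: "S \<subseteq> cbox a b - box a b" and L: "\<And>j. b $ j - a $ j <= L" and N: "1 <= N"
  shows "finite (ctr (real N powr - (1 / real CARD('n))) 0 ` S) \<and>
    card (ctr (real N powr - (1 / real CARD('n))) 0 ` S) <= frontier_cells L N TYPE('n)"
proof -
  define h where "h = real N powr - (1 / real CARD('n))"
  have h: "0 < h" using N by (simp add: h_def)
  have Lh: "L / h = L * real N powr (1 / real CARD('n))" by (simp add: h_def powr_minus divide_inverse)
  define X where "X i = ctr h 0 ` {x \<in> cbox a b. x $ i = a $ i} \<union> ctr h 0 ` {x \<in> cbox a b. x $ i = b $ i}" for i
  have sub: "ctr h 0 ` S \<subseteq> (\<Union>i. X i)"
  proof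
    fix y assume "y \<in> ctr h 0 ` S"
    then obtain x where x: "x \<in> S" "y = ctr h 0 x" by auto
    then have x': "x \<in> cbox a b" "x \<notin> box a b" using S by auto
    then obtain i where i: "\<not> (a $ i < x $ i \<and> x $ i < b $ i)" unfolding mem_box_cart by blast
    moreover have "a $ i <= x $ i" "x $ i <= b $ i" using x'(1) by (auto simp: mem_box_cart)
    ultimately have "x $ i = a $ i \<or> x $ i = b $ i" by linarith
    then have "y \<in> X i" using x x'(1) by (auto simp: X_def)
    then show "y \<in> (\<Union>i. X i)" by blast
  qed
  have finX: "finite (X i)" for i unfolding X_def using card_ctr_face(1)[OF h L] by blast
  have cX: "card (X i) <= 2 * (2 * (nat \<lfloor>L / h\<rfloor> + 2) ^ (CARD('n) - 1))" for i
    unfolding X_def using card_Un_le[of "ctr h 0 ` {x \<in> cbox a b. x $ i = a $ i}" "ctr h 0 ` {x \<in> cbox a b. x $ i = b $ i}"]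
      card_ctr_face(2)[OF h L, of i "a $ i"] card_ctr_face(2)[OF h L, of i "b $ i"] by linarith
  have fin: "finite (\<Union>i. X i)" using finX by simp
  have "card (ctr h 0 ` S) <= card (\<Union>i. X i)" using fin sub by (rule card_mono)
  also have "... <= (\<Sum>i\<in>UNIV. card (X i))" by (rule card_UN_le) simp
  also have "... <= (\<Sum>i\<in>(UNIV :: 'n set). 2 * (2 * (nat \<lfloor>L / h\<rfloor> + 2) ^ (CARD('n) - 1)))" by (intro sum_mono cX)
  also have "... = frontier_cells L N TYPE('n)" by (simp add: frontier_cells_def Lh)
  finally show ?thesis using finite_subset[OF sub fin] by (simp add: h_def)
qed

lemma frontier_cells_le:
  assumes L: "0 <= L" and N: "1 <= N"
  shows "real (frontier_cells L N TYPE('n::finite)) <= 4 * real CARD('n) * (L + 2) ^ (CARD('n) - 1) * real N powr (1 - 1 / real CARD('n))"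
proof -
  let ?d = "CARD('n)"
  define n where "n = real N powr (1 / real ?d)"
  have n: "1 <= n" unfolding n_def using N by (intro ge_one_powr_ge_zero) auto
  have "real (nat \<lfloor>L * n\<rfloor> + 2) <= L * n + 2" using L n by simp
  also have "... <= (L + 2) * n" using n by (simp add: algebra_simps)
  finally have "real (nat \<lfloor>L * n\<rfloor> + 2) ^ (?d - 1) <= ((L + 2) * n) ^ (?d - 1)" by (intro power_mono) auto
  also have "... = (L + 2) ^ (?d - 1) * real N powr (1 - 1 / real ?d)"
  proof -
    have "n ^ (?d - 1) = n powr real (?d - 1)" using n by (intro powr_realpow[symmetric]) simp
    also have "... = real N powr (1 / real ?d * real (?d - 1))" by (simp add: n_def powr_powr)
    also have "1 / real ?d * real (?d - 1) = 1 - 1 / real ?d"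
    proof -
      have "real (?d - 1) = real ?d - 1" by (simp add: of_nat_diff)
      then show ?thesis by (simp add: field_simps)
    qed
    finally show ?thesis by (simp add: power_mult_distrib)
  qed
  finally have "4 * real ?d * real (nat \<lfloor>L * n\<rfloor> + 2) ^ (?d - 1) <= 4 * real ?d * ((L + 2) ^ (?d - 1) * real N powr (1 - 1 / real ?d))" by (rule mult_left_mono) simp
  then show ?thesis by (simp add: frontier_cells_def n_def mult.assoc)
qed

subsection \<open>Superadditivity over separated closed sets\<close>

text \<open>The cost factor of the trees that replace a frontier, from
  \<open>quant_error_graft_le\<close> with mesh h = N^(-1/d) and \<open>frontier_cells\<close> many
  centres.\<close>

definition cut_error :: "real => real => nat => 'n::finite itself => real" where
  "cut_error al L N _ = irr_const al TYPE('n) * real N powr - (1 / real CARD('n)) * real (frontier_cells L N TYPE('n)) powr (1 - al)"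

lemma cut_error_nonneg: "real CARD('n::finite) * (1 - al) < 1 ==> 0 <= cut_error al L N TYPE('n)" by (simp add: cut_error_def irr_const_nonneg)

text \<open>The exponents beta/d, -1/d and (1 - 1/d)(1 - al) add up to -(1 - al)/d. The boundary
  having one dimension less is what makes this negative.\<close>

lemma cut_error_tendsto:
  assumes L: "0 <= L" and al: "0 < al" "al < 1" "real CARD('n::finite) * (1 - al) < 1"
  shows "(\<lambda>N. real N powr (beta_exp al TYPE('n) / real CARD('n)) * cut_error al L N TYPE('n)) \<longlonglongrightarrow> 0"
proof -
  let ?d = "CARD('n)"
  define C where "C = 4 * real ?d * (L + 2) ^ (?d - 1)"
  have C: "0 <= C" using L by (simp add: C_def)
  have irr: "0 <= irr_const al TYPE('n)" using al(3) by (rule irr_const_nonneg)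
  have bound: "real N powr (beta_exp al TYPE('n) / real ?d) * cut_error al L N TYPE('n) \<le>
      irr_const al TYPE('n) * C powr (1 - al) * real N powr - ((1 - al) / real ?d)" if N: "1 <= N" for N
  proof -
    have "real (frontier_cells L N TYPE('n)) powr (1 - al) <= (C * real N powr (1 - 1 / real ?d)) powr (1 - al)"
      using frontier_cells_le[OF L N, where 'n='n] al by (intro powr_mono2) (auto simp: C_def)
    also have "... = C powr (1 - al) * real N powr ((1 - 1 / real ?d) * (1 - al))" by (simp add: powr_mult powr_powr)
    finally have "real N powr (beta_exp al TYPE('n) / real ?d) * cut_error al L N TYPE('n) \<le>
        real N powr (beta_exp al TYPE('n) / real ?d) * (irr_const al TYPE('n) * real N powr - (1 / real ?d) * (C powr (1 - al) * real N powr ((1 - 1 / real ?d) * (1 - al))))"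
      unfolding cut_error_def using irr by (intro mult_left_mono) auto
    also have "... = irr_const al TYPE('n) * C powr (1 - al) *
       (real N powr (beta_exp al TYPE('n) / real ?d) * real N powr - (1 / real ?d) * real N powr ((1 - 1 / real ?d) * (1 - al)))" by (simp add: mult_ac)
    also have "real N powr (beta_exp al TYPE('n) / real ?d) * real N powr - (1 / real ?d) * real N powr ((1 - 1 / real ?d) * (1 - al))
       = real N powr - ((1 - al) / real ?d)"
    proof -
      have "beta_exp al TYPE('n) / real ?d + - (1 / real ?d) + (1 - 1 / real ?d) * (1 - al) = - ((1 - al) / real ?d)" by (simp add: beta_exp_def field_simps)
      then show ?thesis by (simp only: powr_add[symmetric])
    qed
    finally show ?thesis .
  qed
  have "(\<lambda>N. irr_const al TYPE('n) * C powr (1 - al) * real N powr - ((1 - al) / real ?d)) \<longlonglongrightarrow> irr_const al TYPE('n) * C powr (1 - al) * 0"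
    using al by (intro tendsto_intros tendsto_neg_powr filterlim_real_sequentially) auto
  then have lim: "(\<lambda>N. irr_const al TYPE('n) * C powr (1 - al) * real N powr - ((1 - al) / real ?d)) \<longlonglongrightarrow> 0" by simp
  show ?thesis
  proof (rule tendsto_sandwich[OF _ _ tendsto_const lim])
    show "\<forall>\<^sub>F N in sequentially. 0 <= real N powr (beta_exp al TYPE('n) / real ?d) * cut_error al L N TYPE('n)" using cut_error_nonneg[OF al(3)] by simp
    show "\<forall>\<^sub>F N in sequentially. real N powr (beta_exp al TYPE('n) / real ?d) * cut_error al L N TYPE('n) \<le>
      irr_const al TYPE('n) * C powr (1 - al) * real N powr - ((1 - al) / real ?d)" by (rule eventually_sequentiallyI[of 1]) (rule bound)
  qed
qed

lemma frontier_cells_ratio_tendsto: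
  assumes L: "0 <= L"
  shows "(\<lambda>N. real (frontier_cells L N TYPE('n::finite)) / real N) \<longlonglongrightarrow> 0"
proof -
  let ?d = "CARD('n)"
  define C where "C = 4 * real ?d * (L + 2) ^ (?d - 1)"
  have "(\<lambda>N. C * real N powr - (1 / real ?d)) \<longlonglongrightarrow> C * 0" by (intro tendsto_intros tendsto_neg_powr filterlim_real_sequentially) auto
  then have lim: "(\<lambda>N. C * real N powr - (1 / real ?d)) \<longlonglongrightarrow> 0" by simp
  show ?thesis
  proof (rule tendsto_sandwich[OF _ _ tendsto_const lim])
    show "\<forall>\<^sub>F N in sequentially. real (frontier_cells L N TYPE('n)) / real N <= C * real N powr - (1 / real ?d)"
    proof (rule eventually_sequentiallyI[of 1])
      fix N :: nat assume N: "1 <= N"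
      have "real (frontier_cells L N TYPE('n)) / real N <= C * real N powr (1 - 1 / real ?d) / real N"
        using frontier_cells_le[OF L N, where 'n='n] by (intro divide_right_mono) (auto simp: C_def)
      also have "real N powr (1 - 1 / real ?d) = real N powr (1 + - (1 / real ?d))" by simp
      also have "... = real N * real N powr - (1 / real ?d)" using N by (simp only: powr_add) simp
      also have "C * ... / real N = C * real N powr - (1 / real ?d)" using N by simp
      finally show "real (frontier_cells L N TYPE('n)) / real N <= C * real N powr - (1 / real ?d)" .
    qed
  qed simp
qed

lemma superadditive_density:
  fixes P :: "(real => real^'n) measure" and A :: "'j => (real^'n) set"
  assumes f[measurable]: "f \<in> borel_measurable borel"
    and P: "traffic_plan P" "distr P borel curve_end = density lborel f" and F: "finite F" "AE cv in P. cv 0 \<in> F"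
    and A: "\<And>j. j \<in> J ==> closed (A j)" and J: "finite J" "disjoint_family_on A J"
    and fr: "\<And>j. j \<in> J ==> frontier (A j) \<subseteq> cbox (lo j) (hi j) - box (lo j) (hi j)" "\<And>j i. j \<in> J ==> hi j $ i - lo j $ i <= L"
    and N: "1 <= N" and al: "0 < al" "al < 1" "real CARD('n) * (1 - al) < 1"
  shows "(\<Sum>j\<in>J. density_error al (\<lambda>x. f x * indicator (A j) x) (card (F \<inter> A j) + frontier_cells L N TYPE('n))) \<le>
    alpha_mass al P + ennreal (real (card J) * cut_error al L N TYPE('n)) * ennpow (\<integral>\<^sup>+x. f x \<partial>lborel) al"
proof -
  have "0 < real N powr - (1 / real CARD('n))" using N by simp
  from quant_error_superadditive[OF P F A this J _ al, of "frontier_cells L N TYPE('n)"]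
  have "(\<Sum>j\<in>J. quant_error al (density (density lborel f) (indicator (A j))) (card (F \<inter> A j) + frontier_cells L N TYPE('n))) \<le>
     alpha_mass al P + ennreal (real (card J) * (irr_const al TYPE('n) * real N powr - (1 / real CARD('n)) *
       real (frontier_cells L N TYPE('n)) powr (1 - al))) * ennpow (emeasure (density lborel f) UNIV) al" using card_ctr_frontier[OF fr N] by blast
  moreover have "density (density lborel f) (indicator (A j)) = density lborel (\<lambda>x. f x * indicator (A j) x)" if "j \<in> J" for j
    using A[OF that] by (intro density_density_eq) auto
  ultimately show ?thesis by (simp add: cut_error_def emeasure_density)
qed

subsection \<open>The lower bound\<close>

text \<open>The left side is the tangent, along the ray m = r n, of the convex 1-homogeneous
  function m^(1+s) n^(-s); equality holds for m = r n.\<close>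

lemma powr_young:
  fixes m n r s :: real
  assumes "0 <= m" "0 < n" "0 < r" "0 < s"
  shows "(1 + s) * r powr s * m - s * r powr (1 + s) * n <= m powr (1 + s) * n powr - s"
proof (cases "m = 0")
  case False
  then have m: "0 < m" using assms by simp
  define t where "t = n * r / m"
  have t: "0 < t" using m assms by (simp add: t_def)
  have "1 - s * (t - 1) <= t powr - s"
  proof -
    have "1 - s * (t - 1) <= 1 + (- s * ln t)" using ln_le_minus_one[OF t] assms(4) by (simp add: mult_left_mono)
    also have "... <= exp (- s * ln t)" by (rule exp_ge_add_one_self)
    also have "... = t powr - s" using t by (simp add: powr_def)
    finally show ?thesis .
  qed
  then have "m * r powr s * (1 - s * (t - 1)) <= m * r powr s * t powr - s" using m by (intro mult_left_mono) auto
  also have "... = m powr (1 + s) * n powr - s" using m assms by (simp add: t_def powr_mult powr_divide powr_add powr_minus field_simps)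
  also have "m * r powr s * (1 - s * (t - 1)) = (1 + s) * r powr s * m - s * r powr (1 + s) * n" using m assms by (simp add: t_def powr_add field_simps)
  finally show ?thesis .
qed (use assms in simp)

text \<open>The same slope r = (sum of m)/T is used in every term: it is the common ratio m/n of the
  optimal distribution of \<open>T\<close> sources.\<close>

lemma sum_powr_holder:
  fixes m n :: "'j => real"
  assumes J: "finite J" and m: "\<And>j. j \<in> J ==> 0 <= m j" and n: "\<And>j. j \<in> J ==> 0 < n j" and s: "0 < s" and T: "sum n J <= T" "0 < T"
  shows "(sum m J) powr (1 + s) * T powr - s <= (\<Sum>j\<in>J. m j powr (1 + s) * n j powr - s)"
proof (cases "sum m J = 0")
  case False
  moreover have "0 <= sum m J" by (intro sum_nonneg m)
  ultimately have M: "0 < sum m J" by linarith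
  define r where "r = sum m J / T"
  have r: "0 < r" using M T by (simp add: r_def)
  have "(sum m J) powr (1 + s) * T powr - s = r powr s * sum m J" using M T by (simp add: r_def powr_divide powr_add powr_minus_divide)
  also have "... = (1 + s) * r powr s * sum m J - s * r powr (1 + s) * T"
    proof -
    have "r powr (1 + s) * T = r powr s * sum m J" using M T r by (simp add: powr_add) (simp add: r_def)
    then have "s * r powr (1 + s) * T = s * (r powr s * sum m J)" by simp
    then show ?thesis by (auto simp: distrib_right)
  qed
  also have "... <= (1 + s) * r powr s * sum m J - s * r powr (1 + s) * sum n J" using T s r by (intro diff_left_mono mult_left_mono) auto
  also have "... = (\<Sum>j\<in>J. (1 + s) * r powr s * m j - s * r powr (1 + s) * n j)" by (simp add: sum_subtractf sum_distrib_left)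
  also have "... <= (\<Sum>j\<in>J. m j powr (1 + s) * n j powr - s)" using m n r s by (intro sum_mono powr_young) auto
  finally show ?thesis .
qed (auto intro!: sum_nonneg)

text \<open>Closed grid cells share faces; shrinking them about their centres by the factor 1 - dl
  makes them disjoint, as the cutting argument requires.\<close>

definition shrunk_cube :: "real^'n => real => nat => real => ('n => nat) => (real^'n) set" where
  "shrunk_cube v L k dl g = cube (\<chi> i. v $ i + L * (real (g i) + dl / 2) / real k) ((1 - dl) * (L / real k))"

lemma in_shrunk_cube:
  "x \<in> shrunk_cube v L k dl g \<longleftrightarrow> (\<forall>i. v $ i + L / real k * (real (g i) + dl / 2) <= x $ i \<and> x $ i <= v $ i + L / real k * (real (g i) + 1 - dl / 2))"
  by (simp add: shrunk_cube_def in_cube algebra_simps add_divide_distrib diff_divide_distrib)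

lemma shrunk_cube_subset:
  assumes "0 < k" "0 < L" "0 < dl" shows "shrunk_cube v L k dl g \<subseteq> grid_cube v L k g"
proof
  fix x assume x: "x \<in> shrunk_cube v L k dl g"
  have "0 < L / real k" using assms by simp
  then have m: "L / real k * a <= L / real k * b" if "a <= b" for a b using that \<open>0 < L / real k\<close> by (intro mult_left_mono) auto
  show "x \<in> grid_cube v L k g" unfolding in_grid_cube
  proof
    fix i
    have "L / real k * real (g i) <= L / real k * (real (g i) + dl / 2)" "L / real k * (real (g i) + 1 - dl / 2) <= L / real k * real (Suc (g i))"
      using assms by (intro m, simp)+
    moreover have "v $ i + L / real k * (real (g i) + dl / 2) <= x $ i" "x $ i <= v $ i + L / real k * (real (g i) + 1 - dl / 2)" using x by (auto simp: in_shrunk_cube)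
    ultimately show "v $ i + L * real (g i) / real k <= x $ i \<and> x $ i <= v $ i + L * real (Suc (g i)) / real k" by (simp only: times_divide_eq_left) linarith
  qed
qed

lemma shrunk_cube_disjoint:
  fixes v :: "real^'n" and J :: "('n => nat) set"
  assumes "0 < k" "0 < L" "0 < dl" shows "disjoint_family_on (shrunk_cube v L k dl) J" unfolding disjoint_family_on_def
proof (intro ballI impI)
  fix g g' :: "'n => nat" assume "g \<noteq> g'"
  then obtain i where i: "g i \<noteq> g' i" by auto
  show "shrunk_cube v L k dl g \<inter> shrunk_cube v L k dl g' = {}"
  proof (rule ccontr)
    assume "shrunk_cube v L k dl g \<inter> shrunk_cube v L k dl g' \<noteq> {}"
    then obtain x where "x \<in> shrunk_cube v L k dl g" "x \<in> shrunk_cube v L k dl g'" by auto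
    then have "L / real k * (real (g i) + dl / 2) <= L / real k * (real (g' i) + 1 - dl / 2)"
      "L / real k * (real (g' i) + dl / 2) <= L / real k * (real (g i) + 1 - dl / 2)" unfolding in_shrunk_cube by (smt (verit))+
    moreover have "0 < L / real k" using assms by simp
    ultimately have "real (g i) + dl / 2 <= real (g' i) + 1 - dl / 2" "real (g' i) + dl / 2 <= real (g i) + 1 - dl / 2" by (simp_all only: mult_le_cancel_left_pos)
    then have "real (g i) < real (g' i) + 1" "real (g' i) < real (g i) + 1" using assms(3) by linarith+
    then show False using i by linarith
  qed
qed

lemma cube_frontier:
  shows "frontier (cube v l) \<subseteq> cbox v (v + l *\<^sub>R 1) - box v (v + l *\<^sub>R 1)" unfolding cube_def by (auto simp: frontier_def interior_cbox closure_closed closed_cbox)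

text \<open>The origin of the exponent al / (al + 1/d): integrating this power of the density over a
  cell gives a mass whose power 1 + s = al + 1/d is exactly the factor in the scaling law
  \<open>quant_error_cube\<close>.\<close>

lemma mass_powr_eq:
  fixes a l :: real
  assumes "0 < a" "0 < l" and al: "0 < al"
  defines "d \<equiv> real CARD('n::finite)"
  shows "(a powr (al / (al + 1 / d)) * l ^ CARD('n)) powr (1 + beta_exp al TYPE('n) / d) = a powr al * l powr (d * al + 1)"
proof -
  have d: "0 < d" by (simp add: d_def)
  have e1: "1 + beta_exp al TYPE('n) / d = al + 1 / d" using d by (simp add: beta_exp_def d_def field_simps)
  have "al + 1 / d \<noteq> 0" using d al by (metis add_pos_pos less_irrefl zero_less_divide_1_iff)
  then have "al / (al + 1 / d) * (al + 1 / d) = al" by simp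
  moreover have "d * (al + 1 / d) = d * al + 1" using d by (simp add: distrib_left)
  ultimately show ?thesis unfolding e1 using assms(1,2) by (simp only: powr_mult powr_powr powr_realpow[symmetric] d_def)
qed

text \<open>On a shrunk cell the density is at least the constant height \<open>a g\<close>, so the
  scaling law bounds its cost by c m^(1+s) n^(-s). The boundary sources are counted in every n,
  which keeps n positive in cells without sources and bounds the sum of all n by N plus a
  lower-order term.\<close>

lemma step_lower:
  fixes v :: "real^'n"
  assumes al: "0 < al" "al < 1" "real CARD('n) * (1 - al) < 1"
    and c: "0 < c" "\<And>N. 1 <= N ==> ennreal c <= scaled_cube al TYPE('n) N"
    and k: "0 < k" and L: "0 < L" and J: "J \<subseteq> multi_index k" and a: "\<And>g. g \<in> J ==> 0 < a g"
    and dl: "0 < dl" "dl < 1" and N: "1 <= N"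
  defines "s \<equiv> beta_exp al TYPE('n) / real CARD('n)" and "p \<equiv> al / (al + 1 / real CARD('n))"
  shows "ennreal (c * ((1 - dl) ^ CARD('n) * (\<Sum>g\<in>J. a g powr p * (L / real k) ^ CARD('n))) powr (1 + s)
      * (real N + real (card J) * real (frontier_cells L N TYPE('n))) powr - s)
    <= density_error al (step_fun v L k J a) N +
      ennreal (real (card J) * cut_error al L N TYPE('n)) * ennpow (\<integral>\<^sup>+x. step_fun v L k J a x \<partial>lborel) al"
proof -
  let ?d = "CARD('n)" and ?K = "frontier_cells L N TYPE('n)" and ?f = "step_fun v L k J a"
  have finJ: "finite J" using J by (rule finite_subset[OF _ finite_multi_index])
  have \<beta>: "0 < beta_exp al TYPE('n)" using al(3) by (auto simp: beta_exp_def algebra_simps)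
  then have s: "0 < s" by (simp add: s_def)
  define l where "l = (1 - dl) * (L / real k)"
  have l: "0 < l" using dl L k by (simp add: l_def)
  have Lk: "L / real k <= L" using L k by (simp add: divide_le_eq)
  have lL: "l <= L"
  proof -
    have "l <= 1 * (L / real k)" unfolding l_def using dl L k by (intro mult_right_mono) auto
    then show ?thesis using Lk by simp
  qed
  define m where "m g = a g powr p * l ^ ?d" for g
  have K0: "0 < ?K" by (simp add: frontier_cells_def)
  have cell: "ennreal (c * (m g powr (1 + s) * real n powr - s)) \<le>
      density_error al (\<lambda>x. ?f x * indicator (shrunk_cube v L k dl g) x) n"
    if g: "g \<in> J" and n: "1 <= n" for g n
  proof -
    let ?w = "\<chi> i. v $ i + L * (real (g i) + dl / 2) / real k"
    have "ennreal (c * real n powr - s) <= cube_error al TYPE('n) n"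
    proof -
      have "ennreal (real n powr - s) * ennreal c <= ennreal (real n powr - s) * (ennreal (real n powr s) * cube_error al TYPE('n) n)"
        using c(2)[OF n] by (intro mult_left_mono) (simp_all add: scaled_quant_error_def s_def)
      also have "... = ennreal (real n powr - s * real n powr s) * cube_error al TYPE('n) n" by (simp add: ennreal_mult mult.assoc)
      also have "real n powr - s * real n powr s = 1" using n by (simp add: powr_add[symmetric])
      finally show ?thesis using c(1) by (simp add: ennreal_mult[symmetric] mult.commute)
    qed
    then have "ennreal (m g powr (1 + s)) * ennreal (c * real n powr - s) <= ennreal (m g powr (1 + s)) * cube_error al TYPE('n) n" by (rule mult_left_mono) simp
    also have "... = ennreal (a g powr al * l powr (real ?d * al + 1)) * cube_error al TYPE('n) n"
      unfolding m_def p_def s_def using mass_powr_eq[OF a[OF g] l al(1), where 'n='n] by simp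
    also have "... = density_error al (\<lambda>x. ennreal (a g) * indicator (cube ?w l) x) n" using al by (intro quant_error_cube[symmetric] a[OF g] l) auto
    also have "... <= density_error al (\<lambda>x. ?f x * indicator (shrunk_cube v L k dl g) x) n"
    proof (rule quant_error_mono)
      show "ennreal (a g) * indicator (cube ?w l) x <= ?f x * indicator (shrunk_cube v L k dl g) x" for x
      proof (cases "x \<in> shrunk_cube v L k dl g")
        case True
        then have "x \<in> grid_cube v L k g" using shrunk_cube_subset[OF k L dl(1)] by blast
        then have "ennreal (a g) * indicator (grid_cube v L k g) x <= ?f x" unfolding step_fun_def using finJ g by (intro member_le_sum) auto
        then show ?thesis using True \<open>x \<in> grid_cube v L k g\<close> by (simp add: shrunk_cube_def l_def)
      qed (simp add: shrunk_cube_def l_def)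
      show "?f x * indicator (shrunk_cube v L k dl g) x < top" for x using step_fun_less_top[of v L k J a x] by (simp add: indicator_def)
    qed (use al in \<open>auto simp: shrunk_cube_def\<close>)
    finally show ?thesis using c(1) by (simp add: ennreal_mult[symmetric] mult_ac)
  qed
  define err where "err = ennreal (real (card J) * cut_error al L N TYPE('n)) * ennpow (\<integral>\<^sup>+x. ?f x \<partial>lborel) al"
  show ?thesis unfolding err_def[symmetric]
  proof (rule ennreal_le_epsilon)
    fix e :: real
    assume fin: "density_error al ?f N + err < top" and e: "0 < e"
    then have "density_error al ?f N < density_error al ?f N + ennreal e" using ennreal_add_left_cancel_less[of "density_error al ?f N" 0 "ennreal e"] by auto
    then obtain P F where P: "traffic_plan P" "distr P borel curve_end = density lborel ?f" "finite F" "card F <= N"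
      "AE cv in P. cv 0 \<in> F" "alpha_mass al P < density_error al ?f N + ennreal e" by (rule quant_error_less)
    let ?n = "\<lambda>g. card (F \<inter> shrunk_cube v L k dl g) + ?K"
    have "(\<Sum>g\<in>J. ?n g) <= N + card J * ?K"
    proof -
      have "(\<Sum>g\<in>J. card (F \<inter> shrunk_cube v L k dl g)) = card (\<Union>g\<in>J. F \<inter> shrunk_cube v L k dl g)" using finJ P(3) shrunk_cube_disjoint[OF k L dl(1), of v J]
        by (intro card_UN_disjoint[symmetric]) (auto simp: disjoint_family_on_def)
      also have "... <= card F" using P(3) by (intro card_mono) auto
      finally show ?thesis using P(4) by (simp add: sum.distrib)
    qed
    then have "real (\<Sum>g\<in>J. ?n g) <= real (N + card J * ?K)" by (rule of_nat_mono)
    then have nsum: "(\<Sum>g\<in>J. real (?n g)) <= real N + real (card J) * real ?K" by simp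
    have Nn: "0 < real N + real (card J) * real ?K" using N by (intro add_pos_nonneg) auto
    have "(1 - dl) ^ ?d * (\<Sum>g\<in>J. a g powr p * (L / real k) ^ ?d) = (\<Sum>g\<in>J. m g)" unfolding m_def l_def power_mult_distrib sum_distrib_left by (simp only: mult_ac)
    then have "ennreal (c * ((1 - dl) ^ ?d * (\<Sum>g\<in>J. a g powr p * (L / real k) ^ ?d)) powr (1 + s) * (real N + real (card J) * real ?K) powr - s)
       = ennreal (c * ((\<Sum>g\<in>J. m g) powr (1 + s) * (real N + real (card J) * real ?K) powr - s))" by (simp add: mult.assoc)
    also have "... <= ennreal (c * (\<Sum>g\<in>J. m g powr (1 + s) * real (?n g) powr - s))"
      using c(1) finJ s K0 nsum Nn l by (intro ennreal_leI mult_left_mono sum_powr_holder) (auto simp: m_def)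
    also have "... = (\<Sum>g\<in>J. ennreal (c * (m g powr (1 + s) * real (?n g) powr - s)))" using c(1) by (simp add: sum_distrib_left sum_ennreal)
    also have "... <= (\<Sum>g\<in>J. density_error al (\<lambda>x. ?f x * indicator (shrunk_cube v L k dl g) x) (?n g))" using K0 by (intro sum_mono cell) auto
    also have "... <= alpha_mass al P + err" unfolding err_def
    proof (rule superadditive_density[OF _ P(1,2,3,5) _ finJ shrunk_cube_disjoint[OF k L dl(1)] _ _ N al])
      fix g i
      show "closed (shrunk_cube v L k dl g)" unfolding shrunk_cube_def by (rule compact_imp_closed[OF compact_cube])
      show "frontier (shrunk_cube v L k dl g) \<subseteq> cbox (\<chi> i. v $ i + L * (real (g i) + dl / 2) / real k) ((\<chi> i. v $ i + L * (real (g i) + dl / 2) / real k) + l *\<^sub>R 1)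
         - box (\<chi> i. v $ i + L * (real (g i) + dl / 2) / real k) ((\<chi> i. v $ i + L * (real (g i) + dl / 2) / real k) + l *\<^sub>R 1)"
        unfolding shrunk_cube_def l_def[symmetric] by (rule cube_frontier)
      show "((\<chi> i. v $ i + L * (real (g i) + dl / 2) / real k) + l *\<^sub>R 1) $ i - (\<chi> i. v $ i + L * (real (g i) + dl / 2) / real k) $ i <= L" using lL by simp
    qed simp
    also have "... <= density_error al ?f N + ennreal e + err" using P(6) by (intro add_right_mono) simp
    also have "... = density_error al ?f N + err + ennreal e" by (simp add: ac_simps)
    finally show "ennreal (c * ((1 - dl) ^ ?d * (\<Sum>g\<in>J. a g powr p * (L / real k) ^ ?d)) powr (1 + s) * (real N + real (card J) * real ?K) powr - s) <= density_error al ?f N + err + ennreal e" .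
  qed
qed

subsection \<open>The upper bound\<close>

text \<open>Cells overlap only in a null set, so almost everywhere at most one summand is nonzero
  and the power acts termwise.\<close>

lemma nn_integral_step_fun_powr:
  fixes v :: "real^'n"
  assumes k: "0 < k" and L: "0 < L" and J: "J \<subseteq> multi_index k" and a: "\<And>g. g \<in> J ==> 0 < a g"
  shows "(\<integral>\<^sup>+x. ennpow (step_fun v L k J a x) p \<partial>lborel) = ennreal (\<Sum>g\<in>J. a g powr p * (L / real k) ^ CARD('n))"
proof -
  have finJ: "finite J" using J by (rule finite_subset[OF _ finite_multi_index])
  have "AE x in lborel. ennpow (step_fun v L k J a x) p = (\<Sum>g\<in>J. ennreal (a g powr p) * indicator (grid_cube v L k g) x)" using AE_in_one_grid_cube[OF k L, of v]
  proof eventually_elim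
    case (elim x)
    show ?case
    proof (cases "\<exists>g\<in>J. x \<in> grid_cube v L k g")
      case True
      then obtain g where g: "g \<in> J" "x \<in> grid_cube v L k g" by blast
      then have "x \<in> cube v L" using grid_cube_subset[OF k L] J by blast
      then have u: "x \<notin> grid_cube v L k g'" if "g' \<noteq> g" for g' using elim g(2) that by blast
      have one: "(\<Sum>g'\<in>J. b g' * indicator (grid_cube v L k g') x) = b g" for b :: "_ => ennreal"
      proof -
        have "(\<Sum>g'\<in>J. b g' * indicator (grid_cube v L k g') x) = (\<Sum>g'\<in>J. if g' = g then b g else 0)"
          by (rule sum.cong[OF refl]) (use u g(2) in \<open>auto simp: indicator_def\<close>)
        then show ?thesis using finJ g(1) by simp
      qed
      show ?thesis unfolding step_fun_def one using a[OF g(1)] by (simp add: ennpow_ennreal)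
    next
      case False
      then have "(\<Sum>g\<in>J. b g * indicator (grid_cube v L k g) x) = 0" for b :: "_ => ennreal" by (intro sum.neutral) auto
      then show ?thesis by (simp only: step_fun_def ennpow_0)
    qed
  qed
  then have "(\<integral>\<^sup>+x. ennpow (step_fun v L k J a x) p \<partial>lborel) = (\<integral>\<^sup>+x. (\<Sum>g\<in>J. ennreal (a g powr p) * indicator (grid_cube v L k g) x) \<partial>lborel)"
    by (rule nn_integral_cong_AE)
  also have "... = (\<Sum>g\<in>J. ennreal (a g powr p) * emeasure lborel (grid_cube v L k g))" by (subst nn_integral_sum) (auto simp: nn_integral_cmult_indicator)
  also have "... = (\<Sum>g\<in>J. ennreal (a g powr p * (L / real k) ^ CARD('n)))" using L k by (intro sum.cong refl) (simp add: grid_cube_def emeasure_cube ennreal_mult)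
  also have "... = ennreal (\<Sum>g\<in>J. a g powr p * (L / real k) ^ CARD('n))" using L by (intro sum_ennreal) auto
  finally show ?thesis .
qed

lemma nat_floor_ratio_tendsto:
  assumes x: "0 < x" shows "(\<lambda>N. real (nat \<lfloor>x * real N\<rfloor>) / real N) \<longlonglongrightarrow> x"
proof (rule tendsto_sandwich)
  have "(\<lambda>N. x - 1 / real N) \<longlonglongrightarrow> x - 0" by (intro tendsto_intros lim_1_over_n)
  then show "(\<lambda>N. x - 1 / real N) \<longlonglongrightarrow> x" by simp
  show "\<forall>\<^sub>F N in sequentially. x - 1 / real N <= real (nat \<lfloor>x * real N\<rfloor>) / real N"
  proof (rule eventually_sequentiallyI[of 1])
    fix N :: nat assume N: "1 <= N"
    have "x * real N - 1 <= real (nat \<lfloor>x * real N\<rfloor>)" using x by linarith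
    then have "(x * real N - 1) / real N <= real (nat \<lfloor>x * real N\<rfloor>) / real N" by (rule divide_right_mono) simp
    then show "x - 1 / real N <= real (nat \<lfloor>x * real N\<rfloor>) / real N" using N by (simp add: diff_divide_distrib)
  qed
  show "\<forall>\<^sub>F N in sequentially. real (nat \<lfloor>x * real N\<rfloor>) / real N <= x"
  proof (rule eventually_sequentiallyI[of 1])
    fix N :: nat assume N: "1 <= N"
    have "real (nat \<lfloor>x * real N\<rfloor>) <= x * real N" using x by simp
    then show "real (nat \<lfloor>x * real N\<rfloor>) / real N <= x" using N by (simp add: divide_le_eq)
  qed
qed simp

lemma nat_floor_at_top:
  assumes x: "0 < x" shows "filterlim (\<lambda>N. nat \<lfloor>x * real N\<rfloor>) sequentially sequentially" unfolding filterlim_at_top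
proof
  fix Z :: nat
  obtain N0 :: nat where N0: "real Z / x <= real N0" using real_arch_simple by blast
  show "\<forall>\<^sub>F N in sequentially. Z <= nat \<lfloor>x * real N\<rfloor>"
  proof (rule eventually_sequentiallyI[of N0])
    fix N assume "N0 <= N"
    then have "real Z / x <= real N" using N0 by linarith
    then have "real Z <= x * real N" using x by (simp add: divide_le_eq mult.commute)
    then show "Z <= nat \<lfloor>x * real N\<rfloor>" by (simp add: le_nat_floor)
  qed
qed

text \<open>Cell g receives the share m g / M of \<open>tt * N\<close> sources, rounded down so that
  the total stays below \<open>tt * N\<close>. The parameter \<open>tt\<close> lets a caller hold
  back the remaining sources for the error of the step approximation.\<close>

lemma step_upper:
  fixes v :: "real^'n"
  assumes al: "0 < al" "al < 1" "real CARD('n) * (1 - al) < 1"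
    and c: "0 < c" "scaled_cube al TYPE('n) \<longlonglongrightarrow> ennreal c"
    and k: "0 < k" and L: "0 < L" and J: "J \<subseteq> multi_index k" "J \<noteq> {}" and a: "\<And>g. g \<in> J ==> 0 < a g"
    and tt: "0 < tt"
  defines "s \<equiv> beta_exp al TYPE('n) / real CARD('n)" and "p \<equiv> al / (al + 1 / real CARD('n))"
  defines "M \<equiv> \<Sum>g\<in>J. a g powr p * (L / real k) ^ CARD('n)"
  assumes U: "tt powr - s * (c * M powr (1 + s)) < U"
  shows "\<forall>\<^sub>F N in sequentially. \<exists>n. real n <= tt * real N \<and>
    ennreal (real N powr s) * density_error al (step_fun v L k J a) n < ennreal U"
proof -
  let ?d = "CARD('n)" and ?S = "scaled_cube al TYPE('n)"
  have finJ: "finite J" using J(1) by (rule finite_subset[OF _ finite_multi_index])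
  have \<beta>: "0 < beta_exp al TYPE('n)" using al(3) by (auto simp: beta_exp_def algebra_simps)
  then have s: "0 < s" by (simp add: s_def)
  define l where "l = L / real k"
  have l: "0 < l" using L k by (simp add: l_def)
  define m where "m g = a g powr p * l ^ ?d" for g
  have m: "0 < m g" if "g \<in> J" for g using a[OF that] l by (simp add: m_def)
  have Mm: "M = (\<Sum>g\<in>J. m g)" by (simp add: M_def m_def l_def)
  have M: "0 < M" unfolding Mm using finJ J(2) m by (intro sum_pos) auto
  define n where "n N g = nat \<lfloor>tt * (m g / M) * real N\<rfloor>" for N g
  have nle: "real (\<Sum>g\<in>J. n N g) <= tt * real N" for N
  proof -
    have "real (\<Sum>g\<in>J. n N g) = (\<Sum>g\<in>J. real (n N g))" by simp
    also have "... <= (\<Sum>g\<in>J. tt * (m g / M) * real N)" using tt M m by (intro sum_mono) (auto simp: n_def less_imp_le)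
    also have "... = tt * ((\<Sum>g\<in>J. m g) / M) * real N" by (simp add: sum_distrib_left sum_distrib_right sum_divide_distrib)
    also have "... = tt * real N" using M by (simp add: Mm)
    finally show ?thesis .
  qed
  have cell: "(\<lambda>N. ennreal (m g powr (1 + s)) * (ennreal ((real N / real (n N g)) powr s) * ?S (n N g)))
     \<longlonglongrightarrow> ennreal (m g powr (1 + s)) * (ennreal ((1 / (tt * (m g / M))) powr s) * ennreal c)" if g: "g \<in> J" for g
  proof -
    let ?x = "tt * (m g / M)"
    have x: "0 < ?x" using tt M m[OF g] by simp
    have ninf: "filterlim (\<lambda>N. n N g) sequentially sequentially" unfolding n_def by (rule nat_floor_at_top[OF x])
    have "(\<lambda>N. real (n N g) / real N) \<longlonglongrightarrow> ?x" unfolding n_def by (rule nat_floor_ratio_tendsto[OF x])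
    then have "(\<lambda>N. inverse (real (n N g) / real N)) \<longlonglongrightarrow> inverse ?x" using x by (intro tendsto_inverse) auto
    then have "(\<lambda>N. real N / real (n N g)) \<longlonglongrightarrow> 1 / ?x" by (simp add: inverse_eq_divide)
    then have "(\<lambda>N. (real N / real (n N g)) powr s) \<longlonglongrightarrow> (1 / ?x) powr s" using x by (intro tendsto_powr) auto
    moreover have "(\<lambda>N. ?S (n N g)) \<longlonglongrightarrow> ennreal c" by (rule filterlim_compose[OF c(2) ninf])
    ultimately show ?thesis using c(1) by (intro tendsto_mult_ennreal tendsto_const tendsto_ennrealI) auto
  qed
  have "(\<lambda>N. \<Sum>g\<in>J. ennreal (m g powr (1 + s)) * (ennreal ((real N / real (n N g)) powr s) * ?S (n N g)))
     \<longlonglongrightarrow> (\<Sum>g\<in>J. ennreal (m g powr (1 + s)) * (ennreal ((1 / (tt * (m g / M))) powr s) * ennreal c))" by (intro tendsto_sum cell)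
  also have "(\<Sum>g\<in>J. ennreal (m g powr (1 + s)) * (ennreal ((1 / (tt * (m g / M))) powr s) * ennreal c)) = ennreal (tt powr - s * (c * M powr (1 + s)))"
  proof -
    \<comment> \<open>With the optimal shares the cost of a cell becomes proportional to m g, so the
      sum over the cells collapses.\<close>
    have "m g powr (1 + s) * ((1 / (tt * (m g / M))) powr s * c) = tt powr - s * (c * (m g * M powr s))" if g: "g \<in> J" for g
      using m[OF g] M tt by (simp add: powr_mult powr_divide powr_add powr_minus field_simps)
    then have "(\<Sum>g\<in>J. m g powr (1 + s) * ((1 / (tt * (m g / M))) powr s * c)) = (\<Sum>g\<in>J. tt powr - s * (c * (m g * M powr s)))" by (rule sum.cong[OF refl])
    also have "... = tt powr - s * (c * ((\<Sum>g\<in>J. m g) * M powr s))" by (simp add: sum_distrib_left sum_distrib_right)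
    also have "(\<Sum>g\<in>J. m g) * M powr s = M powr (1 + s)" using M by (simp add: Mm powr_add)
    finally show ?thesis using c(1) m by (simp add: ennreal_mult[symmetric] sum_ennreal)
  qed
  finally have lim: "(\<lambda>N. \<Sum>g\<in>J. ennreal (m g powr (1 + s)) * (ennreal ((real N / real (n N g)) powr s) * ?S (n N g))) \<longlonglongrightarrow> ennreal (tt powr - s * (c * M powr (1 + s)))" .
  have "ennreal (tt powr - s * (c * M powr (1 + s))) < ennreal U" using U c(1) by (intro ennreal_lessI) (auto intro: le_less_trans[rotated])
  from order_tendstoD(2)[OF lim this]
  have ev1: "\<forall>\<^sub>F N in sequentially. (\<Sum>g\<in>J. ennreal (m g powr (1 + s)) * (ennreal ((real N / real (n N g)) powr s) * ?S (n N g))) < ennreal U" .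
  have ev2: "\<forall>\<^sub>F N in sequentially. \<forall>g\<in>J. 1 <= n N g"
  proof (intro eventually_ball_finite[OF finJ] ballI)
    fix g assume g: "g \<in> J"
    have x: "0 < tt * (m g / M)" using tt M m[OF g] by simp
    show "\<forall>\<^sub>F N in sequentially. 1 <= n N g" using nat_floor_at_top[OF x] unfolding filterlim_at_top n_def by blast
  qed
  show ?thesis using ev1 ev2
  proof eventually_elim
    case (elim N)
    have "density_error al (step_fun v L k J a) (\<Sum>g\<in>J. n N g) \<le>
       (\<Sum>g\<in>J. density_error al (\<lambda>x. ennreal (a g) * indicator (grid_cube v L k g) x) (n N g))"
      unfolding step_fun_def[abs_def] using finJ J al by (intro quant_error_sum_le) auto
    also have "... = (\<Sum>g\<in>J. ennreal (m g powr (1 + s)) * cube_error al TYPE('n) (n N g))"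
    proof (rule sum.cong[OF refl])
      fix g assume g: "g \<in> J"
      have "density_error al (\<lambda>x. ennreal (a g) * indicator (grid_cube v L k g) x) (n N g) =
        ennreal (a g powr al * l powr (real ?d * al + 1)) * cube_error al TYPE('n) (n N g)"
        unfolding grid_cube_def l_def[symmetric] using al by (intro quant_error_cube a[OF g] l) auto
      also have "a g powr al * l powr (real ?d * al + 1) = m g powr (1 + s)" unfolding m_def p_def s_def using a[OF g] l al(1) by (rule mass_powr_eq[symmetric])
      finally show "density_error al (\<lambda>x. ennreal (a g) * indicator (grid_cube v L k g) x) (n N g) =
        ennreal (m g powr (1 + s)) * cube_error al TYPE('n) (n N g)" .
    qed
    finally have "ennreal (real N powr s) * density_error al (step_fun v L k J a) (\<Sum>g\<in>J. n N g) \<le>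
      ennreal (real N powr s) * (\<Sum>g\<in>J. ennreal (m g powr (1 + s)) * cube_error al TYPE('n) (n N g))" by (rule mult_left_mono) simp
    also have "... = (\<Sum>g\<in>J. ennreal (m g powr (1 + s)) * (ennreal ((real N / real (n N g)) powr s) * ?S (n N g)))" unfolding sum_distrib_left
    proof (rule sum.cong[OF refl])
      fix g assume "g \<in> J"
      then have n1: "1 <= n N g" using elim(2) by blast
      have "real N powr s = (real N / real (n N g)) powr s * real (n N g) powr s" using n1 by (simp add: powr_divide)
      then show "ennreal (real N powr s) * (ennreal (m g powr (1 + s)) * cube_error al TYPE('n) (n N g)) =
        ennreal (m g powr (1 + s)) * (ennreal ((real N / real (n N g)) powr s) * ?S (n N g))" by (simp add: scaled_quant_error_def s_def ennreal_mult mult_ac)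
    qed
    also have "... < ennreal U" by (rule elim(1))
    finally show ?case using nle by blast
  qed
qed



section \<open>Asymptotics for integrable densities\<close>

lemma ennreal_le_add_minus: "x <= y + (x - y)" for x y :: ennreal
proof (cases "y <= x")
  case True
  then show ?thesis by (simp add: add_diff_inverse_ennreal)
next
  case False
  then show ?thesis by (intro add_increasing2) auto
qed

text \<open>Below \<open>l\<close> the constant dominates; above \<open>l\<close> the linear term
  does, since x^(p-1) is decreasing.\<close>

lemma ennpow_le_affine:
  assumes p: "0 < p" "p < 1" and l: "0 < l"
  shows "ennpow x p <= ennreal (l powr (p - 1)) * x + ennreal (l powr p)"
proof (cases x)
  case (real r)
  have "r powr p <= l powr (p - 1) * r + l powr p"
  proof (cases "r <= l")
    case True
    then have "r powr p <= l powr p" using real(1) p by (intro powr_mono2) auto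
    moreover have "0 <= l powr (p - 1) * r" using real by simp
    ultimately show ?thesis by linarith
  next
    case False
    then have "r powr p = r powr (p - 1) * r" using l by (simp add: powr_diff)
    also have "... <= l powr (p - 1) * r" using False p l by (intro mult_right_mono powr_mono2') auto
    finally show ?thesis by (simp add: add_increasing2)
  qed
  then show ?thesis using real by (simp add: ennpow_ennreal ennreal_mult[symmetric] ennreal_plus[symmetric] ennreal_leI del: ennreal_plus)
qed (use l in \<open>simp add: ennreal_mult_top\<close>)

text \<open>The power is not Lipschitz at 0, but on a set of finite volume the affine bound serves:
  first \<open>l\<close> is chosen so small that the constant contributes at most kap/2 over
  \<open>S\<close>, then \<open>eta\<close> so that the large slope contributes at most
  kap/2.\<close>

lemma nn_integral_ennpow_close:
  fixes S :: "'a::euclidean_space set"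
  assumes S: "S \<in> sets borel" "emeasure lborel S < top" and p: "0 < p" "p < 1" and kap: "0 < kap"
  obtains eta where "0 < eta"
    "\<And>f g. f \<in> borel_measurable borel ==> g \<in> borel_measurable borel ==> (\<And>x. x \<notin> S ==> f x = 0) ==>
      (\<integral>\<^sup>+x. (f x - g x) \<partial>lborel) < ennreal eta ==>
      (\<integral>\<^sup>+x. ennpow (f x) p \<partial>lborel) <= (\<integral>\<^sup>+x. ennpow (g x) p \<partial>lborel) + ennreal kap"
proof -
  define V where "V = enn2real (emeasure lborel S)"
  have V: "emeasure lborel S = ennreal V" "0 <= V" using S(2) by (simp_all add: V_def)
  define l where "l = (kap / (2 * (V + 1))) powr (1 / p)"
  have l: "0 < l" using kap V by (simp add: l_def)
  have lV: "l powr p * V <= kap / 2"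
  proof -
    have "l powr p = kap / (2 * (V + 1))" using kap V p by (simp add: l_def powr_powr)
    then have "l powr p * V = kap / 2 * (V / (V + 1))" by (simp add: field_simps)
    also have "... <= kap / 2 * 1" using kap V by (intro mult_left_mono) (auto simp: divide_le_eq)
    finally show ?thesis by simp
  qed
  define eta where "eta = kap / 2 / l powr (p - 1)"
  have eta: "0 < eta" using kap l by (simp add: eta_def)
  show thesis
  proof (rule that[OF eta])
    fix f g :: "'a => ennreal"
    assume [measurable]: "f \<in> borel_measurable borel" "g \<in> borel_measurable borel"
      and supp: "\<And>x. x \<notin> S ==> f x = 0" and I: "(\<integral>\<^sup>+x. (f x - g x) \<partial>lborel) < ennreal eta"
    note [measurable] = S(1)
    have "ennpow (f x) p <= ennpow (g x) p + (ennreal (l powr (p - 1)) * (f x - g x) + ennreal (l powr p) * indicator S x)" for x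
    proof (cases "x \<in> S")
      case True
      have "ennpow (f x) p <= ennpow (g x + (f x - g x)) p" using p by (intro ennpow_mono ennreal_le_add_minus) auto
      also have "... <= ennpow (g x) p + ennpow (f x - g x) p" using p by (intro ennpow_add_le) auto
      also have "... <= ennpow (g x) p + (ennreal (l powr (p - 1)) * (f x - g x) + ennreal (l powr p))" by (intro add_left_mono ennpow_le_affine p l)
      finally show ?thesis using True by simp
    qed (simp add: supp)
    then have "(\<integral>\<^sup>+x. ennpow (f x) p \<partial>lborel) \<le>
        (\<integral>\<^sup>+x. ennpow (g x) p + (ennreal (l powr (p - 1)) * (f x - g x) + ennreal (l powr p) * indicator S x) \<partial>lborel)" by (rule nn_integral_mono)
    also have "... = (\<integral>\<^sup>+x. ennpow (g x) p \<partial>lborel) + (ennreal (l powr (p - 1)) * (\<integral>\<^sup>+x. (f x - g x) \<partial>lborel) + ennreal (l powr p) * emeasure lborel S)"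
      by (simp add: nn_integral_add nn_integral_cmult)
    also have "... <= (\<integral>\<^sup>+x. ennpow (g x) p \<partial>lborel) + (ennreal (l powr (p - 1)) * ennreal eta + ennreal (l powr p) * ennreal V)"
      unfolding V(1) using I by (intro add_mono mult_left_mono order_refl) auto
    also have "ennreal (l powr (p - 1)) * ennreal eta + ennreal (l powr p) * ennreal V = ennreal (l powr (p - 1) * eta + l powr p * V)"
      using eta V by (simp add: ennreal_mult)
    also have "l powr (p - 1) * eta + l powr p * V <= kap" using lV l by (simp add: eta_def)
    finally show "(\<integral>\<^sup>+x. ennpow (f x) p \<partial>lborel) <= (\<integral>\<^sup>+x. ennpow (g x) p \<partial>lborel) + ennreal kap" by (simp add: ennreal_leI add_left_mono)
  qed
qed

text \<open>A fixed fraction \<open>t\<close> of the sources irrigates a remainder of mass below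
  \<open>eta\<close> at a scaled cost of order eta^al. The factor t/2 instead of t absorbs the
  rounding of the number of sources.\<close>

lemma small_density_quant_error:
  fixes h :: "real^'n => ennreal"
  assumes al: "0 < al" "al < 1" "real CARD('n) * (1 - al) < 1"
    and h: "h \<in> borel_measurable borel" "\<And>x. x \<notin> cube v L ==> h x = 0" "(\<integral>\<^sup>+x. h x \<partial>lborel) < ennreal eta"
    and L: "0 < L" and t: "0 < t" and eta: "0 < eta"
  defines "s \<equiv> beta_exp al TYPE('n) / real CARD('n)"
  shows "\<forall>\<^sub>F N in sequentially. ennreal (real N powr s) * density_error al h (nat \<lfloor>t * real N\<rfloor>) \<le>
    ennreal (irr_const al TYPE('n) * 3 * L * (t / 2) powr - s * eta powr al)"
proof -
  have \<beta>: "0 < beta_exp al TYPE('n)" using al(3) by (auto simp: beta_exp_def algebra_simps)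
  then have s: "0 < s" by (simp add: s_def)
  have irr: "0 <= irr_const al TYPE('n)" using al(3) by (rule irr_const_nonneg)
  have ev1: "\<forall>\<^sub>F N in sequentially. 3 ^ CARD('n) <= nat \<lfloor>t * real N\<rfloor>" using nat_floor_at_top[OF t] unfolding filterlim_at_top by blast
  have "t / 2 < t" using t by simp
  from order_tendstoD(1)[OF nat_floor_ratio_tendsto[OF t] this]
  have ev2: "\<forall>\<^sub>F N in sequentially. t / 2 < real (nat \<lfloor>t * real N\<rfloor>) / real N" .
  show ?thesis using ev1 ev2 eventually_ge_at_top[of 1]
  proof eventually_elim
    case (elim N)
    let ?n = "nat \<lfloor>t * real N\<rfloor>"
    have fin: "(\<integral>\<^sup>+x. h x \<partial>lborel) < top" using h(3) by (rule less_trans) simp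
    have tN: "t / 2 * real N <= real ?n" using elim(2,3) by (simp add: pos_less_divide_eq)
    have tN0: "0 < t / 2 * real N" using t elim(3) by simp
    have pw: "real N powr s * real ?n powr - s <= (t / 2) powr - s"
    proof -
      have "real ?n powr - s <= (t / 2 * real N) powr - s" using tN tN0 s by (intro powr_mono2') auto
      then have "real N powr s * real ?n powr - s <= real N powr s * (t / 2 * real N) powr - s" by (rule mult_left_mono) simp
      also have "... = (t / 2) powr - s * (real N powr s * real N powr - s)" by (simp only: powr_mult mult_ac)
      also have "real N powr s * real N powr - s = 1" using elim(3) by (simp add: powr_add[symmetric])
      finally show ?thesis by simp
    qed
    have "density_error al h ?n <= ennreal (irr_const al TYPE('n) * 3 * L * real ?n powr - s) * ennpow (\<integral>\<^sup>+x. h x \<partial>lborel) al"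
      unfolding s_def using h(1) fin h(2) L elim(1) al by (rule quant_error_le_mass)
    also have "... <= ennreal (irr_const al TYPE('n) * 3 * L * real ?n powr - s) * ennreal (eta powr al)"
      using ennpow_mono[OF less_imp_le[OF h(3)], of al] al eta by (intro mult_left_mono) (auto simp: ennpow_ennreal)
    finally have "ennreal (real N powr s) * density_error al h ?n \<le>
        ennreal (real N powr s) * (ennreal (irr_const al TYPE('n) * 3 * L * real ?n powr - s) * ennreal (eta powr al))" by (rule mult_left_mono) simp
    also have "... = ennreal (real N powr s * ((irr_const al TYPE('n) * 3 * L * real ?n powr - s) * eta powr al))" using irr L by (simp add: ennreal_mult)
    also have "real N powr s * ((irr_const al TYPE('n) * 3 * L * real ?n powr - s) * eta powr al) =
        (irr_const al TYPE('n) * 3 * L * eta powr al) * (real N powr s * real ?n powr - s)" by (simp only: mult_ac)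
    also have "... <= (irr_const al TYPE('n) * 3 * L * eta powr al) * (t / 2) powr - s" using irr L by (intro mult_left_mono pw) auto
    finally show ?case by (simp add: ennreal_leI mult_ac)
  qed
qed

lemma small_powr:
  fixes C al tau :: real
  assumes "0 < al" "0 < tau" "0 < eta1"
  obtains eta where "0 < eta" "eta <= eta1" "C * eta powr al < tau"
proof -
  have "((\<lambda>eta. C * eta powr al) \<longlongrightarrow> C * 0 powr al) (at_right 0)"
    using assms(1) by (intro tendsto_intros tendsto_powr') (auto simp: eventually_at_right_less less_imp_le intro!: eventually_mono[OF eventually_at_right_less])
  then have "\<forall>\<^sub>F eta in at_right 0. C * eta powr al < tau" using assms by (intro order_tendstoD(2)) auto
  moreover have "\<forall>\<^sub>F eta in at_right 0. eta < eta1" using assms(3) by (simp add: eventually_at_right_real order_tendstoD(2)[OF tendsto_ident_at])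
  ultimately have "\<forall>\<^sub>F eta in at_right (0::real). 0 < eta \<and> eta <= eta1 \<and> C * eta powr al < tau" using eventually_at_right_less[of 0] by eventually_elim auto
  then show thesis using that eventually_happens'[OF trivial_limit_at_right_real] by blast
qed

lemma nn_integral_minus_less_top:
  fixes f g :: "'a => ennreal"
  assumes [measurable]: "f \<in> borel_measurable M" "g \<in> borel_measurable M"
    and "(\<integral>\<^sup>+x. f x \<partial>M) < top" "(\<integral>\<^sup>+x. (g x - f x) \<partial>M) < top"
  shows "(\<integral>\<^sup>+x. g x \<partial>M) < top"
proof -
  have "(\<integral>\<^sup>+x. g x \<partial>M) <= (\<integral>\<^sup>+x. f x + (g x - f x) \<partial>M)" by (intro nn_integral_mono ennreal_le_add_minus)
  also have "... = (\<integral>\<^sup>+x. f x \<partial>M) + (\<integral>\<^sup>+x. (g x - f x) \<partial>M)" by (rule nn_integral_add) auto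
  also have "... < top" using assms by simp
  finally show ?thesis .
qed

lemma quant_error_le_plus_minus:
  fixes f g :: "'a::euclidean_space => ennreal"
  assumes [measurable]: "f \<in> borel_measurable borel" "g \<in> borel_measurable borel"
    and fin: "\<And>x. f x < top" "\<And>x. g x < top" and al: "0 < al" "al <= 1"
  shows "density_error al f (N + K) \<le>
    density_error al g N + density_error al (\<lambda>x. f x - g x) K"
proof -
  have "density_error al f (N + K) <= density_error al (\<lambda>x. g x + (f x - g x)) (N + K)"
    using fin al by (intro quant_error_mono ennreal_le_add_minus) (auto simp: less_top[symmetric] ennreal_minus_eq_top)
  also have "... <= density_error al g N + density_error al (\<lambda>x. f x - g x) K" using al by (intro quant_error_plus_le) auto
  finally show ?thesis .
qed

text \<open>The share \<open>t\<close> is fixed before \<open>eta\<close>: it is the fraction of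
  sources set aside for \<open>f\<close> minus the step function, and also the permitted excess of
  the power integral. Only then can \<open>eta\<close> be made small enough to beat the factor
  (t/2)^(-s).\<close>

lemma density_upper:
  fixes f :: "real^'n => ennreal"
  assumes al: "0 < al" "al < 1" "real CARD('n) * (1 - al) < 1"
    and c: "0 < c" "scaled_cube al TYPE('n) \<longlonglongrightarrow> ennreal c"
    and f: "f \<in> borel_measurable borel" "\<And>x. f x < top" "\<And>x. x \<notin> cube v L ==> f x = 0" "(\<integral>\<^sup>+x. f x \<partial>lborel) < top" "0 < (\<integral>\<^sup>+x. f x \<partial>lborel)"
    and L: "0 < L" and M: "(\<integral>\<^sup>+x. ennpow (f x) (al / (al + 1 / real CARD('n))) \<partial>lborel) = ennreal M" "0 <= M"
    and U: "c * M powr (1 + beta_exp al TYPE('n) / real CARD('n)) < U"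
  shows "\<forall>\<^sub>F N in sequentially. scaled_quant_error al (density lborel f) N < ennreal U"
proof -
  define s where "s = beta_exp al TYPE('n) / real CARD('n)"
  define p where "p = al / (al + 1 / real CARD('n))"
  have \<beta>: "0 < beta_exp al TYPE('n)" using al(3) by (auto simp: beta_exp_def algebra_simps)
  then have s: "0 < s" by (simp add: s_def)
  have "0 < 1 / real CARD('n)" by simp
  then have p: "0 < p" "p < 1" using al(1) unfolding p_def by (simp_all add: add_pos_pos)
  have irr: "0 <= irr_const al TYPE('n)" using al(3) by (rule irr_const_nonneg)
  obtain U1 where U1: "c * M powr (1 + s) < U1" "U1 < U" using U dense unfolding s_def by blast
  have "((\<lambda>t. (1 - t) powr - s * (c * (M + t) powr (1 + s))) \<longlongrightarrow> (1 - 0) powr - s * (c * (M + 0) powr (1 + s))) (at_right 0)"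
    using s M(2) by (intro tendsto_intros tendsto_powr') (auto intro!: eventually_mono[OF eventually_at_right_less])
  then have "\<forall>\<^sub>F t in at_right 0. (1 - t) powr - s * (c * (M + t) powr (1 + s)) < U1" using U1(1) by (intro order_tendstoD(2)) auto
  moreover have "\<forall>\<^sub>F t in at_right (0::real). t < 1" by (rule order_tendstoD(2)[OF tendsto_ident_at]) simp
  ultimately have "\<forall>\<^sub>F t in at_right (0::real). 0 < t \<and> t < 1 \<and> (1 - t) powr - s * (c * (M + t) powr (1 + s)) < U1"
    using eventually_at_right_less[of 0] by eventually_elim auto
  then obtain t where t: "0 < t" "t < 1" "(1 - t) powr - s * (c * (M + t) powr (1 + s)) < U1" using eventually_happens'[OF trivial_limit_at_right_real] by blast
  have cubeL: "emeasure lborel (cube v L) < top" using L by (simp add: emeasure_cube)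
  obtain eta1 where eta1: "0 < eta1" "\<And>f g. f \<in> borel_measurable borel ==> g \<in> borel_measurable borel ==> (\<And>x. x \<notin> cube v L ==> f x = 0) ==>
      (\<integral>\<^sup>+x. (f x - g x) \<partial>lborel) < ennreal eta1 ==>
      (\<integral>\<^sup>+x. ennpow (f x) p \<partial>lborel) <= (\<integral>\<^sup>+x. ennpow (g x) p \<partial>lborel) + ennreal t"
    apply (rule nn_integral_ennpow_close[OF sets_cube cubeL p t(1)])
    subgoal premises prems by (intro prems(1)[OF prems(2)] prems(3)) auto
    done
  define I where "I = enn2real (\<integral>\<^sup>+x. f x \<partial>lborel)"
  have I: "(\<integral>\<^sup>+x. f x \<partial>lborel) = ennreal I" "0 < I" using f(4,5) by (auto simp: I_def enn2real_positive_iff)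
  \<comment> \<open>Taking \<open>eta\<close> at most the total mass \<open>I\<close> rules out the
    zero step function, for which the shares of the cells would be meaningless.\<close>
  obtain eta where eta: "0 < eta" "eta <= min eta1 I" "irr_const al TYPE('n) * 3 * L * (t / 2) powr - s * eta powr al < U - U1"
    using small_powr[OF al(1), of "U - U1" "min eta1 I"] U1(2) eta1(1) I(2) by auto
  obtain k J a where g: "0 < k" "J \<subseteq> multi_index k" "\<And>g. g \<in> J ==> 0 < a g"
    "(\<integral>\<^sup>+x. (f x - step_fun v L k J a x) \<partial>lborel) < ennreal eta"
    "(\<integral>\<^sup>+x. (step_fun v L k J a x - f x) \<partial>lborel) < ennreal eta" using step_approx[OF f(1,2,4,3) L eta(1)] by blast
  let ?g = "step_fun v L k J a"
  have J: "J \<noteq> {}"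
  proof
    assume "J = {}"
    then have "ennreal I < ennreal eta" using g(4) I(1) by (simp add: step_fun_def)
    then show False using eta(1,2) I(2) by (simp add: ennreal_less_iff)
  qed
  have gs: "?g x = 0" if "x \<notin> cube v L" for x unfolding step_fun_def using that grid_cube_subset[OF g(1) L] g(2) by (intro sum.neutral) (auto simp: indicator_def)
  have int_g: "(\<integral>\<^sup>+x. ennpow (?g x) p \<partial>lborel) = ennreal (\<Sum>g\<in>J. a g powr p * (L / real k) ^ CARD('n))" by (intro nn_integral_step_fun_powr g L)
  have "(\<integral>\<^sup>+x. ennpow (?g x) p \<partial>lborel) <= (\<integral>\<^sup>+x. ennpow (f x) p \<partial>lborel) + ennreal t"
    using g(5) eta(2) by (intro eta1(2) gs f(1)) (auto elim!: less_le_trans intro!: ennreal_leI)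
  then have "ennreal (\<Sum>g\<in>J. a g powr p * (L / real k) ^ CARD('n)) <= ennreal (M + t)" using M t(1) int_g by (simp add: p_def)
  then have Mg: "(\<Sum>g\<in>J. a g powr p * (L / real k) ^ CARD('n)) <= M + t" using M(2) t(1) by (simp add: ennreal_le_iff del: ennreal_plus)
  have "(1 - t) powr - s * (c * (\<Sum>g\<in>J. a g powr p * (L / real k) ^ CARD('n)) powr (1 + s)) \<le> (1 - t) powr - s * (c * (M + t) powr (1 + s))"
    using Mg c(1) s L by (intro mult_left_mono powr_mono2 sum_nonneg) auto
  also note t(3)
  finally have lt: "(1 - t) powr - s * (c * (\<Sum>g\<in>J. a g powr p * (L / real k) ^ CARD('n)) powr (1 + s)) < U1" .
  have ev1: "\<forall>\<^sub>F N in sequentially. \<exists>n. real n <= (1 - t) * real N \<and> ennreal (real N powr s) * density_error al ?g n < ennreal U1"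
    unfolding s_def by (rule step_upper[OF al c g(1) L g(2) J]) (use g(3) t(2) lt in \<open>simp_all add: s_def p_def\<close>)
  have ev2: "\<forall>\<^sub>F N in sequentially. ennreal (real N powr s) * density_error al (\<lambda>x. f x - ?g x) (nat \<lfloor>t * real N\<rfloor>) \<le>
    ennreal (irr_const al TYPE('n) * 3 * L * (t / 2) powr - s * eta powr al)"
    unfolding s_def using f(1,3) g(4) by (intro small_density_quant_error[where v=v] al L t(1) eta(1)) auto
  show ?thesis using ev1 ev2
  proof eventually_elim
    case (elim N)
    then obtain n where n: "real n <= (1 - t) * real N" "ennreal (real N powr s) * density_error al ?g n < ennreal U1" by blast
    let ?K = "nat \<lfloor>t * real N\<rfloor>"
    have "real ?K <= t * real N" using t(1) by simp
    then have "real (n + ?K) <= real N" using n(1) by (simp add: algebra_simps)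
    then have nK: "n + ?K <= N" by (simp only: of_nat_le_iff)
    have "scaled_quant_error al (density lborel f) N <= ennreal (real N powr s) * density_error al f (n + ?K)"
      unfolding scaled_quant_error_def s_def by (intro mult_left_mono quant_error_antimono nK) simp
    also have "... <= ennreal (real N powr s) * (density_error al ?g n + density_error al (\<lambda>x. f x - ?g x) ?K)"
      using f al by (intro mult_left_mono quant_error_le_plus_minus step_fun_less_top) auto
    also have "... = ennreal (real N powr s) * density_error al ?g n + ennreal (real N powr s) * density_error al (\<lambda>x. f x - ?g x) ?K" by (rule distrib_left)
    also have "... < ennreal U1 + ennreal (U - U1)"
    proof (rule add_strict_mono)
      show "ennreal (real N powr s) * density_error al ?g n < ennreal U1" by (rule n(2))
      show "ennreal (real N powr s) * density_error al (\<lambda>x. f x - ?g x) ?K < ennreal (U - U1)"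
        using elim(2) by (rule le_less_trans) (use eta(3) U1 irr L in \<open>auto intro!: ennreal_lessI\<close>)
    qed
    also have "... = ennreal U"
    proof -
      have "0 <= U1" using U1(1) c(1) by (meson less_imp_le mult_nonneg_nonneg order.trans powr_ge_zero)
      then show ?thesis using U1(2) by (simp add: ennreal_plus[symmetric] del: ennreal_plus)
    qed
    finally show ?case .
  qed
qed

text \<open>The roles are exchanged: a plan for \<open>f\<close> with N sources and K N further
  sources for the step function minus \<open>f\<close> together irrigate the step function, so the
  bound of \<open>step_lower\<close> for N + K N sources passes to \<open>f\<close>.\<close>

lemma density_lower:
  fixes f :: "real^'n => ennreal"
  assumes al: "0 < al" "al < 1" "real CARD('n) * (1 - al) < 1"
    and c: "0 < c" "\<And>N. 1 <= N ==> ennreal c <= scaled_cube al TYPE('n) N"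
    and f: "f \<in> borel_measurable borel" "\<And>x. f x < top" "\<And>x. x \<notin> cube v L ==> f x = 0" "(\<integral>\<^sup>+x. f x \<partial>lborel) < top"
    and L: "0 < L" and M: "(\<integral>\<^sup>+x. ennpow (f x) (al / (al + 1 / real CARD('n))) \<partial>lborel) = ennreal M" "0 <= M"
    and U: "0 <= U" "U < c * M powr (1 + beta_exp al TYPE('n) / real CARD('n))"
  shows "\<forall>\<^sub>F N in sequentially. ennreal U < scaled_quant_error al (density lborel f) N"
proof -
  define s where "s = beta_exp al TYPE('n) / real CARD('n)"
  define p where "p = al / (al + 1 / real CARD('n))"
  have \<beta>: "0 < beta_exp al TYPE('n)" using al(3) by (auto simp: beta_exp_def algebra_simps)
  then have s: "0 < s" by (simp add: s_def)
  have "0 < 1 / real CARD('n)" by simp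
  then have p: "0 < p" "p < 1" using al(1) unfolding p_def by (simp_all add: add_pos_pos)
  have irr: "0 <= irr_const al TYPE('n)" using al(3) by (rule irr_const_nonneg)
  have M0: "0 < M" using U M(2) by (cases "M = 0") auto
  obtain U1 where U1: "U < U1" "U1 < c * M powr (1 + s)" using U dense unfolding s_def by blast
  \<comment> \<open>Two errors have to fit between \<open>U\<close> and \<open>U1\<close>: the
    irrigation of the difference and the trees on the cell boundaries.\<close>
  define tau where "tau = (U1 - U) / 2"
  have tau: "0 < tau" using U1 by (simp add: tau_def)
  \<comment> \<open>One parameter serves four purposes: \<open>t\<close> is the shrinking of the
    cells, the permitted loss in the power integral, the share of further sources, and a bound for
    the share of boundary sources. The last two give 1 + 2 t.\<close>
  have "((\<lambda>t. (1 + 2 * t) powr - s * (c * ((1 - t) ^ CARD('n) * (M - t)) powr (1 + s))) \<longlongrightarrow>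
      (1 + 2 * 0) powr - s * (c * ((1 - 0) ^ CARD('n) * (M - 0)) powr (1 + s))) (at_right 0)" using M0 by (intro tendsto_intros) auto
  then have "\<forall>\<^sub>F t in at_right 0. U1 < (1 + 2 * t) powr - s * (c * ((1 - t) ^ CARD('n) * (M - t)) powr (1 + s))" using U1(2) by (intro order_tendstoD(1)) auto
  moreover have "\<forall>\<^sub>F t in at_right (0::real). t < min 1 M" by (rule order_tendstoD(2)[OF tendsto_ident_at]) (use M0 in simp)
  ultimately have "\<forall>\<^sub>F t in at_right (0::real). 0 < t \<and> t < min 1 M \<and> U1 < (1 + 2 * t) powr - s * (c * ((1 - t) ^ CARD('n) * (M - t)) powr (1 + s))"
    using eventually_at_right_less[of 0] by eventually_elim auto
  then obtain t where t: "0 < t" "t < min 1 M" "U1 < (1 + 2 * t) powr - s * (c * ((1 - t) ^ CARD('n) * (M - t)) powr (1 + s))"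
    using eventually_happens'[OF trivial_limit_at_right_real] by blast
  have t1: "t < 1" "t < M" using t(2) by auto
  have cubeL: "emeasure lborel (cube v L) < top" using L by (simp add: emeasure_cube)
  obtain eta1 where eta1: "0 < eta1" "\<And>f g. f \<in> borel_measurable borel ==> g \<in> borel_measurable borel ==> (\<And>x. x \<notin> cube v L ==> f x = 0) ==>
      (\<integral>\<^sup>+x. (f x - g x) \<partial>lborel) < ennreal eta1 ==>
      (\<integral>\<^sup>+x. ennpow (f x) p \<partial>lborel) <= (\<integral>\<^sup>+x. ennpow (g x) p \<partial>lborel) + ennreal t"
    apply (rule nn_integral_ennpow_close[OF sets_cube cubeL p t(1)])
    subgoal premises prems by (intro prems(1)[OF prems(2)] prems(3)) auto
    done
  obtain eta where eta: "0 < eta" "eta <= eta1" "irr_const al TYPE('n) * 3 * L * (t / 2) powr - s * eta powr al < tau" using small_powr[OF al(1) tau eta1(1)] by blast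
  obtain k J a where g: "0 < k" "J \<subseteq> multi_index k" "\<And>g. g \<in> J ==> 0 < a g"
    "(\<integral>\<^sup>+x. (f x - step_fun v L k J a x) \<partial>lborel) < ennreal eta"
    "(\<integral>\<^sup>+x. (step_fun v L k J a x - f x) \<partial>lborel) < ennreal eta" using step_approx[OF f(1,2,4,3) L eta(1)] by blast
  let ?g = "step_fun v L k J a"
  define Mg where "Mg = (\<Sum>g\<in>J. a g powr p * (L / real k) ^ CARD('n))"
  have gs: "?g x = 0" if "x \<notin> cube v L" for x unfolding step_fun_def using that grid_cube_subset[OF g(1) L] g(2) by (intro sum.neutral) (auto simp: indicator_def)
  have Mg0: "0 <= Mg" unfolding Mg_def using L by (intro sum_nonneg) auto
  have int_g: "(\<integral>\<^sup>+x. ennpow (?g x) p \<partial>lborel) = ennreal (\<Sum>g\<in>J. a g powr p * (L / real k) ^ CARD('n))" by (intro nn_integral_step_fun_powr g L)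
  have "(\<integral>\<^sup>+x. ennpow (f x) p \<partial>lborel) <= (\<integral>\<^sup>+x. ennpow (?g x) p \<partial>lborel) + ennreal t"
    using g(4) eta(2) by (intro eta1(2) f) (auto elim!: less_le_trans intro!: ennreal_leI)
  then have "ennreal M <= ennreal (Mg + t)" using M Mg0 t(1) int_g by (simp add: p_def Mg_def)
  then have Mg: "M - t <= Mg" using Mg0 t(1) by (simp add: ennreal_le_iff del: ennreal_plus)
  have gfin: "(\<integral>\<^sup>+x. ?g x \<partial>lborel) < top"
  proof (rule nn_integral_minus_less_top[OF _ _ f(4)])
    show "(\<integral>\<^sup>+x. (?g x - f x) \<partial>lborel) < top" using g(5) by (rule less_trans) simp
  qed (use f(1) in auto)
  define b where "b = enn2real (\<integral>\<^sup>+x. ?g x \<partial>lborel) powr al"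
  have b: "ennpow (\<integral>\<^sup>+x. ?g x \<partial>lborel) al = ennreal b" "0 <= b" using gfin by (simp_all add: b_def ennpow_def)
  define K where "K N = nat \<lfloor>t * real N\<rfloor>" for N
  define E where "E N = real (card J) * cut_error al L N TYPE('n) * b" for N
  let ?cells = "\<lambda>N. real (card J) * real (frontier_cells L N TYPE('n))"
  have E0: "0 <= E N" for N using cut_error_nonneg[OF al(3)] b(2) by (simp add: E_def)
  have NK: "filterlim (\<lambda>N. N + K N) sequentially sequentially" by (rule filterlim_at_top_mono[OF filterlim_ident]) auto
  have "(\<lambda>N. real N powr s * E N) \<longlonglongrightarrow> real (card J) * 0 * b"
    unfolding E_def using tendsto_mult[OF tendsto_mult[OF tendsto_const cut_error_tendsto[OF _ al, of L]] tendsto_const, of "real (card J)" b] L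
    by (simp add: s_def mult_ac)
  from filterlim_compose[OF this NK]
  have "(\<lambda>N. real (N + K N) powr s * E (N + K N)) \<longlonglongrightarrow> 0" by simp
  from order_tendstoD(2)[OF this tau] have ev1: "\<forall>\<^sub>F N in sequentially. real (N + K N) powr s * E (N + K N) < tau" .
  have "(\<lambda>N. 2 * real (card J) * (real (frontier_cells L N TYPE('n)) / real N)) \<longlonglongrightarrow> 2 * real (card J) * 0"
    using L by (intro tendsto_intros frontier_cells_ratio_tendsto) auto
  from filterlim_compose[OF this NK]
  have "(\<lambda>N. 2 * real (card J) * (real (frontier_cells L (N + K N) TYPE('n)) / real (N + K N))) \<longlonglongrightarrow> 0" by simp
  from order_tendstoD(2)[OF this t(1)]
  have ev2: "\<forall>\<^sub>F N in sequentially. 2 * real (card J) * (real (frontier_cells L (N + K N) TYPE('n)) / real (N + K N)) < t" .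
  have ev3: "\<forall>\<^sub>F N in sequentially. ennreal (real N powr s) * density_error al (\<lambda>x. ?g x - f x) (K N) \<le>
    ennreal (irr_const al TYPE('n) * 3 * L * (t / 2) powr - s * eta powr al)"
    unfolding s_def K_def using f(1) gs g(5) by (intro small_density_quant_error[where v=v] al L t(1) eta(1)) auto
  show ?thesis using ev1 ev2 ev3 eventually_ge_at_top[of 1]
  proof eventually_elim
    case (elim N)
    define N' where "N' = N + K N"
    have N': "1 <= N'" "0 < real N" "0 < real N'" using elim(4) by (auto simp: N'_def)
    have KN: "real (K N) <= t * real N" using t(1) by (simp add: K_def)
    have "real N' <= 2 * real N"
    proof -
      have "t * real N <= 1 * real N" using t1 by (intro mult_right_mono) auto
      then show ?thesis using KN by (simp add: N'_def)
    qed
    have cells: "real N' + ?cells N' <= (1 + 2 * t) * real N"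
    proof -
      have "2 * ?cells N' < t * real N'" using elim(2) N'(3) by (simp add: N'_def[symmetric] divide_less_eq)
      also have "... <= t * (2 * real N)" using t(1) \<open>real N' <= 2 * real N\<close> by (intro mult_left_mono) auto
      finally have "?cells N' <= t * real N" by simp
      then show ?thesis using KN by (simp add: N'_def algebra_simps)
    qed
    have "U1 < (1 + 2 * t) powr - s * (c * ((1 - t) ^ CARD('n) * (M - t)) powr (1 + s))" by (rule t(3))
    also have "... <= (1 + 2 * t) powr - s * (c * ((1 - t) ^ CARD('n) * Mg) powr (1 + s))" using Mg t1 c(1) s by (intro mult_left_mono powr_mono2) auto
    also have "(1 + 2 * t) powr - s = real N powr s * ((1 + 2 * t) * real N) powr - s"
    proof -
      have "real N powr s * ((1 + 2 * t) * real N) powr - s = (1 + 2 * t) powr - s * (real N powr s * real N powr - s)" by (simp only: powr_mult mult_ac)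
      also have "real N powr s * real N powr - s = 1" using elim(4) by (simp add: powr_add[symmetric])
      finally show ?thesis by simp
    qed
    also have "real N powr s * ((1 + 2 * t) * real N) powr - s * (c * ((1 - t) ^ CARD('n) * Mg) powr (1 + s)) \<le>
        real N powr s * (real N' + ?cells N') powr - s * (c * ((1 - t) ^ CARD('n) * Mg) powr (1 + s))"
      using cells N' s c(1) by (intro mult_right_mono mult_left_mono powr_mono2' add_pos_nonneg) auto
    finally have "U1 < real N powr s * (c * ((1 - t) ^ CARD('n) * Mg) powr (1 + s) * (real N' + ?cells N') powr - s)" by (simp only: mult_ac)
    then have "ennreal U1 < ennreal (real N powr s) * ennreal (c * ((1 - t) ^ CARD('n) * Mg) powr (1 + s) * (real N' + ?cells N') powr - s)"
      using U U1(1) c(1) by (subst ennreal_mult[symmetric]) (auto intro!: ennreal_lessI elim: le_less_trans[rotated])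
    also have "... <= ennreal (real N powr s) * (density_error al ?g N' + ennreal (E N'))"
    proof (rule mult_left_mono)
      have "ennreal (c * ((1 - t) ^ CARD('n) * Mg) powr (1 + s) * (real N' + ?cells N') powr - s) \<le>
        density_error al ?g N' + ennreal (real (card J) * cut_error al L N' TYPE('n)) * ennpow (\<integral>\<^sup>+x. ?g x \<partial>lborel) al"
        unfolding Mg_def p_def s_def using al c g(1) L g(2,3) t(1) t1(1) N'(1) by (rule step_lower)
      then show "ennreal (c * ((1 - t) ^ CARD('n) * Mg) powr (1 + s) * (real N' + ?cells N') powr - s) \<le>
        density_error al ?g N' + ennreal (E N')" using b cut_error_nonneg[OF al(3), of L N'] by (simp add: E_def ennreal_mult[symmetric])
    qed simp
    also have "... <= ennreal (real N powr s) * (density_error al f N + density_error al (\<lambda>x. ?g x - f x) (K N) + ennreal (E N'))"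
      unfolding N'_def using f al by (intro mult_left_mono add_right_mono quant_error_le_plus_minus step_fun_less_top) auto
    also have "... = scaled_quant_error al (density lborel f) N + ennreal (real N powr s) * density_error al (\<lambda>x. ?g x - f x) (K N) + ennreal (real N powr s * E N')"
      using E0 by (simp add: scaled_quant_error_def s_def distrib_left ennreal_mult)
    also have "... <= scaled_quant_error al (density lborel f) N + ennreal tau + ennreal tau"
    proof (intro add_mono order_refl)
      show "ennreal (real N powr s) * density_error al (\<lambda>x. ?g x - f x) (K N) <= ennreal tau"
        using elim(3) by (rule order.trans) (use eta(3) in \<open>auto intro!: ennreal_leI\<close>)
      have "real N powr s * E N' <= real N' powr s * E N'" using s E0 by (intro mult_right_mono powr_mono2) (auto simp: N'_def)
      then show "ennreal (real N powr s * E N') <= ennreal tau" using elim(1) by (intro ennreal_leI) (simp add: N'_def)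
    qed
    also have "... = scaled_quant_error al (density lborel f) N + ennreal (U1 - U)" using tau by (simp add: add.assoc ennreal_plus[symmetric] tau_def del: ennreal_plus)
    finally have lt: "ennreal U1 < scaled_quant_error al (density lborel f) N + ennreal (U1 - U)" .
    show "ennreal U < scaled_quant_error al (density lborel f) N"
    proof (rule ccontr)
      assume "\<not> ennreal U < scaled_quant_error al (density lborel f) N"
      then have "scaled_quant_error al (density lborel f) N + ennreal (U1 - U) <= ennreal U + ennreal (U1 - U)" by (intro add_right_mono) simp
      also have "... = ennreal U1" using U U1 by (simp add: ennreal_plus[symmetric] del: ennreal_plus)
      finally show False using lt by simp
    qed
  qed
qed



section \<open>Distribution of the atoms\<close>

text \<open>The finite support carries the measure; deleting its points of mass zero leaves
  precisely the atoms.\<close>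

lemma atoms_quantizer:
  fixes \<mu> :: "'a::euclidean_space measure"
  assumes "\<mu> \<in> quantizers \<nu> N"
  shows "finite {x. emeasure \<mu> {x} > 0}" "card {x. emeasure \<mu> {x} > 0} <= N" "AE x in \<mu>. x \<in> {x. emeasure \<mu> {x} > 0}"
proof -
  let ?F = "{x. emeasure \<mu> {x} > 0}"
  have s: "sets \<mu> = sets borel" "finite (spt \<mu>)" "card (spt \<mu>) <= N" using assms by (auto simp: quantizers_def)
  have sub: "?F \<subseteq> spt \<mu>"
  proof (clarsimp simp: spt_def)
    fix x U assume x: "0 < emeasure \<mu> {x}" "open U" "x \<in> U"
    have "emeasure \<mu> {x} <= emeasure \<mu> U" using x s(1) by (intro emeasure_mono) auto
    then show "0 < emeasure \<mu> U" using x(1) by simp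
  qed
  show "finite ?F" using sub s(2) by (rule finite_subset)
  have "card ?F <= card (spt \<mu>)" using s(2) sub by (rule card_mono)
  then show "card ?F <= N" using s(3) by simp
  have "- spt \<mu> \<in> null_sets \<mu>" using emeasure_Compl_spt[OF s(1)] s by (auto simp: null_sets_def finite_imp_closed borel_closed borel_comp)
  moreover have "(\<Union>x\<in>spt \<mu> - ?F. {x}) \<in> null_sets \<mu>" using s by (intro null_sets_UN' countable_finite) (auto simp: null_sets_def)
  ultimately have "- spt \<mu> \<union> (\<Union>x\<in>spt \<mu> - ?F. {x}) \<in> null_sets \<mu>" by (rule null_sets.Un)
  from AE_not_in[OF this] show "AE x in \<mu>. x \<in> ?F" by eventually_elim (auto simp: zero_less_iff_neq_zero)
qed

lemma optimal_quantizer_plan: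
  fixes \<mu> :: "'a::euclidean_space measure"
  assumes opt: "optimal_quantizer al \<nu> N \<mu>" and e: "quant_error al \<nu> N < e"
  obtains P where "traffic_plan P" "distr P borel curve_end = \<nu>" "AE cv in P. cv 0 \<in> {x. emeasure \<mu> {x} > 0}" "alpha_mass al P < e"
proof -
  have "branched_dist al \<mu> \<nu> < e" using assms by (simp add: optimal_quantizer_def)
  then obtain P where P: "P \<in> TP \<mu> \<nu>" "alpha_mass al P < e" unfolding branched_dist_def INF_less_iff by blast
  have tp: "traffic_plan P" using P by (simp add: TP_def)
  have cs: "measurable P borel = measurable curve_borel (borel :: 'a measure)" by (rule measurable_cong_sets[OF traffic_planD(2)[OF tp] refl])
  have m0: "(\<lambda>cv. cv 0) \<in> measurable P (borel :: 'a measure)" unfolding cs by simp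
  have "distr P borel (\<lambda>cv. cv 0) = \<mu>" using P by (simp add: TP_def)
  moreover have "AE x in \<mu>. x \<in> {x. emeasure \<mu> {x} > 0}" using opt by (intro atoms_quantizer(3)[where \<nu>=\<nu> and N=N]) (simp add: optimal_quantizer_def)
  ultimately have "AE x in distr P borel (\<lambda>cv. cv 0). x \<in> {x. emeasure \<mu> {x} > 0}" by (simp only:)
  then have "AE cv in P. cv 0 \<in> {x. emeasure \<mu> {x} > 0}" by (rule AE_distrD[OF m0])
  then show thesis using that[OF tp _ _ P(2)] P by (simp add: TP_def)
qed

text \<open>A quotient of difference quotients at \<open>M\<close>. In the box estimate this
  expression multiplies the mass of the box, so its limit 1/M produces the normalised limit
  distribution.\<close>

lemma powr_difference_ratio_tendsto:
  fixes M s :: real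
  assumes "0 < M" "0 < s"
  shows "((\<lambda>r. (1 + s) * (r powr s - M powr s) / (s * (r powr (1 + s) - M powr (1 + s)))) \<longlongrightarrow> 1 / M) (at_right M)"
proof -
  have d: "((\<lambda>r. (r powr t - M powr t) / (r - M)) \<longlongrightarrow> t * M powr (t - 1)) (at_right M)" for t
    using has_real_derivative_powr[OF assms(1), of t, THEN has_field_derivative_at_within, of "{M<..}"] by (simp add: has_field_derivative_iff)
  have "((\<lambda>r. (1 + s) * ((r powr s - M powr s) / (r - M)) / (s * ((r powr (1 + s) - M powr (1 + s)) / (r - M)))) \<longlongrightarrow>
      (1 + s) * (s * M powr (s - 1)) / (s * ((1 + s) * M powr (1 + s - 1)))) (at_right M)" using assms by (intro tendsto_divide tendsto_mult tendsto_const d) auto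
  also have "(1 + s) * (s * M powr (s - 1)) / (s * ((1 + s) * M powr (1 + s - 1))) = 1 / M"
  proof -
    have "t * (s * X) / (s * (t * (X * M))) = 1 / M" if "t \<noteq> 0" "X \<noteq> 0" for t X using that assms by simp
    from this[of "1 + s" "M powr (s - 1)"] show ?thesis using assms by (simp add: powr_diff)
  qed
  finally show ?thesis by (rule Lim_transform_eventually) (auto simp: eventually_at_right_less intro!: eventually_mono[OF eventually_at_right_less])
qed

text \<open>Finiteness and vanishing off the cube are required of \<open>f\<close> at every point;
  the density of the given measure is adjusted on a null set to meet this.\<close>

locale density_setting =
  fixes al c L :: real and v :: "real^'n" and f :: "real^'n => ennreal"
  assumes al: "0 < al" "al < 1" "real CARD('n) * (1 - al) < 1"
    and c: "0 < c" "scaled_cube al TYPE('n) \<longlonglongrightarrow> ennreal c"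
      "\<And>N. 1 <= N ==> ennreal c <= scaled_cube al TYPE('n) N"
    and f: "f \<in> borel_measurable borel" "\<And>x. f x < top" "\<And>x. x \<notin> cube v L ==> f x = 0" "(\<integral>\<^sup>+x. f x \<partial>lborel) < top" "0 < (\<integral>\<^sup>+x. f x \<partial>lborel)"
    and L: "0 < L"
begin

definition s :: real where "s = beta_exp al TYPE('n) / real CARD('n)"
definition p :: real where "p = al / (al + 1 / real CARD('n))"
definition \<rho> :: "(real^'n) measure" where "\<rho> = density lborel (\<lambda>x. ennpow (f x) p)"
definition M :: real where "M = measure \<rho> UNIV"

lemma s_pos: "0 < s"
proof -
  have "0 < beta_exp al TYPE('n)" using al(3) by (auto simp: beta_exp_def algebra_simps)
  then show ?thesis by (simp add: s_def)
qed

lemma p_pos: "0 < p" "p < 1"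
proof -
  have "0 < 1 / real CARD('n)" by simp
  then show "0 < p" "p < 1" using al(1) unfolding p_def by (simp_all add: add_pos_pos)
qed

lemma s_eq: "1 + s = al + 1 / real CARD('n)" by (simp add: s_def beta_exp_def field_simps)

lemma sets_\<rho> [simp, measurable_cong]: "sets \<rho> = sets borel" by (simp add: \<rho>_def)

lemma space_\<rho> [simp]: "space \<rho> = UNIV" by (simp add: \<rho>_def)

lemma emeasure_\<rho>: "A \<in> sets borel ==> emeasure \<rho> A = (\<integral>\<^sup>+x. ennpow (f x * indicator A x) p \<partial>lborel)"
  using f(1) unfolding \<rho>_def by (subst emeasure_density) (auto intro!: nn_integral_cong simp: indicator_def)

sublocale \<rho>: finite_measure \<rho>
proof (rule finite_measureI)
  note [measurable] = f(1)
  have "emeasure \<rho> UNIV <= (\<integral>\<^sup>+x. f x + indicator (cube v L) x \<partial>lborel)"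
  proof (subst emeasure_\<rho>, simp, rule nn_integral_mono)
    fix x
    show "ennpow (f x * indicator UNIV x) p <= f x + indicator (cube v L) x" using ennpow_le_affine[OF p_pos, of 1 "f x"] f(3)[of x] by (cases "x \<in> cube v L") auto
  qed
  also have "... = (\<integral>\<^sup>+x. f x \<partial>lborel) + emeasure lborel (cube v L)" by (subst nn_integral_add) auto
  also have "... < top" using f(4) L by (simp add: emeasure_cube)
  finally show "emeasure \<rho> (space \<rho>) \<noteq> \<infinity>" by simp
qed

lemma M_eq: "(\<integral>\<^sup>+x. ennpow (f x) p \<partial>lborel) = ennreal M" using emeasure_\<rho>[of UNIV] by (simp add: M_def \<rho>.emeasure_eq_measure)

lemma M_pos: "0 < M"
proof (rule ccontr)
  note [measurable] = f(1)
  assume "\<not> 0 < M"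
  then have "(\<integral>\<^sup>+x. ennpow (f x) p \<partial>lborel) = 0" unfolding M_eq by (simp add: ennreal_neg)
  then have "AE x in lborel. ennpow (f x) p = 0" by (simp add: nn_integral_0_iff_AE)
  then have "AE x in lborel. f x = 0"
  proof eventually_elim
    case (elim x)
    then show ?case by (cases "f x") (auto simp: ennpow_ennreal)
  qed
  then have "(\<integral>\<^sup>+x. f x \<partial>lborel) = 0" by (simp add: nn_integral_0_iff_AE)
  then show False using f(5) by simp
qed

lemma scaled_upper: "c * M powr (1 + s) < U ==> \<forall>\<^sub>F N in sequentially. scaled_quant_error al (density lborel f) N < ennreal U"
  using density_upper[OF al c(1,2) f L, where M=M and U=U] M_eq M_pos by (simp add: p_def s_def)

text \<open>The bound is stated with a threshold because it will be applied to numbers of sources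
  that depend on N through the atoms of the quantizer; the factor 1 - z makes it strict enough to
  hold from some index on.\<close>

lemma scaled_lower:
  assumes A: "A \<in> sets borel" and z: "0 < z" "z < 1"
  obtains m where "\<And>N. m <= N ==> ennreal (c * ((1 - z) * measure \<rho> A) powr (1 + s)) <= scaled_quant_error al (density lborel (\<lambda>x. f x * indicator A x)) N"
proof (cases "measure \<rho> A = 0")
  case True
  then show ?thesis using that[of 0] by simp
next
  case False
  note [measurable] = f(1) A
  have mA: "0 < measure \<rho> A" using False by (simp add: zero_less_measure_iff)
  have le: "(\<integral>\<^sup>+x. f x * indicator A x \<partial>lborel) < top" by (rule le_less_trans[OF nn_integral_mono f(4)]) (simp add: indicator_def)
  have lt: "c * ((1 - z) * measure \<rho> A) powr (1 + s) < c * measure \<rho> A powr (1 + s)" using c(1) s_pos z mA by (intro mult_strict_left_mono powr_less_mono2) auto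
  have "\<forall>\<^sub>F N in sequentially. ennreal (c * ((1 - z) * measure \<rho> A) powr (1 + s)) < scaled_quant_error al (density lborel (\<lambda>x. f x * indicator A x)) N"
  proof (rule density_lower[OF al c(1,3) _ _ _ le L, where v=v and M="measure \<rho> A"])
    show "(\<integral>\<^sup>+x. ennpow (f x * indicator A x) (al / (al + 1 / real CARD('n))) \<partial>lborel) = ennreal (measure \<rho> A)"
      using emeasure_\<rho>[OF A] by (simp add: p_def \<rho>.emeasure_eq_measure)
    show "f x * indicator A x < top" for x using f(2)[of x] by (simp add: indicator_def)
  qed (use f lt c(1) in \<open>auto simp: s_def\<close>)
  then show ?thesis using that unfolding eventually_sequentially by (meson less_imp_le)
qed

lemma scaled_tendsto: "scaled_quant_error al (density lborel f) \<longlonglongrightarrow> ennreal (c * M powr (1 + s))"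
proof (rule order_tendstoI)
  fix a assume "a < ennreal (c * M powr (1 + s))"
  then obtain U where U: "a = ennreal U" "0 <= U" "U < c * M powr (1 + s)" by (cases a) (auto simp: ennreal_less_iff)
  show "\<forall>\<^sub>F N in sequentially. a < scaled_quant_error al (density lborel f) N"
    unfolding U(1) using density_lower[OF al c(1,3) f(1-4) L, where M=M and U=U] M_eq M_pos U(2,3) by (simp add: p_def s_def)
next
  fix a assume a: "ennreal (c * M powr (1 + s)) < a"
  then obtain b where b: "ennreal (c * M powr (1 + s)) < b" "b < a" using dense by blast
  then obtain U where U: "b = ennreal U" "0 <= U" by (cases b) auto
  have "\<forall>\<^sub>F N in sequentially. scaled_quant_error al (density lborel f) N < ennreal U" using b(1) c(1) by (intro scaled_upper) (simp add: U ennreal_less_iff)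
  then show "\<forall>\<^sub>F N in sequentially. scaled_quant_error al (density lborel f) N < a" by eventually_elim (use b(2) U(1) in auto)
qed

text \<open>The closed box and the complement of a slightly larger open box are disjoint closed sets
  that together miss only little mass, as the cutting argument needs.\<close>

lemma box_approx:
  assumes z: "0 < z"
  obtains a' b' where "cbox a b \<subseteq> box a' b'" "measure \<rho> (box a' b') <= measure \<rho> (cbox a b) + z"
proof -
  define B where "B n = box (a - (1 / real (Suc n)) *\<^sub>R 1) (b + (1 / real (Suc n)) *\<^sub>R 1)" for n :: nat
  have inB: "x \<in> B n \<longleftrightarrow> (\<forall>i. a $ i - 1 / real (Suc n) < x $ i \<and> x $ i < b $ i + 1 / real (Suc n))" for x n by (simp add: B_def mem_box_cart)
  have dec: "decseq B"
  proof (intro decseq_SucI subsetI)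
    fix n x assume x: "x \<in> B (Suc n)"
    have "1 / real (Suc (Suc n)) <= 1 / real (Suc n)" by (intro divide_left_mono) auto
    then show "x \<in> B n" using x unfolding inB by (smt (verit))
  qed
  have int: "(\<Inter>n. B n) = cbox a b"
  proof (intro set_eqI iffI)
    fix x assume x: "x \<in> (\<Inter>n. B n)"
    have lim: "(\<lambda>n. 1 / real (Suc n)) \<longlonglongrightarrow> 0" using LIMSEQ_inverse_real_of_nat by (simp add: inverse_eq_divide)
    have "a $ i <= x $ i \<and> x $ i <= b $ i" for i
    proof
      have "(\<lambda>n. a $ i - 1 / real (Suc n)) \<longlonglongrightarrow> a $ i - 0" by (intro tendsto_intros lim)
      then have "a $ i - 0 <= x $ i" by (rule LIMSEQ_le_const2) (use x in \<open>auto simp: inB less_imp_le simp del: of_nat_Suc intro!: exI[of _ 0]\<close>)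
      then show "a $ i <= x $ i" by simp
      have "(\<lambda>n. b $ i + 1 / real (Suc n)) \<longlonglongrightarrow> b $ i + 0" by (intro tendsto_intros lim)
      then have "x $ i <= b $ i + 0" by (rule LIMSEQ_le_const) (use x in \<open>auto simp: inB less_imp_le simp del: of_nat_Suc intro!: exI[of _ 0]\<close>)
      then show "x $ i <= b $ i" by simp
    qed
    then show "x \<in> cbox a b" by (simp add: mem_box_cart)
  next
    fix x assume x: "x \<in> cbox a b"
    have "x \<in> B n" for n unfolding inB
    proof
      fix i
      have "0 < 1 / real (Suc n)" by simp
      moreover have "a $ i <= x $ i" "x $ i <= b $ i" using x by (auto simp: mem_box_cart)
      ultimately show "a $ i - 1 / real (Suc n) < x $ i \<and> x $ i < b $ i + 1 / real (Suc n)" by linarith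
    qed
    then show "x \<in> (\<Inter>n. B n)" by blast
  qed
  have "(\<lambda>n. measure \<rho> (B n)) \<longlonglongrightarrow> measure \<rho> (\<Inter>n. B n)" by (rule \<rho>.finite_Lim_measure_decseq[OF _ dec]) (auto simp: B_def)
  then have "\<forall>\<^sub>F n in sequentially. measure \<rho> (B n) < measure \<rho> (cbox a b) + z" unfolding int using z by (intro order_tendstoD(2)) auto
  then obtain n where "measure \<rho> (B n) < measure \<rho> (cbox a b) + z" by (auto simp: eventually_sequentially)
  moreover have "cbox a b \<subseteq> B n" using int by blast
  ultimately show thesis using that unfolding B_def by (meson less_imp_le)
qed

text \<open>The plan of an optimal quantizer is cut along the boundaries of the box and of a slightly larger
  one. Young's inequality is applied with the sharp slope \<^term>\<open>M\<close> outside the box and with a larger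
  slope inside it, which turns near optimality into a lower bound on the number of atoms in the box.\<close>

lemma atoms_box_inequality:
  assumes opt: "\<forall>N\<ge>1. optimal_quantizer al (density lborel f) N (\<mu> N)"
    and z: "0 < z" "z < 1" and r: "M <= r"
  shows "\<forall>\<^sub>F N in sequentially. (1 + s) * r powr s * ((1 - z) * measure \<rho> (cbox a b)) +
      (1 + s) * M powr s * ((1 - z) * (M - measure \<rho> (cbox a b) - z)) - s * M powr (1 + s) * (1 + 4 * z)
      - s * (r powr (1 + s) - M powr (1 + s)) * (real (card ({x. emeasure (\<mu> N) {x} > 0} \<inter> cbox a b)) / real N + 2 * z)
    <= M powr (1 + s) + 3 * z"
proof -
  obtain a' b' where B: "cbox a b \<subseteq> box a' b'" "measure \<rho> (box a' b') <= measure \<rho> (cbox a b) + z" by (rule box_approx[OF z(1)])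
  define A where "A j = (if j then cbox a b else - box a' b')" for j :: bool
  have Am: "A j \<in> sets borel" for j by (simp add: A_def)
  define L' where "L' = (\<Sum>i\<in>UNIV. \<bar>b $ i - a $ i\<bar>) + (\<Sum>i\<in>UNIV. \<bar>b' $ i - a' $ i\<bar>)"
  have L'0: "0 <= L'" by (simp add: L'_def sum_nonneg)
  have L': "b $ i - a $ i <= L'" "b' $ i - a' $ i <= L'" for i
  proof -
    have "\<bar>b $ i - a $ i\<bar> <= (\<Sum>i\<in>UNIV. \<bar>b $ i - a $ i\<bar>)" "\<bar>b' $ i - a' $ i\<bar> <= (\<Sum>i\<in>UNIV. \<bar>b' $ i - a' $ i\<bar>)" by (rule member_le_sum; simp)+
    moreover have "0 <= (\<Sum>i\<in>UNIV. \<bar>b $ i - a $ i\<bar>)" "0 <= (\<Sum>i\<in>UNIV. \<bar>b' $ i - a' $ i\<bar>)" by (simp_all add: sum_nonneg)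
    ultimately show "b $ i - a $ i <= L'" "b' $ i - a' $ i <= L'" unfolding L'_def by linarith+
  qed
  define m where "m j = (1 - z) * measure \<rho> (A j)" for j
  have m0: "0 <= m j" for j using z by (simp add: m_def)
  have "\<exists>k. \<forall>N\<ge>k. ennreal (c * m j powr (1 + s)) <= scaled_quant_error al (density lborel (\<lambda>x. f x * indicator (A j) x)) N" for j
    unfolding m_def by (rule scaled_lower[OF Am z]) blast
  then obtain k where k: "\<And>j N. k j <= N ==> ennreal (c * m j powr (1 + s)) <= scaled_quant_error al (density lborel (\<lambda>x. f x * indicator (A j) x)) N" by metis
  define I where "I = enn2real (\<integral>\<^sup>+x. f x \<partial>lborel) powr al"
  have I: "ennpow (\<integral>\<^sup>+x. f x \<partial>lborel) al = ennreal I" "0 <= I" using f(4) by (simp_all add: I_def ennpow_def)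
  \<comment> \<open>Besides the boundary sources, another z N sources are granted to each of the two
    regions. They lift the number of sources above the threshold \<open>k j\<close> even where the
    quantizer has few atoms.\<close>
  define K where "K N = frontier_cells L' N TYPE('n) + nat \<lfloor>z * real N\<rfloor>" for N
  define F where "F N = {x. emeasure (\<mu> N) {x} > 0}" for N
  have ev1: "\<forall>\<^sub>F N in sequentially. max 1 (max (k True) (k False)) <= nat \<lfloor>z * real N\<rfloor>" using nat_floor_at_top[OF z(1)] unfolding filterlim_at_top by blast
  have ev2: "\<forall>\<^sub>F N in sequentially. scaled_quant_error al (density lborel f) N < ennreal (c * (M powr (1 + s) + z))" using c(1) z(1) by (intro scaled_upper) simp
  have ev3: "\<forall>\<^sub>F N in sequentially. real (frontier_cells L' N TYPE('n)) / real N < z" using order_tendstoD(2)[OF frontier_cells_ratio_tendsto[OF L'0] z(1)] .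
  have "(\<lambda>N. real N powr s * cut_error al L' N TYPE('n) * (2 * I)) \<longlonglongrightarrow> 0 * (2 * I)" unfolding s_def by (intro tendsto_mult cut_error_tendsto L'0 al tendsto_const)
  then have ev4: "\<forall>\<^sub>F N in sequentially. real N powr s * cut_error al L' N TYPE('n) * (2 * I) < c * z" using c(1) z(1) by (intro order_tendstoD(2)) auto
  show ?thesis using ev1 ev2 ev3 ev4 eventually_ge_at_top[of 1]
  proof eventually_elim
    case (elim N)
    have N: "0 < real N" using elim(5) by simp
    have Np: "0 < real N powr s" using N by simp
    let ?E = "density_error al f N"
    have "ennreal (real N powr s) * ?E < top" using elim(2) unfolding scaled_quant_error_def s_def by (rule less_trans) simp
    then have "?E < top" using Np by (auto simp: ennreal_mult_less_top)
    moreover have e0: "0 < real N powr - s * (c * z)" using N c(1) z(1) by simp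
    ultimately have "?E < ?E + ennreal (real N powr - s * (c * z))" using ennreal_add_left_cancel_less[of ?E 0 "ennreal (real N powr - s * (c * z))"] by auto
    from optimal_quantizer_plan[OF opt[rule_format, OF elim(5)] this]
    obtain P where P: "traffic_plan P" "distr P borel curve_end = density lborel f" "AE cv in P. cv 0 \<in> F N"
      "alpha_mass al P < ?E + ennreal (real N powr - s * (c * z))" unfolding F_def by metis
    have "\<mu> N \<in> quantizers (density lborel f) N" using opt[rule_format, OF elim(5)] by (simp add: optimal_quantizer_def)
    from atoms_quantizer[OF this] have F: "finite (F N)" "card (F N) <= N" by (simp_all add: F_def)
    define y where "y j = real (card (F N \<inter> A j) + K N) / real N" for j
    have kK: "k j <= card (F N \<inter> A j) + K N" "1 <= card (F N \<inter> A j) + K N" for j using elim(1) by (cases j; simp add: K_def)+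
    have y0: "0 < y j" for j using kK(2)[of j] N by (simp add: y_def)
    have cell: "ennreal (c * (m j powr (1 + s) * y j powr - s)) \<le>
      ennreal (real N powr s) * density_error al (\<lambda>x. f x * indicator (A j) x) (card (F N \<inter> A j) + frontier_cells L' N TYPE('n))" for j
    proof -
      let ?m = "card (F N \<inter> A j) + K N"
      let ?q = "density_error al (\<lambda>x. f x * indicator (A j) x)"
      have mm: "0 < real ?m" using kK(2)[of j] by linarith
      have "ennreal (y j powr - s) * ennreal (c * m j powr (1 + s)) <= ennreal (y j powr - s) * (ennreal (real ?m powr s) * ?q ?m)"
        using k[OF kK(1)[of j]] by (intro mult_left_mono) (simp_all add: scaled_quant_error_def s_def)
      also have "... = ennreal (y j powr - s * real ?m powr s) * ?q ?m" by (simp add: ennreal_mult mult.assoc)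
      also have "y j powr - s * real ?m powr s = real N powr s" using mm N by (simp add: y_def powr_divide powr_minus field_simps)
      also have "ennreal (real N powr s) * ?q ?m <= ennreal (real N powr s) * ?q (card (F N \<inter> A j) + frontier_cells L' N TYPE('n))"
        by (intro mult_left_mono quant_error_antimono) (simp_all add: K_def)
      finally show ?thesis using c(1) by (simp add: ennreal_mult[symmetric] mult_ac)
    qed
    have "ennreal (\<Sum>j\<in>UNIV. c * (m j powr (1 + s) * y j powr - s)) = (\<Sum>j\<in>UNIV. ennreal (c * (m j powr (1 + s) * y j powr - s)))"
      using c(1) by (intro sum_ennreal[symmetric]) auto
    also have "... <= (\<Sum>j\<in>UNIV. ennreal (real N powr s) * density_error al (\<lambda>x. f x * indicator (A j) x) (card (F N \<inter> A j) + frontier_cells L' N TYPE('n)))"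
      by (intro sum_mono cell)
    also have "... = ennreal (real N powr s) * (\<Sum>j\<in>UNIV. density_error al (\<lambda>x. f x * indicator (A j) x) (card (F N \<inter> A j) + frontier_cells L' N TYPE('n)))"
      by (simp add: sum_distrib_left)
    also have "... <= ennreal (real N powr s) * (alpha_mass al P + ennreal (real (card (UNIV :: bool set)) * cut_error al L' N TYPE('n)) * ennpow (\<integral>\<^sup>+x. f x \<partial>lborel) al)"
    proof (intro mult_left_mono superadditive_density[OF f(1) P(1,2) F(1) P(3)])
      show "closed (A j)" for j by (simp add: A_def closed_cbox closed_Compl[OF open_box])
      show "disjoint_family_on A UNIV" unfolding disjoint_family_on_def A_def using B(1) by auto
      show "frontier (A j) \<subseteq> cbox (if j then a else a') (if j then b else b') - box (if j then a else a') (if j then b else b')" for j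
      proof (cases j)
        case True
        then show ?thesis by (simp add: A_def frontier_def interior_cbox closure_closed closed_cbox)
      next
        case False
        have "closure (box a' b') \<subseteq> cbox a' b'" using box_subset_cbox closed_cbox by (rule closure_minimal)
        moreover have "frontier (A j) = frontier (box a' b')" using False by (simp add: A_def frontier_complement)
        ultimately show ?thesis using False by (auto simp: frontier_def interior_open[OF open_box])
      qed
      show "(if j then b else b') $ i - (if j then a else a') $ i <= L'" for j i using L' by simp
    qed (use al elim(5) in auto)
    also have "... <= ennreal (real N powr s) * (?E + ennreal (real N powr - s * (c * z)) + ennreal (2 * cut_error al L' N TYPE('n)) * ennreal I)"
      using P(4) by (intro mult_left_mono add_mono) (simp_all add: I)
    also have "... = scaled_quant_error al (density lborel f) N + ennreal (real N powr s * (real N powr - s * (c * z))) + ennreal (real N powr s * (2 * cut_error al L' N TYPE('n) * I))"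
      using cut_error_nonneg[OF al(3), of L' N] I(2) c(1) z(1) by (simp add: scaled_quant_error_def s_def distrib_left ennreal_mult)
    also have "real N powr s * (real N powr - s * (c * z)) = c * z" using N by (simp add: mult.assoc[symmetric] powr_add[symmetric])
    also have "scaled_quant_error al (density lborel f) N + ennreal (c * z) + ennreal (real N powr s * (2 * cut_error al L' N TYPE('n) * I))
       <= ennreal (c * (M powr (1 + s) + z)) + ennreal (c * z) + ennreal (c * z)" using elim(2,4) by (intro add_mono ennreal_leI) (simp_all add: mult_ac)
    also have "... = ennreal (c * (M powr (1 + s) + z) + c * z + c * z)" using c(1) z(1) by (simp add: ennreal_plus[symmetric] del: ennreal_plus)
    also have "c * (M powr (1 + s) + z) + c * z + c * z = c * (M powr (1 + s) + 3 * z)" by (simp add: algebra_simps)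
    finally have "(\<Sum>j\<in>UNIV. c * (m j powr (1 + s) * y j powr - s)) <= c * (M powr (1 + s) + 3 * z)" using c(1) z(1) by (subst (asm) ennreal_le_iff) auto
    then have "c * (m True powr (1 + s) * y True powr - s + m False powr (1 + s) * y False powr - s) <= c * (M powr (1 + s) + 3 * z)"
      by (simp add: UNIV_bool distrib_left add.commute)
    then have main: "m True powr (1 + s) * y True powr - s + m False powr (1 + s) * y False powr - s <= M powr (1 + s) + 3 * z" using c(1) by simp
    have r0: "0 < r" using r M_pos by simp
    have Y: "(1 + s) * r powr s * m True - s * r powr (1 + s) * y True <= m True powr (1 + s) * y True powr - s"
      "(1 + s) * M powr s * m False - s * M powr (1 + s) * y False <= m False powr (1 + s) * y False powr - s" using m0 y0 s_pos r0 M_pos by (intro powr_young; simp)+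
    have KN: "real (K N) / real N <= 2 * z"
    proof -
      have "real (nat \<lfloor>z * real N\<rfloor>) <= z * real N" using z(1) by simp
      then have "real (nat \<lfloor>z * real N\<rfloor>) / real N <= z" using N by (simp add: divide_le_eq)
      then show ?thesis using elim(3) by (simp add: K_def add_divide_distrib)
    qed
    have yT: "y True <= real (card (F N \<inter> cbox a b)) / real N + 2 * z" using KN by (simp add: y_def A_def add_divide_distrib)
    have "card (F N \<inter> A True) + card (F N \<inter> A False) = card (F N \<inter> A True \<union> F N \<inter> A False)" using F(1) B(1) by (intro card_Un_disjoint[symmetric]) (auto simp: A_def)
    also have "... <= card (F N)" using F(1) by (intro card_mono) auto
    finally have "real (card (F N \<inter> A True)) + real (card (F N \<inter> A False)) <= real N" using F(2) by linarith
    then have "(real (card (F N \<inter> A True)) + real (card (F N \<inter> A False))) / real N <= 1" using N by simp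
    then have yF: "y False <= 1 + 4 * z - y True" using KN by (simp add: y_def add_divide_distrib)
    have mF: "(1 - z) * (M - measure \<rho> (cbox a b) - z) <= m False"
    proof -
      have "measure \<rho> (A False) = M - measure \<rho> (box a' b')" using \<rho>.finite_measure_compl[of "box a' b'"] by (simp add: A_def M_def Compl_eq_Diff_UNIV)
      then show ?thesis unfolding m_def using B(2) z by (intro mult_left_mono) auto
    qed
    \<comment> \<open>Expressing the sources outside through those inside cancels the slope
      \<open>M\<close> and leaves \<open>y True\<close> with the small positive coefficient s
      (r^(1+s) - M^(1+s)).\<close>
    have c1: "s * M powr (1 + s) * y False <= s * M powr (1 + s) * (1 + 4 * z - y True)" using yF s_pos by (intro mult_left_mono) auto
    have c2: "s * (r powr (1 + s) - M powr (1 + s)) * y True \<le>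
        s * (r powr (1 + s) - M powr (1 + s)) * (real (card (F N \<inter> cbox a b)) / real N + 2 * z)"
      using yT s_pos M_pos r by (intro mult_left_mono mult_nonneg_nonneg) (auto intro!: powr_mono2)
    have c3: "(1 + s) * M powr s * ((1 - z) * (M - measure \<rho> (cbox a b) - z)) <= (1 + s) * M powr s * m False" using mF s_pos by (intro mult_left_mono) auto
    have mT: "m True = (1 - z) * measure \<rho> (cbox a b)" by (simp add: m_def A_def)
    have c4: "s * M powr (1 + s) * (1 + 4 * z - y True) = s * M powr (1 + s) * (1 + 4 * z) - s * M powr (1 + s) * y True" by (rule right_diff_distrib)
    have c5: "s * (r powr (1 + s) - M powr (1 + s)) * y True = s * r powr (1 + s) * y True - s * M powr (1 + s) * y True" by (simp add: algebra_simps)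
    show ?case using main Y c1 c2 c3 c4 c5 unfolding mT F_def by linarith
  qed
qed

text \<open>In \<open>atoms_box_inequality\<close> first \<open>r\<close> is chosen near
  \<open>M\<close>, where the ratio of the slope differences is close to 1/M, and then
  \<open>z\<close> near 0. Dividing by the coefficient \<open>D\<close> of the atom fraction is
  possible because r > M.\<close>

lemma atoms_box_lower:
  assumes opt: "\<forall>N\<ge>1. optimal_quantizer al (density lborel f) N (\<mu> N)" and dl: "0 < dl"
  shows "\<forall>\<^sub>F N in sequentially. measure \<rho> (cbox a b) / M - dl < real (card ({x. emeasure (\<mu> N) {x} > 0} \<inter> cbox a b)) / real N"
proof -
  define m where "m = measure \<rho> (cbox a b)"
  have "((\<lambda>r. (1 + s) * (r powr s - M powr s) / (s * (r powr (1 + s) - M powr (1 + s))) * m) \<longlongrightarrow> 1 / M * m) (at_right M)"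
    by (intro tendsto_mult powr_difference_ratio_tendsto M_pos s_pos tendsto_const)
  then have "\<forall>\<^sub>F r in at_right M. m / M - dl / 2 < (1 + s) * (r powr s - M powr s) / (s * (r powr (1 + s) - M powr (1 + s))) * m"
    using dl by (intro order_tendstoD(1)) auto
  then have "\<forall>\<^sub>F r in at_right M. M < r \<and> m / M - dl / 2 < (1 + s) * (r powr s - M powr s) / (s * (r powr (1 + s) - M powr (1 + s))) * m"
    using eventually_at_right_less[of M] by eventually_elim auto
  then obtain r where r: "M < r" "m / M - dl / 2 < (1 + s) * (r powr s - M powr s) / (s * (r powr (1 + s) - M powr (1 + s))) * m"
    using eventually_happens'[OF trivial_limit_at_right_real] by blast
  define D where "D = s * (r powr (1 + s) - M powr (1 + s))"
  have D: "0 < D" unfolding D_def using r(1) M_pos s_pos by (intro mult_pos_pos) (auto intro!: powr_less_mono2)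
  define \<Psi> where "\<Psi> z = (1 + s) * r powr s * ((1 - z) * m) + (1 + s) * M powr s * ((1 - z) * (M - m - z))
     - s * M powr (1 + s) * (1 + 4 * z) - (M powr (1 + s) + 3 * z)" for z
  have "((\<lambda>z. \<Psi> z / D - 2 * z) \<longlongrightarrow> \<Psi> 0 / D - 2 * 0) (at_right 0)" unfolding \<Psi>_def using D by (intro tendsto_intros) auto
  \<comment> \<open>At z = 0 all terms in M^(1+s) cancel: the exact minimum M^(1+s) of the convex
    problem has been subtracted, and only the change of slope inside the box remains.\<close>
  also have "\<Psi> 0 = (1 + s) * (r powr s - M powr s) * m" using M_pos by (simp add: \<Psi>_def powr_add algebra_simps)
  finally have "((\<lambda>z. \<Psi> z / D - 2 * z) \<longlongrightarrow> (1 + s) * (r powr s - M powr s) / D * m) (at_right 0)" by simp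
  then have "\<forall>\<^sub>F z in at_right 0. m / M - dl < \<Psi> z / D - 2 * z" using r(2) dl unfolding D_def[symmetric] by (intro order_tendstoD(1)) auto
  moreover have "\<forall>\<^sub>F z in at_right (0::real). z < 1" by (rule order_tendstoD(2)[OF tendsto_ident_at]) simp
  ultimately have "\<forall>\<^sub>F z in at_right (0::real). 0 < z \<and> z < 1 \<and> m / M - dl < \<Psi> z / D - 2 * z" using eventually_at_right_less[of 0] by eventually_elim auto
  then obtain z where z: "0 < z" "z < 1" "m / M - dl < \<Psi> z / D - 2 * z" using eventually_happens'[OF trivial_limit_at_right_real] by blast
  show ?thesis using atoms_box_inequality[OF opt z(1,2) less_imp_le[OF r(1)], of a b]
  proof eventually_elim
    case (elim N)
    then have "\<Psi> z <= (real (card ({x. emeasure (\<mu> N) {x} > 0} \<inter> cbox a b)) / real N + 2 * z) * D" unfolding \<Psi>_def D_def m_def by (simp add: mult.commute)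
    then have "\<Psi> z / D <= real (card ({x. emeasure (\<mu> N) {x} > 0} \<inter> cbox a b)) / real N + 2 * z" using D by (simp add: pos_divide_le_eq)
    then show ?case using z(3) unfolding m_def by linarith
  qed
qed

end



section \<open>Narrow convergence\<close>

lemma AE_interior_grid_cube:
  fixes v :: "real^'n"
  assumes k: "0 < k" and L: "0 < L"
  shows "AE x in lborel. x \<in> cube v L \<longrightarrow> (\<exists>g\<in>multi_index k. x \<in> interior (grid_cube v L k g))"
proof -
  have "AE x in lborel. x \<notin> grid_cube v L k g - interior (grid_cube v L k g)" for g
  proof (rule AE_not_in)
    have "emeasure lborel (cbox a b - box a b) = 0" for a b :: "real^'n"
    proof -
      have "emeasure lborel (cbox a b) = emeasure lborel (box a b)" by (simp only: emeasure_lborel_cbox_eq emeasure_lborel_box_eq)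
      then show ?thesis using box_subset_cbox[of a b] by (subst emeasure_Diff) (auto simp: emeasure_lborel_box_eq)
    qed
    then show "grid_cube v L k g - interior (grid_cube v L k g) \<in> null_sets lborel" unfolding grid_cube_def cube_def interior_cbox by (auto simp: null_sets_def)
  qed
  then have "AE x in lborel. \<forall>g\<in>multi_index k. x \<notin> grid_cube v L k g - interior (grid_cube v L k g)" by (intro AE_finite_allI finite_multi_index)
  with AE_in_one_grid_cube[OF k L, of v] show ?thesis by eventually_elim blast
qed

text \<open>Interiors of cells are increasing unions of shrunk cells, and the cell boundaries are
  null sets of an absolutely continuous measure.\<close>

lemma shrunk_cubes_exhaust:
  fixes sig :: "(real^'n) measure"
  assumes sig: "finite_measure sig" "sets sig = sets borel" "absolutely_continuous lborel sig" "AE x in sig. x \<in> cube v L"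
    and k: "0 < k" and L: "0 < L" and e: "0 < e"
  obtains dl where "0 < dl" "dl < 1" "measure sig UNIV - e < measure sig (\<Union>g\<in>multi_index k. shrunk_cube v L k dl g)"
proof -
  interpret finite_measure sig by fact
  have Lk: "0 < L / real k" using L k by simp
  define B where "B n = (\<Union>g\<in>multi_index k. shrunk_cube v L k (1 / real (n + 2)) g)" for n :: nat
  have sc: "shrunk_cube v L k dl g \<in> sets borel" for dl g by (simp add: shrunk_cube_def)
  have Bm: "B n \<in> sets borel" for n unfolding B_def using sc by (intro sets.finite_UN finite_multi_index) auto
  have mono: "shrunk_cube v L k dl g \<subseteq> shrunk_cube v L k dl' g" if "dl' <= dl" for dl dl' g
  proof
    fix x assume x: "x \<in> shrunk_cube v L k dl g"
    have "L / real k * (real (g i) + dl' / 2) <= L / real k * (real (g i) + dl / 2)"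
      "L / real k * (real (g i) + 1 - dl / 2) <= L / real k * (real (g i) + 1 - dl' / 2)" for i using that Lk by (intro mult_left_mono; simp)+
    then show "x \<in> shrunk_cube v L k dl' g" using x unfolding in_shrunk_cube by (smt (verit))
  qed
  have inc: "incseq B"
  proof (rule incseq_SucI)
    fix n
    have "1 / real (Suc n + 2) <= 1 / real (n + 2)" by (intro divide_left_mono) auto
    then show "B n <= B (Suc n)" unfolding B_def using mono by blast
  qed
  have "AE x in sig. x \<in> cube v L \<longrightarrow> (\<exists>g\<in>multi_index k. x \<in> interior (grid_cube v L k g))"
    using absolutely_continuous_AE[OF _ sig(3) AE_interior_grid_cube[OF k L]] sig(2) by simp
  with sig(4) have "AE x in sig. x \<in> (\<Union>n. B n)"
  proof eventually_elim
    case (elim x)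
    then obtain g where g: "g \<in> multi_index k" "x \<in> interior (grid_cube v L k g)" by blast
    have lim: "(\<lambda>n. 1 / real (n + 2)) \<longlonglongrightarrow> 0" using LIMSEQ_ignore_initial_segment[OF lim_1_over_n, of 2] by simp
    have x: "v $ i + L * real (g i) / real k < x $ i" "x $ i < v $ i + L * real (Suc (g i)) / real k" for i
    proof -
      have "v $ i + L * real (Suc (g i)) / real k = v $ i + L * real (g i) / real k + L / real k" by (simp add: algebra_simps add_divide_distrib)
      moreover have "v $ i + L * real (g i) / real k < x $ i \<and> x $ i < v $ i + L * real (g i) / real k + L / real k"
        using g(2) unfolding grid_cube_def cube_def interior_cbox mem_box_cart by simp
      ultimately show "v $ i + L * real (g i) / real k < x $ i" "x $ i < v $ i + L * real (Suc (g i)) / real k" by linarith+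
    qed
    have "\<forall>\<^sub>F n in sequentially. \<forall>i\<in>UNIV. v $ i + L / real k * (real (g i) + 1 / real (n + 2) / 2) < x $ i \<and>
        x $ i < v $ i + L / real k * (real (g i) + 1 - 1 / real (n + 2) / 2)"
    proof (intro eventually_ball_finite ballI eventually_conj)
      fix i
      have "(\<lambda>n. v $ i + L / real k * (real (g i) + 1 / real (n + 2) / 2)) \<longlonglongrightarrow> v $ i + L / real k * (real (g i) + 0 / 2)" by (intro tendsto_intros lim) simp
      then show "\<forall>\<^sub>F n in sequentially. v $ i + L / real k * (real (g i) + 1 / real (n + 2) / 2) < x $ i" by (rule order_tendstoD(2)) (use x(1)[of i] in simp)
      have "(\<lambda>n. v $ i + L / real k * (real (g i) + 1 - 1 / real (n + 2) / 2)) \<longlonglongrightarrow> v $ i + L / real k * (real (g i) + 1 - 0 / 2)" by (intro tendsto_intros lim) simp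
      then show "\<forall>\<^sub>F n in sequentially. x $ i < v $ i + L / real k * (real (g i) + 1 - 1 / real (n + 2) / 2)"
        by (rule order_tendstoD(1)) (use x(2)[of i] in \<open>simp add: add.commute\<close>)
    qed simp
    then obtain n where "\<forall>i\<in>UNIV. v $ i + L / real k * (real (g i) + 1 / real (n + 2) / 2) < x $ i \<and>
        x $ i < v $ i + L / real k * (real (g i) + 1 - 1 / real (n + 2) / 2)" unfolding eventually_sequentially by blast
    then have "x \<in> shrunk_cube v L k (1 / real (n + 2)) g" unfolding in_shrunk_cube by (auto simp: less_imp_le)
    then show ?case using g(1) unfolding B_def by blast
  qed
  then have "measure sig (\<Union>n. B n) = measure sig UNIV" using Bm sig(2) sets_eq_imp_space_eq[OF sig(2)] by (intro finite_measure_eq_AE) auto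
  moreover have "(\<lambda>n. measure sig (B n)) \<longlonglongrightarrow> measure sig (\<Union>n. B n)" by (rule finite_Lim_measure_incseq[OF _ inc]) (use Bm sig(2) in auto)
  ultimately have "\<forall>\<^sub>F n in sequentially. measure sig UNIV - e < measure sig (B n)" using e by (intro order_tendstoD(1)) auto
  then obtain n where "measure sig UNIV - e < measure sig (B n)" by (auto simp: eventually_sequentially)
  then show thesis using that[of "1 / real (n + 2)"] by (simp add: B_def)
qed

text \<open>On each cell \<open>h\<close> is at least its minimum \<open>h (z g)\<close>, so lower
  bounds for the atom fractions suffice when \<open>h\<close> is nonnegative. Shrunk cells are
  disjoint, so no atom is counted twice.\<close>

lemma sum_atoms_lower:
  fixes sig :: "(real^'n) measure" and F :: "nat => (real^'n) set" and h :: "real^'n => real"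
  assumes sig: "finite_measure sig" "sets sig = sets borel" "absolutely_continuous lborel sig" "AE x in sig. x \<in> cube v L"
    and L: "0 < L" and F: "\<And>N. 1 <= N ==> finite (F N)"
    and low: "\<And>a b dl. 0 < dl ==> \<forall>\<^sub>F N in sequentially. measure sig (cbox a b) - dl < real (card (F N \<inter> cbox a b)) / real N"
    and h: "continuous_on UNIV h" "\<And>x. 0 <= h x" "\<And>x. h x <= G" and dl: "0 < dl"
  shows "\<forall>\<^sub>F N in sequentially. integral\<^sup>L sig h - dl < (\<Sum>x\<in>F N. h x) / real N"
proof -
  interpret finite_measure sig by fact
  have space: "space sig = UNIV" using sets_eq_imp_space_eq[OF sig(2)] by simp
  define T where "T = measure sig UNIV"
  have T: "0 <= T" by (simp add: T_def)
  have G: "0 <= G" using h(2,3) order.trans by blast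
  \<comment> \<open>Two losses: the oscillation e on mass at most T, and the bound G on the mass at
    most e outside the shrunk cells; together they stay below dl/2.\<close>
  define e where "e = dl / (2 * (T + G + 1))"
  have e: "0 < e" using dl T G by (simp add: e_def)
  have eTG: "e * T + G * e < dl / 2"
  proof -
    have "0 < T + G + 1" by (intro add_nonneg_pos add_nonneg_nonneg T G zero_less_one)
    then have "0 < 2 * (T + G + 1)" by simp
    then have "2 * (T + G + 1) \<noteq> 0" by (rule less_imp_neq[THEN not_sym])
    then have "e * (2 * (T + G + 1)) = dl" using e_def by (rule nonzero_eq_divide_eq[THEN iffD1])
    then show ?thesis using e by (simp add: algebra_simps)
  qed
  have "uniformly_continuous_on (cube v L) h" using compact_uniformly_continuous[OF continuous_on_subset[OF h(1)] compact_cube] by simp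
  then obtain d where d: "0 < d" "\<And>x y. x \<in> cube v L ==> y \<in> cube v L ==> dist x y < d ==> dist (h x) (h y) < e" unfolding uniformly_continuous_on_def using e by metis
  obtain k :: nat where k: "real CARD('n) * L / d < real k" using reals_Archimedean2 by blast
  have k0: "0 < k" using k d(1) L by (meson divide_nonneg_pos less_imp_le mult_nonneg_nonneg not_less of_nat_0_le_iff of_nat_0_less_iff order_le_less_trans)
  have Lk: "real CARD('n) * (L / real k) < d" using k d(1) k0 by (simp add: field_simps)
  define I where "I = (multi_index k :: ('n => nat) set)"
  have fI: "finite I" by (simp add: I_def finite_multi_index)
  obtain t where t: "0 < t" "t < 1" "T - e < measure sig (\<Union>g\<in>I. shrunk_cube v L k t g)" unfolding T_def I_def by (rule shrunk_cubes_exhaust[OF sig k0 L e])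
  let ?S = "shrunk_cube v L k t"
  have Sm: "?S g \<in> sets sig" for g by (simp add: shrunk_cube_def sig(2))
  have Um: "(\<Union>g\<in>I. ?S g) \<in> sets sig" using fI Sm by (intro sets.finite_UN) auto
  have disj: "disjoint_family_on ?S I" by (rule shrunk_cube_disjoint[OF k0 L t(1)])
  have close: "dist x y < d" if "x \<in> grid_cube v L k g" "y \<in> grid_cube v L k g" for x y g
  proof -
    have "\<bar>(x - y) $ i\<bar> <= L / real k" for i
    proof -
      have "L * real (Suc (g i)) / real k = L * real (g i) / real k + L / real k" by (simp add: algebra_simps add_divide_distrib)
      then show ?thesis using that[unfolded in_grid_cube, rule_format, of i] by (simp add: abs_le_iff)
    qed
    then have "norm (x - y) <= (\<Sum>i\<in>(UNIV :: 'n set). L / real k)" by (intro order.trans[OF norm_le_l1_cart] sum_mono)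
    then show ?thesis using Lk by (simp add: dist_norm)
  qed
  have "\<exists>z. z \<in> grid_cube v L k g \<and> (\<forall>x\<in>grid_cube v L k g. h z <= h x)" for g
  proof -
    have "(\<chi> i. v $ i + L * real (g i) / real k) \<in> grid_cube v L k g" using L by (simp add: in_grid_cube algebra_simps add_divide_distrib)
    then have "grid_cube v L k g \<noteq> {}" by blast
    moreover have "compact (grid_cube v L k g)" unfolding grid_cube_def by (rule compact_cube)
    moreover have "continuous_on (grid_cube v L k g) h" using h(1) by (rule continuous_on_subset) simp
    ultimately show ?thesis using continuous_attains_inf by blast
  qed
  then obtain z where z: "\<And>g. z g \<in> grid_cube v L k g" "\<And>g x. x \<in> grid_cube v L k g ==> h (z g) <= h x" by metis
  have osc: "h x <= h (z g) + e" if "g \<in> I" "x \<in> grid_cube v L k g" for x g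
    using d(2)[of x "z g"] close[OF that(2) z(1)] z(1)[of g] grid_cube_subset[OF k0 L that(1)[unfolded I_def]] that(2) by (force simp: dist_real_def)
  have Sg: "?S g \<subseteq> grid_cube v L k g" for g by (rule shrunk_cube_subset[OF k0 L t(1)])
  have bm: "h \<in> borel_measurable sig" using borel_measurable_continuous_onI[OF h(1)] measurable_cong_sets[OF sig(2) refl] by blast
  have int_h: "integrable sig h" using h(2,3) bm by (intro integrable_const_bound[where B=G]) auto
  have "integral\<^sup>L sig h <= (\<integral>x. (\<Sum>g\<in>I. (h (z g) + e) * indicator (?S g) x) + G * indicator (UNIV - (\<Union>g\<in>I. ?S g)) x \<partial>sig)"
  proof (rule integral_mono[OF int_h])
    fix x
    show "h x <= (\<Sum>g\<in>I. (h (z g) + e) * indicator (?S g) x) + G * indicator (UNIV - (\<Union>g\<in>I. ?S g)) x"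
    proof (cases "x \<in> (\<Union>g\<in>I. ?S g)")
      case True
      then obtain g where g: "g \<in> I" "x \<in> ?S g" by blast
      have "h x <= (h (z g) + e) * indicator (?S g) x" using osc[OF g(1)] Sg g(2) by auto
      also have "... <= (\<Sum>g\<in>I. (h (z g) + e) * indicator (?S g) x)" using fI g(1) h(2) e by (intro member_le_sum) (auto simp: indicator_def add_nonneg_nonneg)
      finally show ?thesis using True by simp
    next
      case False
      have "0 <= (\<Sum>g\<in>I. (h (z g) + e) * indicator (?S g) x)" using h(2) e by (intro sum_nonneg) (auto simp: indicator_def add_nonneg_nonneg)
      then show ?thesis using False h(3)[of x] by simp
    qed
    have "UNIV - (\<Union>g\<in>I. ?S g) \<in> sets sig" using sets.compl_sets[OF Um] by (simp add: space)
    then show "integrable sig (\<lambda>x. (\<Sum>g\<in>I. (h (z g) + e) * indicator (?S g) x) + G * indicator (UNIV - (\<Union>g\<in>I. ?S g)) x)"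
      using Sm by (intro Bochner_Integration.integrable_add Bochner_Integration.integrable_sum integrable_mult_right integrable_real_indicator) (auto simp: less_top[symmetric])
  qed
  also have "... = (\<Sum>g\<in>I. (h (z g) + e) * measure sig (?S g)) + G * measure sig (UNIV - (\<Union>g\<in>I. ?S g))"
  proof -
    have "UNIV - (\<Union>g\<in>I. ?S g) \<in> sets sig" using sets.compl_sets[OF Um] by (simp add: space)
    then show ?thesis using Sm by (subst Bochner_Integration.integral_add)
         (auto intro!: Bochner_Integration.integrable_sum integrable_mult_right integrable_real_indicator simp: less_top[symmetric] Bochner_Integration.integral_sum space)
  qed
  also have "(\<Sum>g\<in>I. (h (z g) + e) * measure sig (?S g)) = (\<Sum>g\<in>I. h (z g) * measure sig (?S g)) + e * measure sig (\<Union>g\<in>I. ?S g)"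
    using fI Sm disj by (subst finite_measure_finite_Union) (auto simp: distrib_right sum.distrib sum_distrib_left)
  also have "measure sig (UNIV - (\<Union>g\<in>I. ?S g)) = T - measure sig (\<Union>g\<in>I. ?S g)" using finite_measure_compl[OF Um] by (simp add: T_def space)
  finally have up: "integral\<^sup>L sig h <= (\<Sum>g\<in>I. h (z g) * measure sig (?S g)) + e * measure sig (\<Union>g\<in>I. ?S g) + G * (T - measure sig (\<Union>g\<in>I. ?S g))" .
  have "e * measure sig (\<Union>g\<in>I. ?S g) <= e * T" using e by (intro mult_left_mono) (auto simp: T_def space intro!: bounded_measure[unfolded space])
  moreover have "G * (T - measure sig (\<Union>g\<in>I. ?S g)) <= G * e" using t(3) G by (intro mult_left_mono) auto
  ultimately have up': "integral\<^sup>L sig h < (\<Sum>g\<in>I. h (z g) * measure sig (?S g)) + dl / 2" using up eTG by linarith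
  \<comment> \<open>Each of the \<open>card I\<close> cells may lose eta in its fraction, that is G
    * eta in the sum; together at most dl/2.\<close>
  define eta where "eta = dl / (2 * (real (card I) * G + 1))"
  have cG: "0 <= real (card I) * G" using G by simp
  have eta: "0 < eta" using dl cG by (simp add: eta_def add_nonneg_pos)
  have etaG: "real (card I) * G * eta <= dl / 2"
  proof -
    have "0 < real (card I) * G + 1" by (intro add_nonneg_pos cG zero_less_one)
    then have "2 * (real (card I) * G + 1) \<noteq> 0" by simp
    then have "eta * (2 * (real (card I) * G + 1)) = dl" using eta_def by (rule nonzero_eq_divide_eq[THEN iffD1])
    then show ?thesis using eta by (simp add: algebra_simps)
  qed
  have ev: "\<forall>\<^sub>F N in sequentially. \<forall>g\<in>I. measure sig (?S g) - eta < real (card (F N \<inter> ?S g)) / real N"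
    unfolding shrunk_cube_def cube_def by (intro eventually_ball_finite fI ballI low eta)
  show ?thesis using ev eventually_ge_at_top[of 1]
  proof eventually_elim
    case (elim N)
    have fN: "finite (F N)" by (rule F[OF elim(2)])
    have "(\<Sum>g\<in>I. h (z g) * measure sig (?S g)) - dl / 2 <= (\<Sum>g\<in>I. h (z g) * measure sig (?S g)) - (\<Sum>g\<in>I. G * eta)" using etaG by (simp add: mult.assoc)
    also have "... = (\<Sum>g\<in>I. h (z g) * measure sig (?S g) - G * eta)" by (simp add: sum_subtractf)
    also have "... <= (\<Sum>g\<in>I. h (z g) * (real (card (F N \<inter> ?S g)) / real N))"
    proof (rule sum_mono)
      fix g assume g: "g \<in> I"
      have "h (z g) * (measure sig (?S g) - eta) <= h (z g) * (real (card (F N \<inter> ?S g)) / real N)" using elim(1) g h(2) by (intro mult_left_mono) (auto simp: less_imp_le)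
      moreover have "h (z g) * eta <= G * eta" using h(3) eta by (intro mult_right_mono) auto
      ultimately show "h (z g) * measure sig (?S g) - G * eta <= h (z g) * (real (card (F N \<inter> ?S g)) / real N)" by (simp add: right_diff_distrib)
    qed
    also have "... = (\<Sum>g\<in>I. \<Sum>x\<in>F N \<inter> ?S g. h (z g)) / real N" by (simp add: sum_divide_distrib mult.commute)
    also have "... <= (\<Sum>g\<in>I. \<Sum>x\<in>F N \<inter> ?S g. h x) / real N" using z(2) Sg by (intro divide_right_mono sum_mono) auto
    also have "(\<Sum>g\<in>I. \<Sum>x\<in>F N \<inter> ?S g. h x) = (\<Sum>x\<in>(\<Union>g\<in>I. F N \<inter> ?S g). h x)" using fI fN disj by (intro sum.UNION_disjoint[symmetric]) (auto simp: disjoint_family_on_def)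
    also have "... / real N <= (\<Sum>x\<in>F N. h x) / real N" using fN h(2) by (intro divide_right_mono sum_mono2) auto
    finally show ?case using up' by linarith
  qed
qed

text \<open>The one-sided bound is applied to h + G and to -h + G. Since there are at most N atoms
  and \<open>sig\<close> has mass 1, the added constant contributes at most G to the sum and exactly
  G to the integral, so it can be removed and upper bounds follow from lower ones.\<close>

lemma sum_atoms_tendsto:
  fixes sig :: "(real^'n) measure" and F :: "nat => (real^'n) set" and h :: "real^'n => real"
  assumes sig: "finite_measure sig" "sets sig = sets borel" "absolutely_continuous lborel sig" "AE x in sig. x \<in> cube v L" "measure sig UNIV = 1"
    and L: "0 < L" and F: "\<And>N. 1 <= N ==> finite (F N)" "\<And>N. 1 <= N ==> card (F N) <= N"
    and low: "\<And>a b dl. 0 < dl ==> \<forall>\<^sub>F N in sequentially. measure sig (cbox a b) - dl < real (card (F N \<inter> cbox a b)) / real N"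
    and h: "continuous_on UNIV h" "\<And>x. \<bar>h x\<bar> <= G"
  shows "(\<lambda>N. (\<Sum>x\<in>F N. h x) / real N) \<longlonglongrightarrow> integral\<^sup>L sig h"
proof -
  interpret finite_measure sig by fact
  have space: "space sig = UNIV" using sets_eq_imp_space_eq[OF sig(2)] by simp
  have G: "0 <= G" using h(2)[of 0] by linarith
  have one_sided: "\<forall>\<^sub>F N in sequentially. integral\<^sup>L sig u - dl < (\<Sum>x\<in>F N. u x) / real N"
    if u: "continuous_on UNIV u" "\<And>x. \<bar>u x\<bar> <= G" and dl: "0 < dl" for u :: "real^'n => real" and dl
  proof -
    have bm: "u \<in> borel_measurable sig" using borel_measurable_continuous_onI[OF u(1)] measurable_cong_sets[OF sig(2) refl] by blast
    have int: "integrable sig u" using u(2) bm by (intro integrable_const_bound[where B=G]) auto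
    have "\<forall>\<^sub>F N in sequentially. integral\<^sup>L sig (\<lambda>x. u x + G) - dl < (\<Sum>x\<in>F N. u x + G) / real N"
    proof (rule sum_atoms_lower[OF sig(1-4) L F(1) low _ _ _ dl, where G="2 * G"])
      show "0 <= u x + G" "u x + G <= 2 * G" for x using u(2)[of x] by (auto simp: abs_le_iff)
    qed (use u(1) in \<open>auto intro!: continuous_intros\<close>)
    then show ?thesis using eventually_ge_at_top[of 1]
    proof eventually_elim
      case (elim N)
      have "integral\<^sup>L sig (\<lambda>x. u x + G) = integral\<^sup>L sig u + G" using int by (simp add: Bochner_Integration.integral_add space sig(5))
      moreover have "(\<Sum>x\<in>F N. u x + G) / real N <= (\<Sum>x\<in>F N. u x) / real N + G"
      proof -
        have "real (card (F N)) * G <= real N * G" using F(2)[OF elim(2)] G by (intro mult_right_mono) auto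
        then have "real (card (F N)) * G / real N <= G" using elim(2) by (simp add: divide_le_eq mult.commute)
        then show ?thesis by (simp add: sum.distrib add_divide_distrib)
      qed
      ultimately show ?case using elim(1) by linarith
    qed
  qed
  show ?thesis
  proof (rule order_tendstoI)
    fix a assume "a < integral\<^sup>L sig h"
    with one_sided[OF h, of "integral\<^sup>L sig h - a"] show "\<forall>\<^sub>F N in sequentially. a < (\<Sum>x\<in>F N. h x) / real N" by simp
  next
    fix a assume a: "integral\<^sup>L sig h < a"
    have "\<forall>\<^sub>F N in sequentially. integral\<^sup>L sig (\<lambda>x. - h x) - (a - integral\<^sup>L sig h) < (\<Sum>x\<in>F N. - h x) / real N"
      using h a by (intro one_sided) (auto intro: continuous_on_minus)
    then show "\<forall>\<^sub>F N in sequentially. (\<Sum>x\<in>F N. h x) / real N < a" by eventually_elim (simp add: sum_negf)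
  qed
qed

lemma integral_atom_distribution:
  fixes h :: "'a::euclidean_space => real"
  assumes F: "finite {x. emeasure \<mu> {x} > 0}" and h: "h \<in> borel_measurable borel"
  shows "integral\<^sup>L (atom_distribution N \<mu>) h = (\<Sum>x\<in>{x. emeasure \<mu> {x} > 0}. h x) / real N"
proof -
  let ?F = "{x. emeasure \<mu> {x} > 0}"
  let ?D = "distr (count_space ?F) borel (\<lambda>x. x)"
  have "atom_distribution N \<mu> = density ?D (\<lambda>_. ennreal (1 / real N))"
    unfolding atom_distribution_def by (rule measure_eqI) (auto simp: emeasure_density nn_integral_cmult)
  then have "integral\<^sup>L (atom_distribution N \<mu>) h = integral\<^sup>L ?D (\<lambda>x. (1 / real N) *\<^sub>R h x)" using h by (simp only: integral_density) (subst integral_density, auto)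
  also have "... = integral\<^sup>L (count_space ?F) (\<lambda>x. (1 / real N) *\<^sub>R h x)" using h by (subst integral_distr) auto
  also have "... = (\<Sum>x\<in>?F. h x) / real N" using F by (simp add: lebesgue_integral_count_space_finite sum_divide_distrib)
  finally show ?thesis .
qed

theorem theorem1p1:
  fixes \<alpha> :: real and \<nu> :: "(real^'n) measure"
  assumes "1 - 1 / real CARD('n) < \<alpha>" and "\<alpha> < 1"
    and "sets \<nu> = sets borel" and "finite_measure \<nu>" and "emeasure \<nu> UNIV \<noteq> 0"
    and "compact (spt \<nu>)"
    and "absolutely_continuous lborel \<nu>"
  shows "(\<forall>\<mu> :: nat \<Rightarrow> (real^'n) measure.
            (\<forall>N\<ge>1. optimal_quantizer \<alpha> \<nu> N (\<mu> N)) \<longrightarrow>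
            narrow_conv (\<lambda>N. atom_distribution N (\<mu> N))
              (density lborel (\<lambda>x. inverse (M_const \<alpha> \<nu>) * density_pow \<alpha> \<nu> x)))
    \<and> convergent (scaled_quant_error \<alpha> (cube_measure :: (real^'n) measure))
    \<and> 0 < c_const \<alpha> TYPE('n) \<and> c_const \<alpha> TYPE('n) < \<infinity>
    \<and> scaled_quant_error \<alpha> \<nu> \<longlonglongrightarrow>
        c_const \<alpha> TYPE('n) * ennpow (M_const \<alpha> \<nu>) (\<alpha> + 1 / real CARD('n))"
proof -
  interpret \<nu>: finite_measure \<nu> by fact
  have "0 <= 1 - 1 / real CARD('n)" by (simp add: divide_le_eq)
  then have \<alpha>0: "0 < \<alpha>" using assms(1) by linarith
  have "real CARD('n) * (1 - \<alpha>) < real CARD('n) * (1 / real CARD('n))" using assms(1) by (intro mult_strict_left_mono) auto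
  then have \<alpha>d: "real CARD('n) * (1 - \<alpha>) < 1" by simp
  note \<alpha> = \<alpha>0 assms(2) \<alpha>d
  obtain c where c: "0 < c" "scaled_quant_error \<alpha> (cube_measure :: (real^'n) measure) \<longlonglongrightarrow> ennreal c"
    "\<And>N. 1 <= N ==> ennreal c <= scaled_quant_error \<alpha> (cube_measure :: (real^'n) measure) N" using scaled_cube_tendsto[OF \<alpha>] by blast
  have cc: "c_const \<alpha> TYPE('n) = ennreal c" unfolding c_const_def by (rule limI[OF c(2)])
  obtain B where B: "\<And>x. x \<in> spt \<nu> ==> norm x <= B" using compact_imp_bounded[OF assms(6)] by (auto simp: bounded_iff)
  define L where "L = 2 * (\<bar>B\<bar> + 1)"
  define v where "v = - ((\<bar>B\<bar> + 1) *\<^sub>R (1 :: real^'n))"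
  have L: "0 < L" by (simp add: L_def)
  have spt: "spt \<nu> \<subseteq> cube v L"
  proof
    fix x assume "x \<in> spt \<nu>"
    then have "\<bar>x $ i\<bar> <= \<bar>B\<bar>" for i using B[of x] component_le_norm_cart[of x i] by linarith
    then show "x \<in> cube v L" unfolding in_cube L_def v_def by (simp add: abs_le_iff) (smt (verit))
  qed
  define f0 where "f0 = RN_deriv lborel \<nu>"
  have f0[measurable]: "f0 \<in> borel_measurable borel" using borel_measurable_RN_deriv[of lborel \<nu>] by (simp add: f0_def)
  have df0: "density lborel f0 = \<nu>" unfolding f0_def using assms(3,7) by (intro sigma_finite_measure.density_RN_deriv[OF sigma_finite_lborel]) auto
  \<comment> \<open>The derivative is determined only almost everywhere. This version is finite and
    vanishes off the cube at every point, as \<open>density_setting\<close> demands, and still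
    represents \<nu>.\<close>
  define f where "f x = (if x \<in> cube v L \<and> f0 x < top then f0 x else 0)" for x
  have f[measurable]: "f \<in> borel_measurable borel" unfolding f_def by measurable
  have "- spt \<nu> \<in> sets \<nu>" unfolding assms(3) by (intro borel_comp borel_closed compact_imp_closed assms(6))
  then have "emeasure \<nu> (- cube v L) <= emeasure \<nu> (- spt \<nu>)" using spt by (intro emeasure_mono) auto
  then have "emeasure \<nu> (- cube v L) = 0" using emeasure_Compl_spt[OF assms(3)] by simp
  then have "(\<integral>\<^sup>+x. f0 x * indicator (- cube v L) x \<partial>lborel) = 0" unfolding df0[symmetric] by (simp add: emeasure_density)
  then have "AE x in lborel. f0 x * indicator (- cube v L) x = 0" by (simp add: nn_integral_0_iff_AE)
  moreover have "AE x in lborel. f0 x \<noteq> \<infinity>" unfolding f0_def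
    using assms(3,7) \<nu>.sigma_finite_measure_axioms by (intro sigma_finite_measure.RN_deriv_finite[OF sigma_finite_lborel]) auto
  ultimately have ae: "AE x in lborel. f0 x = f x" by eventually_elim (auto simp: f_def less_top indicator_def split: if_splits)
  have df: "density lborel f = \<nu>" unfolding df0[symmetric] using ae by (intro density_cong) auto
  have int_f: "(\<integral>\<^sup>+x. f x \<partial>lborel) = emeasure \<nu> UNIV" unfolding df[symmetric] by (simp add: emeasure_density)
  interpret density_setting \<alpha> c L v f
  proof unfold_locales
    show "0 < \<alpha>" "\<alpha> < 1" "real CARD('n) * (1 - \<alpha>) < 1" by (rule \<alpha>)+
    show "0 < c" "scaled_quant_error \<alpha> (cube_measure :: (real^'n) measure) \<longlonglongrightarrow> ennreal c" by (rule c)+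
    show "ennreal c <= scaled_quant_error \<alpha> (cube_measure :: (real^'n) measure) N" if "1 <= N" for N using that by (rule c)
    show "f \<in> borel_measurable borel" by (rule f)
    show "(\<integral>\<^sup>+x. f x \<partial>lborel) < top" unfolding int_f by (rule less_top[THEN iffD1]) simp
    show "0 < (\<integral>\<^sup>+x. f x \<partial>lborel)" unfolding int_f using assms(5) by (simp add: zero_less_iff_neq_zero)
  qed (auto simp: f_def L)
  have dp: "density_pow \<alpha> \<nu> x = ennpow (f0 x) p" for x by (simp add: density_pow_def f0_def p_def)
  have Mc: "M_const \<alpha> \<nu> = ennreal M" unfolding M_const_def dp M_eq[symmetric] by (rule nn_integral_cong_AE) (use ae in eventually_elim, simp)
  define \<sigma> where "\<sigma> = density lborel (\<lambda>x. inverse (M_const \<alpha> \<nu>) * density_pow \<alpha> \<nu> x)"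
  have \<sigma>_eq: "emeasure \<sigma> A = ennreal (measure \<rho> A / M)" if A: "A \<in> sets borel" for A
  proof -
    note [measurable] = A
    have "emeasure \<sigma> A = (\<integral>\<^sup>+x. inverse (M_const \<alpha> \<nu>) * (ennpow (f0 x) p * indicator A x) \<partial>lborel)" unfolding \<sigma>_def dp by (simp add: emeasure_density mult.assoc)
    also have "... = inverse (M_const \<alpha> \<nu>) * (\<integral>\<^sup>+x. ennpow (f0 x) p * indicator A x \<partial>lborel)" by (rule nn_integral_cmult) measurable
    also have "(\<integral>\<^sup>+x. ennpow (f0 x) p * indicator A x \<partial>lborel) = (\<integral>\<^sup>+x. ennpow (f x) p * indicator A x \<partial>lborel)"
      by (rule nn_integral_cong_AE) (use ae in eventually_elim, simp)
    also have "... = emeasure \<rho> A" unfolding \<rho>_def by (simp add: emeasure_density)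
    finally show ?thesis unfolding Mc using M_pos by (simp add: \<rho>.emeasure_eq_measure inverse_ennreal ennreal_mult[symmetric] divide_inverse mult.commute)
  qed
  have m\<sigma>: "measure \<sigma> A = measure \<rho> A / M" if "A \<in> sets borel" for A using \<sigma>_eq[OF that] M_pos by (simp add: measure_def)
  have s\<sigma>: "sets \<sigma> = sets borel" "space \<sigma> = UNIV" by (simp_all add: \<sigma>_def)
  have f\<sigma>: "finite_measure \<sigma>" using \<sigma>_eq[of UNIV] by (intro finite_measureI) (simp add: s\<sigma>)
  have ac\<sigma>: "absolutely_continuous lborel \<sigma>" unfolding \<sigma>_def dp by (intro absolutely_continuousI_density) measurable
  have supp\<sigma>: "AE x in \<sigma>. x \<in> cube v L"
  proof (rule AE_I[where N="- cube v L"])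
    have "emeasure \<rho> (- cube v L) = 0" by (subst emeasure_\<rho>) (auto simp: nn_integral_0_iff_AE f_def indicator_def)
    then show "emeasure \<sigma> (- cube v L) = 0" using \<sigma>_eq[of "- cube v L"] by (simp add: measure_def)
  qed (auto simp: s\<sigma>)
  have "narrow_conv (\<lambda>N. atom_distribution N (\<mu> N)) \<sigma>"
    if opt: "\<forall>N\<ge>1. optimal_quantizer \<alpha> \<nu> N (\<mu> N)" for \<mu> :: "nat => (real^'n) measure" unfolding narrow_conv_def
  proof (intro allI impI)
    fix h :: "real^'n => real" assume "continuous_on UNIV h \<and> bounded (range h)"
    then obtain G where h: "continuous_on UNIV h" "\<And>x. \<bar>h x\<bar> <= G" by (auto simp: bounded_iff)
    let ?F = "\<lambda>N. {x. emeasure (\<mu> N) {x} > 0}"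
    have q: "\<mu> N \<in> quantizers \<nu> N" if "1 <= N" for N using opt that by (simp add: optimal_quantizer_def)
    have "(\<lambda>N. (\<Sum>x\<in>?F N. h x) / real N) \<longlonglongrightarrow> integral\<^sup>L \<sigma> h"
    proof (rule sum_atoms_tendsto[OF f\<sigma> s\<sigma>(1) ac\<sigma> supp\<sigma> _ L _ _ _ h])
      show "measure \<sigma> UNIV = 1" using M_pos by (simp add: m\<sigma> M_def)
      show "finite (?F N)" "card (?F N) <= N" if "1 <= N" for N using atoms_quantizer[OF q[OF that]] by auto
      show "\<forall>\<^sub>F N in sequentially. measure \<sigma> (cbox a b) - \<delta> < real (card (?F N \<inter> cbox a b)) / real N" if "0 < \<delta>" for a b \<delta>
        using atoms_box_lower[of \<mu> \<delta> a b] opt that by (simp add: m\<sigma> df)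
    qed
    moreover have "\<forall>\<^sub>F N in sequentially. (\<Sum>x\<in>?F N. h x) / real N = integral\<^sup>L (atom_distribution N (\<mu> N)) h" using eventually_ge_at_top[of 1]
    proof eventually_elim
      case (elim N)
      then show ?case using integral_atom_distribution[OF atoms_quantizer(1)[OF q] borel_measurable_continuous_onI[OF h(1)]] by simp
    qed
    ultimately show "(\<lambda>N. integral\<^sup>L (atom_distribution N (\<mu> N)) h) \<longlonglongrightarrow> integral\<^sup>L \<sigma> h" by (rule Lim_transform_eventually)
  qed
  moreover have "scaled_quant_error \<alpha> \<nu> \<longlonglongrightarrow> c_const \<alpha> TYPE('n) * ennpow (M_const \<alpha> \<nu>) (\<alpha> + 1 / real CARD('n))"
    using scaled_tendsto M_pos c(1) unfolding cc Mc df s_eq by (simp add: ennpow_ennreal ennreal_mult)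
  moreover have "convergent (scaled_quant_error \<alpha> (cube_measure :: (real^'n) measure))" using c(2) by (auto simp: convergent_def)
  moreover have "0 < c_const \<alpha> TYPE('n)" "c_const \<alpha> TYPE('n) < \<infinity>" using c(1) by (simp_all add: cc)
  ultimately show ?thesis unfolding \<sigma>_def by blast
qed

end
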